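(* Let $n\geq 2$, let $s\in(-n/2,\infty)\setminus\mathbb{Z}$, let $V\subset\mathbb{R}^n$ be a nonempty open set and let $f\in\mathcal{E}'(\mathbb{R}^n)\cap\mathcal{A}_V$. If there is some $x_0\in V$ such that $\partial^\beta((-\Delta)^sf)(x_0)=0$ for all multi-indices $\beta\in\mathbb{N}^n$, then $f=0$.
   Context: All functions and distributions are complex valued, and $\mathbb{N}$ contains $0$. $\mathcal{E}'(\mathbb{R}^n)$ is the space of compactly supported distributions. The Fourier transform $\hat f=\mathcal{F}(f)$ on tempered distributions $\mathscr{S}'(\mathbb{R}^n)$ is normalized so that $\widehat{D_jf}(\xi)=\xi_j\hat f(\xi)$, where $D_j=-i\partial_j$. For $r\in\mathbb{R}$, $H^r(\mathbb{R}^n)=\{f\in\mathscr{S}'(\mathbb{R}^n):(1+|\cdot|^2)^{r/2}\hat f\in L^2(\mathbb{R}^n)\}$, and $H^{-\infty}(\mathbb{R}^n)=\bigcup_{r\in\mathbb{R}}H^r(\mathbb{R}^n)$. $\mathcal{P}$ is the set of all nonzero polynomials on $\mathbb{R}^n$ with complex coefficients; $P(\xi)=\sum_{|\alpha|\leq m}a_\alpha\xi^\alpha\in\mathcal{P}$ induces the constant coefficient operator $P(D)=\sum_{|\alpha|\leq m}a_\alpha D^\alpha$, $D^\alpha=D_1^{\alpha_1}\cdots D_n^{\alpha_n}$, acting on distributions. For a nonempty open set $V\subset\mathbb{R}^n$ the set of admissible functions is $$\mathcal{A}_V=\{f\in H^{-\infty}(\mathbb{R}^n): P(D)f|_V=0\text{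 for some }P\in\mathcal{P}\},$$ where $|_V$ denotes restriction of distributions to $V$. The fractional Laplacian is $(-\Delta)^sf=\mathcal{F}^{-1}(|\cdot|^{2s}\hat f)$; it is well defined as a tempered distribution for $f\in\mathcal{E}'(\mathbb{R}^n)$ and $s\in(-n/2,\infty)\setminus\mathbb{Z}$. The hypothesis that all $\partial^\beta((-\Delta)^sf)(x_0)$ vanish is understood to include that the distribution $(-\Delta)^sf$ is a smooth function in some neighborhood of $x_0$, so that the pointwise values of the derivatives make sense. *)

theory Defs
  imports
    "HOL-Analysis.Analysis"
    "HOL-Library.FuncSet"
    "HOL-Library.Poly_Mapping"
begin

type_synonym 'n cfun = "(real, 'n) vec \<Rightarrow> complex"
type_synonym 'n functional = "'n cfun \<Rightarrow> complex"
type_synonym 'n multiindex = "'n \<Rightarrow> nat"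

definition mi_order :: "'n::finite multiindex \<Rightarrow> nat"
  where "mi_order \<alpha> = (\<Sum>i\<in>UNIV. \<alpha> i)"

definition mi_power :: "real ^ 'n::finite \<Rightarrow> 'n multiindex \<Rightarrow> real"
  where "mi_power x \<alpha> = (\<Prod>i\<in>UNIV. (x $ i) ^ \<alpha> i)"


subsection \<open>Derivatives and smooth functions\<close>

definition partial :: "'n::finite \<Rightarrow> 'n cfun \<Rightarrow> 'n cfun"
  where "partial i \<phi> = (\<lambda>x. frechet_derivative \<phi> (at x) (axis i 1))"

definition partials :: "'n::finite list \<Rightarrow> 'n cfun \<Rightarrow> 'n cfun"
  where "partials is \<phi> = foldr partial is \<phi>"

text \<open>
  \<open>smooth_on U g\<close> means \<open>C\<^sup>\<infinity>\<close> on the open set \<open>U\<close>: the iterated partial derivatives of all orders,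
  taken in any order of the coordinates, exist and are themselves (Frechet) differentiable, hence
  continuous, on \<open>U\<close>.
\<close>

definition smooth_on :: "(real ^ 'n::finite) set \<Rightarrow> 'n cfun \<Rightarrow> bool"
  where "smooth_on U \<phi> \<longleftrightarrow> open U \<and> (\<forall>is. \<forall>x\<in>U. partials is \<phi> differentiable (at x))"

text \<open>
  \<open>\<partial>\<^sup>\<alpha>\<close> applies the partial derivatives in the order of a fixed enumeration of the coordinates,
  since the index type carries no order. It is only used for functions that are smooth near the
  point of evaluation, where the choice of the enumeration is immaterial.
\<close>

definition coordinates :: "'n::finite list"
  where "coordinates = (SOME is. distinct is \<and> set is = UNIV)"

definition mi_partial :: "'n::finite multiindex \<Rightarrow> 'n cfun \<Rightarrow> 'n cfun"
  where "mi_partial \<alpha> = partials (concat (map (\<lambda>i. replicate (\<alpha> i) i) coordinates))"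

text \<open>\<open>D\<^sup>\<alpha> = (-\<i>)\<^bsup>|\<alpha>|\<^esup> \<partial>\<^sup>\<alpha>\<close>, that is, \<open>D\<^sub>j = -\<i> \<partial>\<^sub>j\<close>.\<close>

definition mi_D :: "'n::finite multiindex \<Rightarrow> 'n cfun \<Rightarrow> 'n cfun"
  where "mi_D \<alpha> \<phi> = (\<lambda>x. (- \<i>) ^ mi_order \<alpha> * mi_partial \<alpha> \<phi> x)"


subsection \<open>Test functions and Schwartz functions\<close>

definition test_functions :: "(real ^ 'n::finite) set \<Rightarrow> 'n cfun set"
  where "test_functions V =
    {\<phi>. smooth_on UNIV \<phi> \<and> compact (closure {x. \<phi> x \<noteq> 0}) \<and> closure {x. \<phi> x \<noteq> 0} \<subseteq> V}"

definition schwartz :: "'n::finite cfun set"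
  where "schwartz =
    {\<phi>. smooth_on UNIV \<phi> \<and>
        (\<forall>\<alpha> \<beta>. bounded (range (\<lambda>x. of_real (mi_power x \<alpha>) * mi_partial \<beta> \<phi> x)))}"

definition schwartz_seminorm :: "'n::finite multiindex \<Rightarrow> 'n multiindex \<Rightarrow> 'n cfun \<Rightarrow> real"
  where "schwartz_seminorm \<alpha> \<beta> \<phi> = (SUP x. norm (of_real (mi_power x \<alpha>) * mi_partial \<beta> \<phi> x))"


subsection \<open>Tempered distributions\<close>

text \<open>
  A tempered distribution is a continuous linear functional on the Schwartz space. Functionals on a
  set \<open>X\<close> of functions are extensional (they are \<open>undefined\<close> outside \<open>X\<close>), so that two of them are
  equal in HOL iff they are equal as distributions.
\<close>

definition tempered :: "'n::finite functional set"
  where "tempered =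
    {u \<in> extensional schwartz.
      (\<forall>\<phi>\<in>schwartz. \<forall>\<psi>\<in>schwartz. u (\<lambda>x. \<phi> x + \<psi> x) = u \<phi> + u \<psi>) \<and>
      (\<forall>c. \<forall>\<phi>\<in>schwartz. u (\<lambda>x. c * \<phi> x) = c * u \<phi>) \<and>
      (\<exists>C N. \<forall>\<phi>\<in>schwartz. norm (u \<phi>) \<le>
         C * (\<Sum>\<alpha> | mi_order \<alpha> \<le> N. \<Sum>\<beta> | mi_order \<beta> \<le> N. schwartz_seminorm \<alpha> \<beta> \<phi>))}"

definition zero_dist :: "'n::finite cfun set \<Rightarrow> 'n functional"
  where "zero_dist X = (\<lambda>\<phi>\<in>X. 0)"

text \<open>The distribution given by a function \<open>g\<close>, on the space \<open>X\<close> of test functions.\<close>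

definition dist_of_fun :: "'n::finite cfun set \<Rightarrow> 'n cfun \<Rightarrow> 'n functional"
  where "dist_of_fun X g = (\<lambda>\<phi>\<in>X. LINT x|lborel. g x * \<phi> x)"

definition dist_restrict :: "'n::finite functional \<Rightarrow> (real ^ 'n) set \<Rightarrow> 'n functional"
  where "dist_restrict u V = restrict u (test_functions V)"

definition dist_support :: "'n::finite functional \<Rightarrow> (real ^ 'n) set"
  where "dist_support u = - \<Union>{U. open U \<and> dist_restrict u U = zero_dist (test_functions U)}"

text \<open>
  \<open>\<E>'\<close>, viewed inside the space of tempered distributions: every compactly supported distribution
  extends uniquely to a tempered one with the same support.
\<close>

definition compactly_supported :: "'n::finite functional set"
  where "compactly_supported = {u \<in> tempered. compact (dist_support u)}"

definition dist_mult :: "'n::finite cfun \<Rightarrow> 'n functional \<Rightarrow> 'n functional"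
  where "dist_mult m u = (\<lambda>\<phi>\<in>schwartz. u (\<lambda>x. m x * \<phi> x))"


subsection \<open>Constant coefficient operators\<close>

text \<open>\<open>\<langle>D\<^sup>\<alpha>u, \<phi>\<rangle> = (-1)\<^bsup>|\<alpha>|\<^esup> \<langle>u, D\<^sup>\<alpha>\<phi>\<rangle>\<close>\<close>

definition dist_D :: "'n::finite multiindex \<Rightarrow> 'n functional \<Rightarrow> 'n functional"
  where "dist_D \<alpha> u = (\<lambda>\<phi>\<in>schwartz. (- 1) ^ mi_order \<alpha> * u (mi_D \<alpha> \<phi>))"

text \<open>
  A polynomial \<open>P(\<xi>) = \<Sum>\<^sub>\<alpha> a\<^sub>\<alpha> \<xi>\<^sup>\<alpha>\<close> is given by its finitely supported family of coefficients.
\<close>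

definition dist_op :: "('n::finite multiindex \<Rightarrow>\<^sub>0 complex) \<Rightarrow> 'n functional \<Rightarrow> 'n functional"
  where "dist_op P u =
    (\<lambda>\<phi>\<in>schwartz. \<Sum>\<alpha>\<in>Poly_Mapping.keys P. Poly_Mapping.lookup P \<alpha> * dist_D \<alpha> u \<phi>)"


subsection \<open>Fourier transform\<close>

definition fourier :: "'n::finite cfun \<Rightarrow> 'n cfun"
  where "fourier \<phi> = (\<lambda>\<xi>. LINT x|lborel. exp (- \<i> * of_real (x \<bullet> \<xi>)) * \<phi> x)"

definition inv_fourier :: "'n::finite cfun \<Rightarrow> 'n cfun"
  where "inv_fourier \<phi> =
    (\<lambda>x. (LINT \<xi>|lborel. exp (\<i> * of_real (x \<bullet> \<xi>)) * \<phi> \<xi>) / of_real ((2 * pi) ^ CARD('n)))"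

definition dist_fourier :: "'n::finite functional \<Rightarrow> 'n functional"
  where "dist_fourier u = (\<lambda>\<phi>\<in>schwartz. u (fourier \<phi>))"

definition dist_inv_fourier :: "'n::finite functional \<Rightarrow> 'n functional"
  where "dist_inv_fourier u = (\<lambda>\<phi>\<in>schwartz. u (inv_fourier \<phi>))"


subsection \<open>Sobolev spaces and admissible functions\<close>

definition sobolev :: "real \<Rightarrow> 'n::finite functional set"
  where "sobolev r =
    {f \<in> tempered. \<exists>g. g \<in> borel_measurable lborel \<and> integrable lborel (\<lambda>\<xi>. (norm (g \<xi>))\<^sup>2) \<and>
       dist_mult (\<lambda>\<xi>. of_real ((1 + (norm \<xi>)\<^sup>2) powr (r / 2))) (dist_fourier f)
         = dist_of_fun schwartz g}"

definition sobolev_minus_infinity :: "'n::finite functional set"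
  where "sobolev_minus_infinity = (\<Union>r. sobolev r)"

definition admissible :: "(real ^ 'n::finite) set \<Rightarrow> 'n functional set"
  where "admissible V =
    {f \<in> sobolev_minus_infinity.
       \<exists>P. P \<noteq> 0 \<and> dist_restrict (dist_op P f) V = zero_dist (test_functions V)}"


subsection \<open>The fractional Laplacian\<close>

text \<open>
  For compactly supported \<open>f\<close> the Fourier transform is a smooth function; \<open>fourier_fun f\<close> is this
  function, the unique continuous one that induces \<open>dist_fourier f\<close>. Forming the product
  \<open>|\<xi>|\<^bsup>2s\<^esup> \<cdot> fourier_fun f \<xi>\<close> of functions is necessary because \<open>|\<xi>|\<^bsup>2s\<^esup>\<close> is not smooth at the origin,
  so it does not multiply Schwartz functions. The product is locally integrable for \<open>2s > -n\<close>.
\<close>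

definition fourier_fun :: "'n::finite functional \<Rightarrow> 'n cfun"
  where "fourier_fun f =
    (THE g. continuous_on UNIV g \<and> dist_fourier f = dist_of_fun schwartz g)"

definition frac_laplacian :: "real \<Rightarrow> 'n::finite functional \<Rightarrow> 'n functional"
  where "frac_laplacian s f =
    dist_inv_fourier
      (dist_of_fun schwartz (\<lambda>\<xi>. of_real (norm \<xi> powr (2 * s)) * fourier_fun f \<xi>))"

end

theory Submission
  imports Defs "HOL-Probability.Probability"
begin

text \<open>
  The idea is to read the hypotheses on the Fourier side and to decide everything by the heat flow
  at the single point \<open>x0\<close>.

  Since \<open>f\<close> has compact support, \<open>F = \<F> f\<close> is a continuous function of polynomial growth
  (\<open>compactly_supported_fourier\<close>). Let \<open>P\<close> be a nonzero polynomial with \<open>P(D) f = 0\<close> on \<open>V\<close> and put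
  \<open>w = P F\<close>. The distribution \<open>\<F>\<^sup>-\<^sup>1 w = P(D) f\<close> vanishes in a ball around \<open>x0\<close>. Moreover
  \<open>(-\<Delta>)\<^sup>s \<F>\<^sup>-\<^sup>1 w = P(D) (-\<Delta>)\<^sup>s f\<close> is a smooth function near \<open>x0\<close> all of whose derivatives vanish at
  \<open>x0\<close>, because this is assumed for \<open>(-\<Delta>)\<^sup>s f\<close>. Both properties pass from \<open>w\<close> to \<open>Q w\<close> for every
  polynomial \<open>Q\<close>. It suffices to conclude \<open>w = 0\<close>: the zero set of \<open>P\<close> has no interior point
  (\<open>symbol_nonzero\<close>), hence the continuous function \<open>F\<close> vanishes, and with it \<open>f\<close>.

  To prove \<open>w = 0\<close> (\<open>fractional_unique_continuation\<close>), consider for \<open>u = Q w\<close> the function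
  \<open>h(t) = \<integral> u(\<xi>) exp (- t |\<xi>|\<^sup>2) exp (i x0 \<xi>) d\<xi>\<close>, which is a multiple of the heat extension of
  \<open>\<F>\<^sup>-\<^sup>1 u\<close> at the point \<open>x0\<close>.

  \<^item> As \<open>t\<close> tends to \<open>0\<close>, the function \<open>h\<close> is \<open>O (exp (- c / t))\<close>, because \<open>\<F>\<^sup>-\<^sup>1 u\<close> vanishes near
  \<open>x0\<close> and the Gaussian kernel is exponentially small off the diagonal
  (\<open>heat_small_near_zero_set\<close>). As \<open>t\<close> tends to infinity, \<open>h\<close> is
  \<open>O (t\<^bsup>-\<gamma>/2\<^esup>)\<close> for every positive \<open>\<gamma> < n\<close> (\<open>heat_decay_large_time\<close>), and \<open>\<gamma> > - 2 s\<close> can be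
  chosen.

  \<^item> The Gamma integral writes \<open>|\<xi>|\<^sup>2\<^sup>s\<close> as a superposition of Gaussians. So the value of
  \<open>(-\<Delta>)\<^sup>s \<F>\<^sup>-\<^sup>1 u\<close> at \<open>x0\<close>, which is zero, is a power moment of a derivative of \<open>h\<close>
  (\<open>J_vanishes\<close>). Integrating by parts, where \<open>s \<notin> \<int>\<close> guarantees that no factor vanishes, and
  using the multiples \<open>|\<xi>|\<^sup>2\<^sup>j u\<close> as well, one gets
  \<open>\<integral> t\<^bsup>-s-1-j\<^esup> h(t) dt = 0\<close> for all \<open>j\<close> (\<open>J_moments_vanish\<close>).

  \<^item> Because of the bound \<open>exp (- c / t)\<close> these identities can be summed with the coefficients of
  the exponential series, so that \<open>\<integral> t\<^bsup>-s-1\<^esup> exp (- a / t) h(t) dt = 0\<close> for \<open>0 < a < c\<close>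
  (\<open>bessel_average_vanishes\<close>).

  \<^item> Exchanging the integrals turns this into \<open>\<integral> u(\<xi>) exp (i x0 \<xi>) K\<^sub>a(\<xi>) d\<xi> = 0\<close> with the kernel
  \<open>K\<^sub>a(\<xi>) = \<integral> t\<^bsup>-s-1\<^esup> exp (- a / t - t |\<xi>|\<^sup>2) dt\<close>, a modified Bessel function, which is positive and
  decays exponentially. As \<open>u\<close> runs through all monomial multiples of \<open>w\<close>, all moments of
  \<open>w(\<xi>) exp (i x0 \<xi>) K\<^sub>a(\<xi>)\<close> vanish. A function with an exponential moment is determined by its
  moments (\<open>moments_determine\<close>), and therefore \<open>w = 0\<close>.
\<close>

section \<open>Partial derivatives\<close>

lemma partial_eqI:
  assumes "(\<phi> has_derivative \<phi>') (at x)"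
  shows "partial i \<phi> x = \<phi>' (axis i 1)"
  using frechet_derivative_at[OF assms] by (simp add: partial_def)

lemma partials_Nil [simp]: "partials [] \<phi> = \<phi>"
  by (simp add: partials_def)

lemma partials_Cons [simp]: "partials (i # is) \<phi> = partial i (partials is \<phi>)"
  by (simp add: partials_def)

lemma partials_append: "partials (is @ js) \<phi> = partials is (partials js \<phi>)"
  by (simp add: partials_def)

lemma smooth_on_partials:
  assumes "smooth_on U \<phi>"
  shows "smooth_on U (partials is \<phi>)"
  using assms by (simp add: smooth_on_def flip: partials_append)

lemma smooth_on_partial: "smooth_on U \<phi> \<Longrightarrow> smooth_on U (partial i \<phi>)"
  using smooth_on_partials[of U \<phi> "[i]"] by simp

lemma smooth_on_differentiable: "smooth_on U \<phi> \<Longrightarrow> x \<in> U \<Longrightarrow> \<phi> differentiable (at x)"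
  unfolding smooth_on_def by (metis partials_Nil)

lemma smooth_on_continuous_on: "smooth_on U \<phi> \<Longrightarrow> continuous_on U \<phi>"
  by (meson continuous_at_imp_continuous_on differentiable_imp_continuous_within smooth_on_differentiable)

lemma smooth_on_open: "smooth_on U \<phi> \<Longrightarrow> open U"
  by (simp add: smooth_on_def)

lemma has_derivative_partials:
  assumes "\<phi> differentiable (at x)"
  shows "(\<phi> has_derivative (\<lambda>h. \<Sum>i\<in>UNIV. h $ i *\<^sub>R partial i \<phi> x)) (at x)"
proof -
  let ?D = "frechet_derivative \<phi> (at x)"
  have D: "(\<phi> has_derivative ?D) (at x)"
    using assms by (simp add: frechet_derivative_works)
  have "linear ?D" using D has_derivative_linear by blast
  have "?D h = (\<Sum>i\<in>UNIV. h $ i *\<^sub>R partial i \<phi> x)" for h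
  proof -
    have "?D h = ?D (\<Sum>i\<in>UNIV. h $ i *\<^sub>R axis i 1)"
      using basis_expansion[of h] by (simp add: scalar_mult_eq_scaleR)
    also have "\<dots> = (\<Sum>i\<in>UNIV. h $ i *\<^sub>R ?D (axis i 1))"
      using \<open>linear ?D\<close> by (simp add: linear_sum linear_scale)
    finally show ?thesis by (simp add: partial_def)
  qed
  then show ?thesis using D by presburger
qed

lemma partial_cong_open:
  assumes "open U" "\<And>y. y \<in> U \<Longrightarrow> \<phi> y = \<psi> y" "x \<in> U"
  shows "partial i \<phi> x = partial i \<psi> x"
proof -
  have "(\<phi> has_derivative D) (at x) \<longleftrightarrow> (\<psi> has_derivative D) (at x)" for D
    using assms has_derivative_transform_within_open[of _ D x UNIV U] by metis
  then show ?thesis by (simp add: partial_def frechet_derivative_def)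
qed

lemma partials_cong_open:
  assumes "open U" "\<And>y. y \<in> U \<Longrightarrow> \<phi> y = \<psi> y" "x \<in> U"
  shows "partials is \<phi> x = partials is \<psi> x"
  using assms(3)
proof (induction "is" arbitrary: x)
  case Nil then show ?case using assms by simp
next
  case (Cons i "is")
  then show ?case using partial_cong_open[OF assms(1) Cons.IH] by simp
qed

lemma partial_add:
  assumes "\<phi> differentiable (at x)" "\<psi> differentiable (at x)"
  shows "partial i (\<lambda>x. \<phi> x + \<psi> x) x = partial i \<phi> x + partial i \<psi> x"
proof -
  have "((\<lambda>x. \<phi> x + \<psi> x) has_derivative (\<lambda>h. frechet_derivative \<phi> (at x) h + frechet_derivative \<psi> (at x) h)) (at x)"
    using assms by (intro has_derivative_add) (auto simp: frechet_derivative_works)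
  from partial_eqI[OF this] show ?thesis by (simp add: partial_def)
qed

lemma partial_mult:
  assumes "\<phi> differentiable (at x)" "\<psi> differentiable (at x)"
  shows "partial i (\<lambda>x. \<phi> x * \<psi> x) x = partial i \<phi> x * \<psi> x + \<phi> x * partial i \<psi> x"
proof -
  have "((\<lambda>x. \<phi> x * \<psi> x) has_derivative (\<lambda>h. \<phi> x * frechet_derivative \<psi> (at x) h + frechet_derivative \<phi> (at x) h * \<psi> x)) (at x)"
    using assms by (intro has_derivative_mult) (auto simp: frechet_derivative_works)
  from partial_eqI[OF this] show ?thesis by (simp add: partial_def)
qed

lemma partial_const [simp]: "partial i (\<lambda>x. c) = (\<lambda>x. 0)"
  by (intro ext) (metis has_derivative_const partial_eqI)

lemma partial_cmult:
  assumes "\<phi> differentiable (at x)"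
  shows "partial i (\<lambda>x. c * \<phi> x) x = c * partial i \<phi> x"
  using partial_mult[of "\<lambda>_. c" x \<phi> i] assms by simp

lemma differentiable_sum_list:
  fixes T :: "('a::real_normed_vector \<Rightarrow> 'b::real_normed_vector) list"
  assumes "\<And>\<psi>. \<psi> \<in> set T \<Longrightarrow> \<psi> differentiable (at x)"
  shows "(\<lambda>x. \<Sum>\<psi>\<leftarrow>T. \<psi> x) differentiable (at x)"
  using assms by (induction T) auto

lemma partial_sum_list:
  assumes "\<And>\<psi>. \<psi> \<in> set T \<Longrightarrow> \<psi> differentiable (at x)"
  shows "partial i (\<lambda>x. \<Sum>\<psi>\<leftarrow>T. \<psi> x) x = (\<Sum>\<psi>\<leftarrow>T. partial i \<psi> x)"
  using assms
  by (induction T) (auto simp: partial_add differentiable_sum_list)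

text \<open>
  The second difference quotient depends symmetrically on the two directions, which gives the
  symmetry of second derivatives from mere differentiability of the first ones. It is computed by
  the mean value inequality along the direction \<open>i\<close> for the increment in the direction \<open>j\<close>,
  corrected by the linear term.
\<close>

lemma young_limit:
  fixes \<phi> :: "'n::finite cfun"
  assumes U: "open U" "x \<in> U" "\<And>y. y \<in> U \<Longrightarrow> \<phi> differentiable (at y)"
    and d: "partial i \<phi> differentiable (at x)"
  shows "((\<lambda>h. (\<phi> (x + h *\<^sub>R axis i 1 + h *\<^sub>R axis j 1) - \<phi> (x + h *\<^sub>R axis i 1)
             - \<phi> (x + h *\<^sub>R axis j 1) + \<phi> x) /\<^sub>R h\<^sup>2) \<longlongrightarrow> partial j (partial i \<phi>) x) (at_right 0)"
proof -
  let ?a = "axis i 1 :: real^'n" and ?b = "axis j 1 :: real^'n"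
  define D where "D = frechet_derivative (partial i \<phi>) (at x)"
  have D: "(partial i \<phi> has_derivative D) (at x)"
    using d by (simp add: D_def frechet_derivative_works)
  then have lin: "linear D" by (simp add: has_derivative_linear)
  have na: "norm (h *\<^sub>R (axis i (1::real) :: real^'n)) = \<bar>h\<bar>" for h i by (simp add: norm_axis_1)
  show ?thesis
  proof (rule tendstoI)
    fix e :: real assume "e > 0"
    define e' where "e' = e / 8"
    have "e' > 0" using \<open>e > 0\<close> by (simp add: e'_def)
    obtain d1 where d1: "d1 > 0"
      "\<And>y. norm (y - x) < d1 \<Longrightarrow> norm (partial i \<phi> y - partial i \<phi> x - D (y - x)) \<le> e' * norm (y - x)"
      using D \<open>e' > 0\<close> unfolding has_derivative_at_alt by blast
    obtain d2 where d2: "d2 > 0" "ball x d2 \<subseteq> U" using U open_contains_ball by blast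
    define r where "r = min d1 d2 / 3"
    have "r > 0" using d1 d2 by (simp add: r_def)
    have main: "norm ((\<phi> (x + h *\<^sub>R ?a + h *\<^sub>R ?b) - \<phi> (x + h *\<^sub>R ?a)
             - \<phi> (x + h *\<^sub>R ?b) + \<phi> x) /\<^sub>R h\<^sup>2 - D ?b) \<le> 3 * e'" if h: "0 < h" "h < r" for h
    proof -
      (* the increment in the direction j along a segment in the direction i, minus its expected linear part *)
      define g where "g = (\<lambda>t. \<phi> (x + t *\<^sub>R ?a + h *\<^sub>R ?b) - \<phi> (x + t *\<^sub>R ?a) - (t * h) *\<^sub>R D ?b)"
      have in1: "norm (t *\<^sub>R ?a + h *\<^sub>R ?b) \<le> 2 * h" if "t \<in> {0..h}" for t
        using norm_triangle_ineq[of "t *\<^sub>R ?a" "h *\<^sub>R ?b"] that h na[of t i] na[of h j] by (simp add: norm_axis_1)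
      have in2: "norm (t *\<^sub>R ?a) \<le> h" if "t \<in> {0..h}" for t
        using that h by (simp add: norm_axis_1)
      have inU: "x + t *\<^sub>R ?a + h *\<^sub>R ?b \<in> U" "x + t *\<^sub>R ?a \<in> U" if "t \<in> {0..h}" for t
      proof -
        have dxv: "dist x (x + v) = norm v" for v :: "real^'n"
          by (simp add: dist_norm)
        have "x + (t *\<^sub>R ?a + h *\<^sub>R ?b) \<in> ball x d2" "x + t *\<^sub>R ?a \<in> ball x d2"
          unfolding mem_ball dxv using in1[OF that] in2[OF that] h by (auto simp only: r_def)
        then show "x + t *\<^sub>R ?a + h *\<^sub>R ?b \<in> U" "x + t *\<^sub>R ?a \<in> U"
          using subsetD[OF d2(2)] by (simp_all only: add.assoc)
      qed
      define g' where "g' = (\<lambda>t. partial i \<phi> (x + t *\<^sub>R ?a + h *\<^sub>R ?b) - partial i \<phi> (x + t *\<^sub>R ?a) - h *\<^sub>R D ?b)"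
      have line: "((\<lambda>t. \<phi> (c + t *\<^sub>R ?a)) has_vector_derivative partial i \<phi> (c + t *\<^sub>R ?a)) (at t)"
        if "c + t *\<^sub>R ?a \<in> U" for c t
      proof -
        have 1: "(\<phi> has_derivative frechet_derivative \<phi> (at (c + t *\<^sub>R ?a))) (at (c + t *\<^sub>R ?a))"
          using U(3)[OF that] by (simp add: frechet_derivative_works)
        have 2: "((\<lambda>t. c + t *\<^sub>R ?a) has_derivative (\<lambda>t. t *\<^sub>R ?a)) (at t)"
          by (auto intro!: derivative_eq_intros)
        have "((\<lambda>t. \<phi> (c + t *\<^sub>R ?a)) has_derivative (\<lambda>s. frechet_derivative \<phi> (at (c + t *\<^sub>R ?a)) (s *\<^sub>R ?a))) (at t)"
          using has_derivative_compose[OF 2 1] by simp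
        moreover have "frechet_derivative \<phi> (at (c + t *\<^sub>R ?a)) (s *\<^sub>R ?a) = s *\<^sub>R partial i \<phi> (c + t *\<^sub>R ?a)" for s
          using 1 by (simp add: partial_def has_derivative_linear linear_scale)
        ultimately show ?thesis by (simp add: has_vector_derivative_def)
      qed
      have gd: "(g has_vector_derivative g' t) (at t within {0..h})" if "t \<in> {0..h}" for t
      proof -
        have A: "((\<lambda>t. \<phi> (x + t *\<^sub>R ?a + h *\<^sub>R ?b)) has_vector_derivative partial i \<phi> (x + t *\<^sub>R ?a + h *\<^sub>R ?b)) (at t)"
          using line[of "x + h *\<^sub>R ?b" t] inU(1)[OF that] by (simp add: algebra_simps)
        have B: "((\<lambda>t. \<phi> (x + t *\<^sub>R ?a)) has_vector_derivative partial i \<phi> (x + t *\<^sub>R ?a)) (at t)"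
          using line[of x t] inU(2)[OF that] by simp
        have C: "((\<lambda>t. (t * h) *\<^sub>R D ?b) has_vector_derivative h *\<^sub>R D ?b) (at t)"
          unfolding has_vector_derivative_def
          by (auto intro!: derivative_eq_intros)
        show ?thesis unfolding g_def g'_def
          using has_vector_derivative_diff[OF has_vector_derivative_diff[OF A B] C]
          by (rule has_vector_derivative_at_within)
      qed
      have bound: "norm (g' t) \<le> 3 * e' * h" if "t \<in> {0..h}" for t
      proof -
        have "norm (partial i \<phi> (x + t *\<^sub>R ?a + h *\<^sub>R ?b) - partial i \<phi> x - D (t *\<^sub>R ?a + h *\<^sub>R ?b)) \<le> e' * norm (t *\<^sub>R ?a + h *\<^sub>R ?b)"
          using d1(2)[of "x + t *\<^sub>R ?a + h *\<^sub>R ?b"] in1[OF that] h d1 d2 by (simp add: r_def add.assoc)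
        also have "\<dots> \<le> e' * (2 * h)" using in1[OF that] \<open>e' > 0\<close> by (intro mult_left_mono) auto
        finally have 1: "norm (partial i \<phi> (x + t *\<^sub>R ?a + h *\<^sub>R ?b) - partial i \<phi> x - D (t *\<^sub>R ?a + h *\<^sub>R ?b)) \<le> e' * (2 * h)" .
        have "norm (partial i \<phi> (x + t *\<^sub>R ?a) - partial i \<phi> x - D (t *\<^sub>R ?a)) \<le> e' * norm (t *\<^sub>R ?a)"
          using d1(2)[of "x + t *\<^sub>R ?a"] in2[OF that] h d1 d2 by (simp add: r_def)
        also have "\<dots> \<le> e' * h" using in2[OF that] \<open>e' > 0\<close> by (intro mult_left_mono) auto
        finally have 2: "norm (partial i \<phi> (x + t *\<^sub>R ?a) - partial i \<phi> x - D (t *\<^sub>R ?a)) \<le> e' * h" .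
        (* the partial derivative is compared with its linearisation at both ends of the segment *)
        have eq: "g' t = (partial i \<phi> (x + t *\<^sub>R ?a + h *\<^sub>R ?b) - partial i \<phi> x - D (t *\<^sub>R ?a + h *\<^sub>R ?b))
            - (partial i \<phi> (x + t *\<^sub>R ?a) - partial i \<phi> x - D (t *\<^sub>R ?a))"
          unfolding g'_def linear_add[OF lin] linear_scale[OF lin] by simp
        have "norm (g' t) \<le> e' * (2 * h) + e' * h"
          unfolding eq by (rule order_trans[OF norm_triangle_ineq4 add_mono[OF 1 2]])
        then show ?thesis by simp
      qed
      have "norm (g h - g 0) \<le> 3 * e' * h * norm (h - 0)"
      proof (rule differentiable_bound[where S="{0..h}" and f'="\<lambda>t s. s *\<^sub>R g' t"])
        show "(g has_derivative (\<lambda>s. s *\<^sub>R g' t)) (at t within {0..h})" if "t \<in> {0..h}" for t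
          using gd[OF that] by (simp add: has_vector_derivative_def)
        show "onorm (\<lambda>s. s *\<^sub>R g' t) \<le> 3 * e' * h" if "t \<in> {0..h}" for t
          using bound[OF that]
          by (intro onorm_le) (metis mult.commute mult_right_mono norm_ge_zero norm_scaleR real_norm_def)
      qed (use h in auto)
      then have n: "norm (g h - g 0) \<le> 3 * e' * h\<^sup>2" using h by (simp add: power2_eq_square)
      have "(\<phi> (x + h *\<^sub>R ?a + h *\<^sub>R ?b) - \<phi> (x + h *\<^sub>R ?a) - \<phi> (x + h *\<^sub>R ?b) + \<phi> x) /\<^sub>R h\<^sup>2 - D ?b = (g h - g 0) /\<^sub>R h\<^sup>2"
        using h by (simp add: g_def power2_eq_square algebra_simps)
      then have "norm ((\<phi> (x + h *\<^sub>R ?a + h *\<^sub>R ?b) - \<phi> (x + h *\<^sub>R ?a) - \<phi> (x + h *\<^sub>R ?b) + \<phi> x) /\<^sub>R h\<^sup>2 - D ?b) = norm (g h - g 0) / h\<^sup>2"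
        by (simp add: divide_inverse_commute)
      also have "\<dots> \<le> 3 * e'" using n h by (simp add: divide_le_eq)
      finally show ?thesis .
    qed
    have "eventually (\<lambda>h::real. 0 < h \<and> h < r) (at_right 0)"
      using \<open>r > 0\<close> eventually_at_right_field by (auto simp: eventually_at_right_field)
    then show "eventually (\<lambda>h. dist ((\<phi> (x + h *\<^sub>R ?a + h *\<^sub>R ?b) - \<phi> (x + h *\<^sub>R ?a) - \<phi> (x + h *\<^sub>R ?b) + \<phi> x) /\<^sub>R h\<^sup>2) (partial j (partial i \<phi>) x) < e) (at_right 0)"
    proof eventually_elim
      case (elim h)
      have "3 * e' < e" using \<open>e > 0\<close> by (simp add: e'_def)
      then show ?case using main[of h] elim by (simp add: dist_norm D_def partial_def)
    qed
  qed
qed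

lemma partial_commute:
  assumes "smooth_on U \<phi>" "x \<in> U"
  shows "partial i (partial j \<phi>) x = partial j (partial i \<phi>) x"
proof -
  have d: "open U" "\<And>y. y \<in> U \<Longrightarrow> \<phi> differentiable (at y)" "\<And>i. partial i \<phi> differentiable (at x)"
    using smooth_on_open[OF assms(1)] smooth_on_differentiable[OF assms(1)]
      smooth_on_differentiable[OF smooth_on_partial[OF assms(1)] assms(2)] by blast+
  have "((\<lambda>h. (\<phi> (x + h *\<^sub>R axis i 1 + h *\<^sub>R axis j 1) - \<phi> (x + h *\<^sub>R axis i 1)
             - \<phi> (x + h *\<^sub>R axis j 1) + \<phi> x) /\<^sub>R h\<^sup>2) \<longlongrightarrow> partial i (partial j \<phi>) x) (at_right 0)"
    using young_limit[OF d(1) assms(2) d(2,3), of j i] by (simp add: algebra_simps)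
  from tendsto_unique[OF _ this young_limit[OF d(1) assms(2) d(2,3), of i j]]
  show ?thesis by simp
qed

lemma partials_partial_commute:
  assumes "smooth_on U \<phi>" "x \<in> U"
  shows "partials is (partial i \<phi>) x = partial i (partials is \<phi>) x"
  using assms(2)
proof (induction "is" arbitrary: x)
  case (Cons j "is")
  have "partials (j # is) (partial i \<phi>) x = partial j (partial i (partials is \<phi>)) x"
    using partial_cong_open[OF smooth_on_open[OF assms(1)] Cons.IH Cons.prems] by simp
  also have "\<dots> = partial i (partial j (partials is \<phi>)) x"
    using partial_commute[OF smooth_on_partials[OF assms(1)] Cons.prems] .
  finally show ?case by simp
qed simp

lemma partials_mset_cong:
  assumes "smooth_on U \<phi>" "mset is = mset js" "x \<in> U"
  shows "partials is \<phi> x = partials js \<phi> x"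
  using assms(2,3)
proof (induction "is" arbitrary: js x)
  case (Cons i "is")
  then have "i \<in> set js" by (metis list.set_intros(1) set_mset_mset)
  then obtain ys zs where js: "js = ys @ i # zs" by (meson split_list)
  have m: "mset is = mset (ys @ zs)" using Cons.prems(1) js by simp
  have "partials js \<phi> x = partial i (partials (ys @ zs) \<phi>) x"
    using partials_partial_commute[OF smooth_on_partials[OF assms(1)] Cons.prems(2)]
    by (simp add: js partials_append)
  also have "\<dots> = partial i (partials is \<phi>) x"
    using Cons.IH[OF m] by (intro partial_cong_open[OF smooth_on_open[OF assms(1)] _ Cons.prems(2)]) simp
  finally show ?case by simp
qed simp

lemma coordinates: "distinct (coordinates :: 'n::finite list)" "set (coordinates :: 'n list) = UNIV"
proof -
  have "\<exists>is::'n list. distinct is \<and> set is = UNIV" using finite_distinct_list[of "UNIV :: 'n set"] by auto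
  then have "distinct (coordinates :: 'n list) \<and> set (coordinates :: 'n list) = UNIV"
    unfolding coordinates_def by (rule someI_ex)
  then show "distinct (coordinates :: 'n::finite list)" "set (coordinates :: 'n list) = UNIV" by auto
qed

definition mi_list :: "'n::finite multiindex \<Rightarrow> 'n list"
  where "mi_list \<alpha> = concat (map (\<lambda>i. replicate (\<alpha> i) i) coordinates)"

lemma mi_partial_eq: "mi_partial \<alpha> = partials (mi_list \<alpha>)"
  by (simp add: mi_partial_def mi_list_def)

lemma count_mi_list: "count (mset (mi_list \<alpha>)) i = \<alpha> i"
proof -
  have "count (mset (concat (map (\<lambda>i. replicate (\<alpha> i) i) xs))) i = (if i \<in> set xs then \<alpha> i else 0)"
    if "distinct xs" for xs
    using that by (induction xs) auto
  then show ?thesis using coordinates[where 'n='a] by (simp add: mi_list_def)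
qed

lemma partials_eq_mi_partial:
  assumes "smooth_on U \<phi>" "x \<in> U"
  shows "partials is \<phi> x = mi_partial (count (mset is)) \<phi> x"
  unfolding mi_partial_eq
  by (rule partials_mset_cong[OF assms(1) _ assms(2)]) (auto intro!: multiset_eqI simp: count_mi_list)

section \<open>Functions with controlled derivatives\<close>

text \<open>
  Smoothness and derivative bounds are proved by coinduction: if each partial derivative of a
  member of a class \<open>T\<close> is a finite sum of members of \<open>T\<close>, then so are the derivatives of all
  orders, and it suffices to check differentiability and bounds for the members themselves. The
  members are families indexed by \<open>p\<close>, with one and the same sum for all \<open>p\<close>, so that bounds which
  are uniform in \<open>p\<close> survive.
\<close>

lemma partials_coinduct:
  fixes T :: "('p \<Rightarrow> 'n::finite cfun) set"
  assumes diff: "\<And>\<Phi> p x. \<Phi> \<in> T \<Longrightarrow> p \<in> I \<Longrightarrow> \<Phi> p differentiable (at x)"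
    and part: "\<And>\<Phi> i. \<Phi> \<in> T \<Longrightarrow> \<exists>L. set L \<subseteq> T \<and> (\<forall>p\<in>I. \<forall>x. partial i (\<Phi> p) x = (\<Sum>\<Psi>\<leftarrow>L. \<Psi> p x))"
    and "\<Phi> \<in> T"
  shows "\<exists>L. set L \<subseteq> T \<and> (\<forall>p\<in>I. \<forall>x. partials is (\<Phi> p) x = (\<Sum>\<Psi>\<leftarrow>L. \<Psi> p x))"
proof (induction "is")
  case Nil
  show ?case by (rule exI[of _ "[\<Phi>]"]) (simp add: assms)
next
  case (Cons i "is")
  then obtain L where L: "set L \<subseteq> T" "\<And>p x. p \<in> I \<Longrightarrow> partials is (\<Phi> p) x = (\<Sum>\<Psi>\<leftarrow>L. \<Psi> p x)" by blast
  from part[of _ i] obtain K where K: "\<And>\<Psi>. \<Psi> \<in> T \<Longrightarrow> set (K \<Psi>) \<subseteq> T"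
    "\<And>\<Psi> p x. \<Psi> \<in> T \<Longrightarrow> p \<in> I \<Longrightarrow> partial i (\<Psi> p) x = (\<Sum>\<Xi>\<leftarrow>K \<Psi>. \<Xi> p x)"
    by metis
  have "partials (i # is) (\<Phi> p) x = (\<Sum>\<Psi>\<leftarrow>concat (map K L). \<Psi> p x)" if "p \<in> I" for p x
  proof -
    have "partials (i # is) (\<Phi> p) x = partial i (\<lambda>x. \<Sum>\<psi>\<leftarrow>map (\<lambda>\<Psi>. \<Psi> p) L. \<psi> x) x"
      by (simp add: o_def ext[OF L(2)[OF that]])
    also have "\<dots> = (\<Sum>\<psi>\<leftarrow>map (\<lambda>\<Psi>. \<Psi> p) L. partial i \<psi> x)"
      using L(1) diff that by (intro partial_sum_list) auto
    also have "\<dots> = (\<Sum>\<Psi>\<leftarrow>L. (\<Sum>\<Xi>\<leftarrow>K \<Psi>. \<Xi> p x))"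
      using L(1) K(2) that by (simp add: o_def subset_iff cong: map_cong)
    also have "\<dots> = (\<Sum>\<Psi>\<leftarrow>concat (map K L). \<Psi> p x)"
      by (induction L) auto
    finally show ?thesis .
  qed
  moreover have "set (concat (map K L)) \<subseteq> T" using L(1) K(1) by auto
  ultimately show ?case by blast
qed

lemma smooth_coinduct:
  fixes T :: "('p \<Rightarrow> 'n::finite cfun) set"
  assumes diff: "\<And>\<Phi> p x. \<Phi> \<in> T \<Longrightarrow> p \<in> I \<Longrightarrow> \<Phi> p differentiable (at x)"
    and part: "\<And>\<Phi> i. \<Phi> \<in> T \<Longrightarrow> \<exists>L. set L \<subseteq> T \<and> (\<forall>p\<in>I. \<forall>x. partial i (\<Phi> p) x = (\<Sum>\<Psi>\<leftarrow>L. \<Psi> p x))"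
    and "\<Phi> \<in> T" "p \<in> I"
  shows "smooth_on UNIV (\<Phi> p)"
  unfolding smooth_on_def
proof (intro conjI allI ballI)
  fix "is" x
  have "\<exists>L. set L \<subseteq> T \<and> (\<forall>p\<in>I. \<forall>x. partials is (\<Phi> p) x = (\<Sum>\<Psi>\<leftarrow>L. \<Psi> p x))"
    by (rule partials_coinduct[where T=T and I=I], erule (1) diff, erule part, fact)
  then obtain L where L: "set L \<subseteq> T" "\<And>x. partials is (\<Phi> p) x = (\<Sum>\<Psi>\<leftarrow>L. \<Psi> p x)"
    using assms(4) by metis
  have "(\<lambda>x. \<Sum>\<psi>\<leftarrow>map (\<lambda>\<Psi>. \<Psi> p) L. \<psi> x) differentiable (at x)"
    using L(1) diff assms(4) by (intro differentiable_sum_list) auto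
  moreover have "partials is (\<Phi> p) = (\<lambda>x. \<Sum>\<psi>\<leftarrow>map (\<lambda>\<Psi>. \<Psi> p) L. \<psi> x)"
    using L(2) by (auto simp: o_def)
  ultimately show "partials is (\<Phi> p) differentiable (at x)" by simp
qed simp

text \<open>
  The square of the Japanese bracket: its powers dominate all polynomials, and it is itself a polynomial.
\<close>

definition jap :: "real ^ 'n::finite \<Rightarrow> real"
  where "jap x = 1 + (norm x)\<^sup>2"

lemma jap_ge_1 [simp]: "1 \<le> jap x" by (simp add: jap_def)
lemma jap_pos [simp]: "0 < jap x" by (rule less_le_trans[OF zero_less_one jap_ge_1])
lemma jap_nonneg [simp]: "0 \<le> jap x" using jap_pos[of x] by linarith
lemma jap_neq_0 [simp]: "jap x \<noteq> 0" using jap_pos[of x] by linarith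
lemma jap_power_mono: "m \<le> n \<Longrightarrow> jap x ^ m \<le> jap x ^ n" by (simp add: power_increasing)
lemma norm_le_jap: "norm x \<le> jap x"
  using zero_le_power2[of "norm x - 1/2"] by (simp add: jap_def power2_eq_square algebra_simps)
lemma continuous_jap [continuous_intros]: "continuous_on S jap"
  unfolding jap_def by (intro continuous_intros)
lemma abs_component_le_jap: "\<bar>x $ i\<bar> \<le> jap x"
  using component_le_norm_cart[of x i] norm_le_jap[of x] by linarith

text \<open>
  A family of Schwartz functions whose seminorms are all bounded by constant multiples of the
  weight \<open>w p\<close>. The smallness of a parametrised family has to be carried through the Fourier
  transform, where the loss of finitely many derivatives is harmless because all seminorms are
  controlled. A single Schwartz function is the case of one parameter and weight \<open>1\<close>.
\<close>

definition schwartz_family :: "'p set \<Rightarrow> ('p \<Rightarrow> real) \<Rightarrow> ('p \<Rightarrow> 'n::finite cfun) \<Rightarrow> bool"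
  where "schwartz_family I w \<Phi> \<longleftrightarrow> (\<forall>p\<in>I. 0 \<le> w p \<and> smooth_on UNIV (\<Phi> p)) \<and>
    (\<forall>is N. \<exists>C. \<forall>p\<in>I. \<forall>x. jap x ^ N * norm (partials is (\<Phi> p) x) \<le> C * w p)"

text \<open>
  The multipliers of the Schwartz space.
\<close>

definition slow_growth :: "'n::finite cfun \<Rightarrow> bool"
  where "slow_growth \<kappa> \<longleftrightarrow> smooth_on UNIV \<kappa> \<and>
    (\<forall>is. \<exists>C N. \<forall>x. norm (partials is \<kappa> x) \<le> C * jap x ^ N)"

lemma schwartz_family_coinduct:
  fixes T :: "('p \<Rightarrow> 'n::finite cfun) set"
  assumes w: "\<And>p. p \<in> I \<Longrightarrow> 0 \<le> w p"
    and diff: "\<And>\<Phi> p x. \<Phi> \<in> T \<Longrightarrow> p \<in> I \<Longrightarrow> \<Phi> p differentiable (at x)"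
    and part: "\<And>\<Phi> i. \<Phi> \<in> T \<Longrightarrow> \<exists>L. set L \<subseteq> T \<and> (\<forall>p\<in>I. \<forall>x. partial i (\<Phi> p) x = (\<Sum>\<Psi>\<leftarrow>L. \<Psi> p x))"
    and bound: "\<And>\<Phi> N. \<Phi> \<in> T \<Longrightarrow> \<exists>C. \<forall>p\<in>I. \<forall>x. jap x ^ N * norm (\<Phi> p x) \<le> C * w p"
    and "\<Phi> \<in> T"
  shows "schwartz_family I w \<Phi>"
  unfolding schwartz_family_def
proof (intro conjI allI ballI)
  fix p assume "p \<in> I"
  then show "0 \<le> w p" using w by blast
  show "smooth_on UNIV (\<Phi> p)" 
    by (rule smooth_coinduct[where T=T and I=I], erule (1) diff, erule part) (use \<open>\<Phi> \<in> T\<close> \<open>p \<in> I\<close> in auto)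
next
  fix "is" N
  have "\<exists>L. set L \<subseteq> T \<and> (\<forall>p\<in>I. \<forall>x. partials is (\<Phi> p) x = (\<Sum>\<Psi>\<leftarrow>L. \<Psi> p x))"
    by (rule partials_coinduct[where T=T and I=I], erule (1) diff, erule part, fact)
  then obtain L where L: "set L \<subseteq> T" "\<And>p x. p \<in> I \<Longrightarrow> partials is (\<Phi> p) x = (\<Sum>\<Psi>\<leftarrow>L. \<Psi> p x)"
    by metis
  have "\<exists>C. \<forall>p\<in>I. \<forall>x. jap x ^ N * norm (\<Sum>\<Psi>\<leftarrow>L. \<Psi> p x) \<le> C * w p"
    using L(1)
  proof (induction L)
    case Nil show ?case by (rule exI[of _ 0]) simp
  next
    case (Cons \<Psi> L)
    then obtain C where C: "\<And>p x. p \<in> I \<Longrightarrow> jap x ^ N * norm (\<Sum>\<Psi>\<leftarrow>L. \<Psi> p x) \<le> C * w p" by auto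
    obtain D where D: "\<And>p x. p \<in> I \<Longrightarrow> jap x ^ N * norm (\<Psi> p x) \<le> D * w p" using bound Cons.prems by fastforce
    show ?case
    proof (intro exI ballI allI)
      fix p x assume "p \<in> I"
      have "jap x ^ N * norm (\<Sum>\<Psi>\<leftarrow>\<Psi> # L. \<Psi> p x) \<le> jap x ^ N * (norm (\<Psi> p x) + norm (\<Sum>\<Psi>\<leftarrow>L. \<Psi> p x))"
        by (intro mult_left_mono) (auto intro: norm_triangle_ineq)
      also have "\<dots> \<le> (D + C) * w p" using C[OF \<open>p \<in> I\<close>, of x] D[OF \<open>p \<in> I\<close>, of x] by (simp add: algebra_simps)
      finally show "jap x ^ N * norm (\<Sum>\<Psi>\<leftarrow>\<Psi> # L. \<Psi> p x) \<le> (D + C) * w p" .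
    qed
  qed
  then show "\<exists>C. \<forall>p\<in>I. \<forall>x. jap x ^ N * norm (partials is (\<Phi> p) x) \<le> C * w p" using L(2) by simp
qed

lemma slow_growth_coinduct:
  fixes T :: "('n::finite cfun) set"
  assumes diff: "\<And>\<phi> x. \<phi> \<in> T \<Longrightarrow> \<phi> differentiable (at x)"
    and part: "\<And>\<phi> i. \<phi> \<in> T \<Longrightarrow> \<exists>L. set L \<subseteq> T \<and> (\<forall>x. partial i \<phi> x = (\<Sum>\<psi>\<leftarrow>L. \<psi> x))"
    and bound: "\<And>\<phi>. \<phi> \<in> T \<Longrightarrow> \<exists>C N. \<forall>x. norm (\<phi> x) \<le> C * jap x ^ N"
    and "\<phi> \<in> T"
  shows "slow_growth \<phi>"
proof -
  define T' where "T' = (\<lambda>\<phi> (u::unit). \<phi>) ` T"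
  have T': "\<And>\<Phi> p x. \<Phi> \<in> T' \<Longrightarrow> p \<in> UNIV \<Longrightarrow> \<Phi> p differentiable (at x)"
    "\<And>\<Phi> i. \<Phi> \<in> T' \<Longrightarrow> \<exists>L. set L \<subseteq> T' \<and> (\<forall>p\<in>UNIV. \<forall>x. partial i (\<Phi> p) x = (\<Sum>\<Psi>\<leftarrow>L. \<Psi> p x))"
  proof -
    fix \<Phi> p x assume "\<Phi> \<in> T'" then show "\<Phi> p differentiable (at x)" using diff by (auto simp: T'_def)
  next
    fix \<Phi> i assume "\<Phi> \<in> T'"
    then obtain \<phi> where \<phi>: "\<phi> \<in> T" "\<Phi> = (\<lambda>u. \<phi>)" by (auto simp: T'_def)
    obtain L where "set L \<subseteq> T" "\<forall>x. partial i \<phi> x = (\<Sum>\<psi>\<leftarrow>L. \<psi> x)" using part[OF \<phi>(1)] by blast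
    then show "\<exists>L. set L \<subseteq> T' \<and> (\<forall>p\<in>UNIV. \<forall>x. partial i (\<Phi> p) x = (\<Sum>\<Psi>\<leftarrow>L. \<Psi> p x))"
      using \<phi>(2) by (intro exI[of _ "map (\<lambda>\<phi> u. \<phi>) L"]) (auto simp: T'_def o_def)
  qed
  have mem: "(\<lambda>u. \<phi>) \<in> T'" using assms(4) by (simp add: T'_def)
  show ?thesis unfolding slow_growth_def
  proof (intro conjI allI)
    show "smooth_on UNIV \<phi>"
      by (rule smooth_coinduct[where T=T' and I=UNIV and \<Phi>="\<lambda>u. \<phi>"], erule (1) T', erule T') (use mem in auto)
    fix "is"
    have "\<exists>L. set L \<subseteq> T' \<and> (\<forall>p\<in>UNIV. \<forall>x. partials is \<phi> x = (\<Sum>\<Psi>\<leftarrow>L. \<Psi> p x))"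
      by (rule partials_coinduct[where T=T' and I=UNIV and \<Phi>="\<lambda>u. \<phi>"], erule (1) T', erule T', fact)
    then obtain L where L: "set L \<subseteq> T'" "\<And>x. partials is \<phi> x = (\<Sum>\<Psi>\<leftarrow>L. \<Psi> () x)"
      by blast
    have "\<exists>C N. \<forall>x. norm (\<Sum>\<Psi>\<leftarrow>L. \<Psi> () x) \<le> C * jap x ^ N"
      using L(1)
    proof (induction L)
      case Nil show ?case by (rule exI[of _ 0]) simp
    next
      case (Cons \<Psi> L)
      then obtain C N where C: "\<And>x. norm (\<Sum>\<Psi>\<leftarrow>L. \<Psi> () x) \<le> C * jap x ^ N" by auto
      obtain D M where D: "\<And>x. norm (\<Psi> () x) \<le> D * jap x ^ M" using bound Cons.prems by (fastforce simp: T'_def)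
      show ?case
      proof (intro exI allI)
        fix x
        have "norm (\<Sum>\<Psi>\<leftarrow>\<Psi> # L. \<Psi> () x) \<le> norm (\<Psi> () x) + norm (\<Sum>\<Psi>\<leftarrow>L. \<Psi> () x)"
          by (auto intro: norm_triangle_ineq)
        also have "\<dots> \<le> D * jap x ^ M + C * jap x ^ N" using C[of x] D[of x] by simp
        also have "\<dots> \<le> \<bar>D\<bar> * jap x ^ (M + N) + \<bar>C\<bar> * jap x ^ (M + N)"
          by (intro add_mono mult_mono jap_power_mono) auto
        finally show "norm (\<Sum>\<Psi>\<leftarrow>\<Psi> # L. \<Psi> () x) \<le> (\<bar>D\<bar> + \<bar>C\<bar>) * jap x ^ (M + N)" by (simp add: algebra_simps)
      qed
    qed
    then show "\<exists>C N. \<forall>x. norm (partials is \<phi> x) \<le> C * jap x ^ N" using L(2) by simp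
  qed
qed

lemma slow_growth_smooth: "slow_growth \<kappa> \<Longrightarrow> smooth_on UNIV \<kappa>" by (simp add: slow_growth_def)
lemma slow_growth_differentiable: "slow_growth \<kappa> \<Longrightarrow> \<kappa> differentiable (at x)"
  by (meson UNIV_I slow_growth_smooth smooth_on_differentiable)
lemma slow_growth_continuous: "slow_growth \<kappa> \<Longrightarrow> continuous_on S \<kappa>"
  by (meson slow_growth_smooth smooth_on_continuous_on continuous_on_subset subset_UNIV)
lemma slow_growth_partial: "slow_growth \<kappa> \<Longrightarrow> slow_growth (partial i \<kappa>)"
  unfolding slow_growth_def
  using smooth_on_partial partials_append[of _ "[i]" \<kappa>] by (metis partials_Cons partials_Nil)
lemma slow_growth_bound:
  assumes "slow_growth \<kappa>" obtains C N where "C > 0" "\<And>x. norm (\<kappa> x) \<le> C * jap x ^ N"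
proof -
  obtain C N where C: "\<And>x. norm (\<kappa> x) \<le> C * jap x ^ N" using assms unfolding slow_growth_def by (metis partials_Nil)
  have "norm (\<kappa> x) \<le> (\<bar>C\<bar> + 1) * jap x ^ N" for x
    using C[of x] by (rule order_trans) (intro mult_right_mono, auto)
  then show thesis by (intro that[of "\<bar>C\<bar> + 1" N]) auto
qed

lemma schwartz_family_nonneg: "schwartz_family I w \<Phi> \<Longrightarrow> p \<in> I \<Longrightarrow> 0 \<le> w p" by (simp add: schwartz_family_def)
lemma schwartz_family_smooth: "schwartz_family I w \<Phi> \<Longrightarrow> p \<in> I \<Longrightarrow> smooth_on UNIV (\<Phi> p)" by (simp add: schwartz_family_def)
lemma schwartz_family_differentiable: "schwartz_family I w \<Phi> \<Longrightarrow> p \<in> I \<Longrightarrow> \<Phi> p differentiable (at x)"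
  by (meson UNIV_I schwartz_family_smooth smooth_on_differentiable)
lemma schwartz_family_partial: "schwartz_family I w \<Phi> \<Longrightarrow> schwartz_family I w (\<lambda>p. partial i (\<Phi> p))"
  unfolding schwartz_family_def
  using smooth_on_partial partials_append[of _ "[i]"] by (metis partials_Cons partials_Nil)
lemma schwartz_family_bound:
  assumes "schwartz_family I w \<Phi>" obtains C where "C > 0" "\<And>p x. p \<in> I \<Longrightarrow> jap x ^ N * norm (\<Phi> p x) \<le> C * w p"
proof -
  obtain C where C: "\<And>p x. p \<in> I \<Longrightarrow> jap x ^ N * norm (\<Phi> p x) \<le> C * w p" using assms unfolding schwartz_family_def by (metis partials_Nil)
  have "jap x ^ N * norm (\<Phi> p x) \<le> (\<bar>C\<bar> + 1) * w p" if "p \<in> I" for p x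
    using C[OF that, of x] by (rule order_trans) (intro mult_right_mono schwartz_family_nonneg[OF assms that], auto)
  then show thesis by (intro that[of "\<bar>C\<bar> + 1"]) auto
qed

text \<open>
  By the product rule, the products of a multiplier and a family form a class as required for
  coinduction.
\<close>

lemma schwartz_family_mult:
  fixes \<Phi> :: "'p \<Rightarrow> 'n::finite cfun"
  assumes "slow_growth \<kappa>" "schwartz_family I w \<Phi>"
  shows "schwartz_family I w (\<lambda>p x. \<kappa> x * \<Phi> p x)"
proof (rule schwartz_family_coinduct[where T="{\<lambda>p x. \<kappa> x * \<Phi> p x | \<kappa> \<Phi>. slow_growth \<kappa> \<and> schwartz_family I w \<Phi>}"])
  show "0 \<le> w p" if "p \<in> I" for p using schwartz_family_nonneg[OF assms(2) that] .
  show "\<Xi> p differentiable (at x)" if "\<Xi> \<in> {\<lambda>p x. \<kappa> x * \<Phi> p x | \<kappa> \<Phi>. slow_growth \<kappa> \<and> schwartz_family I w \<Phi>}" "p \<in> I" for \<Xi> p x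
    using that(1) by (clarify, intro differentiable_mult slow_growth_differentiable schwartz_family_differentiable[OF _ that(2)])
  show "(\<lambda>p x. \<kappa> x * \<Phi> p x) \<in> {\<lambda>p x. \<kappa> x * \<Phi> p x | \<kappa> \<Phi>. slow_growth \<kappa> \<and> schwartz_family I w \<Phi>}"
    using assms by blast
next
  fix \<Xi> :: "'p \<Rightarrow> 'n cfun" and i
  assume "\<Xi> \<in> {\<lambda>p x. \<kappa> x * \<Phi> p x | \<kappa> \<Phi>. slow_growth \<kappa> \<and> schwartz_family I w \<Phi>}"
  then obtain \<kappa> \<Phi> where *: "\<Xi> = (\<lambda>p x. \<kappa> x * \<Phi> p x)" "slow_growth \<kappa>" "schwartz_family I w \<Phi>" by blast
  show "\<exists>L. set L \<subseteq> {\<lambda>p x. \<kappa> x * \<Phi> p x | \<kappa> \<Phi>. slow_growth \<kappa> \<and> schwartz_family I w \<Phi>} \<and> (\<forall>p\<in>I. \<forall>x. partial i (\<Xi> p) x = (\<Sum>\<Psi>\<leftarrow>L. \<Psi> p x))"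
    apply (rule exI[of _ "[\<lambda>p x. partial i \<kappa> x * \<Phi> p x, \<lambda>p x. \<kappa> x * partial i (\<Phi> p) x]"])
    using slow_growth_partial[OF *(2), of i] schwartz_family_partial[OF *(3), of i] *(2,3)
      partial_mult[OF slow_growth_differentiable[OF *(2)] schwartz_family_differentiable[OF *(3)]]
    by (auto simp: *(1))
next
  fix \<Xi> :: "'p \<Rightarrow> 'n cfun" and N
  assume "\<Xi> \<in> {\<lambda>p x. \<kappa> x * \<Phi> p x | \<kappa> \<Phi>. slow_growth \<kappa> \<and> schwartz_family I w \<Phi>}"
  then obtain \<kappa> \<Phi> where *: "\<Xi> = (\<lambda>p x. \<kappa> x * \<Phi> p x)" "slow_growth \<kappa>" "schwartz_family I w \<Phi>" by blast
  obtain C M where C: "C > 0" "\<And>x. norm (\<kappa> x) \<le> C * jap x ^ M" using slow_growth_bound *(2) by blast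
  obtain D where D: "D > 0" "\<And>p x. p \<in> I \<Longrightarrow> jap x ^ (N + M) * norm (\<Phi> p x) \<le> D * w p" using schwartz_family_bound *(3) by blast
  show "\<exists>C. \<forall>p\<in>I. \<forall>x. jap x ^ N * norm (\<Xi> p x) \<le> C * w p"
  proof (intro exI ballI allI)
    fix p x assume "p \<in> I"
    have "jap x ^ N * norm (\<Xi> p x) = jap x ^ N * (norm (\<kappa> x) * norm (\<Phi> p x))" by (simp add: *(1) norm_mult)
    also have "\<dots> \<le> jap x ^ N * ((C * jap x ^ M) * norm (\<Phi> p x))"
      by (intro mult_left_mono mult_right_mono C) auto
    also have "\<dots> = C * (jap x ^ (N + M) * norm (\<Phi> p x))" by (simp add: power_add)
    also have "\<dots> \<le> C * (D * w p)" using C(1) by (intro mult_left_mono D \<open>p \<in> I\<close>) auto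
    finally show "jap x ^ N * norm (\<Xi> p x) \<le> (C * D) * w p" by simp
  qed
qed

lemma slow_growth_add:
  assumes "slow_growth \<kappa>" "slow_growth \<mu>"
  shows "slow_growth (\<lambda>x. \<kappa> x + \<mu> x)"
proof (rule slow_growth_coinduct[where T="{\<lambda>x. \<kappa> x + \<mu> x | \<kappa> \<mu>. slow_growth \<kappa> \<and> slow_growth \<mu>}"])
  fix \<phi> :: "'a cfun" assume "\<phi> \<in> {\<lambda>x. \<kappa> x + \<mu> x | \<kappa> \<mu>. slow_growth \<kappa> \<and> slow_growth \<mu>}"
  then obtain \<kappa> \<mu> where *: "\<phi> = (\<lambda>x. \<kappa> x + \<mu> x)" "slow_growth \<kappa>" "slow_growth \<mu>" by blast
  show "\<phi> differentiable (at x)" for x unfolding * using *(2,3) by (intro differentiable_add slow_growth_differentiable)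
  show "\<exists>L. set L \<subseteq> {\<lambda>x. \<kappa> x + \<mu> x | \<kappa> \<mu>. slow_growth \<kappa> \<and> slow_growth \<mu>} \<and> (\<forall>x. partial i \<phi> x = (\<Sum>\<psi>\<leftarrow>L. \<psi> x))" for i
    apply (rule exI[of _ "[\<lambda>x. partial i \<kappa> x + partial i \<mu> x]"])
    using slow_growth_partial[OF *(2), of i] slow_growth_partial[OF *(3), of i]
      partial_add[OF slow_growth_differentiable[OF *(2)] slow_growth_differentiable[OF *(3)]]
    by (auto simp: *(1))
  obtain C M where C: "C > 0" "\<And>x. norm (\<kappa> x) \<le> C * jap x ^ M" using slow_growth_bound *(2) by blast
  obtain D N where D: "D > 0" "\<And>x. norm (\<mu> x) \<le> D * jap x ^ N" using slow_growth_bound *(3) by blast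
  show "\<exists>C N. \<forall>x. norm (\<phi> x) \<le> C * jap x ^ N"
  proof (intro exI allI)
    fix x
    have "norm (\<phi> x) \<le> C * jap x ^ M + D * jap x ^ N"
      unfolding *(1) by (rule order_trans[OF norm_triangle_ineq add_mono[OF C(2) D(2)]])
    also have "\<dots> \<le> C * jap x ^ (M + N) + D * jap x ^ (M + N)"
      using C(1) D(1) by (intro add_mono mult_left_mono jap_power_mono) auto
    finally show "norm (\<phi> x) \<le> (C + D) * jap x ^ (M + N)" by (simp add: algebra_simps)
  qed
qed (use assms in blast)

lemma slow_growth_mult:
  assumes "slow_growth \<kappa>" "slow_growth \<mu>"
  shows "slow_growth (\<lambda>x. \<kappa> x * \<mu> x)"
proof (rule slow_growth_coinduct[where T="{\<lambda>x. \<kappa> x * \<mu> x | \<kappa> \<mu>. slow_growth \<kappa> \<and> slow_growth \<mu>}"])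
  fix \<phi> :: "'a cfun" assume "\<phi> \<in> {\<lambda>x. \<kappa> x * \<mu> x | \<kappa> \<mu>. slow_growth \<kappa> \<and> slow_growth \<mu>}"
  then obtain \<kappa> \<mu> where *: "\<phi> = (\<lambda>x. \<kappa> x * \<mu> x)" "slow_growth \<kappa>" "slow_growth \<mu>" by blast
  show "\<phi> differentiable (at x)" for x using * slow_growth_differentiable by (auto intro!: differentiable_mult)
  show "\<exists>L. set L \<subseteq> {\<lambda>x. \<kappa> x * \<mu> x | \<kappa> \<mu>. slow_growth \<kappa> \<and> slow_growth \<mu>} \<and> (\<forall>x. partial i \<phi> x = (\<Sum>\<psi>\<leftarrow>L. \<psi> x))" for i
    apply (rule exI[of _ "[\<lambda>x. partial i \<kappa> x * \<mu> x, \<lambda>x. \<kappa> x * partial i \<mu> x]"])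
    using slow_growth_partial[OF *(2), of i] slow_growth_partial[OF *(3), of i] *(2,3)
      partial_mult[OF slow_growth_differentiable[OF *(2)] slow_growth_differentiable[OF *(3)]]
    by (auto simp: *(1))
  obtain C M where C: "C > 0" "\<And>x. norm (\<kappa> x) \<le> C * jap x ^ M" using slow_growth_bound *(2) by blast
  obtain D N where D: "D > 0" "\<And>x. norm (\<mu> x) \<le> D * jap x ^ N" using slow_growth_bound *(3) by blast
  show "\<exists>C N. \<forall>x. norm (\<phi> x) \<le> C * jap x ^ N"
  proof (intro exI allI)
    fix x
    have "norm (\<phi> x) \<le> (C * jap x ^ M) * (D * jap x ^ N)"
      unfolding *(1) norm_mult using C by (intro mult_mono C(2) D(2)) auto
    then show "norm (\<phi> x) \<le> (C * D) * jap x ^ (M + N)" by (simp add: power_add ac_simps)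
  qed
qed (use assms in blast)

lemma slow_growth_const [simp]: "slow_growth (\<lambda>x. c)"
proof (rule slow_growth_coinduct[where T="range (\<lambda>c x. c)"])
  fix \<phi> :: "'a cfun" assume "\<phi> \<in> range (\<lambda>c x. c)"
  then obtain c where [simp]: "\<phi> = (\<lambda>x. c)" by auto
  show "\<phi> differentiable (at x)" for x by simp
  show "\<exists>L. set L \<subseteq> range (\<lambda>c x. c) \<and> (\<forall>x. partial i \<phi> x = (\<Sum>\<psi>\<leftarrow>L. \<psi> x))" for i
    by (rule exI[of _ "[\<lambda>x. 0]"]) auto
  show "\<exists>C N. \<forall>x. norm (\<phi> x) \<le> C * jap x ^ N" by (intro exI[of _ "norm c"] exI[of _ 0]) auto
qed auto

lemma has_derivative_coord: "((\<lambda>x. complex_of_real (x $ j)) has_derivative (\<lambda>h. complex_of_real (h $ j))) (at x)"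
  by (intro bounded_linear.has_derivative[OF bounded_linear_of_real] bounded_linear.has_derivative[OF bounded_linear_vec_nth]) simp

lemma partial_coord: "partial i (\<lambda>x. complex_of_real (x $ j)) x = (if i = j then 1 else 0)"
  by (subst partial_eqI[OF has_derivative_coord]) (simp add: axis_def)

lemma slow_growth_coord [simp]: "slow_growth (\<lambda>x. complex_of_real (x $ j))"
proof (rule slow_growth_coinduct[where T="insert (\<lambda>x. complex_of_real (x $ j)) {\<phi>. slow_growth \<phi>}"])
  fix \<phi> :: "'a cfun" and i assume "\<phi> \<in> insert (\<lambda>x. complex_of_real (x $ j)) {\<phi>. slow_growth \<phi>}"
  then consider "\<phi> = (\<lambda>x. complex_of_real (x $ j))" | "slow_growth \<phi>" by blast
  note cs = this
  show "\<phi> differentiable (at x)" for x using cs slow_growth_differentiable has_derivative_coord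
    unfolding differentiable_def by metis
  show "\<exists>L. set L \<subseteq> insert (\<lambda>x. complex_of_real (x $ j)) {\<phi>. slow_growth \<phi>} \<and> (\<forall>x. partial i \<phi> x = (\<Sum>\<psi>\<leftarrow>L. \<psi> x))"
    using cs
  proof cases
    case 1 then show ?thesis by (intro exI[of _ "[\<lambda>x. (if i = j then 1 else 0)]"]) (auto simp: partial_coord)
  next
    case 2 then show ?thesis by (intro exI[of _ "[partial i \<phi>]"]) (auto simp: slow_growth_partial)
  qed
  show "\<exists>C N. \<forall>x. norm (\<phi> x) \<le> C * jap x ^ N"
    using cs
  proof cases
    case 1 then show ?thesis by (intro exI[of _ 1]) (auto simp: abs_component_le_jap)
  next
    case 2 then show ?thesis using slow_growth_bound by metis
  qed
qed auto

lemma slow_growth_power: "slow_growth \<kappa> \<Longrightarrow> slow_growth (\<lambda>x. \<kappa> x ^ N)"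
  by (induction N) (auto intro: slow_growth_mult)
lemma slow_growth_sum: "(\<And>i. i \<in> A \<Longrightarrow> slow_growth (\<kappa> i)) \<Longrightarrow> slow_growth (\<lambda>x. \<Sum>i\<in>A. \<kappa> i x)"
  by (induction A rule: infinite_finite_induct) (auto intro: slow_growth_add)
lemma slow_growth_diff: "slow_growth \<kappa> \<Longrightarrow> slow_growth \<mu> \<Longrightarrow> slow_growth (\<lambda>x. \<kappa> x - \<mu> x)"
  using slow_growth_add[of \<kappa> "\<lambda>x. (-1) * \<mu> x"] slow_growth_mult[of "\<lambda>x. -1" \<mu>] by simp

lemma norm_sq_eq: "(norm x)\<^sup>2 = (\<Sum>i\<in>UNIV. (x $ i)\<^sup>2)" for x :: "real ^ 'n::finite"
  by (simp add: norm_vec_def L2_set_def sum_nonneg)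

lemma slow_growth_norm_sq [simp]: "slow_growth (\<lambda>x. complex_of_real ((norm x)\<^sup>2))"
proof -
  have "slow_growth (\<lambda>x::real^'a. \<Sum>i\<in>UNIV. complex_of_real (x $ i) ^ 2)"
    by (intro slow_growth_sum slow_growth_power) simp
  then show ?thesis by (simp add: norm_sq_eq)
qed

lemma has_derivative_norm_sq: "((\<lambda>x. (norm x)\<^sup>2) has_derivative (\<lambda>h. 2 * (x \<bullet> h))) (at x)"
  for x :: "real ^ 'n::finite"
  unfolding power2_norm_eq_inner
  by (auto intro!: derivative_eq_intros simp: inner_commute)

lemma has_derivative_radial:
  fixes x a :: "real ^ 'n::finite"
  assumes "(h has_vector_derivative h') (at ((norm (x - a))\<^sup>2))"
  shows "((\<lambda>x. h ((norm (x - a))\<^sup>2)) has_derivative (\<lambda>v. (2 * ((x - a) \<bullet> v)) *\<^sub>R h')) (at x)"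
proof -
  have 1: "((\<lambda>x. (norm (x - a))\<^sup>2) has_derivative (\<lambda>h. 2 * ((x - a) \<bullet> h))) (at x)"
    using has_derivative_compose[OF _ has_derivative_norm_sq, of "\<lambda>x. x - a" "\<lambda>h. h" x UNIV]
    by (simp add: has_derivative_diff[OF has_derivative_ident has_derivative_const, simplified])
  show ?thesis
    using has_derivative_compose[OF 1 assms[unfolded has_vector_derivative_def]] by simp
qed

lemma partial_radial:
  fixes x a :: "real ^ 'n::finite"
  assumes "(h has_vector_derivative h') (at ((norm (x - a))\<^sup>2))"
  shows "partial i (\<lambda>x. h ((norm (x - a))\<^sup>2)) x = (2 * (complex_of_real (x $ i) - complex_of_real (a $ i))) * h'"
  using partial_eqI[OF has_derivative_radial[OF assms]]
  by (simp add: inner_axis scaleR_conv_of_real)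

text \<open>
  A derivative of \<open>jap\<^sup>r\<close> is a polynomial times \<open>jap\<^bsup>r-1\<^esup>\<close>, so the products of multipliers
  with real powers of \<open>jap\<close> are closed under differentiation.
\<close>

lemma slow_growth_jap_powr [simp]: "slow_growth (\<lambda>x::real^'n::finite. complex_of_real (jap x powr r))"
proof -
  let ?T = "{\<lambda>x::real^'n. \<kappa> x * complex_of_real (jap x powr r) | \<kappa> r. slow_growth \<kappa>}"
  have "slow_growth (\<lambda>x::real^'n. 1 * complex_of_real (jap x powr r))"
  proof (rule slow_growth_coinduct[where T="?T"])
    fix \<phi> i assume "\<phi> \<in> ?T"
    then obtain \<kappa> r where *: "\<phi> = (\<lambda>x. \<kappa> x * complex_of_real (jap x powr r))" "slow_growth \<kappa>" by blast
    define h where "h = (\<lambda>r t. complex_of_real ((1 + t) powr r))"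
    have h: "(h r has_vector_derivative of_real r * h (r - 1) t) (at t)" if "t \<ge> 0" for r t
    proof -
      have "((\<lambda>t. (1 + t) powr r) has_real_derivative r * (1 + t) powr (r - 1)) (at t)"
        using that by (auto intro!: derivative_eq_intros)
      from has_vector_derivative_of_real[OF this, where 'a=complex]
      show ?thesis by (simp add: h_def)
    qed
    have hd: "((\<lambda>x. h r ((norm (x - 0))\<^sup>2)) has_derivative (\<lambda>v. (2 * ((x - 0) \<bullet> v)) *\<^sub>R (of_real r * h (r - 1) ((norm (x - 0))\<^sup>2)))) (at x)" for x :: "real^'n"
      by (rule has_derivative_radial, rule h) simp
    have hp: "partial i (\<lambda>x. h r ((norm (x - 0))\<^sup>2)) x = 2 * (complex_of_real (x $ i) - complex_of_real (0 $ i)) * (of_real r * h (r - 1) ((norm (x - 0))\<^sup>2))" for x :: "real^'n"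
      by (rule partial_radial, rule h) simp
    have d: "(\<lambda>x::real^'n. complex_of_real (jap x powr r)) differentiable (at x)" for x
      using differentiableI[OF hd[of x]] by (simp only: h_def jap_def diff_zero)
    have p: "partial i (\<lambda>x::real^'n. complex_of_real (jap x powr r)) x = 2 * complex_of_real (x $ i) * of_real r * complex_of_real (jap x powr (r - 1))" for x
      using hp[of x] by (simp only: h_def jap_def diff_zero zero_index of_real_0 mult.assoc)
    show "\<phi> differentiable (at x)" for x
      unfolding *(1) using d slow_growth_differentiable[OF *(2)] by (intro differentiable_mult)
    have pp: "partial i \<phi> x = partial i \<kappa> x * complex_of_real (jap x powr r) + (2 * complex_of_real r * \<kappa> x * complex_of_real (x $ i)) * complex_of_real (jap x powr (r - 1))" for x
      unfolding *(1) partial_mult[OF slow_growth_differentiable[OF *(2)] d] p by simp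
    have A: "(\<lambda>x. (2 * complex_of_real r * \<kappa> x * complex_of_real (x $ i)) * complex_of_real (jap x powr (r - 1))) \<in> ?T"
      by (rule CollectI, intro exI conjI, rule refl) (intro slow_growth_mult slow_growth_const slow_growth_coord *)
    have B: "(\<lambda>x. partial i \<kappa> x * complex_of_real (jap x powr r)) \<in> ?T"
      using slow_growth_partial[OF *(2)] by blast
    show "\<exists>L. set L \<subseteq> ?T \<and> (\<forall>x. partial i \<phi> x = (\<Sum>\<psi>\<leftarrow>L. \<psi> x))"
      apply (intro exI[of _ "[\<lambda>x. partial i \<kappa> x * complex_of_real (jap x powr r), \<lambda>x. (2 * complex_of_real r * \<kappa> x * complex_of_real (x $ i)) * complex_of_real (jap x powr (r - 1))]"])
      using A B pp by (simp del: mem_Collect_eq)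
    obtain C M where C: "C > 0" "\<And>x. norm (\<kappa> x) \<le> C * jap x ^ M" using slow_growth_bound *(2) by blast
    have j: "jap x powr r \<le> jap x ^ nat \<lceil>\<bar>r\<bar>\<rceil>" for x :: "real^'n"
      by (subst powr_realpow[symmetric], simp, rule powr_mono) (auto, linarith)
    have "norm (\<phi> x) \<le> C * jap x ^ (M + nat \<lceil>\<bar>r\<bar>\<rceil>)" for x
      unfolding *(1) norm_mult power_add mult.assoc[symmetric] using C j[of x] by (intro mult_mono) auto
    then show "\<exists>C N. \<forall>x. norm (\<phi> x) \<le> C * jap x ^ N" by blast
  next
    show "(\<lambda>x::real^'n. 1 * complex_of_real (jap x powr r)) \<in> ?T" by (rule CollectI, intro exI conjI, rule refl) simp
  qed
  then show ?thesis by simp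
qed

section \<open>Integrals over the half line and over Euclidean space\<close>

text \<open>
  Integration over \<open>t > 0\<close> is integration with respect to a measure, not over a set, so that the
  theorems on product measures apply to it directly.
\<close>

definition halfline :: "real measure"
  where "halfline = density lborel (indicator {0<..})"

lemma sets_halfline [measurable_cong, simp]: "sets halfline = sets borel"
  by (simp add: halfline_def)
lemma space_halfline [simp]: "space halfline = UNIV"
  by (simp add: halfline_def)

lemma sigma_finite_halfline: "sigma_finite_measure halfline"
  unfolding halfline_def
  by (subst sigma_finite_measure.sigma_finite_iff_density_finite[OF sigma_finite_lborel]) (auto simp: indicator_def)

lemma AE_halfline: "AE t in halfline. t > 0"
  unfolding halfline_def by (subst AE_density) (auto simp: indicator_def)

lemma AE_halflineI: "(\<And>t. t > 0 \<Longrightarrow> P t) \<Longrightarrow> AE t in halfline. P t"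
  using AE_halfline by eventually_elim simp

lemma nn_integral_halfline:
  assumes [measurable]: "f \<in> borel_measurable borel"
  shows "(\<integral>\<^sup>+t. f t \<partial>halfline) = (\<integral>\<^sup>+t. f t * indicator {0<..} t \<partial>lborel)"
  unfolding halfline_def by (subst nn_integral_density) (auto simp: mult.commute)

lemma integral_halfline:
  fixes f :: "real \<Rightarrow> 'a::{banach, second_countable_topology}"
  assumes [measurable]: "f \<in> borel_measurable borel"
  shows "(LINT t|halfline. f t) = (LINT t:{0<..}|lborel. f t)"
proof -
  have *: "halfline = density lborel (\<lambda>t. ennreal (indicator {0<..} t))"
    by (simp add: halfline_def ennreal_indicator)
  show ?thesis
    unfolding set_lebesgue_integral_def * by (subst integral_density) auto
qed

lemma integrable_halfline:
  fixes f :: "real \<Rightarrow> 'a::{banach, second_countable_topology}"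
  assumes [measurable]: "f \<in> borel_measurable borel"
  shows "integrable halfline f \<longleftrightarrow> set_integrable lborel {0<..} f"
proof -
  have *: "halfline = density lborel (\<lambda>t. ennreal (indicator {0<..} t))"
    by (simp add: halfline_def ennreal_indicator)
  show ?thesis
    unfolding set_integrable_def * by (subst integrable_density) auto
qed

lemma tonelli_swap:
  assumes "sigma_finite_measure M" "sigma_finite_measure N"
    and [measurable]: "case_prod f \<in> borel_measurable (M \<Otimes>\<^sub>M N)"
  shows "(\<integral>\<^sup>+x. \<integral>\<^sup>+y. f x y \<partial>N \<partial>M) = (\<integral>\<^sup>+y. \<integral>\<^sup>+x. f x y \<partial>M \<partial>N)"
proof -
  interpret pair_sigma_finite M N using assms by (simp add: pair_sigma_finite_def)
  show ?thesis using Fubini'[OF assms(3)] by simp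
qed

lemma fubini_swap:
  fixes f :: "'a \<Rightarrow> 'b \<Rightarrow> complex"
  assumes "sigma_finite_measure M" "sigma_finite_measure N"
    and [measurable]: "case_prod f \<in> borel_measurable (M \<Otimes>\<^sub>M N)"
    and fin: "(\<integral>\<^sup>+x. \<integral>\<^sup>+y. norm (f x y) \<partial>N \<partial>M) < \<infinity>"
  shows "(LINT x|M. LINT y|N. f x y) = (LINT y|N. LINT x|M. f x y)"
    and "integrable M (\<lambda>x. LINT y|N. f x y)"
proof -
  interpret pair_sigma_finite M N using assms by (simp add: pair_sigma_finite_def)
  have int: "integrable (M \<Otimes>\<^sub>M N) (case_prod f)"
  proof (rule integrableI_bounded)
    have "(\<integral>\<^sup>+ p. norm (case_prod f p) \<partial>(M \<Otimes>\<^sub>M N)) = (\<integral>\<^sup>+x. \<integral>\<^sup>+y. norm (f x y) \<partial>N \<partial>M)"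
      by (subst M2.nn_integral_fst [symmetric]) auto
    then show "(\<integral>\<^sup>+ p. norm (case_prod f p) \<partial>(M \<Otimes>\<^sub>M N)) < \<infinity>" using fin by simp
  qed simp
  show "(LINT x|M. LINT y|N. f x y) = (LINT y|N. LINT x|M. f x y)"
    using Fubini_integral[OF int] by simp
  show "integrable M (\<lambda>x. LINT y|N. f x y)" using integrable_fst'[OF int] by simp
qed

lemma nn_integral_product_bound:
  fixes A :: "'a \<Rightarrow> real" and B :: "'b \<Rightarrow> real"
  assumes "integrable M A" "integrable N B"
    and le: "\<And>x y. norm (f x y) \<le> A x * B y"
  shows "(\<integral>\<^sup>+x. \<integral>\<^sup>+y. norm (f x y :: complex) \<partial>N \<partial>M) < \<infinity>"
proof -
  have [measurable]: "A \<in> borel_measurable M" "B \<in> borel_measurable N" using assms by auto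
  have "(\<integral>\<^sup>+x. \<integral>\<^sup>+y. norm (f x y) \<partial>N \<partial>M) \<le> (\<integral>\<^sup>+x. \<integral>\<^sup>+y. ennreal (norm (A x)) * ennreal (norm (B y)) \<partial>N \<partial>M)"
  proof (intro nn_integral_mono)
    fix x y
    have "norm (f x y) \<le> norm (A x) * norm (B y)" using le[of x y] by (metis abs_mult abs_ge_self order_trans real_norm_def)
    then show "ennreal (norm (f x y)) \<le> ennreal (norm (A x)) * ennreal (norm (B y))"
      by (simp add: ennreal_leI flip: ennreal_mult)
  qed
  also have "\<dots> = (\<integral>\<^sup>+x. ennreal (norm (A x)) \<partial>M) * (\<integral>\<^sup>+y. ennreal (norm (B y)) \<partial>N)"
    by (simp add: nn_integral_cmult nn_integral_multc)
  also have "\<dots> < \<infinity>" using assms(1,2) by (simp add: integrable_iff_bounded ennreal_mult_less_top)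
  finally show ?thesis .
qed

text \<open>
  Differentiation under the integral sign, by dominated convergence of the difference quotients;
  the mean value inequality bounds them by \<open>B\<close>.
\<close>

lemma has_derivative_integral:
  fixes f :: "'a::euclidean_space \<Rightarrow> 'b \<Rightarrow> complex"
  assumes r: "r > 0"
    and int: "\<And>z. z \<in> ball z0 r \<Longrightarrow> integrable M (f z)"
    and der: "\<And>z y. z \<in> ball z0 r \<Longrightarrow> y \<in> space M \<Longrightarrow> ((\<lambda>z. f z y) has_derivative f' z y) (at z)"
    and bound: "\<And>z y h. z \<in> ball z0 r \<Longrightarrow> y \<in> space M \<Longrightarrow> norm (f' z y h) \<le> B y * norm h"
    and B: "integrable M B"
    and meas: "\<And>h. (\<lambda>y. f' z0 y h) \<in> borel_measurable M"
  shows "((\<lambda>z. LINT y|M. f z y) has_derivative (\<lambda>h. LINT y|M. f' z0 y h)) (at z0)"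
    and "\<And>h. integrable M (\<lambda>y. f' z0 y h)"
proof -
  have z0: "z0 \<in> ball z0 r" using r by simp
  have lin: "linear (f' z0 y)" if "y \<in> space M" for y
    using der[OF z0 that] has_derivative_linear by blast
  show int': "integrable M (\<lambda>y. f' z0 y h)" for h
  proof (rule Bochner_Integration.integrable_bound[OF _ meas])
    show "integrable M (\<lambda>y. B y * norm h)" using B by simp
    show "AE y in M. norm (f' z0 y h) \<le> norm (B y * norm h)"
    proof (rule AE_I2)
      fix y assume "y \<in> space M"
      from bound[OF z0 this, of h] show "norm (f' z0 y h) \<le> norm (B y * norm h)" by simp
    qed
  qed
  have bl: "bounded_linear (\<lambda>h. LINT y|M. f' z0 y h)"
  proof (rule bounded_linear_intro)
    show "(LINT y|M. f' z0 y (h + k)) = (LINT y|M. f' z0 y h) + (LINT y|M. f' z0 y k)" for h k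
      unfolding Bochner_Integration.integral_add[OF int' int', symmetric]
      by (intro Bochner_Integration.integral_cong refl linear_add lin)
    show "(LINT y|M. f' z0 y (c *\<^sub>R h)) = c *\<^sub>R (LINT y|M. f' z0 y h)" for c h
      unfolding integral_scaleR_right[symmetric]
      by (intro Bochner_Integration.integral_cong refl linear_scale lin)
    show "norm (LINT y|M. f' z0 y h) \<le> norm h * (LINT y|M. B y)" for h
    proof -
      have "norm (LINT y|M. f' z0 y h) \<le> (LINT y|M. B y * norm h)"
        using bound[OF z0] B
        by (intro order_trans[OF integral_norm_bound] Bochner_Integration.integral_mono integrable_norm int') auto
      then show ?thesis using B by (simp add: mult.commute)
    qed
  qed
  have lip: "norm (f z y - f z0 y) \<le> B y * norm (z - z0)" if "z \<in> ball z0 r" "y \<in> space M" for z y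
  proof (rule differentiable_bound[where S="ball z0 r" and f'="\<lambda>z. f' z y" and f="\<lambda>z. f z y"])
    show "((\<lambda>z. f z y) has_derivative f' z y) (at z within ball z0 r)" if "z \<in> ball z0 r" for z
      using der[OF that \<open>y \<in> space M\<close>] by (rule has_derivative_at_withinI)
    show "onorm (f' z y) \<le> B y" if "z \<in> ball z0 r" for z
      using bound[OF that \<open>y \<in> space M\<close>] by (rule onorm_le)
  qed (use that z0 in auto)
  show "((\<lambda>z. LINT y|M. f z y) has_derivative (\<lambda>h. LINT y|M. f' z0 y h)) (at z0)"
    unfolding has_derivative_iff_norm
  proof (intro conjI bl)
    show "((\<lambda>z. norm ((LINT y|M. f z y) - (LINT y|M. f z0 y) - (LINT y|M. f' z0 y (z - z0))) / norm (z - z0)) \<longlongrightarrow> 0) (at z0)"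
      unfolding tendsto_at_iff_sequentially
    proof (intro allI impI)
      fix X assume X: "\<forall>i::nat. X i \<in> UNIV - {z0}" "X \<longlonglongrightarrow> z0"
      from X(2) r have "eventually (\<lambda>i. X i \<in> ball z0 r) sequentially"
        using topological_tendstoD[OF X(2) open_ball z0] by simp
      then obtain N where N: "\<And>i. i \<ge> N \<Longrightarrow> X i \<in> ball z0 r" by (auto simp: eventually_sequentially)
      define Y where "Y = (\<lambda>i. X (i + N))"
      have Y: "\<And>i. Y i \<noteq> z0" "Y \<longlonglongrightarrow> z0" "\<And>i. Y i \<in> ball z0 r"
        using X N by (auto simp: Y_def LIMSEQ_ignore_initial_segment)
      define q where "q = (\<lambda>i y. (f (Y i) y - f z0 y - f' z0 y (Y i - z0)) /\<^sub>R norm (Y i - z0))"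
      have qint: "integrable M (q i)" for i
        unfolding q_def using int[OF Y(3)] int[OF z0] int' by (intro integrable_scaleR_right Bochner_Integration.integrable_diff)
      have "(\<lambda>i. LINT y|M. q i y) \<longlonglongrightarrow> (LINT y|M. 0)"
      proof (rule integral_dominated_convergence[where w="\<lambda>y. 2 * B y"])
        show "integrable M (\<lambda>y. 2 * B y)" using B by simp
        show "q i \<in> borel_measurable M" for i using qint[of i] by simp
        show "AE y in M. (\<lambda>i. q i y) \<longlonglongrightarrow> 0"
        proof (rule AE_I2)
          fix y assume "y \<in> space M"
          have "((\<lambda>z. norm (f z y - f z0 y - f' z0 y (z - z0)) / norm (z - z0)) \<longlongrightarrow> 0) (at z0)"
            using der[OF z0 \<open>y \<in> space M\<close>] unfolding has_derivative_iff_norm by blast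
          then have "(\<lambda>i. norm (f (Y i) y - f z0 y - f' z0 y (Y i - z0)) / norm (Y i - z0)) \<longlonglongrightarrow> 0"
            using Y unfolding tendsto_at_iff_sequentially o_def by blast
          then show "(\<lambda>i. q i y) \<longlonglongrightarrow> 0"
            unfolding q_def by (subst tendsto_norm_zero_iff[symmetric]) (simp add: divide_inverse_commute)
        qed
        show "AE y in M. norm (q i y) \<le> 2 * B y" for i
        proof (rule AE_I2)
          fix y assume y: "y \<in> space M"
          have "norm (f (Y i) y - f z0 y - f' z0 y (Y i - z0)) \<le> B y * norm (Y i - z0) + B y * norm (Y i - z0)"
            by (rule order_trans[OF norm_triangle_ineq4 add_mono[OF lip[OF Y(3) y] bound[OF z0 y]]])
          then show "norm (q i y) \<le> 2 * B y"
            using Y(1)[of i]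
            by (simp only: q_def norm_scaleR abs_inverse abs_norm_cancel) (simp add: inverse_eq_divide divide_le_eq)
        qed
      qed simp
      moreover have "(LINT y|M. q i y) = ((LINT y|M. f (Y i) y) - (LINT y|M. f z0 y) - (LINT y|M. f' z0 y (Y i - z0))) /\<^sub>R norm (Y i - z0)" for i
        unfolding q_def using int[OF Y(3)[of i]] int[OF z0] int' by simp
      ultimately have "(\<lambda>i. norm ((LINT y|M. f (Y i) y) - (LINT y|M. f z0 y) - (LINT y|M. f' z0 y (Y i - z0))) / norm (Y i - z0)) \<longlonglongrightarrow> 0"
        using tendsto_norm_zero by (fastforce simp: divide_inverse_commute)
      then show "((\<lambda>z. norm ((LINT y|M. f z y) - (LINT y|M. f z0 y) - (LINT y|M. f' z0 y (z - z0))) / norm (z - z0)) \<circ> X) \<longlonglongrightarrow> 0"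
        unfolding Y_def o_def by (rule LIMSEQ_offset)
    qed
  qed
qed

lemma nn_integral_powr_near_0:
  assumes "a > -1"
  shows "(\<integral>\<^sup>+t. ennreal (t powr a * indicator {0<..1} t) \<partial>lborel) < \<infinity>"
proof -
  have "((\<lambda>x. x powr a) has_integral (1 powr (a+1) / (a+1))) {0..1}"
    by (rule has_integral_powr_from_0) (use assms in auto)
  then have "((\<lambda>x. x powr a * indicator {0<..1} x) has_integral (1 powr (a+1) / (a+1))) UNIV"
    by (subst (asm) has_integral_restrict_UNIV[symmetric])
       (erule has_integral_eq[rotated], auto simp: indicator_def)
  from nn_integral_has_integral_lborel[OF _ _ this] show ?thesis by simp
qed

lemma nn_integral_powr_near_inf:
  assumes "a < -1"
  shows "(\<integral>\<^sup>+t. ennreal (t powr a * indicator {1..} t) \<partial>lborel) < \<infinity>"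
proof -
  have "((\<lambda>x. x powr a) has_integral (-(1 powr (a+1)) / (a+1))) {1..}"
    by (rule has_integral_powr_to_inf) (use assms in auto)
  then have "((\<lambda>x. x powr a * indicator {1..} x) has_integral (-(1 powr (a+1)) / (a+1))) UNIV"
    by (subst (asm) has_integral_restrict_UNIV[symmetric])
       (erule has_integral_eq[rotated], auto simp: indicator_def)
  from nn_integral_has_integral_lborel[OF _ _ this] show ?thesis by simp
qed

text \<open>
  The convergence of integrals over time mostly rests on two powers: a power above \<open>-1\<close> bounds the integrand
  near \<open>0\<close>, and a power below \<open>-1\<close> bounds it near infinity.
\<close>

lemma nn_integral_halfline_powr:
  fixes g :: "real \<Rightarrow> real"
  assumes [measurable]: "g \<in> borel_measurable borel"
    and a: "a > -1" "b < -1"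
    and g0: "\<And>t. 0 < t \<Longrightarrow> t \<le> 1 \<Longrightarrow> g t \<le> C * t powr a"
    and g1: "\<And>t. 1 \<le> t \<Longrightarrow> g t \<le> C * t powr b"
  shows "(\<integral>\<^sup>+t. g t \<partial>halfline) < \<infinity>"
proof -
  define D where "D = max C 0"
  have D0: "D \<ge> 0" by (simp add: D_def)
  have "(\<integral>\<^sup>+t. g t \<partial>halfline) = (\<integral>\<^sup>+t. ennreal (g t) * indicator {0<..} t \<partial>lborel)" by (rule nn_integral_halfline) simp
  also have "\<dots> \<le> (\<integral>\<^sup>+t. ennreal D * ennreal (t powr a * indicator {0<..1} t) + ennreal D * ennreal (t powr b * indicator {1..} t) \<partial>lborel)"
  proof (rule nn_integral_mono)
    fix t :: real
    consider "t \<le> 0" | "0 < t" "t \<le> 1" | "1 < t" by linarith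
    then show "ennreal (g t) * indicator {0<..} t \<le> ennreal D * ennreal (t powr a * indicator {0<..1} t) + ennreal D * ennreal (t powr b * indicator {1..} t)"
    proof cases
      case 1 then show ?thesis by simp
    next
      case 2
      have "g t \<le> D * t powr a" using g0[OF 2] by (rule order_trans) (auto intro!: mult_right_mono simp: D_def)
      then have "ennreal (g t) \<le> ennreal D * ennreal (t powr a)" by (simp add: D0 ennreal_leI flip: ennreal_mult)
      then have "ennreal (g t) \<le> ennreal D * ennreal (t powr a) + ennreal D * ennreal (t powr b * indicator {1..} t)"
        by (rule order_trans) simp
      then show ?thesis using 2 by (simp add: indicator_def)
    next
      case 3
      have "g t \<le> D * t powr b" using g1[of t] 3 by (intro order_trans[OF g1]) (auto intro!: mult_right_mono simp: D_def)
      then have "ennreal (g t) \<le> ennreal D * ennreal (t powr b)" by (simp add: D0 ennreal_leI flip: ennreal_mult)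
      then show ?thesis using 3 by (simp add: indicator_def)
    qed
  qed
  also have "\<dots> = ennreal D * (\<integral>\<^sup>+t. ennreal (t powr a * indicator {0<..1} t) \<partial>lborel) + ennreal D * (\<integral>\<^sup>+t. ennreal (t powr b * indicator {1..} t) \<partial>lborel)"
    by (simp add: nn_integral_add nn_integral_cmult)
  also have "\<dots> < \<infinity>"
    using nn_integral_powr_near_0[OF a(1)] nn_integral_powr_near_inf[OF a(2)] by (simp add: ennreal_mult_less_top)
  finally show ?thesis .
qed

text \<open>
  The substitution \<open>t \<mapsto> t y\<close> in the Gamma integral. Negative powers of \<open>y\<close> become superpositions of
  exponentials; with \<open>y = |\<xi>|\<^sup>2\<close> these are Gaussians.
\<close>

lemma gamma_subordination:
  assumes "m > 0" "y > 0"
  shows "(\<integral>\<^sup>+t. ennreal (t powr (m - 1) * exp (- (t * y))) \<partial>halfline) = ennreal (Gamma m * y powr (- m))"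
proof -
  have "((\<lambda>t. t powr (m - 1) / exp t) has_integral Gamma m) {0..}"
    by (rule Gamma_integral_real) fact
  then have "((\<lambda>t. t powr (m - 1) / exp t * indicator {0<..} t) has_integral Gamma m) UNIV"
    by (subst (asm) has_integral_restrict_UNIV[symmetric])
       (erule has_integral_eq[rotated], auto simp: indicator_def)
  from nn_integral_has_integral_lborel[OF _ _ this]
  have G: "(\<integral>\<^sup>+t. ennreal (t powr (m - 1) / exp t * indicator {0<..} t) \<partial>lborel) = ennreal (Gamma m)" by simp
  have "(\<integral>\<^sup>+t. ennreal (t powr (m - 1) * exp (- (t * y))) \<partial>halfline)
      = (\<integral>\<^sup>+t. ennreal (t powr (m - 1) * exp (- (t * y))) * indicator {0<..} t \<partial>lborel)"
    by (simp add: nn_integral_halfline)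
  also have "\<dots> = ennreal (1 / y) * (\<integral>\<^sup>+t. ennreal ((0 + 1 / y * t) powr (m - 1) * exp (- ((0 + 1 / y * t) * y))) * indicator {0<..} (0 + 1 / y * t) \<partial>lborel)"
    using assms by (subst nn_integral_real_affine[of _ "1 / y" 0]) auto
  also have "\<dots> = ennreal (1 / y) * (\<integral>\<^sup>+t. ennreal (y powr (1 - m)) * ennreal (t powr (m - 1) / exp t * indicator {0<..} t) \<partial>lborel)"
  proof (rule arg_cong2[where f="(*)", OF refl], rule nn_integral_cong)
    fix t :: real
    have *: "(t / y) powr (m - 1) * exp (- t) = y powr (1 - m) * (t powr (m - 1) / exp t)" if "t > 0"
    proof -
      have "y powr (1 - m) = 1 / y powr (m - 1)" using powr_minus_divide[of y "m - 1"] by simp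
      moreover have "(t / y) powr (m - 1) = t powr (m - 1) / y powr (m - 1)"
        using that assms by (simp add: powr_divide)
      ultimately show ?thesis by (simp add: exp_minus field_simps)
    qed
    show "ennreal ((0 + 1 / y * t) powr (m - 1) * exp (- ((0 + 1 / y * t) * y))) * indicator {0<..} (0 + 1 / y * t)
      = ennreal (y powr (1 - m)) * ennreal (t powr (m - 1) / exp t * indicator {0<..} t)"
      using assms * by (cases "t > 0") (auto simp: zero_less_divide_iff simp flip: ennreal_mult)
  qed
  also have "\<dots> = ennreal (1 / y) * (ennreal (y powr (1 - m)) * ennreal (Gamma m))"
    by (subst nn_integral_cmult) (use G in auto)
  also have "\<dots> = ennreal (Gamma m * y powr (- m))"
    using assms by (simp add: powr_diff powr_minus field_simps Gamma_real_pos less_imp_le flip: ennreal_mult)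
  finally show ?thesis .
qed

lemma nn_integral_gauss:
  assumes "t > 0"
  shows "(\<integral>\<^sup>+x. ennreal (exp (- (t * (norm (x::real^'n::finite))\<^sup>2))) \<partial>lborel) = ennreal (sqrt (pi / t) ^ CARD('n))"
proof -
  have 1: "(\<integral>\<^sup>+u. ennreal (exp (- (t * u\<^sup>2))) \<partial>lborel) = ennreal (sqrt (pi / t))"
  proof -
    define \<sigma> where "\<sigma> = sqrt (1 / (2 * t))"
    have \<sigma>: "\<sigma> > 0" "\<sigma>\<^sup>2 = 1 / (2 * t)" using assms by (auto simp: \<sigma>_def)
    have eq: "exp (- (t * u\<^sup>2)) = sqrt (pi / t) * normal_density 0 \<sigma> u" for u
      using assms by (simp add: normal_density_def \<sigma>(2))
    have "(\<integral>\<^sup>+u. ennreal (exp (- (t * u\<^sup>2))) \<partial>lborel) = (\<integral>\<^sup>+u. ennreal (sqrt (pi / t)) * ennreal (normal_density 0 \<sigma> u) \<partial>lborel)"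
      unfolding eq using assms by (simp add: ennreal_mult)
    also have "\<dots> = ennreal (sqrt (pi / t)) * (\<integral>\<^sup>+u. ennreal (normal_density 0 \<sigma> u) \<partial>lborel)"
      by (rule nn_integral_cmult) simp
    also have "(\<integral>\<^sup>+u. ennreal (normal_density 0 \<sigma> u) \<partial>lborel) = ennreal 1"
      using \<sigma>(1) by (subst nn_integral_eq_integral) auto
    finally show ?thesis by simp
  qed
  have "(\<integral>\<^sup>+x. ennreal (exp (- (t * (norm (x::real^'n))\<^sup>2))) \<partial>lborel)
      = (\<integral>\<^sup>+(x::real^'n). (\<Prod>b\<in>Basis. ennreal (exp (- (t * (x \<bullet> b)\<^sup>2)))) \<partial>lborel)"
  proof (rule nn_integral_cong)
    fix x :: "real^'n"
    have "(norm x)\<^sup>2 = (\<Sum>b\<in>Basis. (x \<bullet> b)\<^sup>2)"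
      unfolding power2_norm_eq_inner by (subst euclidean_inner) (simp add: power2_eq_square)
    then show "ennreal (exp (- (t * (norm x)\<^sup>2))) = (\<Prod>b\<in>Basis. ennreal (exp (- (t * (x \<bullet> b)\<^sup>2))))"
      by (simp add: prod_ennreal exp_sum sum_distrib_left flip: sum_negf)
  qed
  also have "\<dots> = (\<Prod>b\<in>(Basis::(real^'n) set). (\<integral>\<^sup>+u. ennreal (exp (- (t * u\<^sup>2))) \<partial>lborel))"
    by (rule nn_integral_lborel_prod) auto
  also have "\<dots> = ennreal (sqrt (pi / t) ^ CARD('n))"
    using assms by (simp add: 1 ennreal_power)
  finally show ?thesis .
qed

lemma integrable_gauss:
  assumes "t > 0"
  shows "integrable lborel (\<lambda>x::real^'n::finite. exp (- (t * (norm x)\<^sup>2)))"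
  using nn_integral_gauss[OF assms, where 'n='n]
  by (intro integrableI_nonneg) auto

lemma integral_gauss:
  assumes "t > 0"
  shows "(LINT x|lborel. exp (- (t * (norm (x::real^'n::finite))\<^sup>2))) = sqrt (pi / t) ^ CARD('n)"
  using nn_integral_gauss[OF assms, where 'n='n] assms
  by (intro integral_eq_nn_integral[THEN trans]) auto

text \<open>
  Subordination replaces polar coordinates: after writing \<open>jap\<^bsup>-n\<^esup>\<close> as a superposition of Gaussians,
  the integral over space is a product of one-dimensional ones, and what remains is the Gamma
  integral at \<open>n/2\<close>.
\<close>

lemma integrable_jap_power:
  "integrable lborel (\<lambda>x::real^'n::finite. 1 / jap x ^ CARD('n))"
proof (rule integrableI_nonneg)
  let ?n = "real CARD('n)"
  have n: "?n > 0" by simp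
  have "Gamma ?n > 0" by (simp add: Gamma_real_pos)
  have "ennreal (Gamma ?n) * (\<integral>\<^sup>+(x::real^'n). ennreal (1 / jap x ^ CARD('n)) \<partial>lborel)
      = (\<integral>\<^sup>+(x::real^'n). ennreal (Gamma ?n * jap x powr (- ?n)) \<partial>lborel)"
    using \<open>Gamma ?n > 0\<close>
    by (subst nn_integral_cmult[symmetric])
       (auto intro!: nn_integral_cong simp: jap_def powr_minus powr_realpow divide_inverse add_pos_nonneg simp flip: ennreal_mult)
  also have "\<dots> = (\<integral>\<^sup>+(x::real^'n). \<integral>\<^sup>+t. ennreal (t powr (?n - 1) * exp (- (t * jap x))) \<partial>halfline \<partial>lborel)"
    by (subst gamma_subordination) auto
  also have "\<dots> = (\<integral>\<^sup>+t. \<integral>\<^sup>+(x::real^'n). ennreal (t powr (?n - 1) * exp (- (t * jap x))) \<partial>lborel \<partial>halfline)"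
    unfolding jap_def by (rule tonelli_swap) (auto intro: sigma_finite_lborel sigma_finite_halfline)
  also have "\<dots> = (\<integral>\<^sup>+t. ennreal (t powr (?n - 1) * exp (- t) * sqrt (pi / t) ^ CARD('n)) \<partial>halfline)"
  proof (rule nn_integral_cong_AE, rule AE_halflineI)
    fix t :: real assume t: "t > 0"
    have "(\<integral>\<^sup>+(x::real^'n). ennreal (t powr (?n - 1) * exp (- (t * jap x))) \<partial>lborel) =
      (\<integral>\<^sup>+(x::real^'n). ennreal (t powr (?n - 1) * exp (- t)) * ennreal (exp (- (t * (norm x)\<^sup>2))) \<partial>lborel)"
      by (intro nn_integral_cong) (simp add: jap_def algebra_simps exp_add[symmetric] flip: ennreal_mult)
    also have "\<dots> = ennreal (t powr (?n - 1) * exp (- t)) * ennreal (sqrt (pi / t) ^ CARD('n))"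
      using nn_integral_gauss[OF t, where 'n='n] by (simp add: nn_integral_cmult)
    finally show "(\<integral>\<^sup>+(x::real^'n). ennreal (t powr (?n - 1) * exp (- (t * jap x))) \<partial>lborel) = ennreal (t powr (?n - 1) * exp (- t) * sqrt (pi / t) ^ CARD('n))"
      using t by (simp flip: ennreal_mult)
  qed
  also have "\<dots> = (\<integral>\<^sup>+t. ennreal (sqrt pi ^ CARD('n)) * ennreal (t powr (?n/2 - 1) * exp (- (t * 1))) \<partial>halfline)"
  proof (rule nn_integral_cong_AE, rule AE_halflineI)
    fix t :: real assume t: "t > 0"
    have "sqrt (pi / t) ^ CARD('n) = sqrt pi ^ CARD('n) * t powr (- ?n / 2)"
      using t by (simp add: real_sqrt_divide power_divide powr_minus powr_half_sqrt[symmetric] powr_power field_simps)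
    then show "ennreal (t powr (?n - 1) * exp (- t) * sqrt (pi / t) ^ CARD('n)) = ennreal (sqrt pi ^ CARD('n)) * ennreal (t powr (?n/2 - 1) * exp (- (t * 1)))"
      using t by (simp add: powr_add[symmetric] mult_ac flip: ennreal_mult)
  qed
  also have "\<dots> = ennreal (sqrt pi ^ CARD('n)) * ennreal (Gamma (?n / 2) * 1 powr (- (?n / 2)))"
    using gamma_subordination[of "?n / 2" 1] by (subst nn_integral_cmult) auto
  also have "\<dots> < \<infinity>" by (simp add: ennreal_mult_less_top)
  finally show "(\<integral>\<^sup>+(x::real^'n). ennreal (1 / jap x ^ CARD('n)) \<partial>lborel) < \<infinity>"
    using \<open>Gamma ?n > 0\<close> by (auto simp: ennreal_mult_less_top)
qed (auto simp: jap_def)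

lemma lborel_integral_affine:
  fixes f :: "'a::euclidean_space \<Rightarrow> complex"
  assumes "c \<noteq> 0" and [measurable]: "f \<in> borel_measurable borel"
  shows "(LINT x|lborel. f x) = \<bar>c\<bar> ^ DIM('a) *\<^sub>R (LINT x|lborel. f (t + c *\<^sub>R x))"
proof -
  have "(LINT x|lborel. f x) = (LINT x|density (distr lborel borel (\<lambda>x. t + c *\<^sub>R x)) (\<lambda>_. ennreal (\<bar>c\<bar> ^ DIM('a))). f x)"
    using lborel_affine[OF assms(1), of t] by simp
  also have "\<dots> = (LINT x|distr lborel borel (\<lambda>x. t + c *\<^sub>R x). \<bar>c\<bar> ^ DIM('a) *\<^sub>R f x)"
    by (subst integral_density) auto
  also have "\<dots> = \<bar>c\<bar> ^ DIM('a) *\<^sub>R (LINT x|lborel. f (t + c *\<^sub>R x))"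
    by (subst integral_distr) auto
  finally show ?thesis .
qed

section \<open>The Schwartz space\<close>

lemma exp_ge_power_div_fact:
  assumes "(x::real) \<ge> 0" shows "x ^ n / fact n \<le> exp x"
proof -
  have "(\<Sum>k\<in>{n}. x ^ k /\<^sub>R fact k) \<le> suminf (\<lambda>k. x ^ k /\<^sub>R fact k)"
    using exp_converges[of x] assms by (intro sum_le_suminf) (auto intro: sums_summable)
  then show ?thesis using exp_converges[of x] by (simp add: sums_unique[symmetric] divide_inverse_commute)
qed

lemma jap_power_gauss_bound:
  assumes "t > 0" obtains C where "C > 0" "\<And>x. jap x ^ N * exp (- (t * (norm x)\<^sup>2)) \<le> C"
proof (rule that[of "fact N / t ^ N * exp t"])
  fix x :: "real ^ 'a"
  have "(t * jap x) ^ N / fact N \<le> exp (t * jap x)" using assms by (intro exp_ge_power_div_fact) auto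
  then have "jap x ^ N \<le> fact N / t ^ N * exp (t * jap x)"
    using assms by (simp add: field_simps power_mult_distrib)
  then have "jap x ^ N * exp (- (t * (norm x)\<^sup>2)) \<le> fact N / t ^ N * exp (t * jap x) * exp (- (t * (norm x)\<^sup>2))"
    by (rule mult_right_mono) simp
  also have "\<dots> = fact N / t ^ N * exp t"
    by (simp add: jap_def mult_exp_exp[symmetric] ring_distribs exp_minus)
  finally show "jap x ^ N * exp (- (t * (norm x)\<^sup>2)) \<le> fact N / t ^ N * exp t" .
qed (use assms in auto)

lemma peetre: "jap x \<le> 2 * jap (x + h) * jap h"
proof -
  have "norm x \<le> norm (x + h) + norm h" using norm_triangle_ineq4[of "x + h" h] by simp
  then have "(norm x)\<^sup>2 \<le> (norm (x + h) + norm h)\<^sup>2" by (intro power_mono) auto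
  also have "\<dots> \<le> 2 * (norm (x + h))\<^sup>2 + 2 * (norm h)\<^sup>2"
    using zero_le_power2[of "norm (x + h) - norm h"] by (simp add: power2_eq_square algebra_simps)
  finally have "jap x \<le> 2 * (1 + (norm (x + h))\<^sup>2 + (norm h)\<^sup>2)" by (simp add: jap_def)
  also have "\<dots> \<le> 2 * jap (x + h) * jap h" by (simp add: jap_def algebra_simps)
  finally show ?thesis .
qed

lemma mi_power_le_jap: "\<bar>mi_power x \<alpha>\<bar> \<le> jap x ^ mi_order \<alpha>"
proof -
  have "\<bar>mi_power x \<alpha>\<bar> = (\<Prod>i\<in>UNIV. \<bar>x $ i\<bar> ^ \<alpha> i)" by (simp add: mi_power_def abs_prod power_abs)
  also have "\<dots> \<le> (\<Prod>i\<in>UNIV. jap x ^ \<alpha> i)" by (intro prod_mono conjI power_mono abs_component_le_jap) auto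
  finally show ?thesis by (simp add: mi_order_def power_sum)
qed

lemma jap_power_le_components:
  fixes x :: "real ^ 'n::finite"
  shows "jap x ^ N \<le> (real CARD('n) + 1) ^ N * (1 + (\<Sum>j\<in>UNIV. (x $ j) ^ (2 * N)))"
proof -
  obtain j where j: "\<And>i. (x $ i)\<^sup>2 \<le> (x $ j)\<^sup>2"
  proof -
    have "Max (range (\<lambda>i. (x $ i)\<^sup>2)) \<in> range (\<lambda>i. (x $ i)\<^sup>2)" by (rule Max_in) auto
    then obtain j where j: "Max (range (\<lambda>i. (x $ i)\<^sup>2)) = (x $ j)\<^sup>2" by blast
    have "(x $ i)\<^sup>2 \<le> Max (range (\<lambda>i. (x $ i)\<^sup>2))" for i by (rule Max_ge) auto
    then show thesis using that[of j] j by simp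
  qed
  define m where "m = max 1 ((x $ j)\<^sup>2)"
  have "(\<Sum>i\<in>UNIV. (x $ i)\<^sup>2) \<le> (\<Sum>i\<in>(UNIV::'n set). m)" using j by (intro sum_mono) (simp add: m_def le_max_iff_disj)
  then have "jap x \<le> (real CARD('n) + 1) * m" by (simp add: jap_def norm_sq_eq m_def algebra_simps)
  then have "jap x ^ N \<le> ((real CARD('n) + 1) * m) ^ N" by (intro power_mono) auto
  also have "\<dots> = (real CARD('n) + 1) ^ N * m ^ N" by (simp add: power_mult_distrib)
  also have "m ^ N \<le> 1 + (\<Sum>j\<in>UNIV. (x $ j) ^ (2 * N))"
  proof -
    have "(x $ j) ^ (2 * N) \<le> (\<Sum>j\<in>UNIV. (x $ j) ^ (2 * N))" by (intro member_le_sum) auto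
    moreover have "(\<Sum>j\<in>UNIV. (x $ j) ^ (2 * N)) \<ge> 0" by (intro sum_nonneg) auto
    ultimately show ?thesis by (auto simp: m_def max_def power_mult)
  qed
  finally show ?thesis by (simp add: mult_left_mono)
qed

abbreviation schwartz_fun :: "'n::finite cfun \<Rightarrow> bool"
  where "schwartz_fun \<phi> \<equiv> schwartz_family {()} (\<lambda>_. 1) (\<lambda>_. \<phi>)"

text \<open>
  Powers of \<open>jap\<close> and monomials dominate each other: a power of \<open>jap\<close> is bounded by the sum of the
  pure even powers of the coordinates.
\<close>

lemma schwartz_iff_family: "\<phi> \<in> schwartz \<longleftrightarrow> schwartz_fun \<phi>" for \<phi> :: "'n::finite cfun"
proof
  assume \<phi>: "\<phi> \<in> schwartz"
  then have sm: "smooth_on UNIV \<phi>"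
    and bd: "\<And>\<alpha> \<beta>. bounded (range (\<lambda>x. of_real (mi_power x \<alpha>) * mi_partial \<beta> \<phi> x))"
    by (auto simp: schwartz_def)
  show "schwartz_fun \<phi>"
    unfolding schwartz_family_def
  proof (intro conjI ballI allI)
    fix "is" :: "'n list" and N
    define \<beta> where "\<beta> = count (mset is)"
    have "\<exists>C. \<forall>x. \<bar>mi_power x \<alpha>\<bar> * norm (partials is \<phi> x) \<le> C" for \<alpha>
      using bd[of \<alpha> \<beta>] by (auto simp: bounded_iff norm_mult partials_eq_mi_partial[OF sm] \<beta>_def)
    then obtain C where C: "\<And>\<alpha> x. \<bar>mi_power x \<alpha>\<bar> * norm (partials is \<phi> x) \<le> C \<alpha>" by metis
    define \<alpha> :: "'n \<Rightarrow> 'n multiindex" where "\<alpha> = (\<lambda>j i. if i = j then 2 * N else 0)"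
    have mp: "mi_power x (\<alpha> j) = (x $ j) ^ (2 * N)" for x j
      by (simp add: mi_power_def \<alpha>_def if_distrib[of "(^) _"] cong: if_cong)
    have mpa: "\<bar>mi_power x (\<alpha> j)\<bar> = (x $ j) ^ (2 * N)" for x j
      by (simp add: mp power_mult)
    have mp0: "mi_power x (\<lambda>_. 0) = 1" for x :: "real^'n" by (simp add: mi_power_def)
    show "\<exists>C. \<forall>p\<in>{()}. \<forall>x. jap x ^ N * norm (partials is \<phi> x) \<le> C * 1"
    proof (intro exI ballI allI)
      fix x
      have "jap x ^ N * norm (partials is \<phi> x) \<le> ((real CARD('n) + 1) ^ N * (1 + (\<Sum>j\<in>UNIV. (x $ j) ^ (2 * N)))) * norm (partials is \<phi> x)"
        by (intro mult_right_mono jap_power_le_components) auto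
      also have "\<dots> = (real CARD('n) + 1) ^ N * (\<bar>mi_power x (\<lambda>_. 0)\<bar> * norm (partials is \<phi> x) + (\<Sum>j\<in>UNIV. \<bar>mi_power x (\<alpha> j)\<bar> * norm (partials is \<phi> x)))"
        by (simp add: mpa mp0 algebra_simps sum_distrib_left)
      also have "\<dots> \<le> (real CARD('n) + 1) ^ N * (C (\<lambda>_. 0) + (\<Sum>j\<in>UNIV. C (\<alpha> j)))"
        by (intro mult_left_mono add_mono sum_mono C) auto
      finally show "jap x ^ N * norm (partials is \<phi> x) \<le> (real CARD('n) + 1) ^ N * (C (\<lambda>_. 0) + (\<Sum>j\<in>UNIV. C (\<alpha> j))) * 1" by simp
    qed
  qed (use sm in auto)
next
  assume F: "schwartz_fun \<phi>"
  show "\<phi> \<in> schwartz"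
    unfolding schwartz_def
  proof (intro CollectI conjI allI)
    show "smooth_on UNIV \<phi>" using schwartz_family_smooth[OF F] by simp
    fix \<alpha> \<beta> :: "'n multiindex"
    obtain C where C: "\<And>x. jap x ^ mi_order \<alpha> * norm (mi_partial \<beta> \<phi> x) \<le> C"
      using F unfolding schwartz_family_def mi_partial_eq mult_1_right by blast
    have "norm (of_real (mi_power x \<alpha>) * mi_partial \<beta> \<phi> x) \<le> C" for x
      unfolding norm_mult norm_of_real
      by (rule order_trans[OF mult_right_mono[OF mi_power_le_jap] C]) auto
    then show "bounded (range (\<lambda>x. of_real (mi_power x \<alpha>) * mi_partial \<beta> \<phi> x))"
      by (auto simp: bounded_iff)
  qed
qed

lemma schwartz_family_single: "schwartz_family I w \<Phi> \<Longrightarrow> p \<in> I \<Longrightarrow> \<Phi> p \<in> schwartz"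
proof -
  assume F: "schwartz_family I w \<Phi>" and p: "p \<in> I"
  show "\<Phi> p \<in> schwartz"
    unfolding schwartz_iff_family schwartz_family_def
  proof (intro conjI ballI allI)
    show "smooth_on UNIV (\<Phi> p)" by (rule schwartz_family_smooth[OF F p])
    fix "is" N
    obtain C where "\<forall>p\<in>I. \<forall>x. jap x ^ N * norm (partials is (\<Phi> p) x) \<le> C * w p"
      using F unfolding schwartz_family_def by blast
    then show "\<exists>C. \<forall>q\<in>{()}. \<forall>x. jap x ^ N * norm (partials is (\<Phi> p) x) \<le> C * 1"
      using p by (intro exI[of _ "C * w p"]) simp
  qed simp
qed

lemma schwartz_mult: "slow_growth \<kappa> \<Longrightarrow> \<phi> \<in> schwartz \<Longrightarrow> (\<lambda>x. \<kappa> x * \<phi> x) \<in> schwartz"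
  using schwartz_family_mult unfolding schwartz_iff_family by blast
lemma schwartz_partial: "\<phi> \<in> schwartz \<Longrightarrow> partial i \<phi> \<in> schwartz"
  using schwartz_family_partial unfolding schwartz_iff_family by blast
lemma schwartz_partials: "\<phi> \<in> schwartz \<Longrightarrow> partials is \<phi> \<in> schwartz"
  by (induction "is") (auto simp: schwartz_partial)
lemma schwartz_smooth: "\<phi> \<in> schwartz \<Longrightarrow> smooth_on UNIV \<phi>" by (simp add: schwartz_def)
lemma schwartz_differentiable: "\<phi> \<in> schwartz \<Longrightarrow> \<phi> differentiable (at x)"
  by (meson UNIV_I schwartz_smooth smooth_on_differentiable)
lemma schwartz_continuous: "\<phi> \<in> schwartz \<Longrightarrow> continuous_on S \<phi>"
  by (meson schwartz_smooth smooth_on_continuous_on continuous_on_subset subset_UNIV)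
lemma schwartz_measurable: "\<phi> \<in> schwartz \<Longrightarrow> \<phi> \<in> borel_measurable borel"
  by (intro borel_measurable_continuous_onI schwartz_continuous)

lemma schwartz_family_add:
  fixes \<Phi> :: "'p \<Rightarrow> 'n::finite cfun"
  assumes "schwartz_family I w \<Phi>" "schwartz_family I w \<Psi>"
  shows "schwartz_family I w (\<lambda>p x. \<Phi> p x + \<Psi> p x)"
proof (rule schwartz_family_coinduct[where T="{\<lambda>p x. \<Phi> p x + \<Psi> p x | \<Phi> \<Psi>. schwartz_family I w \<Phi> \<and> schwartz_family I w \<Psi>}"])
  show "0 \<le> w p" if "p \<in> I" for p using schwartz_family_nonneg[OF assms(2) that] .
  show "(\<lambda>p x. \<Phi> p x + \<Psi> p x) \<in> {\<lambda>p x. \<Phi> p x + \<Psi> p x | \<Phi> \<Psi>. schwartz_family I w \<Phi> \<and> schwartz_family I w \<Psi>}"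
    using assms by blast
next
  fix \<Xi> :: "'p \<Rightarrow> 'n cfun" and p x
  assume "\<Xi> \<in> {\<lambda>p x. \<Phi> p x + \<Psi> p x | \<Phi> \<Psi>. schwartz_family I w \<Phi> \<and> schwartz_family I w \<Psi>}" "p \<in> I"
  then obtain \<Phi> \<Psi> where *: "\<Xi> = (\<lambda>p x. \<Phi> p x + \<Psi> p x)" "schwartz_family I w \<Phi>" "schwartz_family I w \<Psi>" by blast
  show "\<Xi> p differentiable (at x)"
    unfolding *(1) using *(2,3) \<open>p \<in> I\<close> by (intro differentiable_add schwartz_family_differentiable)
next
  fix \<Xi> :: "'p \<Rightarrow> 'n cfun" and i
  assume "\<Xi> \<in> {\<lambda>p x. \<Phi> p x + \<Psi> p x | \<Phi> \<Psi>. schwartz_family I w \<Phi> \<and> schwartz_family I w \<Psi>}"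
  then obtain \<Phi> \<Psi> where *: "\<Xi> = (\<lambda>p x. \<Phi> p x + \<Psi> p x)" "schwartz_family I w \<Phi>" "schwartz_family I w \<Psi>" by blast
  show "\<exists>L. set L \<subseteq> {\<lambda>p x. \<Phi> p x + \<Psi> p x | \<Phi> \<Psi>. schwartz_family I w \<Phi> \<and> schwartz_family I w \<Psi>} \<and> (\<forall>p\<in>I. \<forall>x. partial i (\<Xi> p) x = (\<Sum>\<Psi>\<leftarrow>L. \<Psi> p x))"
    apply (rule exI[of _ "[\<lambda>p x. partial i (\<Phi> p) x + partial i (\<Psi> p) x]"])
    using schwartz_family_partial[OF *(2), of i] schwartz_family_partial[OF *(3), of i]
      partial_add[OF schwartz_family_differentiable[OF *(2)] schwartz_family_differentiable[OF *(3)]]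
    by (auto simp: *(1))
next
  fix \<Xi> :: "'p \<Rightarrow> 'n cfun" and N
  assume "\<Xi> \<in> {\<lambda>p x. \<Phi> p x + \<Psi> p x | \<Phi> \<Psi>. schwartz_family I w \<Phi> \<and> schwartz_family I w \<Psi>}"
  then obtain \<Phi> \<Psi> where *: "\<Xi> = (\<lambda>p x. \<Phi> p x + \<Psi> p x)" "schwartz_family I w \<Phi>" "schwartz_family I w \<Psi>" by blast
  obtain C where C: "C > 0" "\<And>p x. p \<in> I \<Longrightarrow> jap x ^ N * norm (\<Phi> p x) \<le> C * w p" using schwartz_family_bound *(2) by blast
  obtain D where D: "D > 0" "\<And>p x. p \<in> I \<Longrightarrow> jap x ^ N * norm (\<Psi> p x) \<le> D * w p" using schwartz_family_bound *(3) by blast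
  show "\<exists>C. \<forall>p\<in>I. \<forall>x. jap x ^ N * norm (\<Xi> p x) \<le> C * w p"
  proof (intro exI ballI allI)
    fix p x assume p: "p \<in> I"
    have "jap x ^ N * norm (\<Xi> p x) \<le> jap x ^ N * (norm (\<Phi> p x) + norm (\<Psi> p x))"
      unfolding *(1) by (intro mult_left_mono norm_triangle_ineq) auto
    also have "\<dots> \<le> (C + D) * w p" using C(2)[OF p, of x] D(2)[OF p, of x] by (simp add: algebra_simps)
    finally show "jap x ^ N * norm (\<Xi> p x) \<le> (C + D) * w p" .
  qed
qed

lemma schwartz_family_cmult: "schwartz_family I w \<Phi> \<Longrightarrow> schwartz_family I w (\<lambda>p x. c * \<Phi> p x)"
  using schwartz_family_mult[OF slow_growth_const] .

lemma schwartz_family_sum: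
  assumes "finite A" "A \<noteq> {}" "\<And>i. i \<in> A \<Longrightarrow> schwartz_family I w (\<Phi> i)"
  shows "schwartz_family I w (\<lambda>p x. \<Sum>i\<in>A. \<Phi> i p x)"
  using assms
proof (induction A rule: finite_ne_induct)
  case (insert i A)
  then show ?case using schwartz_family_add[of I w "\<Phi> i" "\<lambda>p x. \<Sum>i\<in>A. \<Phi> i p x"] by simp
qed auto

lemma schwartz_add: "\<phi> \<in> schwartz \<Longrightarrow> \<psi> \<in> schwartz \<Longrightarrow> (\<lambda>x. \<phi> x + \<psi> x) \<in> schwartz"
  using schwartz_family_add unfolding schwartz_iff_family by blast
lemma schwartz_cmult: "\<phi> \<in> schwartz \<Longrightarrow> (\<lambda>x. c * \<phi> x) \<in> schwartz"
  using schwartz_mult[OF slow_growth_const] .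

lemma schwartz_family_reflect:
  fixes \<Phi> :: "'p \<Rightarrow> 'n::finite cfun"
  assumes "schwartz_family I w \<Phi>"
  shows "schwartz_family I w (\<lambda>p x. \<Phi> p (- x))"
proof -
  let ?T = "{\<lambda>p x. \<Phi> p (- x) | \<Phi>. schwartz_family I w \<Phi>}"
  have der: "((\<lambda>x. \<phi> (- x)) has_derivative (\<lambda>h. - frechet_derivative \<phi> (at (- x)) h)) (at x)"
    if "\<phi> differentiable (at (- x))" for \<phi> :: "'n cfun" and x
  proof -
    have D: "(\<phi> has_derivative frechet_derivative \<phi> (at (- x))) (at (- x))"
      using that by (simp add: frechet_derivative_works)
    have "((\<lambda>x. \<phi> (- x)) has_derivative (\<lambda>h. frechet_derivative \<phi> (at (- x)) (- h))) (at x)"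
      by (rule has_derivative_compose[where f="\<lambda>x. - x" and g=\<phi>, OF _ D]) (auto intro!: derivative_eq_intros)
    then show ?thesis using D by (simp add: has_derivative_linear linear_neg)
  qed
  show ?thesis
  proof (rule schwartz_family_coinduct[where T="?T"])
    show "0 \<le> w p" if "p \<in> I" for p using schwartz_family_nonneg[OF assms that] .
    show "(\<lambda>p x. \<Phi> p (- x)) \<in> ?T" by (rule CollectI, rule exI[of _ \<Phi>], rule conjI[OF refl assms])
  next
    fix \<Xi> :: "'p \<Rightarrow> 'n cfun" and p x assume "\<Xi> \<in> ?T" "p \<in> I"
    then obtain \<Phi> where *: "\<Xi> = (\<lambda>p x. \<Phi> p (- x))" "schwartz_family I w \<Phi>" by blast
    show "\<Xi> p differentiable (at x)"
      unfolding *(1) by (rule differentiableI[OF der[OF schwartz_family_differentiable[OF *(2) \<open>p \<in> I\<close>]]])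
  next
    fix \<Xi> :: "'p \<Rightarrow> 'n cfun" and i assume "\<Xi> \<in> ?T"
    then obtain \<Phi> where *: "\<Xi> = (\<lambda>p x. \<Phi> p (- x))" "schwartz_family I w \<Phi>" by blast
    have "partial i (\<Xi> p) x = (-1) * partial i (\<Phi> p) (- x)" if "p \<in> I" for p x
      using partial_eqI[OF der[OF schwartz_family_differentiable[OF *(2) that]]] by (simp add: *(1) partial_def)
    moreover have "(\<lambda>p x. (-1) * partial i (\<Phi> p) (- x)) \<in> ?T"
      by (rule CollectI, rule exI[of _ "\<lambda>p y. (-1) * partial i (\<Phi> p) y"], rule conjI[OF refl],
          rule schwartz_family_cmult[OF schwartz_family_partial[OF *(2), of i]])
    ultimately show "\<exists>L. set L \<subseteq> ?T \<and> (\<forall>p\<in>I. \<forall>x. partial i (\<Xi> p) x = (\<Sum>\<Psi>\<leftarrow>L. \<Psi> p x))"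
      by (intro exI[of _ "[\<lambda>p x. (-1) * partial i (\<Phi> p) (- x)]"]) (simp del: mem_Collect_eq)
  next
    fix \<Xi> :: "'p \<Rightarrow> 'n cfun" and N assume "\<Xi> \<in> ?T"
    then obtain \<Phi> where *: "\<Xi> = (\<lambda>p x. \<Phi> p (- x))" "schwartz_family I w \<Phi>" by blast
    obtain C where C: "C > 0" "\<And>p x. p \<in> I \<Longrightarrow> jap x ^ N * norm (\<Phi> p x) \<le> C * w p"
      using schwartz_family_bound *(2) by blast
    show "\<exists>C. \<forall>p\<in>I. \<forall>x. jap x ^ N * norm (\<Xi> p x) \<le> C * w p"
    proof (intro exI ballI allI)
      fix p x assume "p \<in> I"
      from C(2)[OF this, of "- x"] show "jap x ^ N * norm (\<Xi> p x) \<le> C * w p" by (simp add: *(1) jap_def)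
    qed
  qed
qed

text \<open>
  The functions which define a tempered distribution by integration.
\<close>

definition tame :: "'n::finite cfun \<Rightarrow> bool"
  where "tame F \<longleftrightarrow> F \<in> borel_measurable borel \<and> (\<exists>M. integrable lborel (\<lambda>\<xi>. norm (F \<xi>) / jap \<xi> ^ M))"

lemma jap_measurable [measurable]: "jap \<in> borel_measurable borel"
  by (intro borel_measurable_continuous_onI continuous_jap)

lemma tame_const: "tame (\<lambda>x. c)"
  unfolding tame_def using integrable_mult_right[OF integrable_jap_power, of "norm c"] by auto

text \<open>
  The pairing of a tame function with a family of Schwartz functions is small with the weight of
  the family.
\<close>

lemma tame_schwartz_family:
  assumes "tame F" "schwartz_family I w \<Phi>"
  shows "\<And>p. p \<in> I \<Longrightarrow> integrable lborel (\<lambda>x. F x * \<Phi> p x)"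
    and "\<exists>C>0. \<forall>p\<in>I. (LINT x|lborel. norm (F x * \<Phi> p x)) \<le> C * w p"
proof -
  obtain M where M: "integrable lborel (\<lambda>\<xi>. norm (F \<xi>) / jap \<xi> ^ M)"
    and [measurable]: "F \<in> borel_measurable borel" using assms(1) by (auto simp: tame_def)
  obtain C where C: "C > 0" "\<And>p x. p \<in> I \<Longrightarrow> jap x ^ M * norm (\<Phi> p x) \<le> C * w p"
    using schwartz_family_bound assms(2) by blast
  have le: "norm (F x * \<Phi> p x) \<le> (C * w p) * (norm (F x) / jap x ^ M)" if "p \<in> I" for p x
  proof -
    have "norm (F x * \<Phi> p x) = (norm (F x) / jap x ^ M) * (jap x ^ M * norm (\<Phi> p x))"
      by (simp add: norm_mult)
    also have "\<dots> \<le> (norm (F x) / jap x ^ M) * (C * w p)" by (intro mult_left_mono C(2) that) auto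
    finally show ?thesis by (simp add: mult.commute)
  qed
  show int: "integrable lborel (\<lambda>x. F x * \<Phi> p x)" if "p \<in> I" for p
  proof (rule Bochner_Integration.integrable_bound)
    show "integrable lborel (\<lambda>x. (C * w p) * (norm (F x) / jap x ^ M))" using M by (rule integrable_mult_right)
    show "(\<lambda>x. F x * \<Phi> p x) \<in> borel_measurable lborel"
      using schwartz_measurable[OF schwartz_family_single[OF assms(2) that]] by measurable
    show "AE x in lborel. norm (F x * \<Phi> p x) \<le> norm (C * w p * (norm (F x) / jap x ^ M))"
      using le[OF that] by (intro AE_I2) (metis abs_ge_self order_trans real_norm_def)
  qed
  define K where "K = C * (LINT x|lborel. norm (F x) / jap x ^ M) + 1"
  have "(LINT x|lborel. norm (F x * \<Phi> p x)) \<le> K * w p" if "p \<in> I" for p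
  proof -
    have "(LINT x|lborel. norm (F x * \<Phi> p x)) \<le> (LINT x|lborel. (C * w p) * (norm (F x) / jap x ^ M))"
      using int[OF that] M le[OF that] by (intro Bochner_Integration.integral_mono integrable_norm integrable_mult_right)
    also have "\<dots> = (C * w p) * (LINT x|lborel. norm (F x) / jap x ^ M)" by (rule integral_mult_right_zero)
    also have "\<dots> = C * (LINT x|lborel. norm (F x) / jap x ^ M) * w p" by (simp only: mult_ac)
    also have "\<dots> \<le> K * w p" using schwartz_family_nonneg[OF assms(2) that] by (intro mult_right_mono) (auto simp: K_def)
    finally show ?thesis .
  qed
  moreover have "K > 0" using C(1) by (auto simp: K_def intro!: add_nonneg_pos mult_nonneg_nonneg integral_nonneg_AE)
  ultimately show "\<exists>C>0. \<forall>p\<in>I. (LINT x|lborel. norm (F x * \<Phi> p x)) \<le> C * w p" by blast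
qed

lemma tame_schwartz_integrable:
  assumes "tame F" "\<phi> \<in> schwartz" shows "integrable lborel (\<lambda>x. F x * \<phi> x)"
  using tame_schwartz_family(1)[OF assms(1) assms(2)[unfolded schwartz_iff_family]] by simp

lemma schwartz_integrable: "\<phi> \<in> schwartz \<Longrightarrow> integrable lborel \<phi>"
  using tame_schwartz_integrable[OF tame_const[of 1]] by simp

lemma slow_growth_tame_mult:
  assumes "slow_growth \<kappa>" "tame F"
  shows "tame (\<lambda>x. \<kappa> x * F x)"
proof -
  obtain M where M: "integrable lborel (\<lambda>\<xi>. norm (F \<xi>) / jap \<xi> ^ M)"
    and [measurable]: "F \<in> borel_measurable borel" using assms(2) by (auto simp: tame_def)
  obtain C N where C: "C > 0" "\<And>x. norm (\<kappa> x) \<le> C * jap x ^ N" using slow_growth_bound[OF assms(1)] by blast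
  have [measurable]: "\<kappa> \<in> borel_measurable borel"
    using slow_growth_continuous[OF assms(1)] by (rule borel_measurable_continuous_onI)
  have "integrable lborel (\<lambda>\<xi>. norm (\<kappa> \<xi> * F \<xi>) / jap \<xi> ^ (N + M))"
  proof (rule Bochner_Integration.integrable_bound)
    show "integrable lborel (\<lambda>x. C * (norm (F x) / jap x ^ M))" using M by (rule integrable_mult_right)
    show "AE x in lborel. norm (norm (\<kappa> x * F x) / jap x ^ (N + M)) \<le> norm (C * (norm (F x) / jap x ^ M))"
    proof (rule AE_I2)
      fix x :: "real^'a"
      have "norm (\<kappa> x * F x) / jap x ^ (N + M) \<le> (C * jap x ^ N) * norm (F x) / jap x ^ (N + M)"
        unfolding norm_mult by (intro divide_right_mono mult_right_mono C) auto
      then show "norm (norm (\<kappa> x * F x) / jap x ^ (N + M)) \<le> norm (C * (norm (F x) / jap x ^ M))"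
        using C(1) by (simp add: power_add abs_mult)
    qed
  qed measurable
  then show ?thesis unfolding tame_def by auto
qed

section \<open>The Fourier transform on the Schwartz space\<close>

lemma has_derivative_character:
  "((\<lambda>x. exp (\<i> * complex_of_real (x \<bullet> y))) has_derivative (\<lambda>h. exp (\<i> * complex_of_real (x \<bullet> y)) * (\<i> * complex_of_real (h \<bullet> y)))) (at x)"
  for x y :: "real ^ 'n::finite"
proof -
  have 1: "((\<lambda>x. \<i> * complex_of_real (x \<bullet> y)) has_derivative (\<lambda>h. \<i> * complex_of_real (h \<bullet> y))) (at x)"
    by (intro derivative_eq_intros) auto
  have 2: "(exp has_derivative (\<lambda>h. exp (\<i> * complex_of_real (x \<bullet> y)) * h)) (at (\<i> * complex_of_real (x \<bullet> y)))"
    using DERIV_exp[of "\<i> * complex_of_real (x \<bullet> y)"] by (simp add: has_field_derivative_def)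
  show ?thesis using has_derivative_compose[OF 1 2] .
qed

lemma slow_growth_character [simp]: "slow_growth (\<lambda>x::real^'n::finite. exp (\<i> * complex_of_real (x \<bullet> y)))"
proof -
  let ?T = "{\<lambda>x::real^'n. c * exp (\<i> * complex_of_real (x \<bullet> y)) | c. True}"
  have "slow_growth (\<lambda>x::real^'n. 1 * exp (\<i> * complex_of_real (x \<bullet> y)))"
  proof (rule slow_growth_coinduct[where T="?T"])
    fix \<phi> i assume "\<phi> \<in> ?T"
    then obtain c where *: "\<phi> = (\<lambda>x. c * exp (\<i> * complex_of_real (x \<bullet> y)))" by blast
    have D: "(\<phi> has_derivative (\<lambda>h. c * (exp (\<i> * complex_of_real (x \<bullet> y)) * (\<i> * complex_of_real (h \<bullet> y))))) (at x)" for x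
      unfolding * using has_derivative_mult_right[OF has_derivative_character] .
    show "\<phi> differentiable (at x)" for x using D by (rule differentiableI)
    have "partial i \<phi> x = (c * \<i> * complex_of_real (y $ i)) * exp (\<i> * complex_of_real (x \<bullet> y))" for x
      using partial_eqI[OF D] by (simp add: inner_axis inner_commute)
    then show "\<exists>L. set L \<subseteq> ?T \<and> (\<forall>x. partial i \<phi> x = (\<Sum>\<psi>\<leftarrow>L. \<psi> x))"
      by (intro exI[of _ "[\<lambda>x. (c * \<i> * complex_of_real (y $ i)) * exp (\<i> * complex_of_real (x \<bullet> y))]"]) auto
    have "norm (\<phi> x) \<le> norm c * jap x ^ 0" for x by (simp add: * norm_mult)
    then show "\<exists>C N. \<forall>x. norm (\<phi> x) \<le> C * jap x ^ N" by blast
  qed blast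
  then show ?thesis by simp
qed

lemma slow_growth_character_minus [simp]: "slow_growth (\<lambda>x::real^'n::finite. exp (- (\<i> * complex_of_real (x \<bullet> y))))"
  using slow_growth_character[of "- y"] by simp

text \<open>
  The integral of \<open>\<psi>\<close> is invariant under translation; differentiate it in the translation
  parameter.
\<close>

lemma integral_partial_zero:
  fixes \<psi> :: "'n::finite cfun"
  assumes "\<psi> \<in> schwartz"
  shows "(LINT x|lborel. partial i \<psi> x) = 0"
proof -
  let ?e = "axis i 1 :: real^'n"
  note F = assms[unfolded schwartz_iff_family]
  let ?n = "CARD('n)"
  have dpsi: "partial i \<psi> \<in> schwartz" using assms by (rule schwartz_partial)
  obtain C where C: "C > 0" "\<And>x. jap x ^ ?n * norm (partial i \<psi> x) \<le> C"
    using schwartz_family_bound[OF schwartz_family_partial[OF F, of i], of ?n] by auto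
  define f where "f = (\<lambda>(h::real) x. \<psi> (x + h *\<^sub>R ?e))"
  define f' where "f' = (\<lambda>(h::real) x k. k *\<^sub>R partial i \<psi> (x + h *\<^sub>R ?e))"
  have const: "(LINT x|lborel. f h x) = (LINT x|lborel. \<psi> x)" for h
    using lborel_integral_affine[of 1 \<psi> "h *\<^sub>R ?e"] schwartz_measurable[OF assms]
    by (simp add: f_def add.commute)
  have fint: "integrable lborel (f h)" for h
  proof -
    have "integrable (distr lborel borel ((+) (h *\<^sub>R ?e))) \<psi>"
      using schwartz_integrable[OF assms] by (simp add: lborel_distr_plus)
    then have "integrable lborel (\<lambda>x. \<psi> (h *\<^sub>R ?e + x))"
      by (rule integrable_distr[rotated]) simp
    then show ?thesis by (simp add: f_def add.commute)
  qed
  have "((\<lambda>h. LINT x|lborel. f h x) has_derivative (\<lambda>k. LINT x|lborel. f' 0 x k)) (at 0)"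
  proof (rule has_derivative_integral[where r=1 and B="\<lambda>x. (C * 4 ^ ?n) * (1 / jap x ^ ?n)"])
    show "integrable lborel (f z)" for z by (rule fint)
    show "((\<lambda>z. f z y) has_derivative f' z y) (at z)" for z y
    proof -
      have D: "(\<psi> has_derivative frechet_derivative \<psi> (at (y + z *\<^sub>R ?e))) (at (y + z *\<^sub>R ?e))"
        using schwartz_differentiable[OF assms] by (simp add: frechet_derivative_works)
      have "((\<lambda>z. \<psi> (y + z *\<^sub>R ?e)) has_derivative (\<lambda>k. frechet_derivative \<psi> (at (y + z *\<^sub>R ?e)) (k *\<^sub>R ?e))) (at z)"
        by (rule has_derivative_compose[where f="\<lambda>z. y + z *\<^sub>R ?e" and g=\<psi>, OF _ D]) (auto intro!: derivative_eq_intros)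
      then show ?thesis using D by (simp add: f_def f'_def partial_def has_derivative_linear linear_scale)
    qed
    show "norm (f' z y h) \<le> (C * 4 ^ ?n) * (1 / jap y ^ ?n) * norm h" if "z \<in> ball 0 1" for z y h
    proof -
      have "(norm (z *\<^sub>R ?e))\<^sup>2 \<le> 1" using that by (simp add: norm_axis_1 abs_square_le_1)
      then have "jap (z *\<^sub>R ?e) \<le> 2" by (simp add: jap_def)
      then have "2 * jap (y + z *\<^sub>R ?e) * jap (z *\<^sub>R ?e) \<le> 2 * jap (y + z *\<^sub>R ?e) * 2"
        by (intro mult_left_mono) auto
      then have "jap y \<le> 4 * jap (y + z *\<^sub>R ?e)" using peetre[of y "z *\<^sub>R ?e"] by linarith
      then have "jap y ^ ?n \<le> (4 * jap (y + z *\<^sub>R ?e)) ^ ?n" by (intro power_mono) auto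
      then have "jap y ^ ?n * norm (partial i \<psi> (y + z *\<^sub>R ?e)) \<le> (4 * jap (y + z *\<^sub>R ?e)) ^ ?n * norm (partial i \<psi> (y + z *\<^sub>R ?e))"
        by (rule mult_right_mono) simp
      also have "\<dots> = 4 ^ ?n * (jap (y + z *\<^sub>R ?e) ^ ?n * norm (partial i \<psi> (y + z *\<^sub>R ?e)))"
        by (simp add: power_mult_distrib)
      also have "\<dots> \<le> 4 ^ ?n * C" by (intro mult_left_mono C) auto
      (* translations of length at most 1 change jap by at most the factor 4 *)
      finally have *: "norm (partial i \<psi> (y + z *\<^sub>R ?e)) \<le> (C * 4 ^ ?n) * (1 / jap y ^ ?n)"
        by (simp add: field_simps)
      have "norm (f' z y h) = norm (partial i \<psi> (y + z *\<^sub>R ?e)) * norm h" by (simp add: f'_def)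
      also have "\<dots> \<le> (C * 4 ^ ?n) * (1 / jap y ^ ?n) * norm h" by (rule mult_right_mono[OF *]) simp
      finally show ?thesis .
    qed
    show "integrable lborel (\<lambda>x::real^'n. C * 4 ^ ?n * (1 / jap x ^ ?n))"
      by (rule integrable_mult_right[OF integrable_jap_power])
    show "(\<lambda>y. f' 0 y h) \<in> borel_measurable lborel" for h
      unfolding f'_def using schwartz_measurable[OF dpsi] by simp
  qed simp
  moreover have "((\<lambda>h. LINT x|lborel. f h x) has_derivative (\<lambda>k. 0)) (at 0)"
    unfolding const by simp
  ultimately have "(\<lambda>k::real. LINT x|lborel. f' 0 x k) = (\<lambda>k. 0)"
    by (rule has_derivative_unique)
  from fun_cong[OF this, of 1] show ?thesis by (simp add: f'_def)
qed

lemma fourier_partial: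
  assumes "\<phi> \<in> schwartz"
  shows "fourier (partial i \<phi>) \<xi> = \<i> * complex_of_real (\<xi> $ i) * fourier \<phi> \<xi>"
proof -
  let ?e = "\<lambda>x. exp (- (\<i> * complex_of_real (x \<bullet> \<xi>)))"
  have S: "(\<lambda>x. ?e x * \<phi> x) \<in> schwartz" "(\<lambda>x. ?e x * partial i \<phi> x) \<in> schwartz"
    using schwartz_mult[OF slow_growth_character_minus[of \<xi>] assms]
      schwartz_mult[OF slow_growth_character_minus[of \<xi>] schwartz_partial[OF assms]] by auto
  have pe: "partial i ?e x = - (\<i> * complex_of_real (\<xi> $ i)) * ?e x" for x
    using partial_eqI[OF has_derivative_character[where x=x and y="- \<xi>"]] by (simp add: inner_axis inner_commute)
  have p: "partial i (\<lambda>x. ?e x * \<phi> x) x = - (\<i> * complex_of_real (\<xi> $ i)) * (?e x * \<phi> x) + ?e x * partial i \<phi> x" for x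
    using partial_mult[OF slow_growth_differentiable[OF slow_growth_character_minus] schwartz_differentiable[OF assms], of i \<xi>]
    by (simp add: pe)
  have "0 = (LINT x|lborel. - (\<i> * complex_of_real (\<xi> $ i)) * (?e x * \<phi> x) + ?e x * partial i \<phi> x)"
    using integral_partial_zero[OF S(1), of i] by (simp add: p)
  also have "\<dots> = (LINT x|lborel. - (\<i> * complex_of_real (\<xi> $ i)) * (?e x * \<phi> x)) + (LINT x|lborel. ?e x * partial i \<phi> x)"
    by (rule Bochner_Integration.integral_add[OF integrable_mult_right[OF schwartz_integrable[OF S(1)]] schwartz_integrable[OF S(2)]])
  also have "\<dots> = - (\<i> * complex_of_real (\<xi> $ i)) * fourier \<phi> \<xi> + fourier (partial i \<phi>) \<xi>"
    by (simp add: fourier_def)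
  finally show ?thesis by simp
qed

lemma has_derivative_fourier:
  assumes "\<phi> \<in> schwartz"
  shows "(fourier \<phi> has_derivative (\<lambda>h. LINT x|lborel. exp (- (\<i> * complex_of_real (x \<bullet> \<xi>))) * (- (\<i> * complex_of_real (x \<bullet> h))) * \<phi> x)) (at \<xi>)"
proof -
  have [measurable]: "\<phi> \<in> borel_measurable borel" using schwartz_measurable[OF assms] .
  have N: "integrable lborel (\<lambda>x. jap x * norm (\<phi> x))"
    using integrable_norm[OF schwartz_integrable[OF schwartz_mult[OF slow_growth_jap_powr[of 1] assms]]]
    by (simp add: norm_mult abs_of_nonneg[OF jap_nonneg])
  have D: "((\<lambda>\<xi>. exp (- (\<i> * complex_of_real (x \<bullet> \<xi>))) * \<phi> x) has_derivative
      (\<lambda>h. exp (- (\<i> * complex_of_real (x \<bullet> \<xi>))) * (- (\<i> * complex_of_real (x \<bullet> h))) * \<phi> x)) (at \<xi>)" for x \<xi>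
    using has_derivative_mult_left[OF has_derivative_character[where x=\<xi> and y="- x"], of "\<phi> x"]
    by (simp add: inner_commute[of _ x])
  show ?thesis unfolding fourier_def mult_minus_left
  proof (rule has_derivative_integral(1)[where r=1 and B="\<lambda>x. jap x * norm (\<phi> x)" and f'="\<lambda>\<xi> x h. exp (- (\<i> * complex_of_real (x \<bullet> \<xi>))) * (- (\<i> * complex_of_real (x \<bullet> h))) * \<phi> x", unfolded mult_minus_left])
    show "integrable lborel (\<lambda>x. exp (- (\<i> * complex_of_real (x \<bullet> z))) * \<phi> x)" for z
      by (rule schwartz_integrable[OF schwartz_mult[OF slow_growth_character_minus assms]])
    show "((\<lambda>z. exp (- (\<i> * complex_of_real (y \<bullet> z))) * \<phi> y) has_derivative (\<lambda>h. exp (- (\<i> * complex_of_real (y \<bullet> z))) * - (\<i> * complex_of_real (y \<bullet> h)) * \<phi> y)) (at z)" for z y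
      by (rule D)
    show "norm (exp (- (\<i> * complex_of_real (y \<bullet> z))) * - (\<i> * complex_of_real (y \<bullet> h)) * \<phi> y) \<le> jap y * norm (\<phi> y) * norm h" for y z h
    proof -
      have "\<bar>y \<bullet> h\<bar> \<le> norm y * norm h" by (rule Cauchy_Schwarz_ineq2)
      also have "\<dots> \<le> jap y * norm h" by (intro mult_right_mono norm_le_jap) auto
      finally have "\<bar>y \<bullet> h\<bar> * norm (\<phi> y) \<le> jap y * norm h * norm (\<phi> y)" by (intro mult_right_mono) auto
      then show ?thesis by (simp add: norm_mult mult_ac)
    qed
    show "integrable lborel (\<lambda>x. jap x * norm (\<phi> x))" by (rule N)
  qed (simp, measurable)
qed

lemma fourier_differentiable: "\<phi> \<in> schwartz \<Longrightarrow> fourier \<phi> differentiable (at \<xi>)"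
  using has_derivative_fourier by (rule differentiableI)

lemma partial_fourier:
  assumes "\<phi> \<in> schwartz"
  shows "partial i (fourier \<phi>) \<xi> = fourier (\<lambda>x. - \<i> * complex_of_real (x $ i) * \<phi> x) \<xi>"
  using partial_eqI[OF has_derivative_fourier[OF assms]] by (simp add: fourier_def inner_axis mult_ac)

lemma fourier_add:
  assumes "\<phi> \<in> schwartz" "\<psi> \<in> schwartz"
  shows "fourier (\<lambda>x. \<phi> x + \<psi> x) \<xi> = fourier \<phi> \<xi> + fourier \<psi> \<xi>"
  using schwartz_integrable[OF schwartz_mult[OF slow_growth_character_minus assms(1), of \<xi>]]
    schwartz_integrable[OF schwartz_mult[OF slow_growth_character_minus assms(2), of \<xi>]]
  by (simp add: fourier_def distrib_left)

lemma fourier_cmult: "fourier (\<lambda>x. c * \<phi> x) \<xi> = c * fourier \<phi> \<xi>"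
  by (simp add: fourier_def mult.left_commute)

lemma schwartz_sum:
  assumes "finite A" "A \<noteq> {}" "\<And>i. i \<in> A \<Longrightarrow> \<phi> i \<in> schwartz"
  shows "(\<lambda>x. \<Sum>i\<in>A. \<phi> i x) \<in> schwartz"
  using assms by (induction A rule: finite_ne_induct) (auto intro: schwartz_add)

lemma fourier_sum:
  assumes "finite A" "A \<noteq> {}" "\<And>i. i \<in> A \<Longrightarrow> \<phi> i \<in> schwartz"
  shows "fourier (\<lambda>x. \<Sum>i\<in>A. \<phi> i x) \<xi> = (\<Sum>i\<in>A. fourier (\<phi> i) \<xi>)"
  using assms by (induction A rule: finite_ne_induct) (auto simp: fourier_add schwartz_sum)

text \<open>
  Multiplication by \<open>jap\<close> on the Fourier side is the operator \<open>1 - \<Delta>\<close>; this trades decay of the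
  transform for derivatives of the function.
\<close>

lemma jap_fourier:
  fixes \<phi> :: "'n::finite cfun"
  assumes "\<phi> \<in> schwartz"
  shows "complex_of_real (jap \<xi>) * fourier \<phi> \<xi> = fourier (\<lambda>x. \<phi> x + (-1) * (\<Sum>i\<in>UNIV. partial i (partial i \<phi>) x)) \<xi>"
proof -
  have S: "(\<lambda>x. \<Sum>i\<in>UNIV. partial i (partial i \<phi>) x) \<in> schwartz"
    by (intro schwartz_sum schwartz_partial assms) auto
  have "fourier (\<lambda>x. \<phi> x + (-1) * (\<Sum>i\<in>UNIV. partial i (partial i \<phi>) x)) \<xi>
      = fourier \<phi> \<xi> + (-1) * (\<Sum>i\<in>UNIV. fourier (partial i (partial i \<phi>)) \<xi>)"
    using assms S by (simp only: fourier_add schwartz_cmult fourier_cmult)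
      (subst fourier_sum, auto intro: schwartz_partial)
  also have "(\<Sum>i\<in>UNIV. fourier (partial i (partial i \<phi>)) \<xi>) = (\<Sum>i\<in>UNIV. - complex_of_real ((\<xi> $ i)\<^sup>2) * fourier \<phi> \<xi>)"
  proof (intro sum.cong refl)
    fix i
    have "\<i> * a * (\<i> * a * b) = (\<i> * \<i>) * (a * a * b)" for a b by (simp only: mult_ac)
    then show "fourier (partial i (partial i \<phi>)) \<xi> = - complex_of_real ((\<xi> $ i)\<^sup>2) * fourier \<phi> \<xi>"
      unfolding fourier_partial[OF schwartz_partial[OF assms]] fourier_partial[OF assms]
      by (simp add: power2_eq_square)
  qed
  also have "\<dots> = - complex_of_real ((norm \<xi>)\<^sup>2) * fourier \<phi> \<xi>"
    unfolding norm_sq_eq by (simp add: sum_distrib_right[symmetric] sum_negf)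
  finally show ?thesis by (simp add: jap_def distrib_right)
qed

lemma jap_power_fourier_family:
  fixes \<Phi> :: "'p \<Rightarrow> 'n::finite cfun"
  assumes "schwartz_family I w \<Phi>"
  shows "\<exists>\<Psi>. schwartz_family I w \<Psi> \<and> (\<forall>p\<in>I. \<forall>\<xi>. complex_of_real (jap \<xi> ^ N) * fourier (\<Phi> p) \<xi> = fourier (\<Psi> p) \<xi>)"
proof (induction N)
  case 0
  show ?case using assms by (intro exI[of _ \<Phi>]) simp
next
  case (Suc N)
  then obtain \<Psi> where \<Psi>: "schwartz_family I w \<Psi>"
    "\<And>p \<xi>. p \<in> I \<Longrightarrow> complex_of_real (jap \<xi> ^ N) * fourier (\<Phi> p) \<xi> = fourier (\<Psi> p) \<xi>" by blast
  define \<Xi> where "\<Xi> = (\<lambda>p x. \<Psi> p x + (-1) * (\<Sum>i\<in>UNIV. partial i (partial i (\<Psi> p)) x))"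
  have "schwartz_family I w \<Xi>"
    unfolding \<Xi>_def by (intro schwartz_family_add schwartz_family_cmult schwartz_family_sum schwartz_family_partial \<Psi>) auto
  moreover have "complex_of_real (jap \<xi> ^ Suc N) * fourier (\<Phi> p) \<xi> = fourier (\<Xi> p) \<xi>" if "p \<in> I" for p \<xi>
    unfolding \<Xi>_def jap_fourier[OF schwartz_family_single[OF \<Psi>(1) that], symmetric] \<Psi>(2)[OF that, symmetric]
    by simp
  ultimately show ?case by blast
qed

lemma norm_fourier_le:
  assumes "\<phi> \<in> schwartz"
  shows "norm (fourier \<phi> \<xi>) \<le> (LINT x|lborel. norm (\<phi> x))"
proof -
  have "norm (fourier \<phi> \<xi>) \<le> (LINT x|lborel. norm (exp (- \<i> * of_real (x \<bullet> \<xi>)) * \<phi> x))"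
    unfolding fourier_def by (rule integral_norm_bound)
  then show ?thesis by (simp add: norm_mult)
qed

text \<open>
  A derivative of the transform is the transform of a coordinate multiple, and a power of \<open>jap\<close>
  times a transform is again the transform of a family with the same weight, hence bounded by an
  \<open>L\<^sup>1\<close> norm.
\<close>

theorem schwartz_family_fourier:
  fixes \<Phi> :: "'p \<Rightarrow> 'n::finite cfun"
  assumes "schwartz_family I w \<Phi>"
  shows "schwartz_family I w (\<lambda>p. fourier (\<Phi> p))"
proof -
  let ?T = "{\<lambda>p. fourier (\<Phi> p) | \<Phi>::'p \<Rightarrow> 'n cfun. schwartz_family I w \<Phi>}"
  show ?thesis
  proof (rule schwartz_family_coinduct[where T="?T"])
    show "0 \<le> w p" if "p \<in> I" for p using schwartz_family_nonneg[OF assms that] .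
    show "(\<lambda>p. fourier (\<Phi> p)) \<in> ?T" using assms by blast
  next
    fix \<Xi> :: "'p \<Rightarrow> 'n cfun" and p x assume "\<Xi> \<in> ?T" "p \<in> I"
    then show "\<Xi> p differentiable (at x)"
      by (auto intro!: fourier_differentiable schwartz_family_single)
  next
    fix \<Xi> :: "'p \<Rightarrow> 'n cfun" and i assume "\<Xi> \<in> ?T"
    then obtain \<Phi> where *: "\<Xi> = (\<lambda>p. fourier (\<Phi> p))" "schwartz_family I w \<Phi>" by blast
    have "schwartz_family I w (\<lambda>p x. - \<i> * complex_of_real (x $ i) * \<Phi> p x)"
      by (intro schwartz_family_mult slow_growth_mult *) auto
    moreover have "partial i (\<Xi> p) x = fourier (\<lambda>x. - \<i> * complex_of_real (x $ i) * \<Phi> p x) x" if "p \<in> I" for p x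
      unfolding *(1) by (rule partial_fourier[OF schwartz_family_single[OF *(2) that]])
    ultimately show "\<exists>L. set L \<subseteq> ?T \<and> (\<forall>p\<in>I. \<forall>x. partial i (\<Xi> p) x = (\<Sum>\<Psi>\<leftarrow>L. \<Psi> p x))"
      by (intro exI[of _ "[\<lambda>p. fourier (\<lambda>x. - \<i> * complex_of_real (x $ i) * \<Phi> p x)]"]) auto
  next
    fix \<Xi> :: "'p \<Rightarrow> 'n cfun" and N assume "\<Xi> \<in> ?T"
    then obtain \<Phi> where *: "\<Xi> = (\<lambda>p. fourier (\<Phi> p))" "schwartz_family I w \<Phi>" by blast
    obtain \<Psi> where \<Psi>: "schwartz_family I w \<Psi>"
      "\<And>p \<xi>. p \<in> I \<Longrightarrow> complex_of_real (jap \<xi> ^ N) * fourier (\<Phi> p) \<xi> = fourier (\<Psi> p) \<xi>"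
      using jap_power_fourier_family[OF *(2), of N] by blast
    obtain C where C: "\<And>p. p \<in> I \<Longrightarrow> (LINT x|lborel. norm (1 * \<Psi> p x)) \<le> C * w p"
      using tame_schwartz_family(2)[OF tame_const[of 1] \<Psi>(1)] by blast
    have "jap \<xi> ^ N * norm (\<Xi> p \<xi>) \<le> C * w p" if "p \<in> I" for p \<xi>
    proof -
      have "jap \<xi> ^ N * norm (\<Xi> p \<xi>) = norm (complex_of_real (jap \<xi> ^ N) * fourier (\<Phi> p) \<xi>)"
        by (simp add: *(1) norm_mult norm_power abs_of_nonneg[OF jap_nonneg])
      also have "\<dots> \<le> (LINT x|lborel. norm (\<Psi> p x))"
        unfolding \<Psi>(2)[OF that] by (rule norm_fourier_le[OF schwartz_family_single[OF \<Psi>(1) that]])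
      also have "\<dots> \<le> C * w p" using C[OF that] by simp
      finally show ?thesis .
    qed
    then show "\<exists>C. \<forall>p\<in>I. \<forall>x. jap x ^ N * norm (\<Xi> p x) \<le> C * w p" by blast
  qed
qed

lemma schwartz_fourier: "\<phi> \<in> schwartz \<Longrightarrow> fourier \<phi> \<in> schwartz"
  using schwartz_family_fourier unfolding schwartz_iff_family by blast

lemma inv_fourier_eq:
  fixes \<phi> :: "'n::finite cfun"
  shows "inv_fourier \<phi> = (\<lambda>x. (1 / of_real ((2 * pi) ^ CARD('n))) * fourier \<phi> (- x))"
  by (simp add: inv_fourier_def fourier_def inner_commute)

lemma schwartz_family_inv_fourier:
  "schwartz_family I w \<Phi> \<Longrightarrow> schwartz_family I w (\<lambda>p. inv_fourier (\<Phi> p))"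
  unfolding inv_fourier_eq
  by (intro schwartz_family_cmult schwartz_family_reflect schwartz_family_fourier)

lemma schwartz_inv_fourier: "\<phi> \<in> schwartz \<Longrightarrow> inv_fourier \<phi> \<in> schwartz"
  using schwartz_family_inv_fourier unfolding schwartz_iff_family by blast

lemma inv_fourier_partial:
  assumes "\<phi> \<in> schwartz"
  shows "inv_fourier (partial i \<phi>) \<xi> = - (\<i> * complex_of_real (\<xi> $ i)) * inv_fourier \<phi> \<xi>"
  by (simp add: inv_fourier_eq fourier_partial[OF assms])

lemma inv_fourier_add:
  assumes "\<phi> \<in> schwartz" "\<psi> \<in> schwartz"
  shows "inv_fourier (\<lambda>x. \<phi> x + \<psi> x) \<xi> = inv_fourier \<phi> \<xi> + inv_fourier \<psi> \<xi>"
  by (simp add: inv_fourier_eq fourier_add[OF assms] add_divide_distrib)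

lemma inv_fourier_cmult: "inv_fourier (\<lambda>x. c * \<phi> x) \<xi> = c * inv_fourier \<phi> \<xi>"
  by (simp add: inv_fourier_eq fourier_cmult)

section \<open>Gaussians and the inversion formula\<close>

definition gauss :: "real \<Rightarrow> 'n::finite cfun"
  where "gauss t = (\<lambda>x. complex_of_real (exp (- (t * (norm x)\<^sup>2))))"

lemma has_vector_derivative_exp_lin:
  "((\<lambda>s. complex_of_real (exp (- (t * s)))) has_vector_derivative complex_of_real (- t * exp (- (t * s)))) (at s)"
proof -
  have "((\<lambda>s. exp (- (t * s))) has_real_derivative (- t * exp (- (t * s)))) (at s)"
    by (auto intro!: derivative_eq_intros)
  from has_vector_derivative_of_real[OF this] show ?thesis .
qed

lemma gauss_differentiable: "gauss t differentiable (at x)"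
  using differentiableI[OF has_derivative_radial[where x=x and a=0 and h="\<lambda>s. complex_of_real (exp (- (t * s)))", OF has_vector_derivative_exp_lin]]
  by (simp only: gauss_def diff_zero)

lemma partial_gauss: "partial i (gauss t) x = - (2 * complex_of_real t * complex_of_real (x $ i)) * gauss t x"
  using partial_radial[where x=x and a=0 and i=i and h="\<lambda>s. complex_of_real (exp (- (t * s)))", OF has_vector_derivative_exp_lin]
  by (simp add: gauss_def)

lemma schwartz_gauss:
  assumes "t > 0"
  shows "(gauss t :: 'n::finite cfun) \<in> schwartz"
proof -
  let ?T = "{\<lambda>(_::unit) x. \<kappa> x * gauss t x | \<kappa> :: 'n cfun. slow_growth \<kappa>}"
  have "schwartz_family {()} (\<lambda>_. 1) (\<lambda>_ (x::real^'n). 1 * gauss t x)"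
  proof (rule schwartz_family_coinduct[where T="?T"])
    show "(\<lambda>_ x. 1 * gauss t x) \<in> ?T" by (rule CollectI, rule exI, rule conjI[OF refl]) simp
  next
    fix \<Xi> p x assume "\<Xi> \<in> ?T"
    then obtain \<kappa> where *: "\<Xi> = (\<lambda>_ x. \<kappa> x * gauss t x)" "slow_growth \<kappa>" by blast
    show "\<Xi> p differentiable (at x)"
      unfolding *(1) by (intro differentiable_mult slow_growth_differentiable[OF *(2)] gauss_differentiable)
  next
    fix \<Xi> i assume "\<Xi> \<in> ?T"
    then obtain \<kappa> where *: "\<Xi> = (\<lambda>_ x. \<kappa> x * gauss t x)" "slow_growth \<kappa>" by blast
    have A: "(\<lambda>_ x. partial i \<kappa> x * gauss t x) \<in> ?T"
      by (rule CollectI, rule exI, rule conjI[OF refl]) (rule slow_growth_partial[OF *(2)])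
    have B: "(\<lambda>_ x. (\<kappa> x * (- (2 * complex_of_real t) * complex_of_real (x $ i))) * gauss t x) \<in> ?T"
      by (rule CollectI, rule exI, rule conjI[OF refl])
         (intro slow_growth_mult *(2) slow_growth_const slow_growth_coord)
    have "partial i (\<Xi> p) x = partial i \<kappa> x * gauss t x + (\<kappa> x * (- (2 * complex_of_real t) * complex_of_real (x $ i))) * gauss t x" for p x
      unfolding *(1) partial_mult[OF slow_growth_differentiable[OF *(2)] gauss_differentiable] partial_gauss
      by simp
    then show "\<exists>L. set L \<subseteq> ?T \<and> (\<forall>p\<in>{()}. \<forall>x. partial i (\<Xi> p) x = (\<Sum>\<Psi>\<leftarrow>L. \<Psi> p x))"
      using A B by (intro exI[of _ "[\<lambda>_ x. partial i \<kappa> x * gauss t x, \<lambda>_ x. (\<kappa> x * (- (2 * complex_of_real t) * complex_of_real (x $ i))) * gauss t x]"])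
        (simp del: mem_Collect_eq)
  next
    fix \<Xi> N assume "\<Xi> \<in> ?T"
    then obtain \<kappa> where *: "\<Xi> = (\<lambda>_ x. \<kappa> x * gauss t x)" "slow_growth \<kappa>" by blast
    obtain C M where C: "C > 0" "\<And>x. norm (\<kappa> x) \<le> C * jap x ^ M" using slow_growth_bound[OF *(2)] by blast
    obtain D where D: "D > 0" "\<And>x::real^'n. jap x ^ (N + M) * exp (- (t * (norm x)\<^sup>2)) \<le> D"
      using jap_power_gauss_bound[OF assms] by blast
    have "jap x ^ N * norm (\<Xi> p x) \<le> (C * D) * 1" for p x
    proof -
      have "jap x ^ N * norm (\<Xi> p x) = jap x ^ N * (norm (\<kappa> x) * exp (- (t * (norm x)\<^sup>2)))"
        by (simp add: * norm_mult gauss_def)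
      also have "\<dots> \<le> jap x ^ N * ((C * jap x ^ M) * exp (- (t * (norm x)\<^sup>2)))"
        by (intro mult_left_mono mult_right_mono C) auto
      also have "\<dots> = C * (jap x ^ (N + M) * exp (- (t * (norm x)\<^sup>2)))" by (simp add: power_add)
      also have "\<dots> \<le> C * D" using C(1) by (intro mult_left_mono D) auto
      finally show ?thesis by simp
    qed
    then show "\<exists>C. \<forall>p\<in>{()}. \<forall>x. jap x ^ N * norm (\<Xi> p x) \<le> C * 1" by blast
  qed simp
  then show ?thesis unfolding schwartz_iff_family by simp
qed

text \<open>
  The transform \<open>G\<close> of a Gaussian satisfies the differential equations of the dual Gaussian, so the
  quotient of the two is constant; its value is computed at the origin.
\<close>

lemma fourier_gauss:
  assumes "t > 0"
  shows "fourier (gauss t :: 'n::finite cfun) y = of_real (sqrt (pi / t) ^ CARD('n)) * gauss (1 / (4 * t)) y"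
proof -
  let ?G = "fourier (gauss t :: 'n cfun)"
  note S = schwartz_gauss[OF assms, where 'n='n]
  have pG: "partial i ?G y = - (complex_of_real (y $ i) / of_real (2 * t)) * ?G y" for i y
  proof -
    have "partial i ?G y = fourier (\<lambda>x. (\<i> / of_real (2 * t)) * partial i (gauss t) x) y"
      unfolding partial_fourier[OF S] partial_gauss using assms by (intro arg_cong2[where f=fourier] refl ext) simp
    also have "\<dots> = (\<i> / of_real (2 * t)) * (\<i> * complex_of_real (y $ i) * ?G y)"
      unfolding fourier_cmult fourier_partial[OF S] ..
    finally show ?thesis by (simp add: mult.assoc)
  qed
  (* the reciprocal of the dual Gaussian *)
  define E where "E = (gauss (- (1 / (4 * t))) :: 'n cfun)"
  define H where "H = (\<lambda>y. ?G y * E y)"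
  have dG: "?G differentiable (at y)" and dE: "E differentiable (at y)" for y
    by (rule fourier_differentiable[OF S], simp add: E_def gauss_differentiable)
  have pH: "partial i H y = 0" for i y
    unfolding H_def partial_mult[OF dG dE] pG unfolding E_def partial_gauss
    using assms by (simp add: field_simps)
  have "(H has_derivative (\<lambda>h. 0)) (at y)" for y
    using has_derivative_partials[of H y] dG dE by (simp add: pH H_def[symmetric] differentiable_mult[OF dG dE, folded H_def])
  then have "H y = H 0"
    using has_derivative_zero_constant[of UNIV H] by (metis UNIV_I convex_UNIV)
  moreover have "H 0 = of_real (sqrt (pi / t) ^ CARD('n))"
  proof -
    have "?G 0 = (LINT x|lborel. complex_of_real (exp (- (t * (norm (x::real^'n))\<^sup>2))))"
      by (simp add: fourier_def gauss_def)
    also have "\<dots> = of_real (sqrt (pi / t) ^ CARD('n))"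
      unfolding integral_complex_of_real integral_gauss[OF assms] ..
    finally show ?thesis by (simp add: H_def E_def gauss_def)
  qed
  moreover have "H y * gauss (1 / (4 * t)) y = ?G y"
    by (simp add: H_def E_def gauss_def mult_exp_exp flip: of_real_mult)
  ultimately show ?thesis by metis
qed

lemma fourier_multiplication:
  fixes \<phi> \<psi> :: "'n::finite cfun"
  assumes "\<phi> \<in> schwartz" "\<psi> \<in> schwartz"
  shows "(LINT \<xi>|lborel. fourier \<phi> \<xi> * \<psi> \<xi>) = (LINT x|lborel. \<phi> x * fourier \<psi> x)"
proof -
  define f where "f = (\<lambda>\<xi> x. exp (- \<i> * complex_of_real (x \<bullet> \<xi>)) * \<phi> x * \<psi> \<xi>)"
  have [measurable]: "\<phi> \<in> borel_measurable borel" "\<psi> \<in> borel_measurable borel"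
    using assms by (auto intro: schwartz_measurable)
  have "(LINT \<xi>|lborel. LINT x|lborel. f \<xi> x) = (LINT x|lborel. LINT \<xi>|lborel. f \<xi> x)"
  proof (rule fubini_swap(1)[OF sigma_finite_lborel sigma_finite_lborel])
    show "case_prod f \<in> borel_measurable (lborel \<Otimes>\<^sub>M lborel)" unfolding f_def by measurable
    show "(\<integral>\<^sup>+x. \<integral>\<^sup>+y. norm (f x y) \<partial>lborel \<partial>lborel) < \<infinity>"
      using integrable_norm[OF schwartz_integrable[OF assms(2)]] integrable_norm[OF schwartz_integrable[OF assms(1)]]
      by (rule nn_integral_product_bound) (simp add: f_def norm_mult mult.commute)
  qed
  moreover have "fourier \<phi> \<xi> * \<psi> \<xi> = (LINT x|lborel. f \<xi> x)" for \<xi>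
    by (simp add: f_def fourier_def)
  moreover have "\<phi> x * fourier \<psi> x = (LINT \<xi>|lborel. f \<xi> x)" for x
    unfolding f_def fourier_def
    by (subst integral_mult_right_zero[symmetric]) (simp add: inner_commute mult_ac)
  ultimately show ?thesis by simp
qed

lemma fourier_modulation:
  fixes x y :: "real ^ 'n::finite"
  shows "fourier (\<lambda>\<xi>. exp (\<i> * complex_of_real (x \<bullet> \<xi>)) * \<phi> \<xi>) y = fourier \<phi> (y - x)"
  unfolding fourier_def
  by (intro Bochner_Integration.integral_cong refl)
     (simp add: inner_diff_right inner_commute[of _ x] mult_exp_exp algebra_simps flip: mult.assoc)

text \<open>
  Insert a Gaussian factor that tends to \<open>1\<close> into the inverse transform. The multiplication formula
  moves the Fourier transform to this factor, where it becomes an approximate identity.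
\<close>

theorem fourier_inversion:
  fixes \<phi> :: "'n::finite cfun"
  assumes "\<phi> \<in> schwartz"
  shows "inv_fourier (fourier \<phi>) x = \<phi> x"
proof -
  let ?n = "CARD('n)"
  define c where "c = (\<lambda>k::nat. 1 / real (Suc k))"
  define \<epsilon> where "\<epsilon> = (\<lambda>k. (c k)\<^sup>2 / 4)"
  have cpos: "c k > 0" for k by (simp add: c_def)
  have epos: "\<epsilon> k > 0" for k using cpos[of k] by (simp add: \<epsilon>_def)
  have clim: "c \<longlonglongrightarrow> 0" unfolding c_def by (rule LIMSEQ_Suc[OF lim_1_over_n])
  have elim: "\<epsilon> \<longlonglongrightarrow> 0" unfolding \<epsilon>_def using tendsto_divide[OF tendsto_power[OF clim, of 2] tendsto_const[of 4]] by simp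
  let ?e = "\<lambda>\<xi>. exp (\<i> * complex_of_real (x \<bullet> \<xi>))"
  have sl: "slow_growth ?e" using slow_growth_character[of x] by (simp add: inner_commute)
  have F: "fourier \<phi> \<in> schwartz" by (rule schwartz_fourier[OF assms])
  have [measurable]: "fourier \<phi> \<in> borel_measurable borel" "\<phi> \<in> borel_measurable borel"
    using F assms by (auto intro: schwartz_measurable)
  have gm [measurable]: "(gauss t :: 'n cfun) \<in> borel_measurable borel" for t unfolding gauss_def by measurable
  have L: "(\<lambda>k. LINT \<xi>|lborel. fourier \<phi> \<xi> * (?e \<xi> * gauss (\<epsilon> k) \<xi>)) \<longlonglongrightarrow> (LINT \<xi>|lborel. fourier \<phi> \<xi> * ?e \<xi>)"
  proof (rule integral_dominated_convergence[where w="\<lambda>\<xi>. norm (fourier \<phi> \<xi>)"])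
    show "integrable lborel (\<lambda>\<xi>. norm (fourier \<phi> \<xi>))" using F by (intro integrable_norm schwartz_integrable)
    show "AE \<xi> in lborel. (\<lambda>k. fourier \<phi> \<xi> * (?e \<xi> * gauss (\<epsilon> k) \<xi>)) \<longlonglongrightarrow> fourier \<phi> \<xi> * ?e \<xi>"
    proof (rule AE_I2)
      fix \<xi> :: "real^'n"
      have "(\<lambda>k. gauss (\<epsilon> k) \<xi>) \<longlonglongrightarrow> complex_of_real (exp (- (0 * (norm \<xi>)\<^sup>2)))"
        unfolding gauss_def by (intro tendsto_intros elim)
      then have "(\<lambda>k. fourier \<phi> \<xi> * (?e \<xi> * gauss (\<epsilon> k) \<xi>)) \<longlonglongrightarrow> fourier \<phi> \<xi> * (?e \<xi> * complex_of_real (exp (- (0 * (norm \<xi>)\<^sup>2))))"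
        by (intro tendsto_mult tendsto_const)
      then show "(\<lambda>k. fourier \<phi> \<xi> * (?e \<xi> * gauss (\<epsilon> k) \<xi>)) \<longlonglongrightarrow> fourier \<phi> \<xi> * ?e \<xi>" by simp
    qed
    show "AE \<xi> in lborel. norm (fourier \<phi> \<xi> * (?e \<xi> * gauss (\<epsilon> k) \<xi>)) \<le> norm (fourier \<phi> \<xi>)" for k
      using epos[of k] by (intro AE_I2) (simp add: norm_mult gauss_def mult_left_le)
  qed measurable
  have eq: "(LINT \<xi>|lborel. fourier \<phi> \<xi> * (?e \<xi> * gauss (\<epsilon> k) \<xi>)) =
      of_real ((2 * sqrt pi) ^ ?n) * (LINT z|lborel. \<phi> (x + c k *\<^sub>R z) * gauss 1 z)" for k
  proof -
    have "(LINT \<xi>|lborel. fourier \<phi> \<xi> * (?e \<xi> * gauss (\<epsilon> k) \<xi>)) = (LINT y|lborel. \<phi> y * fourier (\<lambda>\<xi>. ?e \<xi> * gauss (\<epsilon> k) \<xi>) y)"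
      by (rule fourier_multiplication[OF assms schwartz_mult[OF sl schwartz_gauss[OF epos]]])
    also have "\<dots> = (LINT y|lborel. \<phi> y * (of_real (sqrt (pi / \<epsilon> k) ^ ?n) * gauss (1 / (4 * \<epsilon> k)) (y - x)))"
      unfolding fourier_modulation fourier_gauss[OF epos] ..
    also have "\<dots> = \<bar>c k\<bar> ^ DIM(real^'n) *\<^sub>R (LINT z|lborel. \<phi> (x + c k *\<^sub>R z) * (of_real (sqrt (pi / \<epsilon> k) ^ ?n) * gauss (1 / (4 * \<epsilon> k)) (x + c k *\<^sub>R z - x)))"
      using cpos[of k] by (intro lborel_integral_affine borel_measurable_times measurable_const measurable_compose[OF _ gm]) auto
    also have "\<dots> = \<bar>c k\<bar> ^ ?n *\<^sub>R (LINT z|lborel. of_real (sqrt (pi / \<epsilon> k) ^ ?n) * (\<phi> (x + c k *\<^sub>R z) * gauss 1 z))"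
    proof -
      have "gauss (1 / (4 * \<epsilon> k)) (x + c k *\<^sub>R z - x) = gauss 1 z" for z :: "real^'n"
      proof -
        have "1 / (4 * \<epsilon> k) * (norm (c k *\<^sub>R z))\<^sup>2 = 1 * (norm z)\<^sup>2"
          using cpos[of k] by (simp add: \<epsilon>_def power_mult_distrib)
        then show ?thesis unfolding gauss_def add_diff_cancel_left' by (simp only:)
      qed
      then show ?thesis by (simp only: DIM_cart DIM_real mult_1_right mult.left_commute[of "\<phi> _"])
    qed
    also have "\<dots> = of_real (\<bar>c k\<bar> ^ ?n * sqrt (pi / \<epsilon> k) ^ ?n) * (LINT z|lborel. \<phi> (x + c k *\<^sub>R z) * gauss 1 z)"
      unfolding integral_mult_right_zero by (simp add: scaleR_conv_of_real)
    also have "\<bar>c k\<bar> ^ ?n * sqrt (pi / \<epsilon> k) ^ ?n = (2 * sqrt pi) ^ ?n"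
    proof -
      have *: "sqrt (\<epsilon> k) = c k / 2" using cpos[of k] by (simp add: \<epsilon>_def real_sqrt_divide)
      have "\<bar>c k\<bar> * sqrt (pi / \<epsilon> k) = 2 * sqrt pi"
        unfolding real_sqrt_divide * using cpos[of k] by simp
      then show ?thesis by (simp only: power_mult_distrib[symmetric])
    qed
    finally show ?thesis .
  qed
  obtain B where B: "B > 0" "\<And>x. norm (\<phi> x) \<le> B"
    using schwartz_family_bound[OF assms[unfolded schwartz_iff_family], of 0] by auto
  have R: "(\<lambda>k. LINT z|lborel. \<phi> (x + c k *\<^sub>R z) * gauss 1 z) \<longlonglongrightarrow> (LINT z|lborel. \<phi> x * gauss 1 (z::real^'n))"
  proof (rule integral_dominated_convergence[where w="\<lambda>z. B * exp (- (1 * (norm z)\<^sup>2))"])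
    show "integrable lborel (\<lambda>z::real^'n. B * exp (- (1 * (norm z)\<^sup>2)))"
      using integrable_gauss[of 1] by (intro integrable_mult_right) simp
    show "AE z in lborel. (\<lambda>k. \<phi> (x + c k *\<^sub>R z) * gauss 1 z) \<longlonglongrightarrow> \<phi> x * gauss 1 z"
    proof (rule AE_I2)
      fix z :: "real^'n"
      have "(\<lambda>k. x + c k *\<^sub>R z) \<longlonglongrightarrow> x + 0 *\<^sub>R z" by (intro tendsto_intros clim)
      moreover have "isCont \<phi> x" using schwartz_continuous[OF assms, of UNIV] by (simp add: continuous_on_eq_continuous_at)
      ultimately have "(\<lambda>k. \<phi> (x + c k *\<^sub>R z)) \<longlonglongrightarrow> \<phi> x" using isCont_tendsto_compose by fastforce
      then show "(\<lambda>k. \<phi> (x + c k *\<^sub>R z) * gauss 1 z) \<longlonglongrightarrow> \<phi> x * gauss 1 z" by (intro tendsto_intros)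
    qed
    show "AE z in lborel. norm (\<phi> (x + c k *\<^sub>R z) * gauss 1 z) \<le> B * exp (- (1 * (norm z)\<^sup>2))" for k
      by (intro AE_I2) (simp add: norm_mult gauss_def B mult_right_mono)
  qed measurable
  have V: "(LINT z|lborel. \<phi> x * gauss 1 (z::real^'n)) = \<phi> x * of_real (sqrt pi ^ ?n)"
  proof -
    have "(LINT z|lborel. gauss 1 (z::real^'n)) = of_real (sqrt pi ^ ?n)"
      unfolding gauss_def integral_complex_of_real using integral_gauss[of 1, where 'n='n] by simp
    then show ?thesis by simp
  qed
  have "(\<lambda>k. LINT \<xi>|lborel. fourier \<phi> \<xi> * (?e \<xi> * gauss (\<epsilon> k) \<xi>)) \<longlonglongrightarrow> of_real ((2 * sqrt pi) ^ ?n) * (\<phi> x * of_real (sqrt pi ^ ?n))"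
    unfolding eq by (intro tendsto_mult tendsto_const R[unfolded V])
  from LIMSEQ_unique[OF L this]
  have "(LINT \<xi>|lborel. ?e \<xi> * fourier \<phi> \<xi>) = of_real ((2 * sqrt pi) ^ ?n * sqrt pi ^ ?n) * \<phi> x"
    by (simp add: mult_ac)
  also have "(2 * sqrt pi) ^ ?n * sqrt pi ^ ?n = (2 * pi) ^ ?n"
  proof -
    have "2 * sqrt pi * sqrt pi = 2 * pi" by simp
    then show ?thesis by (simp only: power_mult_distrib[symmetric])
  qed
  finally show ?thesis by (simp add: inv_fourier_def)
qed

lemma fourier_inv_fourier:
  fixes \<phi> :: "'n::finite cfun"
  assumes "\<phi> \<in> schwartz"
  shows "fourier (inv_fourier \<phi>) x = \<phi> x"
proof -
  have m: "fourier \<phi> \<in> borel_measurable borel" using assms by (intro schwartz_measurable schwartz_fourier)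
  have "fourier (inv_fourier \<phi>) x = (1 / of_real ((2 * pi) ^ CARD('n))) * fourier (\<lambda>y. fourier \<phi> (- y)) x"
    unfolding inv_fourier_eq[of \<phi>] fourier_cmult ..
  also have "fourier (\<lambda>y. fourier \<phi> (- y)) x = fourier (fourier \<phi>) (- x)"
    unfolding fourier_def[of "\<lambda>y. fourier \<phi> (- y)"] fourier_def[of "fourier \<phi>"]
    using m by (subst lborel_integral_affine[of "-1" _ 0]) simp_all
  also have "(1 / of_real ((2 * pi) ^ CARD('n))) * fourier (fourier \<phi>) (- x) = \<phi> x"
    using fourier_inversion[OF assms, of x] unfolding inv_fourier_eq .
  finally show ?thesis .
qed

section \<open>Test functions and plateau functions\<close>

lemma compact_closed_subset: "compact K \<Longrightarrow> closed S \<Longrightarrow> S \<subseteq> K \<Longrightarrow> compact (S :: 'a::t2_space set)"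
  using compact_Int_closed[of K S] by (simp add: Int_absorb1)

lemma partial_eq_0_outside:
  assumes "x \<notin> closure {x. \<phi> x \<noteq> 0}"
  shows "partials is \<phi> x = 0"
proof -
  have "open (- closure {x. \<phi> x \<noteq> 0})" by (rule open_Compl) simp
  moreover have "\<phi> y = (\<lambda>_. 0) y" if "y \<in> - closure {x. \<phi> x \<noteq> 0}" for y
    using that closure_subset[of "{x. \<phi> x \<noteq> 0}"] by blast
  moreover have "x \<in> - closure {x. \<phi> x \<noteq> 0}" using assms by blast
  ultimately have "partials is \<phi> x = partials is (\<lambda>_. 0) x"
    by (rule partials_cong_open)
  also have "partials is (\<lambda>_. 0) = (\<lambda>_. 0 :: complex)" by (induction "is") auto
  finally show ?thesis by simp
qed

lemma test_functions_smooth: "\<phi> \<in> test_functions V \<Longrightarrow> smooth_on UNIV \<phi>"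
  by (simp add: test_functions_def)
lemma test_functions_mono: "V \<subseteq> W \<Longrightarrow> \<phi> \<in> test_functions V \<Longrightarrow> \<phi> \<in> test_functions W"
  by (auto simp: test_functions_def)

lemma test_functions_support_mono:
  assumes "\<phi> \<in> test_functions V" "smooth_on UNIV \<psi>" "\<And>x. \<phi> x = 0 \<Longrightarrow> \<psi> x = 0"
  shows "\<psi> \<in> test_functions V"
proof -
  have "closure {x. \<psi> x \<noteq> 0} \<subseteq> closure {x. \<phi> x \<noteq> 0}" using assms(3) by (intro closure_mono) auto
  moreover from this have "compact (closure {x. \<psi> x \<noteq> 0})"
    using assms unfolding test_functions_def by (blast intro: compact_closed_subset[OF _ closed_closure])
  ultimately show ?thesis using assms(1,2) by (auto simp: test_functions_def)
qed

lemma test_functions_partial: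
  assumes "\<phi> \<in> test_functions V"
  shows "partial i \<phi> \<in> test_functions V"
proof -
  have "{x. partial i \<phi> x \<noteq> 0} \<subseteq> closure {x. \<phi> x \<noteq> 0}" using partial_eq_0_outside[of _ \<phi> "[i]"] by auto
  then have "closure {x. partial i \<phi> x \<noteq> 0} \<subseteq> closure {x. \<phi> x \<noteq> 0}" by (simp add: closure_minimal)
  moreover from this have "compact (closure {x. partial i \<phi> x \<noteq> 0})"
    using assms unfolding test_functions_def by (blast intro: compact_closed_subset[OF _ closed_closure])
  ultimately show ?thesis using assms smooth_on_partial[of UNIV \<phi> i]
    by (auto simp: test_functions_def)
qed

lemma test_functions_schwartz:
  assumes "\<phi> \<in> test_functions V"
  shows "\<phi> \<in> schwartz"
  unfolding schwartz_iff_family schwartz_family_def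
proof (intro conjI ballI allI)
  show sm: "smooth_on UNIV \<phi>" using assms by (rule test_functions_smooth)
  fix "is" N
  let ?K = "closure {x. \<phi> x \<noteq> 0}" and ?f = "\<lambda>x. jap x ^ N * norm (partials is \<phi> x)"
  have "compact ?K" using assms by (simp add: test_functions_def)
  moreover have "continuous_on UNIV (partials is \<phi>)" by (intro smooth_on_continuous_on smooth_on_partials sm)
  then have "continuous_on ?K ?f"
    by (intro continuous_intros) (auto intro: continuous_on_subset)
  ultimately have "bounded (?f ` ?K)" by (intro compact_imp_bounded compact_continuous_image)
  then obtain C where "\<And>x. x \<in> ?K \<Longrightarrow> norm (?f x) \<le> C" unfolding bounded_iff by blast
  then have C: "?f x \<le> C" if "x \<in> ?K" for x using that by (metis abs_ge_self order_trans real_norm_def)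
  have "?f x \<le> max C 0" for x
    using C[of x] partial_eq_0_outside[of x \<phi> "is"] by (cases "x \<in> ?K") (auto simp: le_max_iff_disj)
  then show "\<exists>C. \<forall>p\<in>{()}. \<forall>x. ?f x \<le> C * 1" by auto
qed simp

lemma test_functions_mult:
  assumes "slow_growth \<kappa>" "\<phi> \<in> test_functions V"
  shows "(\<lambda>x. \<kappa> x * \<phi> x) \<in> test_functions V"
  using assms(2)
  by (rule test_functions_support_mono)
     (auto intro: schwartz_smooth schwartz_mult assms(1) test_functions_schwartz[OF assms(2)])

text \<open>
  The derivatives of \<open>exp (- 1 / t)\<close> are linear combinations of the functions \<open>flat k\<close>.
\<close>

definition flat :: "nat \<Rightarrow> real \<Rightarrow> real"
  where "flat k t = (if t > 0 then (1 / t) ^ k * exp (- (1 / t)) else 0)"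

lemma flat_le: "\<bar>flat k t\<bar> \<le> fact (k + m) * \<bar>t\<bar> ^ m"
proof (cases "t > 0")
  case True
  have "(1 / t) ^ (k + m) / fact (k + m) \<le> exp (1 / t)" using True by (intro exp_ge_power_div_fact) auto
  then have "(1 / t) ^ (k + m) \<le> fact (k + m) * exp (1 / t)" by (simp only: divide_le_eq) (simp add: mult.commute)
  then have "(1 / t) ^ (k + m) * exp (- (1 / t)) \<le> fact (k + m) * exp (1 / t) * exp (- (1 / t))"
    by (rule mult_right_mono) simp
  then have "(1 / t) ^ (k + m) * exp (- (1 / t)) \<le> fact (k + m)"
    by (simp only: mult.assoc exp_minus_inverse mult_1_right)
  then have "t ^ m * ((1 / t) ^ (k + m) * exp (- (1 / t))) \<le> t ^ m * fact (k + m)"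
    using True by (intro mult_left_mono) auto
  moreover have "t ^ m * ((1 / t) ^ (k + m) * exp (- (1 / t))) = flat k t"
    using True by (simp add: flat_def power_add power_one_over)
  ultimately have "flat k t \<le> t ^ m * fact (k + m)" by (simp only:)
  moreover have "flat k t \<ge> 0" using True by (simp add: flat_def)
  ultimately show ?thesis using True by (simp add: mult.commute)
qed (simp add: flat_def)

lemma flat_deriv: "(flat k has_real_derivative flat (k + 2) t - real k * flat (k + 1) t) (at t)"
proof -
  consider "t > 0" | "t < 0" | "t = 0" by linarith
  then show ?thesis
  proof cases
    case 1
    have "((\<lambda>t. (1 / t) ^ k * exp (- (1 / t))) has_real_derivative flat (k + 2) t - real k * flat (k + 1) t) (at t)"
      using 1 by (auto intro!: derivative_eq_intros simp: flat_def field_simps power2_eq_square)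
        (cases k; simp add: field_simps)
    then show ?thesis
      by (rule has_field_derivative_transform_within_open[where S="{0<..}"]) (use 1 in \<open>auto simp: flat_def\<close>)
  next
    case 2
    have "((\<lambda>t. 0::real) has_real_derivative 0) (at t)" by simp
    then have "(flat k has_real_derivative 0) (at t)"
      by (rule has_field_derivative_transform_within_open[where S="{..<0}"]) (use 2 in \<open>auto simp: flat_def\<close>)
    then show ?thesis using 2 by (simp add: flat_def)
  next
    case 3
    have "((\<lambda>h. flat k h / h) \<longlongrightarrow> 0) (at 0)"
    proof (rule Lim_null_comparison)
      show "eventually (\<lambda>h. norm (flat k h / h) \<le> fact (k + 2) * \<bar>h\<bar>) (at 0)"
        unfolding eventually_at_filter
      proof (intro always_eventually allI impI)
        fix h :: real assume "h \<noteq> 0"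
        then show "norm (flat k h / h) \<le> fact (k + 2) * \<bar>h\<bar>"
          using flat_le[of k h 2] by (simp add: divide_le_eq power2_eq_square abs_mult mult.assoc)
      qed
      show "((\<lambda>h::real. fact (k + 2) * \<bar>h\<bar>) \<longlongrightarrow> 0) (at 0)"
        by (auto intro!: tendsto_eq_intros)
    qed
    then show ?thesis using 3 by (simp add: DERIV_def flat_def)
  qed
qed

lemma slow_growth_flat_radial:
  fixes x0 :: "real ^ 'n::finite"
  shows "slow_growth (\<lambda>x. complex_of_real (flat 0 (a + b * (norm (x - x0))\<^sup>2)))"
proof -
  let ?F = "\<lambda>k x. complex_of_real (flat k (a + b * (norm (x - x0))\<^sup>2))"
  let ?T = "{\<lambda>x. \<kappa> x * ?F k x | \<kappa> k. slow_growth \<kappa>}"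
  have "slow_growth (\<lambda>x. 1 * ?F 0 x)"
  proof (rule slow_growth_coinduct[where T="?T"])
    show "(\<lambda>x. 1 * ?F 0 x) \<in> ?T" by (rule CollectI, rule exI, rule exI, rule conjI[OF refl]) simp
  next
    fix \<phi> i assume "\<phi> \<in> ?T"
    then obtain \<kappa> k where *: "\<phi> = (\<lambda>x. \<kappa> x * ?F k x)" "slow_growth \<kappa>" by blast
    have vd: "((\<lambda>s. complex_of_real (flat k (a + b * s))) has_vector_derivative
        complex_of_real ((flat (k + 2) (a + b * s) - real k * flat (k + 1) (a + b * s)) * b)) (at s)" for s
    proof -
      have "((\<lambda>s. flat k (a + b * s)) has_real_derivative ((flat (k + 2) (a + b * s) - real k * flat (k + 1) (a + b * s)) * b)) (at s)"
        by (rule DERIV_chain2[OF flat_deriv]) (auto intro!: derivative_eq_intros)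
      from has_vector_derivative_of_real[OF this] show ?thesis .
    qed
    note R = vd[THEN has_derivative_radial[where h="\<lambda>s. complex_of_real (flat k (a + b * s))" and a=x0]]
    note P = vd[THEN partial_radial[where h="\<lambda>s. complex_of_real (flat k (a + b * s))" and a=x0 and i=i]]
    have d: "?F k differentiable (at x)" for x by (rule differentiableI[OF R])
    show "\<phi> differentiable (at x)" for x
      unfolding *(1) by (intro differentiable_mult slow_growth_differentiable[OF *(2)] d)
    let ?m = "\<lambda>x. 2 * complex_of_real b * (complex_of_real (x $ i) - complex_of_real (x0 $ i)) * \<kappa> x"
    have m: "slow_growth ?m" by (intro slow_growth_mult slow_growth_diff slow_growth_const slow_growth_coord *(2))
    have A: "(\<lambda>x. partial i \<kappa> x * ?F k x) \<in> ?T"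
      by (rule CollectI, rule exI, rule exI, rule conjI[OF refl]) (rule slow_growth_partial[OF *(2)])
    have B: "(\<lambda>x. ?m x * ?F (k + 2) x) \<in> ?T"
      by (rule CollectI, rule exI, rule exI, rule conjI[OF refl]) (rule m)
    have C: "(\<lambda>x. (- of_nat k * ?m x) * ?F (k + 1) x) \<in> ?T"
      by (rule CollectI, rule exI, rule exI, rule conjI[OF refl]) (rule slow_growth_mult[OF slow_growth_const m])
    have "partial i \<phi> x = partial i \<kappa> x * ?F k x + (?m x * ?F (k + 2) x + (- of_nat k * ?m x) * ?F (k + 1) x)" for x
      unfolding *(1) partial_mult[OF slow_growth_differentiable[OF *(2)] d] P
      by (simp add: algebra_simps)
    then show "\<exists>L. set L \<subseteq> ?T \<and> (\<forall>x. partial i \<phi> x = (\<Sum>\<psi>\<leftarrow>L. \<psi> x))"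
      using A B C
      by (intro exI[of _ "[\<lambda>x. partial i \<kappa> x * ?F k x, \<lambda>x. ?m x * ?F (k + 2) x, \<lambda>x. (- of_nat k * ?m x) * ?F (k + 1) x]"])
         (simp del: mem_Collect_eq)
    obtain D M where D: "D > 0" "\<And>x. norm (\<kappa> x) \<le> D * jap x ^ M" using slow_growth_bound[OF *(2)] by blast
    have "norm (\<phi> x) \<le> (D * fact k) * jap x ^ M" for x
    proof -
      have "norm (\<phi> x) = norm (\<kappa> x) * \<bar>flat k (a + b * (norm (x - x0))\<^sup>2)\<bar>" by (simp add: *(1) norm_mult)
      also have "\<dots> \<le> (D * jap x ^ M) * fact k" using flat_le[of k _ 0] D by (intro mult_mono) auto
      finally show ?thesis by (simp add: mult_ac)
    qed
    then show "\<exists>C N. \<forall>x. norm (\<phi> x) \<le> C * jap x ^ N" by blast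
  qed
  then show ?thesis by simp
qed

lemma slow_growth_divide:
  fixes \<kappa> w :: "'n::finite cfun"
  assumes "slow_growth \<kappa>" "slow_growth w" "\<delta> > 0" "\<And>x. norm (w x) \<ge> \<delta>"
  shows "slow_growth (\<lambda>x. \<kappa> x / w x)"
proof -
  have w0: "w x \<noteq> 0" for x using assms(3) assms(4)[of x] by auto
  let ?T = "{\<lambda>x. \<kappa> x * (1 / w x) ^ k | \<kappa> k. slow_growth \<kappa>}"
  have "slow_growth (\<lambda>x. \<kappa> x * (1 / w x) ^ 1)"
  proof (rule slow_growth_coinduct[where T="?T"])
    show "(\<lambda>x. \<kappa> x * (1 / w x) ^ 1) \<in> ?T" by (rule CollectI, rule exI, rule exI, rule conjI[OF refl assms(1)])
  next
    fix \<phi> i assume "\<phi> \<in> ?T"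
    then obtain \<kappa> k where *: "\<phi> = (\<lambda>x. \<kappa> x * (1 / w x) ^ k)" "slow_growth \<kappa>" by blast
    have D: "((\<lambda>x. (1 / w x) ^ k) has_derivative (\<lambda>h. (- of_nat k * frechet_derivative w (at x) h) * (1 / w x) ^ (k + 1))) (at x)" for x
    proof -
      have 1: "(w has_derivative frechet_derivative w (at x)) (at x)"
        using slow_growth_differentiable[OF assms(2)] by (simp add: frechet_derivative_works)
      have "((\<lambda>z. (1 / z) ^ k) has_field_derivative (- of_nat k * (1 / w x) ^ (k + 1))) (at (w x))"
      proof -
        have "((\<lambda>z. 1 / z) has_field_derivative - ((1 / w x) ^ 2)) (at (w x))"
          using w0[of x] by (auto intro!: derivative_eq_intros simp: power2_eq_square)
        from DERIV_power[OF this, of k]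
        have "((\<lambda>z. (1 / z) ^ k) has_field_derivative of_nat k * (- ((1 / w x) ^ 2) * (1 / w x) ^ (k - Suc 0))) (at (w x))" .
        moreover have "of_nat k * (- ((1 / w x) ^ 2) * (1 / w x) ^ (k - Suc 0)) = - of_nat k * (1 / w x) ^ (k + 1)"
          by (cases k) (simp_all del: of_nat_Suc add: power2_eq_square)
        ultimately show ?thesis by (simp only:)
      qed
      from has_derivative_compose[OF 1 this[unfolded has_field_derivative_def]] show ?thesis
        by (simp add: mult_ac)
    qed
    have d: "(\<lambda>x. (1 / w x) ^ k) differentiable (at x)" for x by (rule differentiableI[OF D])
    show "\<phi> differentiable (at x)" for x
      unfolding *(1) by (intro differentiable_mult slow_growth_differentiable[OF *(2)] d)
    have A: "(\<lambda>x. partial i \<kappa> x * (1 / w x) ^ k) \<in> ?T"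
      by (rule CollectI, rule exI, rule exI, rule conjI[OF refl]) (rule slow_growth_partial[OF *(2)])
    have B: "(\<lambda>x. (- of_nat k * (\<kappa> x * partial i w x)) * (1 / w x) ^ (k + 1)) \<in> ?T"
      by (rule CollectI, rule exI, rule exI, rule conjI[OF refl])
         (rule slow_growth_mult[OF slow_growth_const slow_growth_mult[OF *(2) slow_growth_partial[OF assms(2)]]])
    have p: "partial i (\<lambda>x. (1 / w x) ^ k) x = (- of_nat k * partial i w x) * (1 / w x) ^ (k + 1)" for x
      using partial_eqI[OF D] by (simp add: partial_def)
    have "partial i \<phi> x = partial i \<kappa> x * (1 / w x) ^ k + (- of_nat k * (\<kappa> x * partial i w x)) * (1 / w x) ^ (k + 1)" for x
      unfolding *(1) partial_mult[OF slow_growth_differentiable[OF *(2)] d] p by (simp add: algebra_simps)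
    then show "\<exists>L. set L \<subseteq> ?T \<and> (\<forall>x. partial i \<phi> x = (\<Sum>\<psi>\<leftarrow>L. \<psi> x))"
      using A B
      by (intro exI[of _ "[\<lambda>x. partial i \<kappa> x * (1 / w x) ^ k, \<lambda>x. (- of_nat k * (\<kappa> x * partial i w x)) * (1 / w x) ^ (k + 1)]"])
         (simp del: mem_Collect_eq)
    obtain C M where C: "C > 0" "\<And>x. norm (\<kappa> x) \<le> C * jap x ^ M" using slow_growth_bound[OF *(2)] by blast
    have "norm (\<phi> x) \<le> (C * (1 / \<delta>) ^ k) * jap x ^ M" for x
    proof -
      have "norm (\<phi> x) = norm (\<kappa> x) * (1 / norm (w x)) ^ k" by (simp add: *(1) norm_mult norm_power norm_divide)
      also have "\<dots> \<le> (C * jap x ^ M) * (1 / \<delta>) ^ k"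
        using assms(3) assms(4)[of x] C by (intro mult_mono power_mono) (auto intro!: divide_left_mono mult_pos_pos simp: w0)
      finally show ?thesis by (simp add: mult_ac)
    qed
    then show "\<exists>C N. \<forall>x. norm (\<phi> x) \<le> C * jap x ^ N" by blast
  qed
  then show ?thesis by simp
qed

text \<open>
  With \<open>A\<close> vanishing outside the large ball and \<open>B\<close> vanishing in the small one, \<open>A / (A + B)\<close> has
  the required values. The denominator is bounded below, since in each point one of the arguments of
  \<open>flat\<close> is at least half of the gap \<open>r2\<^sup>2 - r1\<^sup>2\<close>.
\<close>

lemma plateau_exists:
  fixes x0 :: "real ^ 'n::finite"
  assumes "0 < r1" "r1 < r2"
  obtains \<eta> :: "real ^ 'n \<Rightarrow> real" where
    "slow_growth (\<lambda>x. complex_of_real (\<eta> x))"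
    "\<And>x. dist x0 x \<le> r1 \<Longrightarrow> \<eta> x = 1"
    "\<And>x. dist x0 x \<ge> r2 \<Longrightarrow> \<eta> x = 0"
    "\<And>x. 0 \<le> \<eta> x" "\<And>x. \<eta> x \<le> 1"
proof -
  define A where "A = (\<lambda>x::real^'n. flat 0 (r2\<^sup>2 + (-1) * (norm (x - x0))\<^sup>2))"
  define B where "B = (\<lambda>x::real^'n. flat 0 (- r1\<^sup>2 + 1 * (norm (x - x0))\<^sup>2))"
  have nn: "flat 0 t \<ge> 0" for t by (simp add: flat_def)
  have mono: "flat 0 s \<le> flat 0 t" if "s \<le> t" for s t
    using that by (auto simp: flat_def frac_le)
  define e where "e = (r2\<^sup>2 - r1\<^sup>2) / 2"
  have "r1\<^sup>2 < r2\<^sup>2" using assms by (intro power_strict_mono) auto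
  then have "e > 0" by (simp add: e_def)
  then have epos: "flat 0 e > 0" by (simp add: flat_def)
  have low: "flat 0 e \<le> A x + B x" for x
  proof (cases "(norm (x - x0))\<^sup>2 \<le> (r1\<^sup>2 + r2\<^sup>2) / 2")
    case True
    then have "flat 0 e \<le> A x" unfolding A_def by (intro mono) (simp add: e_def field_simps)
    then show ?thesis using nn by (simp add: B_def add_increasing2)
  next
    case False
    then have "flat 0 e \<le> B x" unfolding B_def by (intro mono) (simp add: e_def field_simps)
    then show ?thesis using nn by (simp add: A_def add_increasing)
  qed
  have S: "slow_growth (\<lambda>x. complex_of_real (A x))" "slow_growth (\<lambda>x. complex_of_real (B x))"
    unfolding A_def B_def by (rule slow_growth_flat_radial)+
  have "slow_growth (\<lambda>x. complex_of_real (A x) / (complex_of_real (A x) + complex_of_real (B x)))"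
  proof (rule slow_growth_divide[OF S(1) slow_growth_add[OF S] epos])
    fix x
    have "norm (complex_of_real (A x + B x)) \<ge> flat 0 e"
      unfolding norm_of_real using low[of x] by linarith
    then show "flat 0 e \<le> norm (complex_of_real (A x) + complex_of_real (B x))" by simp
  qed
  then have 1: "slow_growth (\<lambda>x. complex_of_real (A x / (A x + B x)))" by simp
  have pos: "A x + B x > 0" for x using low[of x] epos by linarith
  show thesis
  proof (rule that[OF 1])
    fix x
    have A0: "A x \<ge> 0" and B0: "B x \<ge> 0" using nn by (auto simp: A_def B_def)
    show "0 \<le> A x / (A x + B x)" using A0 pos[of x] by simp
    show "A x / (A x + B x) \<le> 1" using A0 B0 pos[of x] by simp
    show "A x / (A x + B x) = 1" if "dist x0 x \<le> r1"
    proof -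
      have "(norm (x - x0))\<^sup>2 \<le> r1\<^sup>2" using that assms by (intro power_mono) (auto simp: dist_norm norm_minus_commute)
      then have "B x = 0" by (simp add: B_def flat_def)
      then show ?thesis using pos[of x] by simp
    qed
    show "A x / (A x + B x) = 0" if "dist x0 x \<ge> r2"
    proof -
      have "r2\<^sup>2 \<le> (norm (x - x0))\<^sup>2" using that assms by (intro power_mono) (auto simp: dist_norm norm_minus_commute)
      then have "A x = 0" by (simp add: A_def flat_def)
      then show ?thesis by simp
    qed
  qed
qed

lemma test_functionsI:
  assumes "smooth_on UNIV \<phi>" "\<And>x. x \<notin> cball a r \<Longrightarrow> \<phi> x = 0" "cball a r \<subseteq> V"
  shows "\<phi> \<in> test_functions V"
proof -
  have "{x. \<phi> x \<noteq> 0} \<subseteq> cball a r" using assms(2) by blast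
  then have sub: "closure {x. \<phi> x \<noteq> 0} \<subseteq> cball a r" by (simp add: closure_minimal)
  then have "compact (closure {x. \<phi> x \<noteq> 0})"
    by (rule compact_closed_subset[OF compact_cball closed_closure])
  then show ?thesis using assms sub by (auto simp: test_functions_def)
qed

lemma open_not_AE_null:
  fixes U :: "'a::euclidean_space set"
  assumes "open U" "U \<noteq> {}" "AE x in lborel. x \<notin> U"
  shows False
proof -
  have "AE x in lebesgue. x \<notin> U" using assms(3) by (rule AE_completion)
  then have "U \<in> null_sets lebesgue"
    using assms(1) by (subst (asm) AE_iff_null_sets[symmetric]) (auto intro: borel_open sets_completionI_sets)
  then show False using open_not_negligible[OF assms(1,2)] by (simp add: negligible_iff_null_sets)
qed

text \<open>
  A bump function supported where \<open>Re (cnj (h a) h) > 0\<close> makes the integrand nonnegative after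
  multiplication by \<open>cnj (h a)\<close>, so its real part vanishes almost everywhere, which is impossible near
  \<open>a\<close>.
\<close>

theorem weighted_fundamental_lemma:
  fixes h :: "'n::finite cfun" and K :: "real ^ 'n \<Rightarrow> real"
  assumes U: "open U" and h: "continuous_on U h" and K: "\<And>x. x \<in> U \<Longrightarrow> K x > 0"
    and int: "\<And>\<phi>. \<phi> \<in> test_functions U \<Longrightarrow> integrable lborel (\<lambda>x. h x * of_real (K x) * \<phi> x)"
    and zero: "\<And>\<phi>. \<phi> \<in> test_functions U \<Longrightarrow> (LINT x|lborel. h x * of_real (K x) * \<phi> x) = 0"
    and "a \<in> U"
  shows "h a = 0"
proof (rule ccontr)
  assume ha: "h a \<noteq> 0"
  (* rotating the value at a onto the positive axis *)
  define g where "g = (\<lambda>x. Re (cnj (h a) * h x))"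
  have "continuous_on U g" unfolding g_def by (intro continuous_intros h)
  moreover have ga: "g a > 0" using ha by (simp add: g_def complex_neq_0 power2_eq_square)
  ultimately have "eventually (\<lambda>x. g x > 0) (at a within U)"
    using \<open>a \<in> U\<close> by (intro order_tendstoD) (auto simp: continuous_on_def)
  then have "eventually (\<lambda>x. g x > 0) (at a)" using at_within_open[OF \<open>a \<in> U\<close> U] by simp
  then obtain d where d0: "d > 0" "\<And>x. x \<noteq> a \<Longrightarrow> dist x a < d \<Longrightarrow> g x > 0"
    unfolding eventually_at by blast
  have d: "d > 0" "\<And>x. dist a x < d \<Longrightarrow> g x > 0"
  proof -
    fix x assume "dist a x < d"
    then show "g x > 0" using d0(2)[of x] ga by (cases "x = a") (simp_all add: dist_commute)
  qed (rule d0(1))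
  obtain r where r: "r > 0" "cball a r \<subseteq> U" using U \<open>a \<in> U\<close> open_contains_cball by blast
  define \<rho> where "\<rho> = min (d / 2) r"
  have \<rho>: "\<rho> > 0" "\<rho> < d" "\<rho> \<le> r" using d(1) r(1) by (auto simp: \<rho>_def)
  obtain \<eta> :: "real^'n \<Rightarrow> real" where \<eta>: "slow_growth (\<lambda>x. complex_of_real (\<eta> x))"
    "\<And>x. dist a x \<le> \<rho> / 2 \<Longrightarrow> \<eta> x = 1" "\<And>x. dist a x \<ge> \<rho> \<Longrightarrow> \<eta> x = 0" "\<And>x. 0 \<le> \<eta> x" "\<And>x. \<eta> x \<le> 1"
    using plateau_exists[of "\<rho> / 2" \<rho> a] \<rho> by auto
  have T: "(\<lambda>x. complex_of_real (\<eta> x)) \<in> test_functions U"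
    using \<eta>(3) \<rho> r by (intro test_functionsI[of _ a \<rho>] slow_growth_smooth[OF \<eta>(1)]) auto
  note I = integrable_mult_right[OF int[OF T], of "cnj (h a)"]
  let ?G = "\<lambda>x. Re (cnj (h a) * (h x * of_real (K x) * complex_of_real (\<eta> x)))"
  have Geq: "?G x = g x * K x * \<eta> x" for x by (simp add: g_def algebra_simps)
  have "(LINT x|lborel. ?G x) = Re (cnj (h a) * (LINT x|lborel. h x * of_real (K x) * complex_of_real (\<eta> x)))"
    unfolding integral_Re[OF I] integral_mult_right_zero ..
  then have "(LINT x|lborel. ?G x) = 0" using zero[OF T] by simp
  moreover have nn: "?G x \<ge> 0" for x
  proof (cases "dist a x < \<rho>")
    case True
    then have "x \<in> U" "g x > 0" using r \<rho> d(2)[of x] by auto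
    then show ?thesis using K[of x] \<eta>(4)[of x] unfolding Geq by (intro mult_nonneg_nonneg) auto
  qed (use Geq \<eta>(3) in auto)
  moreover have "integrable lborel ?G" using I by (rule integrable_Re)
  ultimately have "AE x in lborel. ?G x = 0" by (subst (asm) integral_nonneg_eq_0_iff_AE) auto
  then have "AE x in lborel. x \<notin> ball a (\<rho> / 2)"
  proof eventually_elim
    case (elim x)
    show ?case
    proof
      assume "x \<in> ball a (\<rho> / 2)"
      then have "x \<in> U" "g x > 0" "\<eta> x = 1" using r \<rho> d(2)[of x] \<eta>(2)[of x] by auto
      then show False using elim K[of x] unfolding Geq by simp
    qed
  qed
  then show False using open_not_AE_null[of "ball a (\<rho> / 2)"] \<rho> by auto
qed

section \<open>The Fourier transform of a distribution of compact support\<close>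

lemma tempered_add: "u \<in> tempered \<Longrightarrow> \<phi> \<in> schwartz \<Longrightarrow> \<psi> \<in> schwartz \<Longrightarrow> u (\<lambda>x. \<phi> x + \<psi> x) = u \<phi> + u \<psi>"
  by (simp add: tempered_def)
lemma tempered_cmult: "u \<in> tempered \<Longrightarrow> \<phi> \<in> schwartz \<Longrightarrow> u (\<lambda>x. c * \<phi> x) = c * u \<phi>"
  by (simp add: tempered_def)

lemma schwartz_zero: "(\<lambda>x. 0) \<in> schwartz"
  using schwartz_cmult[OF schwartz_gauss[of 1], of 0] by simp

lemma tempered_zero: "u \<in> tempered \<Longrightarrow> u (\<lambda>x. 0) = 0"
  using tempered_cmult[OF _ schwartz_zero, of u 0] by simp

text \<open>
  Dividing the square integrable density of a Sobolev distribution by the Bessel weight leaves a tame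
  function, because \<open>2 |g| jap\<^bsup>-n\<^esup> \<le> |g|\<^sup>2 + jap\<^bsup>-2n\<^esup>\<close>.
\<close>

lemma sobolev_density:
  fixes f :: "'n::finite functional"
  assumes "f \<in> sobolev r"
  obtains F0 where "tame F0" "\<And>\<phi>. \<phi> \<in> schwartz \<Longrightarrow> f (fourier \<phi>) = (LINT \<xi>|lborel. F0 \<xi> * \<phi> \<xi>)"
proof -
  obtain g where g: "g \<in> borel_measurable lborel" "integrable lborel (\<lambda>\<xi>. (norm (g \<xi>))\<^sup>2)"
    and eq: "dist_mult (\<lambda>\<xi>. of_real ((1 + (norm \<xi>)\<^sup>2) powr (r / 2))) (dist_fourier f) = dist_of_fun schwartz g"
    using assms by (auto simp: sobolev_def)
  have [measurable]: "g \<in> borel_measurable borel" using g(1) by simp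
  let ?m = "\<lambda>p \<xi>. complex_of_real (jap \<xi> powr p)"
  have "tame g"
    unfolding tame_def
  proof (intro conjI exI)
    show "integrable lborel (\<lambda>\<xi>. norm (g \<xi>) / jap \<xi> ^ CARD('n))"
    proof (rule Bochner_Integration.integrable_bound)
      show "integrable lborel (\<lambda>\<xi>::real^'n. (norm (g \<xi>))\<^sup>2 + 1 / jap \<xi> ^ CARD('n))"
        by (intro Bochner_Integration.integrable_add g integrable_jap_power)
      show "AE \<xi> in lborel. norm (norm (g \<xi>) / jap \<xi> ^ CARD('n)) \<le> norm ((norm (g \<xi>))\<^sup>2 + 1 / jap \<xi> ^ CARD('n))"
      proof (rule AE_I2)
        fix \<xi> :: "real^'n"
        let ?a = "norm (g \<xi>)" and ?b = "1 / jap \<xi> ^ CARD('n)"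
        have b: "0 \<le> ?b" "?b \<le> 1" by (auto simp: divide_le_eq one_le_power)
        have "?a * ?b \<le> ?a\<^sup>2 + ?b\<^sup>2"
          using sum_squares_bound[of ?a ?b] b zero_le_mult_iff[of ?a ?b] norm_ge_zero[of "g \<xi>"] by linarith
        also have "?b\<^sup>2 \<le> ?b" using b mult_left_le[of ?b ?b] by (simp add: power2_eq_square)
        finally show "norm (norm (g \<xi>) / jap \<xi> ^ CARD('n)) \<le> norm ((norm (g \<xi>))\<^sup>2 + 1 / jap \<xi> ^ CARD('n))"
          by (simp add: abs_of_nonneg add_nonneg_nonneg)
      qed
    qed measurable
  qed simp
  then have T: "tame (\<lambda>\<xi>. ?m (- (r / 2)) \<xi> * g \<xi>)" by (intro slow_growth_tame_mult slow_growth_jap_powr)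
  show thesis
  proof (rule that[OF T])
    fix \<phi> :: "'n cfun" assume \<phi>: "\<phi> \<in> schwartz"
    define \<psi> where "\<psi> = (\<lambda>\<xi>. ?m (- (r / 2)) \<xi> * \<phi> \<xi>)"
    have \<psi>: "\<psi> \<in> schwartz" unfolding \<psi>_def by (intro schwartz_mult slow_growth_jap_powr \<phi>)
    have inv: "(\<lambda>\<xi>. of_real ((1 + (norm \<xi>)\<^sup>2) powr (r / 2)) * \<psi> \<xi>) = \<phi>"
      by (auto simp: \<psi>_def jap_def[symmetric] mult.assoc[symmetric] powr_add[symmetric] simp flip: of_real_mult)
    have "f (fourier \<phi>) = dist_mult (\<lambda>\<xi>. of_real ((1 + (norm \<xi>)\<^sup>2) powr (r / 2))) (dist_fourier f) \<psi>"
      using \<psi> \<phi> by (simp add: dist_mult_def dist_fourier_def inv)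
    also have "\<dots> = (LINT \<xi>|lborel. g \<xi> * \<psi> \<xi>)"
      unfolding eq using \<psi> by (simp add: dist_of_fun_def)
    also have "\<dots> = (LINT \<xi>|lborel. ?m (- (r / 2)) \<xi> * g \<xi> * \<phi> \<xi>)"
      by (simp add: \<psi>_def mult_ac)
    finally show "f (fourier \<phi>) = (LINT \<xi>|lborel. ?m (- (r / 2)) \<xi> * g \<xi> * \<phi> \<xi>)" .
  qed
qed

text \<open>
  A partition of unity argument in finitely many steps: by compactness the support of the test function
  is covered by finitely many balls whose doubles lie in members of \<open>\<U>\<close>, and plateau functions split
  off one ball after the other.
\<close>

lemma vanishes_on_union:
  fixes u :: "'n::finite functional"
  assumes u: "u \<in> tempered"
    and van: "\<And>U \<phi>. U \<in> \<U> \<Longrightarrow> \<phi> \<in> test_functions U \<Longrightarrow> u \<phi> = 0"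
    and op: "\<And>U. U \<in> \<U> \<Longrightarrow> open U"
    and \<psi>: "\<psi> \<in> test_functions (\<Union>\<U>)"
  shows "u \<psi> = 0"
proof -
  let ?K = "closure {x. \<psi> x \<noteq> 0}"
  have K: "compact ?K" "?K \<subseteq> \<Union>\<U>" using \<psi> unfolding test_functions_def by blast+
  have "\<exists>r>0. \<exists>U\<in>\<U>. cball x (2 * r) \<subseteq> U" if xU: "x \<in> \<Union>\<U>" for x
  proof -
    obtain U where "U \<in> \<U>" "x \<in> U" using xU by blast
    moreover obtain e where "e > 0" "cball x e \<subseteq> U" using op calculation open_contains_cball by blast
    ultimately show ?thesis by (intro exI[of _ "e / 2"]) auto
  qed
  then obtain r where r: "\<And>x. x \<in> \<Union>\<U> \<Longrightarrow> r x > 0" "\<And>x. x \<in> \<Union>\<U> \<Longrightarrow> \<exists>U\<in>\<U>. cball x (2 * r x) \<subseteq> U" by metis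
  have fin: "u \<phi> = 0" if "finite D" "D \<subseteq> \<Union>\<U>" "\<phi> \<in> test_functions UNIV" "closure {x. \<phi> x \<noteq> 0} \<subseteq> (\<Union>x\<in>D. ball x (r x))" for D \<phi>
    using that
  proof (induction D arbitrary: \<phi> rule: finite_induct)
    case empty
    then have "{x. \<phi> x \<noteq> 0} = {}" using closure_subset[of "{x. \<phi> x \<noteq> 0}"] by blast
    then have "\<phi> = (\<lambda>x. 0)" by blast
    then show ?case using tempered_zero[OF u] by simp
  next
    case (insert a D)
    have aU: "a \<in> \<Union>\<U>" using insert.prems(1) by (rule subsetD) simp
    have ra: "r a > 0" by (rule r(1)[OF aU])
    obtain U where U: "U \<in> \<U>" "cball a (2 * r a) \<subseteq> U" using r(2)[OF aU] by (rule bexE)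
    obtain \<eta> :: "real^'n \<Rightarrow> real" where \<eta>: "slow_growth (\<lambda>x. complex_of_real (\<eta> x))"
      "\<And>x. dist a x \<le> r a \<Longrightarrow> \<eta> x = 1" "\<And>x. dist a x \<ge> 2 * r a \<Longrightarrow> \<eta> x = 0"
      by (rule plateau_exists[of "r a" "2 * r a" a]) (use ra in auto)
    let ?\<phi>1 = "\<lambda>x. complex_of_real (\<eta> x) * \<phi> x" and ?\<phi>2 = "\<lambda>x. (1 - complex_of_real (\<eta> x)) * \<phi> x"
    have T1: "?\<phi>1 \<in> test_functions UNIV" using \<eta>(1) insert.prems by (intro test_functions_mult)
    have T2: "?\<phi>2 \<in> test_functions UNIV"
      using insert.prems by (intro test_functions_mult slow_growth_diff slow_growth_const \<eta>(1))
    have "?\<phi>1 \<in> test_functions U"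
      using U(2) \<eta>(3) by (intro test_functionsI[where a=a and r="2 * r a"] test_functions_smooth[OF T1]) auto
    then have u1: "u ?\<phi>1 = 0" by (rule van[OF U(1)])
    have c1: "closure {x. ?\<phi>2 x \<noteq> 0} \<subseteq> closure {x. \<phi> x \<noteq> 0}" by (intro closure_mono) auto
    have "{x. ?\<phi>2 x \<noteq> 0} \<subseteq> - ball a (r a)" using \<eta>(2) by fastforce
    then have c2: "closure {x. ?\<phi>2 x \<noteq> 0} \<subseteq> - ball a (r a)" by (intro closure_minimal) auto
    have "closure {x. ?\<phi>2 x \<noteq> 0} \<subseteq> (\<Union>x\<in>D. ball x (r x))" using c1 c2 insert.prems(3) by blast
    then have u2: "u ?\<phi>2 = 0" using insert.IH[OF _ T2] insert.prems by blast
    have "u \<phi> = u (\<lambda>x. ?\<phi>1 x + ?\<phi>2 x)" by (simp add: algebra_simps)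
    also have "\<dots> = 0" using tempered_add[OF u test_functions_schwartz[OF T1] test_functions_schwartz[OF T2]] u1 u2 by simp
    finally show ?case .
  qed
  have cov: "?K \<subseteq> (\<Union>x\<in>?K. ball x (r x))" using r(1) K(2) by force
  obtain D where D: "D \<subseteq> ?K" "finite D" "?K \<subseteq> (\<Union>x\<in>D. ball x (r x))"
    by (rule compactE_image[OF K(1) _ cov]) auto
  show ?thesis
    by (rule fin[OF D(2) order_trans[OF D(1) K(2)] test_functions_mono[OF subset_UNIV \<psi>] D(3)])
qed

lemma vanishes_off_support:
  fixes u :: "'n::finite functional"
  assumes "u \<in> tempered" "\<psi> \<in> test_functions (- dist_support u)"
  shows "u \<psi> = 0"
proof (rule vanishes_on_union[OF assms(1), where \<U>="{U. open U \<and> dist_restrict u U = zero_dist (test_functions U)}"])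
  show "u \<phi> = 0" if "U \<in> {U. open U \<and> dist_restrict u U = zero_dist (test_functions U)}" "\<phi> \<in> test_functions U" for U \<phi>
  proof -
    have "dist_restrict u U \<phi> = zero_dist (test_functions U) \<phi>" using that(1) by simp
    then show ?thesis using that(2) by (simp add: dist_restrict_def zero_dist_def)
  qed
qed (use assms(2) in \<open>auto simp: dist_support_def\<close>)

text \<open>
  Beyond radius \<open>k\<close> one power of \<open>jap\<close> can be spent to gain the factor \<open>1 / k\<close>; the derivatives of the
  dilated cutoff only bring further factors \<open>1 / k\<close>.
\<close>

lemma cutoff_at_infinity_family:
  fixes \<kappa> \<psi> :: "'n::finite cfun"
  assumes "slow_growth \<kappa>" "\<And>x. norm x < 1 \<Longrightarrow> \<kappa> x = 0" "\<psi> \<in> schwartz"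
  shows "schwartz_family {1..} (\<lambda>k. 1 / k) (\<lambda>k x. \<kappa> ((1 / k) *\<^sub>R x) * \<psi> x)"
proof -
  let ?t = "\<lambda>j (\<kappa>::'n cfun) (\<psi>::'n cfun) (k::real) x. complex_of_real ((1 / k) ^ j) * (\<kappa> ((1 / k) *\<^sub>R x) * \<psi> x)"
  let ?T = "{?t j \<kappa> \<psi> | j \<kappa> \<psi>. slow_growth \<kappa> \<and> (\<forall>x. norm x < 1 \<longrightarrow> \<kappa> x = 0) \<and> \<psi> \<in> schwartz}"
  have mem: "?t j \<kappa> \<psi> \<in> ?T" if "slow_growth \<kappa>" "\<forall>x. norm x < 1 \<longrightarrow> \<kappa> x = 0" "\<psi> \<in> schwartz" for j \<kappa> \<psi>
    using that by blast
  have "schwartz_family {1..} (\<lambda>k. 1 / k) (?t 0 \<kappa> \<psi>)"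
  proof (rule schwartz_family_coinduct[where T="?T"])
    show "0 \<le> 1 / k" if "k \<in> {1..}" for k :: real using that by simp
    show "?t 0 \<kappa> \<psi> \<in> ?T" using assms by (intro mem) auto
  next
    fix \<Xi> i assume "\<Xi> \<in> ?T"
    then obtain j \<kappa> \<psi> where *: "\<Xi> = ?t j \<kappa> \<psi>" "slow_growth \<kappa>" "\<forall>x. norm x < 1 \<longrightarrow> \<kappa> x = 0" "\<psi> \<in> schwartz"
      by blast
    have D: "((\<lambda>x. \<kappa> ((1 / k) *\<^sub>R x)) has_derivative (\<lambda>h. (1 / k) *\<^sub>R frechet_derivative \<kappa> (at ((1 / k) *\<^sub>R x)) h)) (at x)" for k x
    proof -
      have 1: "(\<kappa> has_derivative frechet_derivative \<kappa> (at ((1 / k) *\<^sub>R x))) (at ((1 / k) *\<^sub>R x))"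
        using slow_growth_differentiable[OF *(2)] by (simp add: frechet_derivative_works)
      have "((\<lambda>x. \<kappa> ((1 / k) *\<^sub>R x)) has_derivative (\<lambda>h. frechet_derivative \<kappa> (at ((1 / k) *\<^sub>R x)) ((1 / k) *\<^sub>R h))) (at x)"
        by (rule has_derivative_compose[where f="\<lambda>x. (1 / k) *\<^sub>R x" and g=\<kappa>, OF _ 1])
          (rule has_derivative_scaleR_right[OF has_derivative_ident])
      then show ?thesis unfolding linear_scale[OF has_derivative_linear[OF 1]] .
    qed
    have d: "(\<lambda>x. \<kappa> ((1 / k) *\<^sub>R x)) differentiable (at x)" for k x by (rule differentiableI[OF D])
    show "\<Xi> k differentiable (at x)" for k x
      unfolding *(1) by (intro differentiable_mult differentiable_const d schwartz_differentiable *)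
    have p: "partial i (\<lambda>x. \<kappa> ((1 / k) *\<^sub>R x)) x = complex_of_real (1 / k) * partial i \<kappa> ((1 / k) *\<^sub>R x)" for k x
      using partial_eqI[OF D] by (simp add: partial_def scaleR_conv_of_real)
    have "partial i \<kappa> x = 0" if "norm x < 1" for x
    proof -
      have "partial i \<kappa> x = partial i (\<lambda>_. 0) x"
        by (rule partial_cong_open[of "ball 0 1"]) (use *(3) that in auto)
      then show ?thesis by simp
    qed
    then have A: "?t (j + 1) (partial i \<kappa>) \<psi> \<in> ?T" using *(2,4) by (intro mem slow_growth_partial) auto
    have B: "?t j \<kappa> (partial i \<psi>) \<in> ?T" using *(2,3,4) by (intro mem schwartz_partial) auto
    have "partial i (\<Xi> k) x = ?t (j + 1) (partial i \<kappa>) \<psi> k x + ?t j \<kappa> (partial i \<psi>) k x" for k x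
    proof -
      have "partial i (\<Xi> k) x = complex_of_real ((1 / k) ^ j) * partial i (\<lambda>x. \<kappa> ((1 / k) *\<^sub>R x) * \<psi> x) x"
        unfolding *(1) by (intro partial_cmult differentiable_mult d schwartz_differentiable *)
      also have "\<dots> = complex_of_real ((1 / k) ^ j) * (complex_of_real (1 / k) * partial i \<kappa> ((1 / k) *\<^sub>R x) * \<psi> x + \<kappa> ((1 / k) *\<^sub>R x) * partial i \<psi> x)"
        unfolding partial_mult[OF d schwartz_differentiable[OF *(4)]] p ..
      finally show ?thesis by (simp add: algebra_simps)
    qed
    then show "\<exists>L. set L \<subseteq> ?T \<and> (\<forall>p\<in>{1..}. \<forall>x. partial i (\<Xi> p) x = (\<Sum>\<Psi>\<leftarrow>L. \<Psi> p x))"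
      using A B by (intro exI[of _ "[?t (j + 1) (partial i \<kappa>) \<psi>, ?t j \<kappa> (partial i \<psi>)]"]) (simp del: mem_Collect_eq)
  next
    fix \<Xi> N assume "\<Xi> \<in> ?T"
    then obtain j \<kappa> \<psi> where *: "\<Xi> = ?t j \<kappa> \<psi>" "slow_growth \<kappa>" "\<forall>x. norm x < 1 \<longrightarrow> \<kappa> x = 0" "\<psi> \<in> schwartz"
      by blast
    obtain C M where C: "C > 0" "\<And>x. norm (\<kappa> x) \<le> C * jap x ^ M" using slow_growth_bound[OF *(2)] by blast
    obtain D where D: "D > 0" "\<And>x. jap x ^ (N + M + 1) * norm (\<psi> x) \<le> D"
      using schwartz_family_bound[OF *(4)[unfolded schwartz_iff_family], of "N + M + 1"] by auto
    show "\<exists>C. \<forall>k\<in>{1..}. \<forall>x. jap x ^ N * norm (\<Xi> k x) \<le> C * (1 / k)"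
    proof (intro exI ballI allI)
      fix k :: real and x :: "real^'n" assume k: "k \<in> {1..}"
      show "jap x ^ N * norm (\<Xi> k x) \<le> (C * D) * (1 / k)"
      proof (cases "norm x < k")
        case True
        then have "norm ((1 / k) *\<^sub>R x) < 1" using k by (simp add: divide_less_eq)
        then show ?thesis using *(3) C D k by (simp add: *(1))
      next
        case False
        have "k \<le> jap x" using False norm_le_jap[of x] by linarith
        have "norm ((1 / k) *\<^sub>R x) \<le> norm x" using k by (simp add: divide_le_eq mult_le_cancel_left1 mult_left_le)
        then have "jap ((1 / k) *\<^sub>R x) \<le> jap x" unfolding jap_def by (intro add_left_mono power_mono) auto
        then have "jap ((1 / k) *\<^sub>R x) ^ M \<le> jap x ^ M" by (intro power_mono) auto
        then have kb: "norm (\<kappa> ((1 / k) *\<^sub>R x)) \<le> C * jap x ^ M"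
          using C by (intro order_trans[OF C(2)] mult_left_mono) auto
        have "(1 / k) ^ j \<le> 1" using k by (intro power_le_one) auto
        have "jap x ^ N * norm (\<Xi> k x) = jap x ^ N * ((1 / k) ^ j * (norm (\<kappa> ((1 / k) *\<^sub>R x)) * norm (\<psi> x)))"
          using k by (simp add: *(1) norm_mult norm_power norm_divide)
        also have "\<dots> \<le> jap x ^ N * (1 * ((C * jap x ^ M) * norm (\<psi> x)))"
          using kb \<open>(1 / k) ^ j \<le> 1\<close> C k by (intro mult_left_mono mult_mono mult_right_mono) auto
        also have "\<dots> = C * (jap x ^ (N + M) * norm (\<psi> x))" by (simp add: power_add)
        also have "\<dots> = C * (k * (jap x ^ (N + M) * norm (\<psi> x))) * (1 / k)" using k by simp
        also have "\<dots> \<le> C * (jap x * (jap x ^ (N + M) * norm (\<psi> x))) * (1 / k)"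
          using C k \<open>k \<le> jap x\<close> by (intro mult_right_mono mult_left_mono) auto
        also have "\<dots> \<le> (C * D) * (1 / k)"
          using C D(2)[of x] k by (intro mult_right_mono mult_left_mono) (auto simp: mult_ac)
        finally show ?thesis .
      qed
    qed
  qed
  then show ?thesis by simp
qed

text \<open>
  A Schwartz function that vanishes near the support need not be a test function off the support. It is
  the sum of such a test function and its tail \<open>\<Phi> k\<close> at infinity, and \<open>f\<close> is continuous along the tails
  because it is given by a tame density on the Fourier side.
\<close>

lemma vanishes_near_support_schwartz:
  fixes f :: "'n::finite functional"
  assumes f: "f \<in> tempered" and supp: "dist_support f \<subseteq> ball 0 R"
    and F0: "tame F0" "\<And>\<phi>. \<phi> \<in> schwartz \<Longrightarrow> f (fourier \<phi>) = (LINT \<xi>|lborel. F0 \<xi> * \<phi> \<xi>)"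
    and \<psi>: "\<psi> \<in> schwartz" "\<And>x. x \<in> ball 0 R \<Longrightarrow> \<psi> x = 0"
  shows "f \<psi> = 0"
proof -
  have rep: "f \<phi> = (LINT \<xi>|lborel. F0 \<xi> * inv_fourier \<phi> \<xi>)" if "\<phi> \<in> schwartz" for \<phi>
  proof -
    have "fourier (inv_fourier \<phi>) = \<phi>" using fourier_inv_fourier[OF that] by (intro ext)
    then show ?thesis using F0(2)[OF schwartz_inv_fourier[OF that]] by simp
  qed
  obtain \<eta> :: "real^'n \<Rightarrow> real" where \<eta>: "slow_growth (\<lambda>x. complex_of_real (\<eta> x))"
    "\<And>x. dist 0 x \<le> 1 \<Longrightarrow> \<eta> x = 1" "\<And>x. dist 0 x \<ge> 2 \<Longrightarrow> \<eta> x = 0"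
    by (rule plateau_exists[of 1 2 0]) auto
  (* this cutoff removes the unit ball, so its dilation by k removes the ball of radius k *)
  define \<kappa> where "\<kappa> = (\<lambda>x. 1 - complex_of_real (\<eta> x))"
  have \<kappa>: "slow_growth \<kappa>" unfolding \<kappa>_def by (intro slow_growth_diff slow_growth_const \<eta>(1))
  define \<Phi> where "\<Phi> = (\<lambda>(k::real) x. \<kappa> ((1 / k) *\<^sub>R x) * \<psi> x)"
  have fam: "schwartz_family {1..} (\<lambda>k. 1 / k) \<Phi>"
    unfolding \<Phi>_def by (rule cutoff_at_infinity_family[OF \<kappa> _ \<psi>(1)]) (simp add: \<kappa>_def \<eta>(2))
  have S: "\<Phi> k \<in> schwartz" if "k \<ge> 1" for k using schwartz_family_single[OF fam] that by simp
  have same: "f (\<Phi> k) = f \<psi>" if k: "k \<ge> 1" for k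
  proof -
    (* the part of the function that is cut off at infinity is a test function off the support *)
    let ?\<theta> = "\<lambda>x. \<psi> x + (-1) * \<Phi> k x"
    have \<theta>S: "?\<theta> \<in> schwartz" by (intro schwartz_add schwartz_cmult \<psi>(1) S k)
    have \<theta>eq: "?\<theta> x = complex_of_real (\<eta> ((1 / k) *\<^sub>R x)) * \<psi> x" for x
      by (simp add: \<Phi>_def \<kappa>_def algebra_simps)
    have far: "?\<theta> x = 0" if "norm x \<ge> 2 * k" for x
    proof -
      have "norm ((1 / k) *\<^sub>R x) \<ge> 2" using that k by (simp add: le_divide_eq)
      then show ?thesis unfolding \<theta>eq by (simp add: \<eta>(3))
    qed
    have "{x. ?\<theta> x \<noteq> 0} \<subseteq> cball 0 (2 * k)" using far by force
    then have "closure {x. ?\<theta> x \<noteq> 0} \<subseteq> cball 0 (2 * k)" by (intro closure_minimal) auto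
    then have c: "compact (closure {x. ?\<theta> x \<noteq> 0})" by (rule compact_closed_subset[OF compact_cball closed_closure])
    have "{x. ?\<theta> x \<noteq> 0} \<subseteq> - ball 0 R" using \<psi>(2) unfolding \<theta>eq by auto
    then have "closure {x. ?\<theta> x \<noteq> 0} \<subseteq> - ball 0 R" by (intro closure_minimal) auto
    then have "?\<theta> \<in> test_functions (- dist_support f)"
      using c supp schwartz_smooth[OF \<theta>S] unfolding test_functions_def by blast
    then have 0: "f ?\<theta> = 0" by (rule vanishes_off_support[OF f])
    have "f \<psi> = f (\<lambda>x. ?\<theta> x + \<Phi> k x)" by simp
    also have "\<dots> = f (\<Phi> k)" unfolding tempered_add[OF f \<theta>S S[OF k]] 0 by simp
    finally show ?thesis by simp
  qed
  obtain C where C: "C > 0" "\<And>k. k \<ge> 1 \<Longrightarrow> (LINT x|lborel. norm (F0 x * inv_fourier (\<Phi> k) x)) \<le> C * (1 / k)"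
    using tame_schwartz_family(2)[OF F0(1) schwartz_family_inv_fourier[OF fam]] by auto
  have bd: "norm (f \<psi>) \<le> C * (1 / k)" if "k \<ge> 1" for k
  proof -
    have "norm (f \<psi>) = norm (LINT x|lborel. F0 x * inv_fourier (\<Phi> k) x)"
      using same[OF that] rep[OF S[OF that]] by simp
    also have "\<dots> \<le> (LINT x|lborel. norm (F0 x * inv_fourier (\<Phi> k) x))" by (rule integral_norm_bound)
    also have "\<dots> \<le> C * (1 / k)" by (rule C(2)[OF that])
    finally show ?thesis .
  qed
  show ?thesis
  proof (rule ccontr)
    assume "f \<psi> \<noteq> 0"
    then have p: "norm (f \<psi>) > 0" by simp
    (* any k beyond C / |f psi| contradicts the bound *)
    define k where "k = max 1 (2 * C / norm (f \<psi>))"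
    have k: "k \<ge> 1" "k \<ge> 2 * C / norm (f \<psi>)" by (auto simp: k_def)
    have "2 * C \<le> k * norm (f \<psi>)" using k(2) p by (simp add: divide_le_eq)
    moreover have "k * norm (f \<psi>) \<le> C" using bd[OF k(1)] k(1) by (simp add: field_simps)
    ultimately show False using C(1) by linarith
  qed
qed

text \<open>
  The transform of \<open>f = \<theta> f\<close>, with a cutoff \<open>\<theta>\<close> equal to \<open>1\<close> near the support, is up to a constant the
  convolution of the tame density \<open>F0\<close> with the Schwartz function \<open>\<F> \<theta>\<close>. Such a convolution is continuous and of
  polynomial growth by Peetre's inequality.
\<close>

theorem compactly_supported_fourier:
  fixes f :: "'n::finite functional"
  assumes "f \<in> compactly_supported" "f \<in> sobolev r"
  obtains F C M where "continuous_on UNIV F" "C > 0" "\<And>\<xi>. norm (F \<xi>) \<le> C * jap \<xi> ^ M"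
    "\<And>\<phi>. \<phi> \<in> schwartz \<Longrightarrow> f (fourier \<phi>) = (LINT \<xi>|lborel. F \<xi> * \<phi> \<xi>)"
proof -
  have f: "f \<in> tempered" and comp: "compact (dist_support f)"
    using assms by (auto simp: compactly_supported_def)
  obtain F0 where F0: "tame F0" "\<And>\<phi>. \<phi> \<in> schwartz \<Longrightarrow> f (fourier \<phi>) = (LINT \<xi>|lborel. F0 \<xi> * \<phi> \<xi>)"
    using sobolev_density[OF assms(2)] by blast
  obtain R where R: "R > 0" "dist_support f \<subseteq> ball 0 R"
    using bounded_subset_ballD[OF compact_imp_bounded[OF comp]] by blast
  obtain \<eta> :: "real^'n \<Rightarrow> real" where \<eta>: "slow_growth (\<lambda>x. complex_of_real (\<eta> x))"
    "\<And>x. dist 0 x \<le> R \<Longrightarrow> \<eta> x = 1" "\<And>x. dist 0 x \<ge> R + 1 \<Longrightarrow> \<eta> x = 0"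
    by (rule plateau_exists[of R "R + 1" 0]) (use R in auto)
  define \<theta> where "\<theta> = (\<lambda>x. complex_of_real (\<eta> x))"
  have \<theta>s: "slow_growth \<theta>" unfolding \<theta>_def by (rule \<eta>(1))
  have "\<theta> \<in> test_functions UNIV"
    by (rule test_functionsI[where a=0 and r="R + 1"]) (use \<eta>(3) slow_growth_smooth[OF \<theta>s] in \<open>auto simp: \<theta>_def\<close>)
  then have \<theta>: "\<theta> \<in> schwartz" by (rule test_functions_schwartz)
  have loc: "f \<psi> = f (\<lambda>x. \<theta> x * \<psi> x)" if "\<psi> \<in> schwartz" for \<psi>
  proof -
    let ?\<phi> = "\<lambda>x. (1 - \<theta> x) * \<psi> x"
    have S: "?\<phi> \<in> schwartz" "(\<lambda>x. \<theta> x * \<psi> x) \<in> schwartz"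
      by (intro schwartz_mult slow_growth_diff slow_growth_const \<theta>s that)+
    have 0: "f ?\<phi> = 0"
      by (rule vanishes_near_support_schwartz[OF f R(2) F0 S(1)]) (auto simp: \<theta>_def \<eta>(2))
    have "f \<psi> = f (\<lambda>x. ?\<phi> x + \<theta> x * \<psi> x)" by (simp add: algebra_simps)
    then show ?thesis unfolding tempered_add[OF f S] 0 by simp
  qed
  obtain M where M: "integrable lborel (\<lambda>\<xi>. norm (F0 \<xi>) / jap \<xi> ^ M)"
    and [measurable]: "F0 \<in> borel_measurable borel" using F0(1) by (auto simp: tame_def)
  let ?c = "inv_fourier \<theta>"
  have cS: "?c \<in> schwartz" by (rule schwartz_inv_fourier[OF \<theta>])
  have [measurable]: "?c \<in> borel_measurable borel" by (rule schwartz_measurable[OF cS])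
  obtain B where B: "B > 0" "\<And>x. jap x ^ M * norm (?c x) \<le> B"
    using schwartz_family_bound[OF cS[unfolded schwartz_iff_family], of M] by auto
  have cb: "norm (?c (\<xi> - \<eta>)) \<le> (B * 2 ^ M) * jap \<eta> ^ M / jap \<xi> ^ M" for \<xi> \<eta> :: "real^'n"
  proof -
    have "jap \<xi> ^ M \<le> (2 * jap (\<xi> - \<eta>) * jap \<eta>) ^ M"
      using peetre[of \<xi> "- \<eta>"] by (intro power_mono) (auto simp: jap_def)
    then have "jap \<xi> ^ M * norm (?c (\<xi> - \<eta>)) \<le> (2 * jap (\<xi> - \<eta>) * jap \<eta>) ^ M * norm (?c (\<xi> - \<eta>))"
      by (rule mult_right_mono) simp
    also have "\<dots> = 2 ^ M * jap \<eta> ^ M * (jap (\<xi> - \<eta>) ^ M * norm (?c (\<xi> - \<eta>)))" by (simp add: power_mult_distrib)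
    also have "\<dots> \<le> 2 ^ M * jap \<eta> ^ M * B" by (intro mult_left_mono B) auto
    finally show ?thesis by (simp add: field_simps)
  qed
  (* the convolution of the density with the transform of the cutoff *)
  define F where "F = (\<lambda>\<eta>. LINT \<xi>|lborel. F0 \<xi> * ?c (\<xi> - \<eta>))"
  have le: "norm (F0 \<xi> * ?c (\<xi> - \<eta>)) \<le> (norm (F0 \<xi>) / jap \<xi> ^ M) * ((B * 2 ^ M) * jap \<eta> ^ M)" for \<xi> \<eta>
  proof -
    have "norm (F0 \<xi>) * norm (?c (\<xi> - \<eta>)) \<le> norm (F0 \<xi>) * ((B * 2 ^ M) * jap \<eta> ^ M / jap \<xi> ^ M)"
      by (rule mult_left_mono[OF cb]) simp
    then show ?thesis by (simp add: norm_mult)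
  qed
  have cont: "continuous_on UNIV F"
    unfolding continuous_on_sequentially o_def
  proof (intro allI ballI impI, elim conjE)
    fix x and a :: "real^'n" assume x: "x \<longlonglongrightarrow> a"
    have "bounded (range x)" using x by (simp add: convergent_imp_bounded)
    then obtain D where D: "\<And>k. norm (x k) \<le> D" by (auto simp: bounded_iff)
    have jb: "jap (x k) ^ M \<le> (1 + D ^ 2) ^ M" for k
      using D[of k] unfolding jap_def by (intro power_mono add_left_mono) auto
    show "(\<lambda>k. F (x k)) \<longlonglongrightarrow> F a"
      unfolding F_def
    proof (rule integral_dominated_convergence[where w="\<lambda>\<xi>. (norm (F0 \<xi>) / jap \<xi> ^ M) * ((B * 2 ^ M) * (1 + D ^ 2) ^ M)"])
      show "integrable lborel (\<lambda>\<xi>. norm (F0 \<xi>) / jap \<xi> ^ M * (B * 2 ^ M * (1 + D ^ 2) ^ M))"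
        using M by (rule integrable_mult_left)
      show "AE \<xi> in lborel. norm (F0 \<xi> * ?c (\<xi> - x k)) \<le> norm (F0 \<xi>) / jap \<xi> ^ M * (B * 2 ^ M * (1 + D ^ 2) ^ M)" for k
        using B(1) jb[of k] by (intro AE_I2 order_trans[OF le] mult_left_mono) auto
      show "AE \<xi> in lborel. (\<lambda>k. F0 \<xi> * ?c (\<xi> - x k)) \<longlonglongrightarrow> F0 \<xi> * ?c (\<xi> - a)"
      proof (intro AE_I2 tendsto_mult tendsto_const)
        fix \<xi>
        have "isCont ?c (\<xi> - a)" using schwartz_continuous[OF cS, of UNIV] by (simp add: continuous_on_eq_continuous_at)
        then show "(\<lambda>k. ?c (\<xi> - x k)) \<longlonglongrightarrow> ?c (\<xi> - a)"
          by (rule isCont_tendsto_compose) (intro tendsto_intros x)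
      qed
    qed measurable
  qed
  define C where "C = (LINT \<xi>|lborel. norm (F0 \<xi>) / jap \<xi> ^ M) * (B * 2 ^ M) + 1"
  have Fb: "norm (F \<eta>) \<le> C * jap \<eta> ^ M" for \<eta>
  proof -
    have "norm (F \<eta>) \<le> (LINT \<xi>|lborel. (norm (F0 \<xi>) / jap \<xi> ^ M) * ((B * 2 ^ M) * jap \<eta> ^ M))"
      unfolding F_def
    proof (rule order_trans[OF integral_norm_bound integral_mono_AE'])
      show "integrable lborel (\<lambda>\<xi>. norm (F0 \<xi>) / jap \<xi> ^ M * (B * 2 ^ M * jap \<eta> ^ M))"
        using M by (rule integrable_mult_left)
    qed (use le B(1) in \<open>auto intro!: AE_I2 divide_nonneg_pos mult_nonneg_nonneg\<close>)
    also have "\<dots> = (LINT \<xi>|lborel. norm (F0 \<xi>) / jap \<xi> ^ M) * ((B * 2 ^ M) * jap \<eta> ^ M)"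
      by (rule integral_mult_left_zero)
    also have "\<dots> \<le> C * jap \<eta> ^ M" by (simp add: C_def distrib_right mult.assoc)
    finally show ?thesis .
  qed
  have "(LINT \<xi>|lborel. norm (F0 \<xi>) / jap \<xi> ^ M) \<ge> 0" by (rule integral_nonneg_AE) auto
  then have Cpos: "C > 0" using B(1) unfolding C_def by (intro add_nonneg_pos mult_nonneg_nonneg) auto
  show thesis
  proof (rule that[OF cont Cpos Fb])
    fix \<phi> :: "'n cfun" assume \<phi>: "\<phi> \<in> schwartz"
    have [measurable]: "\<phi> \<in> borel_measurable borel" by (rule schwartz_measurable[OF \<phi>])
    have S: "(\<lambda>x. \<theta> x * fourier \<phi> x) \<in> schwartz" by (intro schwartz_mult \<theta>s schwartz_fourier \<phi>)
    have conv: "inv_fourier (\<lambda>x. \<theta> x * fourier \<phi> x) \<xi> = (LINT \<eta>|lborel. \<phi> \<eta> * ?c (\<xi> - \<eta>))" for \<xi>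
    proof -
      let ?P = "complex_of_real ((2 * pi) ^ CARD('n))"
      let ?\<psi> = "\<lambda>x. exp (\<i> * complex_of_real (\<xi> \<bullet> x)) * \<theta> x"
      have \<psi>: "?\<psi> \<in> schwartz" using schwartz_mult[OF slow_growth_character[of \<xi>] \<theta>] by (simp add: inner_commute)
      have "inv_fourier (\<lambda>x. \<theta> x * fourier \<phi> x) \<xi> = (LINT x|lborel. fourier \<phi> x * ?\<psi> x) / ?P"
        by (simp add: inv_fourier_def mult_ac)
      also have "\<dots> = (LINT \<eta>|lborel. \<phi> \<eta> * fourier \<theta> (\<eta> - \<xi>)) / ?P"
        unfolding fourier_multiplication[OF \<phi> \<psi>] fourier_modulation ..
      also have "\<dots> = (LINT \<eta>|lborel. \<phi> \<eta> * ?c (\<xi> - \<eta>))"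
        unfolding inv_fourier_eq by (subst integral_divide_zero[symmetric]) (simp add: divide_inverse mult_ac)
      finally show ?thesis .
    qed
    define k where "k = (\<lambda>\<xi> \<eta>. F0 \<xi> * (\<phi> \<eta> * ?c (\<xi> - \<eta>)))"
    have "f (fourier \<phi>) = f (fourier (inv_fourier (\<lambda>x. \<theta> x * fourier \<phi> x)))"
      unfolding ext[OF fourier_inv_fourier[OF S]] by (rule loc[OF schwartz_fourier[OF \<phi>]])
    also have "\<dots> = (LINT \<xi>|lborel. F0 \<xi> * inv_fourier (\<lambda>x. \<theta> x * fourier \<phi> x) \<xi>)"
      by (rule F0(2)[OF schwartz_inv_fourier[OF S]])
    also have "\<dots> = (LINT \<xi>|lborel. LINT \<eta>|lborel. k \<xi> \<eta>)"
      unfolding conv k_def by simp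
    also have "\<dots> = (LINT \<eta>|lborel. LINT \<xi>|lborel. k \<xi> \<eta>)"
    proof (rule fubini_swap(1)[OF sigma_finite_lborel sigma_finite_lborel])
      show "case_prod k \<in> borel_measurable (lborel \<Otimes>\<^sub>M lborel)" unfolding k_def by measurable
      have "integrable lborel (\<lambda>\<eta>. norm (\<phi> \<eta>) * jap \<eta> ^ M)"
        using integrable_norm[OF schwartz_integrable[OF schwartz_mult[OF slow_growth_power[OF slow_growth_jap_powr[of 1], of M] \<phi>]]]
        by (simp add: norm_mult norm_power abs_of_nonneg[OF jap_nonneg] mult.commute)
      then have 2: "integrable lborel (\<lambda>\<eta>. (B * 2 ^ M) * (norm (\<phi> \<eta>) * jap \<eta> ^ M))" by (rule integrable_mult_right)
      show "(\<integral>\<^sup>+x. \<integral>\<^sup>+y. norm (k x y) \<partial>lborel \<partial>lborel) < \<infinity>"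
      proof (rule nn_integral_product_bound[OF M 2])
        fix \<xi> \<eta>
        have "norm (k \<xi> \<eta>) = norm (F0 \<xi> * ?c (\<xi> - \<eta>)) * norm (\<phi> \<eta>)" by (simp add: k_def norm_mult)
        also have "\<dots> \<le> ((norm (F0 \<xi>) / jap \<xi> ^ M) * ((B * 2 ^ M) * jap \<eta> ^ M)) * norm (\<phi> \<eta>)"
          by (rule mult_right_mono[OF le]) simp
        finally show "norm (k \<xi> \<eta>) \<le> norm (F0 \<xi>) / jap \<xi> ^ M * (B * 2 ^ M * (norm (\<phi> \<eta>) * jap \<eta> ^ M))"
          by (simp add: mult_ac)
      qed
    qed
    also have "\<dots> = (LINT \<eta>|lborel. F \<eta> * \<phi> \<eta>)"
      unfolding k_def F_def
      by (intro Bochner_Integration.integral_cong refl, subst integral_mult_left_zero[symmetric]) (simp add: mult_ac)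
    finally show "f (fourier \<phi>) = (LINT \<xi>|lborel. F \<xi> * \<phi> \<xi>)" .
  qed
qed

lemma integrable_continuous_test:
  assumes "continuous_on U h" "\<phi> \<in> test_functions U"
  shows "integrable lborel (\<lambda>x. h x * \<phi> x)"
proof -
  let ?K = "closure {x. \<phi> x \<noteq> 0}"
  have K: "compact ?K" "?K \<subseteq> U" using assms(2) unfolding test_functions_def by blast+
  have "continuous_on ?K (\<lambda>x. h x * \<phi> x)"
    using continuous_on_subset[OF assms(1) K(2)] schwartz_continuous[OF test_functions_schwartz[OF assms(2)]]
    by (intro continuous_intros)
  from borel_integrable_compact[OF K(1) this]
  have "integrable lborel (\<lambda>x. indicator ?K x *\<^sub>R (h x * \<phi> x))" .
  moreover have "(\<lambda>x. indicator ?K x *\<^sub>R (h x * \<phi> x)) = (\<lambda>x. h x * \<phi> x)"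
    using closure_subset[of "{x. \<phi> x \<noteq> 0}"] by (auto simp: indicator_def fun_eq_iff)
  ultimately show ?thesis by simp
qed

lemma fundamental_lemma:
  fixes g h :: "'n::finite cfun"
  assumes "open U" "continuous_on U g" "continuous_on U h"
    and eq: "\<And>\<phi>. \<phi> \<in> test_functions U \<Longrightarrow> (LINT x|lborel. g x * \<phi> x) = (LINT x|lborel. h x * \<phi> x)"
    and "a \<in> U"
  shows "g a = h a"
proof -
  have "g a - h a = 0"
  proof (rule weighted_fundamental_lemma[where U=U and K="\<lambda>_. 1" and h="\<lambda>x. g x - h x"])
    show "continuous_on U (\<lambda>x. g x - h x)" using assms by (intro continuous_intros)
    fix \<phi> assume \<phi>: "\<phi> \<in> test_functions U"
    have I: "integrable lborel (\<lambda>x. g x * \<phi> x)" "integrable lborel (\<lambda>x. h x * \<phi> x)"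
      using assms \<phi> by (auto intro: integrable_continuous_test)
    show "integrable lborel (\<lambda>x. (g x - h x) * of_real 1 * \<phi> x)"
      using Bochner_Integration.integrable_diff[OF I] by (simp add: left_diff_distrib)
    show "(LINT x|lborel. (g x - h x) * of_real 1 * \<phi> x) = 0"
      using Bochner_Integration.integral_diff[OF I] eq[OF \<phi>] by (simp add: left_diff_distrib)
  qed (use assms in auto)
  then show ?thesis by simp
qed

text \<open>
  Continuous densities of one distribution agree, by the fundamental lemma.
\<close>

lemma fourier_fun_eqI:
  fixes f :: "'n::finite functional"
  assumes "continuous_on UNIV F" "\<And>\<phi>. \<phi> \<in> schwartz \<Longrightarrow> f (fourier \<phi>) = (LINT \<xi>|lborel. F \<xi> * \<phi> \<xi>)"
  shows "fourier_fun f = F"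
  unfolding fourier_fun_def
proof (rule the_equality)
  show "continuous_on UNIV F \<and> dist_fourier f = dist_of_fun schwartz F"
    using assms by (auto simp: dist_fourier_def dist_of_fun_def fun_eq_iff restrict_def)
next
  fix G assume G: "continuous_on UNIV G \<and> dist_fourier f = dist_of_fun schwartz G"
  show "G = F"
  proof
    fix a
    show "G a = F a"
    proof (rule fundamental_lemma[of UNIV])
      fix \<phi> :: "'n cfun" assume "\<phi> \<in> test_functions UNIV"
      then have \<phi>: "\<phi> \<in> schwartz" by (rule test_functions_schwartz)
      have "dist_fourier f \<phi> = dist_of_fun schwartz G \<phi>" using G by simp
      then show "(LINT x|lborel. G x * \<phi> x) = (LINT x|lborel. F x * \<phi> x)"
        using assms(2)[OF \<phi>] \<phi> by (simp add: dist_fourier_def dist_of_fun_def)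
    qed (use assms G in auto)
  qed
qed

section \<open>The heat flow\<close>

text \<open>
  Continuous functions of polynomial growth, among which the Fourier transforms of distributions of
  compact support and their polynomial multiples are found.
\<close>

definition moderate :: "'n::finite cfun \<Rightarrow> bool"
  where "moderate u \<longleftrightarrow> continuous_on UNIV u \<and> (\<exists>C M. \<forall>\<xi>. norm (u \<xi>) \<le> C * jap \<xi> ^ M)"

lemma moderate_continuous: "moderate u \<Longrightarrow> continuous_on S u"
  unfolding moderate_def using continuous_on_subset by blast

lemma moderate_measurable: "moderate u \<Longrightarrow> u \<in> borel_measurable borel"
  by (intro borel_measurable_continuous_onI moderate_continuous)

lemma moderate_bound:
  assumes "moderate u" obtains C M where "C > 0" "\<And>\<xi>. norm (u \<xi>) \<le> C * jap \<xi> ^ M"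
proof -
  obtain C M where C: "\<And>\<xi>. norm (u \<xi>) \<le> C * jap \<xi> ^ M" using assms unfolding moderate_def by blast
  have "norm (u \<xi>) \<le> (\<bar>C\<bar> + 1) * jap \<xi> ^ M" for \<xi>
    using C[of \<xi>] by (rule order_trans) (intro mult_right_mono, auto)
  then show thesis by (intro that[of "\<bar>C\<bar> + 1" M]) auto
qed

lemma moderate_tame:
  fixes u :: "'n::finite cfun"
  assumes "moderate u" shows "tame u"
proof -
  obtain C M where C: "C > 0" "\<And>\<xi>. norm (u \<xi>) \<le> C * jap \<xi> ^ M" using moderate_bound[OF assms] by blast
  have [measurable]: "u \<in> borel_measurable borel" by (rule moderate_measurable[OF assms])
  have "integrable lborel (\<lambda>\<xi>. norm (u \<xi>) / jap \<xi> ^ (M + CARD('n)))"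
  proof (rule Bochner_Integration.integrable_bound)
    show "integrable lborel (\<lambda>\<xi>::real^'n. C * (1 / jap \<xi> ^ CARD('n)))" by (intro integrable_mult_right integrable_jap_power)
    show "AE \<xi> in lborel. norm (norm (u \<xi>) / jap \<xi> ^ (M + CARD('n))) \<le> norm (C * (1 / jap \<xi> ^ CARD('n)))"
    proof (rule AE_I2)
      fix \<xi> :: "real^'n"
      have "norm (u \<xi>) / jap \<xi> ^ (M + CARD('n)) \<le> (C * jap \<xi> ^ M) / jap \<xi> ^ (M + CARD('n))"
        by (rule divide_right_mono[OF C(2)]) simp
      then show "norm (norm (u \<xi>) / jap \<xi> ^ (M + CARD('n))) \<le> norm (C * (1 / jap \<xi> ^ CARD('n)))"
        using C(1) by (simp add: power_add)
    qed
  qed measurable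
  then show ?thesis unfolding tame_def by auto
qed

lemma moderate_mult:
  assumes "slow_growth \<kappa>" "moderate u" shows "moderate (\<lambda>\<xi>. \<kappa> \<xi> * u \<xi>)"
proof -
  obtain C M where C: "C > 0" "\<And>\<xi>. norm (u \<xi>) \<le> C * jap \<xi> ^ M" using moderate_bound[OF assms(2)] by blast
  obtain D N where D: "D > 0" "\<And>x. norm (\<kappa> x) \<le> D * jap x ^ N" using slow_growth_bound[OF assms(1)] by blast
  have "norm (\<kappa> \<xi> * u \<xi>) \<le> (D * C) * jap \<xi> ^ (N + M)" for \<xi>
  proof -
    have "norm (\<kappa> \<xi> * u \<xi>) \<le> (D * jap \<xi> ^ N) * (C * jap \<xi> ^ M)"
      unfolding norm_mult using D by (intro mult_mono C(2) D(2)) auto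
    then show ?thesis by (simp add: power_add mult_ac)
  qed
  then show ?thesis unfolding moderate_def
    using slow_growth_continuous[OF assms(1)] moderate_continuous[OF assms(2)] by (blast intro: continuous_on_mult)
qed

lemma bounded_moderate_mult_schwartz:
  assumes "moderate u" "\<phi> \<in> schwartz" obtains B where "B > 0" "\<And>\<xi>. norm (u \<xi> * \<phi> \<xi>) \<le> B"
proof -
  obtain C M where C: "C > 0" "\<And>\<xi>. norm (u \<xi>) \<le> C * jap \<xi> ^ M" using moderate_bound[OF assms(1)] by blast
  obtain D where D: "D > 0" "\<And>x. jap x ^ M * norm (\<phi> x) \<le> D"
    using schwartz_family_bound[OF assms(2)[unfolded schwartz_iff_family], of M] by auto
  have "norm (u \<xi> * \<phi> \<xi>) \<le> C * D" for \<xi>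
  proof -
    have "norm (u \<xi> * \<phi> \<xi>) \<le> (C * jap \<xi> ^ M) * norm (\<phi> \<xi>)" unfolding norm_mult by (intro mult_right_mono C) auto
    also have "\<dots> = C * (jap \<xi> ^ M * norm (\<phi> \<xi>))" by simp
    also have "\<dots> \<le> C * D" using C(1) by (intro mult_left_mono D) auto
    finally show ?thesis .
  qed
  then show thesis using C(1) D(1) by (intro that[of "C * D"]) auto
qed

lemma norm_sq_powr: "x \<noteq> 0 \<Longrightarrow> ((norm x)\<^sup>2) powr (- (\<gamma> / 2)) = norm x powr (- \<gamma>)"
  using powr_powr[of "norm x" 2 "- (\<gamma> / 2)"] by (simp add: powr_numeral)

text \<open>
  Subordination once more: \<open>|x|\<^bsup>-\<gamma>\<^esup>\<close> is a superposition of Gaussians, and the resulting integral over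
  time converges at infinity exactly when \<open>\<gamma> < n\<close>.
\<close>

lemma nn_integral_singular_gauss:
  assumes "0 < \<gamma>" "\<gamma> < real CARD('n)"
  shows "(\<integral>\<^sup>+(x::real^'n::finite). ennreal (norm x powr (- \<gamma>) * exp (- (norm x)\<^sup>2)) \<partial>lborel) < \<infinity>"
proof -
  let ?n = "real CARD('n)"
  have G: "Gamma (\<gamma> / 2) > 0" using assms by (simp add: Gamma_real_pos)
  have "ennreal (Gamma (\<gamma> / 2)) * (\<integral>\<^sup>+(x::real^'n). ennreal (norm x powr (- \<gamma>) * exp (- (norm x)\<^sup>2)) \<partial>lborel)
     = (\<integral>\<^sup>+(x::real^'n). ennreal (Gamma (\<gamma> / 2)) * ennreal (norm x powr (- \<gamma>) * exp (- (norm x)\<^sup>2)) \<partial>lborel)"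
    by (rule nn_integral_cmult[symmetric]) measurable
  also have "\<dots> = (\<integral>\<^sup>+(x::real^'n). \<integral>\<^sup>+t. ennreal (t powr (\<gamma> / 2 - 1) * exp (- (t * (norm x)\<^sup>2)) * exp (- (norm x)\<^sup>2)) \<partial>halfline \<partial>lborel)"
  proof (rule nn_integral_cong_AE)
    show "AE x in lborel. ennreal (Gamma (\<gamma> / 2)) * ennreal (norm (x::real^'n) powr (- \<gamma>) * exp (- (norm x)\<^sup>2)) =
        (\<integral>\<^sup>+t. ennreal (t powr (\<gamma> / 2 - 1) * exp (- (t * (norm x)\<^sup>2)) * exp (- (norm x)\<^sup>2)) \<partial>halfline)"
      using AE_lborel_singleton[of 0]
    proof eventually_elim
      case (elim x)
      then have p: "(norm x)\<^sup>2 > 0" by simp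
      have e: "((norm x)\<^sup>2) powr (- (\<gamma> / 2)) = norm x powr (- \<gamma>)"
        using elim by (simp add: norm_sq_powr)
      have "(\<integral>\<^sup>+t. ennreal (t powr (\<gamma> / 2 - 1) * exp (- (t * (norm x)\<^sup>2)) * exp (- (norm x)\<^sup>2)) \<partial>halfline)
        = (\<integral>\<^sup>+t. ennreal (t powr (\<gamma> / 2 - 1) * exp (- (t * (norm x)\<^sup>2))) * ennreal (exp (- (norm x)\<^sup>2)) \<partial>halfline)"
        by (intro nn_integral_cong) (rule ennreal_mult, auto)
      also have "\<dots> = ennreal (Gamma (\<gamma> / 2) * ((norm x)\<^sup>2) powr (- (\<gamma> / 2))) * ennreal (exp (- (norm x)\<^sup>2))"
        using assms p by (subst nn_integral_multc) (auto simp: gamma_subordination)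
      also have "\<dots> = ennreal (Gamma (\<gamma> / 2)) * ennreal (norm x powr (- \<gamma>) * exp (- (norm x)\<^sup>2))"
        using G by (simp only: e) (simp add: mult.assoc flip: ennreal_mult)
      finally show ?case ..
    qed
  qed
  also have "\<dots> = (\<integral>\<^sup>+t. \<integral>\<^sup>+(x::real^'n). ennreal (t powr (\<gamma> / 2 - 1) * exp (- (t * (norm x)\<^sup>2)) * exp (- (norm x)\<^sup>2)) \<partial>lborel \<partial>halfline)"
    by (rule tonelli_swap) (auto intro: sigma_finite_lborel sigma_finite_halfline)
  also have "\<dots> = (\<integral>\<^sup>+t. ennreal (t powr (\<gamma> / 2 - 1) * sqrt (pi / (t + 1)) ^ CARD('n)) \<partial>halfline)"
  proof (rule nn_integral_cong_AE, rule AE_halflineI)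
    fix t :: real assume t: "t > 0"
    have "(\<integral>\<^sup>+(x::real^'n). ennreal (t powr (\<gamma> / 2 - 1) * exp (- (t * (norm x)\<^sup>2)) * exp (- (norm x)\<^sup>2)) \<partial>lborel)
       = (\<integral>\<^sup>+(x::real^'n). ennreal (t powr (\<gamma> / 2 - 1)) * ennreal (exp (- ((t + 1) * (norm x)\<^sup>2))) \<partial>lborel)"
      by (intro nn_integral_cong) (simp add: mult_exp_exp algebra_simps flip: ennreal_mult)
    also have "\<dots> = ennreal (t powr (\<gamma> / 2 - 1)) * ennreal (sqrt (pi / (t + 1)) ^ CARD('n))"
      using nn_integral_gauss[of "t + 1", where 'n='n] t by (subst nn_integral_cmult) auto
    finally show "(\<integral>\<^sup>+(x::real^'n). ennreal (t powr (\<gamma> / 2 - 1) * exp (- (t * (norm x)\<^sup>2)) * exp (- (norm x)\<^sup>2)) \<partial>lborel)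
       = ennreal (t powr (\<gamma> / 2 - 1) * sqrt (pi / (t + 1)) ^ CARD('n))"
      using t by (simp flip: ennreal_mult)
  qed
  also have "\<dots> < \<infinity>"
  proof (rule nn_integral_halfline_powr[where a="\<gamma> / 2 - 1" and b="\<gamma> / 2 - 1 - ?n / 2" and C="sqrt pi ^ CARD('n)"])
    fix t :: real
    show "t powr (\<gamma> / 2 - 1) * sqrt (pi / (t + 1)) ^ CARD('n) \<le> sqrt pi ^ CARD('n) * t powr (\<gamma> / 2 - 1)" if "0 < t" "t \<le> 1"
    proof -
      have "sqrt (pi / (t + 1)) ^ CARD('n) \<le> sqrt pi ^ CARD('n)"
        using that by (intro power_mono real_sqrt_le_mono) (auto simp: divide_le_eq)
      then show ?thesis by (simp add: mult.commute mult_right_mono)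
    qed
    show "t powr (\<gamma> / 2 - 1) * sqrt (pi / (t + 1)) ^ CARD('n) \<le> sqrt pi ^ CARD('n) * t powr (\<gamma> / 2 - 1 - ?n / 2)" if t: "1 \<le> t"
    proof -
      have "sqrt (pi / (t + 1)) ^ CARD('n) \<le> sqrt (pi / t) ^ CARD('n)"
        using t by (intro power_mono real_sqrt_le_mono divide_left_mono) auto
      also have "\<dots> = sqrt pi ^ CARD('n) * t powr (- (?n / 2))"
        using t by (simp add: real_sqrt_divide power_divide powr_minus powr_half_sqrt[symmetric] powr_power field_simps)
      finally have "t powr (\<gamma> / 2 - 1) * sqrt (pi / (t + 1)) ^ CARD('n) \<le> t powr (\<gamma> / 2 - 1) * (sqrt pi ^ CARD('n) * t powr (- (?n / 2)))"
        by (rule mult_left_mono) simp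
      also have "\<dots> = sqrt pi ^ CARD('n) * (t powr (\<gamma> / 2 - 1) * t powr (- (?n / 2)))" by simp
      also have "t powr (\<gamma> / 2 - 1) * t powr (- (?n / 2)) = t powr (\<gamma> / 2 - 1 - ?n / 2)"
        by (simp flip: powr_add)
      finally show ?thesis .
    qed
  qed (use assms in auto)
  finally show ?thesis using G by (auto simp: ennreal_mult_less_top)
qed

lemma singular_integrable:
  fixes h :: "real^'n::finite \<Rightarrow> real"
  assumes \<gamma>: "0 < \<gamma>" "\<gamma> < real CARD('n)" and h: "integrable lborel h" "\<And>x. 0 \<le> h x" "\<And>x. h x \<le> B"
  shows "integrable lborel (\<lambda>x. norm x powr (- \<gamma>) * h x)"
proof (rule Bochner_Integration.integrable_bound)
  have B: "0 \<le> B" using h(2,3)[of 0] by linarith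
  have q: "integrable lborel (\<lambda>x::real^'n. norm x powr (- \<gamma>) * exp (- (norm x)\<^sup>2))"
    by (rule integrableI_nonneg) (use nn_integral_singular_gauss[OF \<gamma>] in auto)
  show "integrable lborel (\<lambda>x. h x + (exp 1 * B) * (norm x powr (- \<gamma>) * exp (- (norm x)\<^sup>2)))"
    by (intro Bochner_Integration.integrable_add h(1) integrable_mult_right q)
  have [measurable]: "h \<in> borel_measurable borel" using h(1) by auto
  show "(\<lambda>x. norm x powr (- \<gamma>) * h x) \<in> borel_measurable lborel" by measurable
  show "AE x in lborel. norm (norm x powr (- \<gamma>) * h x) \<le> norm (h x + exp 1 * B * (norm x powr (- \<gamma>) * exp (- (norm x)\<^sup>2)))"
  proof (rule AE_I2)
    fix x :: "real^'n"
    let ?r = "exp 1 * B * (norm x powr (- \<gamma>) * exp (- (norm x)\<^sup>2))"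
    have r0: "?r \<ge> 0" using B by simp
    have "norm x powr (- \<gamma>) * h x \<le> h x + ?r"
    proof (cases "norm x \<ge> 1")
      case True
      have "norm x powr (- \<gamma>) \<le> norm x powr 0" using True \<gamma> by (intro powr_mono) auto
      also have "\<dots> = 1" using True by (simp add: powr_def) auto
      finally have "norm x powr (- \<gamma>) * h x \<le> 1 * h x" by (intro mult_right_mono h(2))
      then show ?thesis using r0 by linarith
    next
      case False
      then have "(norm x)\<^sup>2 \<le> 1" by (simp add: abs_square_le_1)
      then have "1 \<le> exp 1 * exp (- (norm x)\<^sup>2)" by (simp add: mult_exp_exp)
      then have "h x * 1 \<le> B * (exp 1 * exp (- (norm x)\<^sup>2))" using h(2,3) B by (intro mult_mono) auto
      then have "norm x powr (- \<gamma>) * h x \<le> norm x powr (- \<gamma>) * (B * (exp 1 * exp (- (norm x)\<^sup>2)))" by (intro mult_left_mono) auto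
      also have "\<dots> = ?r" by simp
      finally show ?thesis using h(2)[of x] by linarith
    qed
    then show "norm (norm x powr (- \<gamma>) * h x) \<le> norm (h x + ?r)"
      using h(2)[of x] r0 by (simp add: abs_mult)
  qed
qed

lemma powr_exp_bound:
  fixes b :: real
  assumes b: "b \<ge> 0"
  obtains C where "C > 0" "\<And>y. y \<ge> 0 \<Longrightarrow> y powr b * exp (- (y / 2)) \<le> C"
proof (rule that)
  define m where "m = nat \<lceil>b\<rceil>"
  have m: "b \<le> real m" using b by (simp add: m_def)
  show "1 + 2 ^ m * fact m > (0::real)" by (simp add: add_pos_nonneg)
  fix y :: real assume y: "y \<ge> 0"
  have "(y / 2) ^ m / fact m \<le> exp (y / 2)" using y by (intro exp_ge_power_div_fact) auto
  then have "y ^ m \<le> 2 ^ m * fact m * exp (y / 2)" by (simp add: field_simps)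
  then have "y ^ m * exp (- (y / 2)) \<le> 2 ^ m * fact m * exp (y / 2) * exp (- (y / 2))" by (rule mult_right_mono) simp
  then have ym: "y ^ m * exp (- (y / 2)) \<le> 2 ^ m * fact m" by (simp only: mult.assoc exp_minus_inverse mult_1_right)
  have e1: "exp (- (y / 2)) \<le> 1" using y by simp
  have pos: "2 ^ m * fact m \<ge> (0::real)" "y ^ m * exp (- (y / 2)) \<ge> 0" using y by auto
  show "y powr b * exp (- (y / 2)) \<le> 1 + 2 ^ m * fact m"
  proof (cases "y \<le> 1")
    case True
    then have "y powr b \<le> 1" using y b by (simp add: powr_le1)
    then have "y powr b * exp (- (y / 2)) \<le> 1 * 1" using e1 by (intro mult_mono) auto
    then show ?thesis using pos by linarith
  next
    case False
    then have "y powr b \<le> y powr real m" using m by (intro powr_mono) auto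
    also have "\<dots> = y ^ m" using False by (simp add: powr_realpow)
    finally have "y powr b * exp (- (y / 2)) \<le> y ^ m * exp (- (y / 2))" by (intro mult_right_mono) auto
    then show ?thesis using ym by linarith
  qed
qed

text \<open>
  Up to the factor \<open>(2\<pi>)\<^sup>n\<close>, the solution at time \<open>t\<close> of the heat equation whose initial value is the
  inverse Fourier transform of \<open>u\<close>. The transform \<open>u\<close> is the argument, since it is a function.
\<close>

definition heat :: "'n::finite cfun \<Rightarrow> real \<Rightarrow> real ^ 'n \<Rightarrow> complex"
  where "heat u t x = (LINT \<xi>|lborel. u \<xi> * (gauss t \<xi> * exp (\<i> * complex_of_real (x \<bullet> \<xi>))))"

abbreviation normsq :: "'n::finite cfun"
  where "normsq \<equiv> (\<lambda>\<xi>. complex_of_real ((norm \<xi>)\<^sup>2))"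

lemma schwartz_wave: "t > 0 \<Longrightarrow> (\<lambda>\<xi>. gauss t \<xi> * exp (\<i> * complex_of_real (x \<bullet> \<xi>))) \<in> schwartz"
  using schwartz_mult[OF slow_growth_character schwartz_gauss, of t x] by (simp add: mult.commute inner_commute)

lemma gauss_measurable [measurable]: "gauss t \<in> borel_measurable borel"
  unfolding gauss_def by measurable

lemma heat_integrable:
  assumes "moderate u" "t > 0"
  shows "integrable lborel (\<lambda>\<xi>. u \<xi> * (gauss t \<xi> * exp (\<i> * complex_of_real (x \<bullet> \<xi>))))"
  by (rule tame_schwartz_integrable[OF moderate_tame[OF assms(1)] schwartz_wave[OF assms(2)]])

lemma norm_gauss: "norm (gauss t \<xi>) = exp (- (t * (norm \<xi>)\<^sup>2))"
  by (simp add: gauss_def)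

lemma abs_gauss_integrable:
  assumes "moderate u" "t > 0"
  shows "integrable lborel (\<lambda>\<xi>. norm (u \<xi>) * exp (- (t * (norm \<xi>)\<^sup>2)))"
  using integrable_norm[OF heat_integrable[OF assms, of 0]] by (simp add: norm_mult norm_gauss)

lemma norm_heat_le:
  "norm (heat u t x) \<le> (LINT \<xi>|lborel. norm (u \<xi>) * exp (- (t * (norm \<xi>)\<^sup>2)))"
  unfolding heat_def by (rule order_trans[OF integral_norm_bound]) (simp add: norm_mult norm_gauss)

text \<open>
  The factor \<open>|\<xi>|\<^sup>2\<^sup>k exp (- t |\<xi>|\<^sup>2 / 2)\<close> is at most a multiple of
  \<open>t\<^bsup>-k-\<gamma>/2\<^esup> |\<xi>|\<^bsup>-\<gamma>\<^esup>\<close>, and the singularity \<open>|\<xi>|\<^bsup>-\<gamma>\<^esup>\<close> is integrable at the origin for \<open>\<gamma> < n\<close>. The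
  rate \<open>t\<^bsup>-\<gamma>/2\<^esup>\<close> for all \<open>\<gamma> < n\<close> is what makes negative values of \<open>s\<close> accessible.
\<close>

lemma heat_decay_large_time:
  fixes u :: "'n::finite cfun"
  assumes u: "moderate u" and \<gamma>: "0 < \<gamma>" "\<gamma> < real CARD('n)"
  obtains C where "C > 0"
    "\<And>t. t \<ge> 1 \<Longrightarrow> (LINT \<xi>|lborel. norm (normsq \<xi> ^ k * u \<xi>) * exp (- (t * (norm \<xi>)\<^sup>2))) \<le> C * t powr (- (real k + \<gamma> / 2))"
proof -
  define b where "b = real k + \<gamma> / 2"
  have b: "b \<ge> 0" using \<gamma> by (simp add: b_def)
  obtain D where D: "D > 0" "\<And>y. y \<ge> 0 \<Longrightarrow> y powr b * exp (- (y / 2)) \<le> D"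
    using powr_exp_bound[OF b] by blast
  define h where "h = (\<lambda>\<xi>. norm (u \<xi>) * exp (- (1 / 2 * (norm \<xi>)\<^sup>2)))"
  have hi: "integrable lborel h" unfolding h_def by (rule abs_gauss_integrable[OF u]) simp
  obtain B where B: "B > 0" "\<And>\<xi>. norm (u \<xi> * gauss (1 / 2) \<xi>) \<le> B"
    using bounded_moderate_mult_schwartz[OF u schwartz_gauss[of "1 / 2"]] by auto
  have hB: "h \<xi> \<le> B" for \<xi> using B(2)[of \<xi>] unfolding h_def norm_mult norm_gauss .
  have h0: "0 \<le> h \<xi>" for \<xi> by (simp add: h_def)
  have I: "integrable lborel (\<lambda>\<xi>. norm \<xi> powr (- \<gamma>) * h \<xi>)"
    by (rule singular_integrable[OF \<gamma> hi h0 hB])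
  define Q where "Q = (LINT \<xi>|lborel. norm \<xi> powr (- \<gamma>) * h \<xi>)"
  have Q0: "Q \<ge> 0" unfolding Q_def using h0 by (intro integral_nonneg_AE AE_I2 mult_nonneg_nonneg) auto
  show thesis
  proof (rule that[of "D * Q + 1"])
    show "D * Q + 1 > 0" using D(1) Q0 by (simp add: add_nonneg_pos)
    fix t :: real assume t: "t \<ge> 1"
    have "(LINT \<xi>|lborel. norm (normsq \<xi> ^ k * u \<xi>) * exp (- (t * (norm \<xi>)\<^sup>2))) \<le> (LINT \<xi>|lborel. (D * t powr (- b)) * (norm \<xi> powr (- \<gamma>) * h \<xi>))"
    proof (rule integral_mono_AE)
      show "integrable lborel (\<lambda>\<xi>. norm (normsq \<xi> ^ k * u \<xi>) * exp (- (t * (norm \<xi>)\<^sup>2)))"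
        using t by (intro abs_gauss_integrable moderate_mult slow_growth_power slow_growth_norm_sq u) auto
      show "integrable lborel (\<lambda>\<xi>. (D * t powr (- b)) * (norm \<xi> powr (- \<gamma>) * h \<xi>))" using I by (rule integrable_mult_right)
      show "AE \<xi> in lborel. norm (normsq \<xi> ^ k * u \<xi>) * exp (- (t * (norm \<xi>)\<^sup>2)) \<le> (D * t powr (- b)) * (norm \<xi> powr (- \<gamma>) * h \<xi>)"
        using AE_lborel_singleton[of "0 :: real^'n"]
      proof eventually_elim
        case (elim \<xi>)
        define N where "N = (norm \<xi>)\<^sup>2"
        have N: "N > 0" using elim by (simp add: N_def)
        have 1: "N powr (- (\<gamma> / 2)) = norm \<xi> powr (- \<gamma>)" using elim by (simp add: N_def norm_sq_powr)
        have "(t * N) powr b * exp (- (t * N / 2)) \<le> D" using t N by (intro D(2)) auto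
        then have e1: "t powr (- b) * N powr (- (\<gamma> / 2)) * ((t * N) powr b * exp (- (t * N / 2))) \<le> t powr (- b) * N powr (- (\<gamma> / 2)) * D"
          by (rule mult_left_mono) simp
        have e2: "t powr (- b) * N powr (- (\<gamma> / 2)) * ((t * N) powr b * exp (- (t * N / 2))) = N ^ k * exp (- (t * N / 2))"
        proof -
          have "t powr (- b) * N powr (- (\<gamma> / 2)) * (t * N) powr b = (t powr (- b) * t powr b) * (N powr (- (\<gamma> / 2)) * N powr b)"
            using t N by (simp add: powr_mult)
          also have "\<dots> = N powr (real k)"
            using t N by (simp add: b_def flip: powr_add)
          also have "\<dots> = N ^ k" using N by (simp add: powr_realpow)
          finally show ?thesis by (simp add: mult.assoc)
        qed
        have 2: "N ^ k * exp (- (t * N / 2)) \<le> D * t powr (- b) * norm \<xi> powr (- \<gamma>)"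
          using e1 unfolding e2 unfolding 1 by (simp only: mult_ac)
        have 3: "exp (- (t * N)) \<le> exp (- (t * N / 2)) * exp (- (1 / 2 * N))"
          using t N by (simp add: mult_exp_exp field_simps)
        have "norm (normsq \<xi> ^ k * u \<xi>) * exp (- (t * (norm \<xi>)\<^sup>2)) = N ^ k * norm (u \<xi>) * exp (- (t * N))"
          by (simp add: N_def norm_mult norm_power)
        also have "\<dots> \<le> N ^ k * norm (u \<xi>) * (exp (- (t * N / 2)) * exp (- (1 / 2 * N)))"
          using N 3 by (intro mult_left_mono) auto
        also have "\<dots> = (N ^ k * exp (- (t * N / 2))) * h \<xi>" by (simp add: h_def N_def)
        also have "\<dots> \<le> (D * t powr (- b) * norm \<xi> powr (- \<gamma>)) * h \<xi>" by (rule mult_right_mono[OF 2 h0])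
        finally show ?case by (simp add: mult.assoc)
      qed
    qed
    also have "\<dots> = (D * t powr (- b)) * Q" unfolding Q_def by (rule integral_mult_right_zero)
    also have "\<dots> \<le> (D * Q + 1) * t powr (- b)" by (simp add: algebra_simps)
    finally show "(LINT \<xi>|lborel. norm (normsq \<xi> ^ k * u \<xi>) * exp (- (t * (norm \<xi>)\<^sup>2))) \<le> (D * Q + 1) * t powr (- (real k + \<gamma> / 2))"
      by (simp add: b_def)
  qed
qed

text \<open>
  A power of \<open>jap\<close> is absorbed by the Gaussian at the cost of the same power of \<open>1 / t\<close>.
\<close>

lemma heat_growth_small_time:
  fixes u :: "'n::finite cfun"
  assumes u: "moderate u"
  obtains C L where "C > 0" "\<And>t. 0 < t \<Longrightarrow> t \<le> 1 \<Longrightarrow> (LINT \<xi>|lborel. norm (u \<xi>) * exp (- (t * (norm \<xi>)\<^sup>2))) \<le> C * (1 / t) ^ L"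
proof -
  obtain C M where C: "C > 0" "\<And>\<xi>. norm (u \<xi>) \<le> C * jap \<xi> ^ M" using moderate_bound[OF u] by blast
  let ?n = "CARD('n)"
  define L where "L = M + ?n"
  define D where "D = C * fact L * exp 1"
  define Q where "Q = (LINT \<xi>|lborel. 1 / jap (\<xi>::real^'n) ^ ?n)"
  have D: "D > 0" using C by (simp add: D_def)
  have Q: "Q \<ge> 0" unfolding Q_def by (intro integral_nonneg_AE) auto
  show thesis
  proof (rule that[of "D * Q + 1" L])
    show "D * Q + 1 > 0" using D Q by (simp add: add_nonneg_pos)
    fix t :: real assume t: "0 < t" "t \<le> 1"
    have "(LINT \<xi>|lborel. norm (u \<xi>) * exp (- (t * (norm \<xi>)\<^sup>2))) \<le> (LINT \<xi>|lborel. (D * (1 / t) ^ L) * (1 / jap (\<xi>::real^'n) ^ ?n))"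
    proof (rule Bochner_Integration.integral_mono)
      show "integrable lborel (\<lambda>\<xi>. norm (u \<xi>) * exp (- (t * (norm \<xi>)\<^sup>2)))" by (rule abs_gauss_integrable[OF u t(1)])
      show "integrable lborel (\<lambda>\<xi>::real^'n. (D * (1 / t) ^ L) * (1 / jap \<xi> ^ ?n))" by (intro integrable_mult_right integrable_jap_power)
      fix \<xi> :: "real^'n"
      have "(t * jap \<xi>) ^ L / fact L \<le> exp (t * jap \<xi>)" using t by (intro exp_ge_power_div_fact) auto
      then have 1: "jap \<xi> ^ L \<le> fact L * (1 / t) ^ L * exp (t * jap \<xi>)"
        using t by (simp add: field_simps power_mult_distrib)
      have 2: "exp (t * jap \<xi>) * exp (- (t * (norm \<xi>)\<^sup>2)) \<le> exp 1"
        using t by (simp add: mult_exp_exp jap_def algebra_simps)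
      have "jap \<xi> ^ L * exp (- (t * (norm \<xi>)\<^sup>2)) \<le> fact L * (1 / t) ^ L * exp (t * jap \<xi>) * exp (- (t * (norm \<xi>)\<^sup>2))"
        by (rule mult_right_mono[OF 1]) simp
      also have "\<dots> = fact L * (1 / t) ^ L * (exp (t * jap \<xi>) * exp (- (t * (norm \<xi>)\<^sup>2)))" by (simp only: mult.assoc)
      also have "\<dots> \<le> fact L * (1 / t) ^ L * exp 1" using t by (intro mult_left_mono[OF 2]) auto
      finally have 3: "jap \<xi> ^ L * exp (- (t * (norm \<xi>)\<^sup>2)) \<le> fact L * (1 / t) ^ L * exp 1" .
      have "norm (u \<xi>) * exp (- (t * (norm \<xi>)\<^sup>2)) \<le> (C * jap \<xi> ^ M) * exp (- (t * (norm \<xi>)\<^sup>2))"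
        by (rule mult_right_mono[OF C(2)]) simp
      also have "\<dots> = C * (jap \<xi> ^ L * exp (- (t * (norm \<xi>)\<^sup>2))) * (1 / jap \<xi> ^ ?n)"
        by (simp add: L_def power_add)
      also have "\<dots> \<le> C * (fact L * (1 / t) ^ L * exp 1) * (1 / jap \<xi> ^ ?n)"
        using C by (intro mult_right_mono mult_left_mono[OF 3]) auto
      finally show "norm (u \<xi>) * exp (- (t * (norm \<xi>)\<^sup>2)) \<le> (D * (1 / t) ^ L) * (1 / jap \<xi> ^ ?n)"
        by (simp add: D_def mult_ac)
    qed
    also have "\<dots> = (D * (1 / t) ^ L) * Q" unfolding Q_def by (rule integral_mult_right_zero)
    also have "\<dots> \<le> (D * Q + 1) * (1 / t) ^ L" using t by (simp add: distrib_right mult_ac)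
    finally show "(LINT \<xi>|lborel. norm (u \<xi>) * exp (- (t * (norm \<xi>)\<^sup>2))) \<le> (D * Q + 1) * (1 / t) ^ L" .
  qed
qed

section \<open>Smallness of the heat flow near an open zero set\<close>

text \<open>
  At distance at least \<open>r\<close> the Gaussian kernel is bounded by a Gaussian independent of \<open>t\<close> times
  \<open>exp (- r\<^sup>2 / (8 t))\<close>. One half of the exponent \<open>r\<^sup>2 / (8 t)\<close> is kept as the weight of the family,
  and the other half absorbs the negative powers of \<open>t\<close> that are produced by differentiation. These
  powers are the coefficients \<open>c p\<close> in the class used for coinduction.
\<close>

lemma heat_kernel_family:
  fixes x0 :: "real ^ 'n::finite"
  assumes r: "r > 0" and \<kappa>: "slow_growth \<kappa>" "\<And>y. y \<in> ball x0 (2 * r) \<Longrightarrow> \<kappa> y = 0"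
  shows "schwartz_family ({0<..1} \<times> ball x0 r) (\<lambda>p. exp (- (r\<^sup>2 / (16 * fst p))))
    (\<lambda>p y. complex_of_real (sqrt (pi / fst p) ^ CARD('n)) * (\<kappa> y * gauss (1 / (4 * fst p)) (y - snd p)))"
proof -
  let ?I = "{0<..1::real} \<times> ball x0 r"
  let ?w = "\<lambda>p::real \<times> (real^'n). exp (- (r\<^sup>2 / (16 * fst p)))"
  let ?G = "\<lambda>(p::real \<times> (real^'n)) y. gauss (1 / (4 * fst p)) (y - snd p)"
  let ?t = "\<lambda>(c :: real \<times> (real^'n) \<Rightarrow> complex) (\<kappa>::'n cfun) p y. c p * (\<kappa> y * ?G p y)"
  let ?c = "\<lambda>c :: real \<times> (real^'n) \<Rightarrow> complex. \<exists>C j. \<forall>p\<in>?I. norm (c p) \<le> C * (1 / fst p) ^ j"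
  let ?k = "\<lambda>\<kappa>::'n cfun. slow_growth \<kappa> \<and> (\<forall>y\<in>ball x0 (2 * r). \<kappa> y = 0)"
  (* Gaussians times a multiplier that vanishes near the centres, with coefficients bounded by negative powers of t *)
  let ?T = "{?t c \<kappa> | c \<kappa>. ?c c \<and> ?k \<kappa>}"
  have mem: "?t c \<kappa> \<in> ?T" if "?c c" "?k \<kappa>" for c \<kappa> using that by blast
  have D: "((\<lambda>y. gauss t (y - a)) has_derivative (\<lambda>v. (2 * ((y - a) \<bullet> v)) *\<^sub>R complex_of_real (- t * exp (- (t * (norm (y - a))\<^sup>2))))) (at y)" for t and a y :: "real^'n"
    using has_derivative_radial[where h="\<lambda>s. complex_of_real (exp (- (t * s)))" and a=a and x=y, OF has_vector_derivative_exp_lin]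
    by (simp only: gauss_def)
  have pG: "partial i (\<lambda>y. gauss t (y - a)) y = - (2 * complex_of_real t) * ((complex_of_real (y $ i) - complex_of_real (a $ i)) * gauss t (y - a))" for i t and a y :: "real^'n"
    using partial_radial[where h="\<lambda>s. complex_of_real (exp (- (t * s)))" and a=a and x=y and i=i, OF has_vector_derivative_exp_lin]
    by (simp add: gauss_def)
  have dG: "?G p differentiable (at y)" for p y by (rule differentiableI[OF D])
  show ?thesis
  proof (rule schwartz_family_coinduct[where T="?T"])
    show "0 \<le> ?w p" for p by simp
    show "?t (\<lambda>p. complex_of_real (sqrt (pi / fst p) ^ CARD('n))) \<kappa> \<in> ?T"
    proof (rule mem)
      have "norm (complex_of_real (sqrt (pi / fst p) ^ CARD('n))) \<le> sqrt pi ^ CARD('n) * (1 / fst p) ^ CARD('n)" if "p \<in> ?I" for p :: "real \<times> (real^'n)"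
      proof -
        have t: "0 < fst p" "fst p \<le> 1" using that by auto
        then have "fst p \<le> sqrt (fst p)" by (intro real_le_rsqrt) (simp add: power2_eq_square mult_left_le)
        then have "1 / sqrt (fst p) \<le> 1 / fst p" using t by (intro divide_left_mono) auto
        then have "sqrt pi * (1 / sqrt (fst p)) \<le> sqrt pi * (1 / fst p)" by (intro mult_left_mono) auto
        then have "sqrt (pi / fst p) \<le> sqrt pi * (1 / fst p)" by (simp add: real_sqrt_divide)
        then have "sqrt (pi / fst p) ^ CARD('n) \<le> (sqrt pi * (1 / fst p)) ^ CARD('n)" using t by (intro power_mono) auto
        then show ?thesis using t unfolding norm_of_real power_mult_distrib[symmetric] by simp
      qed
      then show "?c (\<lambda>p. complex_of_real (sqrt (pi / fst p) ^ CARD('n)))" by blast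
    qed (use \<kappa> in blast)
  next
    fix \<Xi> i assume "\<Xi> \<in> ?T"
    then obtain c \<kappa> where *: "\<Xi> = ?t c \<kappa>" "?c c" "slow_growth \<kappa>" "\<forall>y\<in>ball x0 (2 * r). \<kappa> y = 0" by blast
    show "\<Xi> p differentiable (at y)" for p y
      unfolding *(1) by (intro differentiable_mult differentiable_const dG slow_growth_differentiable *(3))
    have pk: "partial i \<kappa> y = 0" if "y \<in> ball x0 (2 * r)" for y
    proof -
      have "partial i \<kappa> y = partial i (\<lambda>_. 0) y"
        by (rule partial_cong_open[of "ball x0 (2 * r)"]) (use *(4) that in auto)
      then show ?thesis by simp
    qed
    obtain C j where C: "\<And>p. p \<in> ?I \<Longrightarrow> norm (c p) \<le> C * (1 / fst p) ^ j" using *(2) by blast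
    have A: "?t c (partial i \<kappa>) \<in> ?T" using pk slow_growth_partial[OF *(3)] *(2) by (intro mem) auto
    have "norm (- c p / (2 * of_real (fst p))) \<le> (C / 2) * (1 / fst p) ^ (j + 1)" if "p \<in> ?I" for p
    proof -
      have t: "0 < fst p" using that by auto
      have "norm (c p) * (1 / (2 * fst p)) \<le> (C * (1 / fst p) ^ j) * (1 / (2 * fst p))"
        using t by (intro mult_right_mono C that) auto
      then show ?thesis using t by (simp add: norm_divide norm_mult field_simps)
    qed
    (* the derivative of the kernel is split into y / (2 t) and x / (2 t) to separate multiplier and coefficient *)
    then have c2: "?c (\<lambda>p. - c p / (2 * of_real (fst p)))" by blast
    have B: "?t (\<lambda>p. - c p / (2 * of_real (fst p))) (\<lambda>y. complex_of_real (y $ i) * \<kappa> y) \<in> ?T"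
      using *(3,4) by (intro mem c2 conjI slow_growth_mult slow_growth_coord) auto
    have "norm (c p * of_real (snd p $ i) / (2 * of_real (fst p))) \<le> (\<bar>C\<bar> * (norm x0 + r) / 2) * (1 / fst p) ^ (j + 1)" if "p \<in> ?I" for p
    proof -
      have t: "0 < fst p" and x: "dist x0 (snd p) < r" using that by auto
      have "\<bar>snd p $ i\<bar> \<le> norm (snd p)" by (rule component_le_norm_cart)
      also have "\<dots> \<le> norm x0 + r" using x norm_triangle_ineq2[of "snd p" x0] by (simp add: dist_norm norm_minus_commute)
      finally have "norm (c p) * \<bar>snd p $ i\<bar> \<le> (\<bar>C\<bar> * (1 / fst p) ^ j) * (norm x0 + r)"
        using C[OF that] t by (intro mult_mono) (auto intro: order_trans[OF _ mult_right_mono])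
      then have "norm (c p) * \<bar>snd p $ i\<bar> * (1 / (2 * fst p)) \<le> (\<bar>C\<bar> * (1 / fst p) ^ j) * (norm x0 + r) * (1 / (2 * fst p))"
        using t by (intro mult_right_mono) auto
      then show ?thesis using t by (simp add: norm_divide norm_mult field_simps)
    qed
    then have c3: "?c (\<lambda>p. c p * of_real (snd p $ i) / (2 * of_real (fst p)))" by blast
    have E: "?t (\<lambda>p. c p * of_real (snd p $ i) / (2 * of_real (fst p))) \<kappa> \<in> ?T"
      using *(3,4) by (intro mem c3) auto
    have "partial i (\<Xi> p) y = ?t c (partial i \<kappa>) p y + (?t (\<lambda>p. - c p / (2 * of_real (fst p))) (\<lambda>y. complex_of_real (y $ i) * \<kappa> y) p y
        + ?t (\<lambda>p. c p * of_real (snd p $ i) / (2 * of_real (fst p))) \<kappa> p y)" if "p \<in> ?I" for p y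
    proof -
      have "partial i (\<Xi> p) y = c p * partial i (\<lambda>y. \<kappa> y * ?G p y) y"
        unfolding *(1) by (intro partial_cmult differentiable_mult dG slow_growth_differentiable *(3))
      also have "\<dots> = c p * (partial i \<kappa> y * ?G p y + \<kappa> y * (- (2 * complex_of_real (1 / (4 * fst p))) * ((complex_of_real (y $ i) - complex_of_real (snd p $ i)) * ?G p y)))"
        unfolding partial_mult[OF slow_growth_differentiable[OF *(3)] dG] pG ..
      also have "2 * complex_of_real (1 / (4 * fst p)) = 1 / (2 * of_real (fst p))" by simp
      finally show ?thesis by (simp add: algebra_simps add_divide_distrib diff_divide_distrib)
    qed
    then show "\<exists>L. set L \<subseteq> ?T \<and> (\<forall>p\<in>?I. \<forall>x. partial i (\<Xi> p) x = (\<Sum>\<Psi>\<leftarrow>L. \<Psi> p x))"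
      using A B E
      by (intro exI[of _ "[?t c (partial i \<kappa>), ?t (\<lambda>p. - c p / (2 * of_real (fst p))) (\<lambda>y. complex_of_real (y $ i) * \<kappa> y), ?t (\<lambda>p. c p * of_real (snd p $ i) / (2 * of_real (fst p))) \<kappa>]"])
         (simp del: mem_Collect_eq)
  next
    fix \<Xi> N assume "\<Xi> \<in> ?T"
    then obtain c \<kappa> where *: "\<Xi> = ?t c \<kappa>" "?c c" "slow_growth \<kappa>" "\<forall>y\<in>ball x0 (2 * r). \<kappa> y = 0" by blast
    obtain C0 j where C0: "\<And>p. p \<in> ?I \<Longrightarrow> norm (c p) \<le> C0 * (1 / fst p) ^ j" using *(2) by blast
    define C where "C = \<bar>C0\<bar>"
    have C: "norm (c p) \<le> C * (1 / fst p) ^ j" "C \<ge> 0" if "p \<in> ?I" for p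
      using C0[OF that] that by (auto simp: C_def intro: order_trans[OF _ mult_right_mono])
    obtain E M where E: "E > 0" "\<And>x. norm (\<kappa> x) \<le> E * jap x ^ M" using slow_growth_bound[OF *(3)] by blast
    obtain F where F: "F > 0" "\<And>x::real^'n. jap x ^ (N + M) * exp (- (1 / 8 * (norm x)\<^sup>2)) \<le> F"
      using jap_power_gauss_bound[of "1 / 8"] by auto
    define J where "J = 1 + (norm x0 + r)\<^sup>2"
    define H where "H = fact j * (16 / r\<^sup>2) ^ j"
    have H0: "H \<ge> 0" by (simp add: H_def)
    define S where "S = C * E * (2 * J) ^ (N + M) * F * H"
    show "\<exists>C. \<forall>p\<in>?I. \<forall>x. jap x ^ N * norm (\<Xi> p x) \<le> C * ?w p"
    proof (intro exI ballI allI)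
      fix p :: "real \<times> (real^'n)" and y :: "real^'n" assume p: "p \<in> ?I"
      define t x where "t = fst p" and "x = snd p"
      have t: "0 < t" "t \<le> 1" and x: "dist x0 x < r" using p by (auto simp: t_def x_def)
      have J0: "J \<ge> 0" by (simp add: J_def)
      have S0: "S \<ge> 0" using C(2)[OF p] E F J0 H0 by (simp add: S_def)
      show "jap y ^ N * norm (\<Xi> p y) \<le> S * ?w p"
      proof (cases "y \<in> ball x0 (2 * r)")
        case True
        then show ?thesis using *(4) S0 by (simp add: *(1))
      next
        case False
        define d where "d = norm (y - x)"
        have "r \<le> d" using False x dist_triangle[of x0 y x] by (simp add: d_def dist_norm norm_minus_commute)
        then have dr: "r\<^sup>2 \<le> d\<^sup>2" using r by (intro power_mono) auto
        have "norm x \<le> norm x0 + r" using x norm_triangle_ineq2[of x x0] by (simp add: dist_norm norm_minus_commute)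
        then have "jap (- x) \<le> J" unfolding jap_def J_def by (intro add_left_mono power_mono) auto
        then have jm: "2 * jap (y + - x) * jap (- x) \<le> 2 * jap (y + - x) * J" by (intro mult_left_mono) auto
        have "jap y \<le> 2 * jap (y - x) * J" using order_trans[OF peetre[of y "- x"] jm] by simp
        then have jy: "jap y ^ (N + M) \<le> (2 * J) ^ (N + M) * jap (y - x) ^ (N + M)"
          using power_mono[of "jap y" "2 * jap (y - x) * J" "N + M"] by (simp add: power_mult_distrib mult_ac)
        have g1: "exp (- (1 / (4 * t) * d\<^sup>2)) \<le> exp (- (1 / 8 * d\<^sup>2)) * (exp (- (r\<^sup>2 / (16 * t))) * exp (- (r\<^sup>2 / (16 * t))))"
        proof -
          have "1 / 8 * d\<^sup>2 \<le> 1 / (8 * t) * d\<^sup>2" using t by (intro mult_right_mono) (auto simp: field_simps)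
          moreover have "r\<^sup>2 / (8 * t) \<le> d\<^sup>2 / (8 * t)" using t dr by (intro divide_right_mono) auto
          moreover have "1 / (4 * t) * d\<^sup>2 = 1 / (8 * t) * d\<^sup>2 + d\<^sup>2 / (8 * t)" using t by (simp add: field_simps)
          moreover have "r\<^sup>2 / (16 * t) + r\<^sup>2 / (16 * t) = r\<^sup>2 / (8 * t)" using t by (simp add: field_simps)
          ultimately show ?thesis by (simp add: mult_exp_exp)
        qed
        have g2: "(1 / t) ^ j * exp (- (r\<^sup>2 / (16 * t))) \<le> H"
        proof -
          have "(r\<^sup>2 / (16 * t)) ^ j / fact j \<le> exp (r\<^sup>2 / (16 * t))" using t by (intro exp_ge_power_div_fact) auto
          then have "(1 / t) ^ j \<le> H * exp (r\<^sup>2 / (16 * t))"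
            using t r by (simp add: H_def field_simps power_mult_distrib power_divide)
          then have "(1 / t) ^ j * exp (- (r\<^sup>2 / (16 * t))) \<le> H * exp (r\<^sup>2 / (16 * t)) * exp (- (r\<^sup>2 / (16 * t)))"
            by (rule mult_right_mono) simp
          then show ?thesis by (simp only: mult.assoc exp_minus_inverse mult_1_right)
        qed
        have "jap y ^ N * norm (\<Xi> p y) = jap y ^ N * (norm (c p) * (norm (\<kappa> y) * exp (- (1 / (4 * t) * d\<^sup>2))))"
          by (simp add: *(1) norm_mult norm_gauss t_def x_def d_def)
        also have "\<dots> \<le> jap y ^ N * ((C * (1 / t) ^ j) * ((E * jap y ^ M) * (exp (- (1 / 8 * d\<^sup>2)) * (exp (- (r\<^sup>2 / (16 * t))) * exp (- (r\<^sup>2 / (16 * t)))))))"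
          using C[OF p] E t by (intro mult_left_mono mult_mono g1) (auto simp: t_def)
        also have "\<dots> = (C * E) * (jap y ^ (N + M) * exp (- (1 / 8 * d\<^sup>2))) * ((1 / t) ^ j * exp (- (r\<^sup>2 / (16 * t)))) * exp (- (r\<^sup>2 / (16 * t)))"
          by (simp add: power_add)
        also have "\<dots> \<le> (C * E) * ((2 * J) ^ (N + M) * F) * H * exp (- (r\<^sup>2 / (16 * t)))"
        proof -
          have "jap y ^ (N + M) * exp (- (1 / 8 * d\<^sup>2)) \<le> (2 * J) ^ (N + M) * jap (y - x) ^ (N + M) * exp (- (1 / 8 * d\<^sup>2))"
            by (rule mult_right_mono[OF jy]) simp
          also have "\<dots> = (2 * J) ^ (N + M) * (jap (y - x) ^ (N + M) * exp (- (1 / 8 * (norm (y - x))\<^sup>2)))" by (simp add: d_def)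
          also have "\<dots> \<le> (2 * J) ^ (N + M) * F" using J0 by (intro mult_left_mono F) auto
          finally have X1: "(C * E) * (jap y ^ (N + M) * exp (- (1 / 8 * d\<^sup>2))) \<le> (C * E) * ((2 * J) ^ (N + M) * F)"
            using C(2)[OF p] E by (intro mult_left_mono) auto
          have "(C * E) * (jap y ^ (N + M) * exp (- (1 / 8 * d\<^sup>2))) * ((1 / t) ^ j * exp (- (r\<^sup>2 / (16 * t)))) \<le> (C * E) * ((2 * J) ^ (N + M) * F) * H"
            by (rule mult_mono[OF X1 g2]) (use C(2)[OF p] E F J0 t in auto)
          then show ?thesis by (rule mult_right_mono) simp
        qed
        also have "\<dots> = S * ?w p" by (simp add: S_def t_def)
        finally show ?thesis .
      qed
    qed
  qed
qed

text \<open>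
  The inverse Fourier transform of \<open>u\<close>, as a distribution, vanishes on \<open>U\<close>.
\<close>

definition spectrally_vanishes :: "(real ^ 'n::finite) set \<Rightarrow> 'n cfun \<Rightarrow> bool"
  where "spectrally_vanishes U u \<longleftrightarrow> (\<forall>\<phi>\<in>test_functions U. (LINT \<xi>|lborel. u \<xi> * inv_fourier \<phi> \<xi>) = 0)"

text \<open>
  The heat flow at \<open>x\<close> is the pairing of the initial value with a Gaussian centred at \<open>x\<close>. The part of
  this Gaussian in the zero set contributes nothing, and the remaining part is a Schwartz family of
  exponentially small weight.
\<close>

theorem heat_small_near_zero_set:
  fixes u :: "'n::finite cfun"
  assumes u: "moderate u" and r: "r > 0" and van: "spectrally_vanishes (ball x0 (4 * r)) u"
  obtains C where "C > 0" "\<And>t x. 0 < t \<Longrightarrow> t \<le> 1 \<Longrightarrow> x \<in> ball x0 r \<Longrightarrow> norm (heat u t x) \<le> C * exp (- (r\<^sup>2 / (16 * t)))"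
proof -
  obtain \<eta> :: "real^'n \<Rightarrow> real" where \<eta>: "slow_growth (\<lambda>x. complex_of_real (\<eta> x))"
    "\<And>x. dist x0 x \<le> 2 * r \<Longrightarrow> \<eta> x = 1" "\<And>x. dist x0 x \<ge> 3 * r \<Longrightarrow> \<eta> x = 0"
    by (rule plateau_exists[of "2 * r" "3 * r" x0]) (use r in auto)
  let ?n = "CARD('n)"
  (* this multiplier removes the part of the Gaussian inside the zero set *)
  define \<kappa> where "\<kappa> = (\<lambda>x. 1 - complex_of_real (\<eta> x))"
  have \<kappa>: "slow_growth \<kappa>" unfolding \<kappa>_def by (intro slow_growth_diff slow_growth_const \<eta>(1))
  let ?I = "{0<..1::real} \<times> ball x0 r"
  let ?\<psi> = "\<lambda>t x y. complex_of_real (sqrt (pi / t) ^ ?n) * gauss (1 / (4 * t)) (y - x)"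
  let ?\<Phi> = "\<lambda>p y. complex_of_real (sqrt (pi / fst p) ^ ?n) * (\<kappa> y * gauss (1 / (4 * fst p)) (y - snd p))"
  have fam: "schwartz_family ?I (\<lambda>p. exp (- (r\<^sup>2 / (16 * fst p)))) ?\<Phi>"
    by (rule heat_kernel_family[OF r \<kappa>]) (simp add: \<kappa>_def \<eta>(2))
  obtain C where C: "C > 0" "\<And>p. p \<in> ?I \<Longrightarrow> (LINT \<xi>|lborel. norm (u \<xi> * inv_fourier (?\<Phi> p) \<xi>)) \<le> C * exp (- (r\<^sup>2 / (16 * fst p)))"
    using tame_schwartz_family(2)[OF moderate_tame[OF u] schwartz_family_inv_fourier[OF fam]] by blast
  show thesis
  proof (rule that[OF C(1)])
    fix t :: real and x :: "real^'n" assume t: "0 < t" "t \<le> 1" and x: "x \<in> ball x0 r"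
    let ?W = "\<lambda>\<xi>. gauss t \<xi> * exp (\<i> * complex_of_real (x \<bullet> \<xi>))"
    have W: "?W \<in> schwartz" by (rule schwartz_wave[OF t(1)])
    have \<psi>: "fourier ?W = ?\<psi> t x"
      using fourier_modulation[of x "gauss t"] fourier_gauss[OF t(1), where 'n='n]
      by (intro ext) (simp add: mult.commute)
    have \<psi>S: "?\<psi> t x \<in> schwartz" using schwartz_fourier[OF W] unfolding \<psi> .
    let ?A = "\<lambda>y. complex_of_real (\<eta> y) * ?\<psi> t x y" and ?B = "\<lambda>y. ?\<Phi> (t, x) y"
    have AS: "?A \<in> schwartz" by (rule schwartz_mult[OF \<eta>(1) \<psi>S])
    have BS: "?B \<in> schwartz" using schwartz_family_single[OF fam, of "(t, x)"] t x by simp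
    have "?A \<in> test_functions (ball x0 (4 * r))"
      by (rule test_functionsI[OF schwartz_smooth[OF AS], where a=x0 and r="3 * r"]) (use \<eta>(3) r in auto)
    then have A0: "(LINT \<xi>|lborel. u \<xi> * inv_fourier ?A \<xi>) = 0"
      using van unfolding spectrally_vanishes_def by blast
    have split: "?\<psi> t x = (\<lambda>y. ?A y + ?B y)" by (simp add: \<kappa>_def algebra_simps)
    have "heat u t x = (LINT \<xi>|lborel. u \<xi> * inv_fourier (?\<psi> t x) \<xi>)"
      unfolding heat_def \<psi>[symmetric] fourier_inversion[OF W] ..
    also have "\<dots> = (LINT \<xi>|lborel. u \<xi> * inv_fourier ?A \<xi> + u \<xi> * inv_fourier ?B \<xi>)"
      unfolding split inv_fourier_add[OF AS BS] by (simp add: distrib_left)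
    also have "\<dots> = (LINT \<xi>|lborel. u \<xi> * inv_fourier ?A \<xi>) + (LINT \<xi>|lborel. u \<xi> * inv_fourier ?B \<xi>)"
      by (intro Bochner_Integration.integral_add tame_schwartz_integrable moderate_tame[OF u] schwartz_inv_fourier AS BS)
    also have "\<dots> = (LINT \<xi>|lborel. u \<xi> * inv_fourier ?B \<xi>)" using A0 by simp
    finally have "norm (heat u t x) \<le> (LINT \<xi>|lborel. norm (u \<xi> * inv_fourier ?B \<xi>))"
      by (simp only: integral_norm_bound)
    also have "\<dots> \<le> C * exp (- (r\<^sup>2 / (16 * t)))" using C(2)[of "(t, x)"] t x by simp
    finally show "norm (heat u t x) \<le> C * exp (- (r\<^sup>2 / (16 * t)))" .
  qed
qed

lemma powr_exp_inverse_bound: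
  fixes c q :: real
  assumes "c > 0"
  obtains D where "D > 0" "\<And>t. 0 < t \<Longrightarrow> t \<le> 1 \<Longrightarrow> t powr q * exp (- (c / t)) \<le> D"
proof (rule that)
  define m where "m = nat \<lceil>\<bar>q\<bar>\<rceil>"
  have m: "\<bar>q\<bar> \<le> real m" by (simp add: m_def)
  show "fact m * (1 / c) ^ m > 0" using assms by simp
  fix t :: real assume t: "0 < t" "t \<le> 1"
  have "t powr q \<le> t powr (- real m)" using t m by (intro powr_mono') auto
  also have "\<dots> = (1 / t) ^ m" using t by (simp add: powr_minus powr_realpow divide_inverse power_inverse)
  finally have 1: "t powr q \<le> (1 / t) ^ m" .
  have "(c / t) ^ m / fact m \<le> exp (c / t)" using t assms by (intro exp_ge_power_div_fact) auto
  then have 2: "(1 / t) ^ m \<le> fact m * (1 / c) ^ m * exp (c / t)"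
    using t assms by (simp add: field_simps power_divide)
  have "t powr q * exp (- (c / t)) \<le> fact m * (1 / c) ^ m * exp (c / t) * exp (- (c / t))"
    by (rule mult_right_mono[OF order_trans[OF 1 2]]) simp
  then show "t powr q * exp (- (c / t)) \<le> fact m * (1 / c) ^ m"
    by (simp only: mult.assoc exp_minus_inverse mult_1_right)
qed

lemma heat_measurable:
  fixes u :: "'n::finite cfun"
  assumes [measurable]: "u \<in> borel_measurable borel"
  shows "(\<lambda>p. heat u (fst p) (snd p)) \<in> borel_measurable (borel \<Otimes>\<^sub>M borel)"
  unfolding heat_def gauss_def
  by (rule sigma_finite_measure.borel_measurable_lebesgue_integral[OF sigma_finite_lborel]) measurable

lemma heat_measurable_time [measurable]:
  assumes "u \<in> borel_measurable borel"
  shows "(\<lambda>t. heat u t x) \<in> borel_measurable borel"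
  using measurable_compose[OF _ heat_measurable[OF assms], of "\<lambda>t. (t, x)" borel] by simp

section \<open>Differentiation of the heat flow in time\<close>

lemma heat_time_derivative:
  fixes u :: "'n::finite cfun"
  assumes u: "moderate u" and t: "t > 0"
  shows "((\<lambda>t. heat u t x) has_vector_derivative - heat (\<lambda>\<xi>. normsq \<xi> * u \<xi>) t x) (at t)"
proof -
  let ?e = "\<lambda>\<xi>. exp (\<i> * complex_of_real (x \<bullet> \<xi>))"
  define f where "f = (\<lambda>t \<xi>. u \<xi> * (gauss t \<xi> * ?e \<xi>))"
  define f' where "f' = (\<lambda>t \<xi> h. h *\<^sub>R (- (normsq \<xi> * u \<xi> * (gauss t \<xi> * ?e \<xi>))))"
  have nu: "moderate (\<lambda>\<xi>. normsq \<xi> * u \<xi>)" by (intro moderate_mult slow_growth_norm_sq u)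
  have [measurable]: "u \<in> borel_measurable borel" by (rule moderate_measurable[OF u])
  have B: "ball t (t / 2) \<subseteq> {t / 2<..}" 
  proof
    fix z assume "z \<in> ball t (t / 2)"
    then have "\<bar>t - z\<bar> < t / 2" by (simp add: dist_real_def)
    then have "z > t / 2" by arith
    then show "z \<in> {t / 2<..}" by simp
  qed
  have "((\<lambda>t. LINT \<xi>|lborel. f t \<xi>) has_derivative (\<lambda>h. LINT \<xi>|lborel. f' t \<xi> h)) (at t)"
  proof (rule has_derivative_integral(1)[where r="t / 2" and B="\<lambda>\<xi>. norm (normsq \<xi> * u \<xi>) * exp (- (t / 2 * (norm \<xi>)\<^sup>2))"])
    show "t / 2 > 0" using t by simp
    show "integrable lborel (f z)" if "z \<in> ball t (t / 2)" for z
      unfolding f_def using that B t by (intro heat_integrable u) auto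
    show "((\<lambda>z. f z y) has_derivative f' z y) (at z)" for z y
    proof -
      have "((\<lambda>z. complex_of_real (exp (- (z * (norm y)\<^sup>2)))) has_vector_derivative complex_of_real (- ((norm y)\<^sup>2) * exp (- (z * (norm y)\<^sup>2)))) (at z)"
        using has_vector_derivative_exp_lin[of "(norm y)\<^sup>2" z] by (simp add: mult.commute)
      then have "((\<lambda>z. gauss z y) has_vector_derivative - (normsq y * gauss z y)) (at z)"
        by (simp add: gauss_def)
      from has_vector_derivative_mult_left[OF this, of "?e y * u y"]
      show ?thesis unfolding has_vector_derivative_def f_def f'_def by (simp add: mult_ac)
    qed
    show "norm (f' z y h) \<le> norm (normsq y * u y) * exp (- (t / 2 * (norm y)\<^sup>2)) * norm h" if "z \<in> ball t (t / 2)" for z y h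
    proof -
      have "exp (- (z * (norm y)\<^sup>2)) \<le> exp (- (t / 2 * (norm y)\<^sup>2))"
      proof -
        have "t / 2 < z" using that B by blast
        then have "t / 2 * (norm y)\<^sup>2 \<le> z * (norm y)\<^sup>2" by (intro mult_right_mono) auto
        then show ?thesis by (simp only: exp_le_cancel_iff neg_le_iff_le)
      qed
      then have "norm (normsq y * u y) * exp (- (z * (norm y)\<^sup>2)) * norm h \<le> norm (normsq y * u y) * exp (- (t / 2 * (norm y)\<^sup>2)) * norm h"
        by (intro mult_right_mono mult_left_mono) auto
      then show ?thesis by (simp add: f'_def norm_mult norm_gauss mult_ac)
    qed
    show "integrable lborel (\<lambda>\<xi>. norm (normsq \<xi> * u \<xi>) * exp (- (t / 2 * (norm \<xi>)\<^sup>2)))"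
      using t by (intro abs_gauss_integrable nu) auto
    show "(\<lambda>y. f' t y h) \<in> borel_measurable lborel" for h unfolding f'_def by measurable
  qed
  moreover have "(LINT \<xi>|lborel. f' t \<xi> h) = h *\<^sub>R (- heat (\<lambda>\<xi>. normsq \<xi> * u \<xi>) t x)" for h
    unfolding f'_def heat_def by simp
  ultimately show ?thesis unfolding has_vector_derivative_def heat_def[of u] f_def by simp
qed

section \<open>Power moments of the heat flow at a point\<close>

text \<open>
  A class of Fourier transforms that is closed under addition and under multiplication by the
  coordinates and whose members share two properties: the inverse transform vanishes near \<open>x0\<close>, and its
  fractional Laplacian is a continuous function near \<open>x0\<close> that vanishes at \<open>x0\<close>. Working with the
  class replaces derivatives at \<open>x0\<close> by values at \<open>x0\<close> of further members. The exponent \<open>\<gamma>\<close> makes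
  \<open>|\<xi>|\<^bsup>-\<gamma>\<^esup>\<close> locally integrable while it dominates \<open>|\<xi>|\<^sup>2\<^sup>s\<close> near the origin; it exists because \<open>s > - n / 2\<close>.
\<close>

locale continuation_class =
  fixes UU :: "'n::finite cfun set" and s \<gamma> r :: real and x0 :: "real ^ 'n"
  assumes s: "s \<notin> \<int>" and \<gamma>: "0 < \<gamma>" "\<gamma> < real CARD('n)" "- 2 * s < \<gamma>" and r: "r > 0"
    and mod: "\<And>u. u \<in> UU \<Longrightarrow> moderate u"
    and coord: "\<And>u i. u \<in> UU \<Longrightarrow> (\<lambda>\<xi>. complex_of_real (\<xi> $ i) * u \<xi>) \<in> UU"
    and add: "\<And>u v. u \<in> UU \<Longrightarrow> v \<in> UU \<Longrightarrow> (\<lambda>\<xi>. u \<xi> + v \<xi>) \<in> UU"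
    and van: "\<And>u. u \<in> UU \<Longrightarrow> spectrally_vanishes (ball x0 (4 * r)) u"
    and frac: "\<And>u. u \<in> UU \<Longrightarrow> \<exists>g. continuous_on (ball x0 (4 * r)) g \<and> g x0 = 0 \<and>
      (\<forall>\<phi>\<in>test_functions (ball x0 (4 * r)).
        (LINT \<xi>|lborel. complex_of_real (norm \<xi> powr (2 * s)) * u \<xi> * inv_fourier \<phi> \<xi>) = (LINT x|lborel. g x * \<phi> x))"
begin

lemma normsq_closed: assumes "u \<in> UU" shows "(\<lambda>\<xi>. normsq \<xi> * u \<xi>) \<in> UU"
proof -
  have S: "(\<lambda>\<xi>. \<Sum>i\<in>A. complex_of_real (\<xi> $ i) * (complex_of_real (\<xi> $ i) * u \<xi>)) \<in> UU" if "finite A" "A \<noteq> {}" for A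
    using that
  proof (induction A rule: finite_ne_induct)
    case (insert i A)
    then show ?case using add[OF coord[OF coord[OF assms], of i i]] by simp
  next
    case (singleton i)
    show ?case using coord[OF coord[OF assms], of i i] by simp
  qed
  have eq: "(\<Sum>i\<in>UNIV. complex_of_real (\<xi> $ i) * (complex_of_real (\<xi> $ i) * u \<xi>)) = normsq \<xi> * u \<xi>" for \<xi>
    unfolding norm_sq_eq of_real_sum sum_distrib_right by (intro sum.cong refl) (simp add: power2_eq_square)
  show ?thesis using S[OF finite UNIV_not_empty] unfolding eq .
qed

lemma normsq_power_closed: "u \<in> UU \<Longrightarrow> (\<lambda>\<xi>. normsq \<xi> ^ k * u \<xi>) \<in> UU"
proof (induction k)
  case (Suc k)
  from normsq_closed[OF Suc.IH[OF Suc.prems]] show ?case by (simp only: power_Suc mult.assoc)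
qed simp

definition c where "c = r\<^sup>2 / 16"
text \<open>
  Up to a constant, the bound of \<open>heat_bound\<close> on the \<open>k\<close>-th time derivative of the heat flow near \<open>x0\<close>.
\<close>

definition \<beta> where "\<beta> k t = (if t \<le> 1 then exp (- (c / t)) else t powr (- (real k + \<gamma> / 2)))"

lemma c_pos: "c > 0" using r by (simp add: c_def)
lemma \<beta>_nonneg: "\<beta> k t \<ge> 0" by (simp add: \<beta>_def)
lemma \<beta>_measurable [measurable]: "\<beta> k \<in> borel_measurable borel" unfolding \<beta>_def by measurable

lemma heat_bound:
  assumes "u \<in> UU"
  obtains C where "C > 0" "\<And>t x. 0 < t \<Longrightarrow> x \<in> ball x0 r \<Longrightarrow> norm (heat (\<lambda>\<xi>. normsq \<xi> ^ k * u \<xi>) t x) \<le> C * \<beta> k t"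
proof -
  note nu = normsq_power_closed[OF assms, of k]
  obtain C1 where C1: "C1 > 0" "\<And>t x. 0 < t \<Longrightarrow> t \<le> 1 \<Longrightarrow> x \<in> ball x0 r \<Longrightarrow> norm (heat (\<lambda>\<xi>. normsq \<xi> ^ k * u \<xi>) t x) \<le> C1 * exp (- (r\<^sup>2 / (16 * t)))"
    using heat_small_near_zero_set[OF mod[OF nu] r van[OF nu]] by blast
  obtain C2 where C2: "C2 > 0" "\<And>t. t \<ge> 1 \<Longrightarrow> (LINT \<xi>|lborel. norm (normsq \<xi> ^ k * u \<xi>) * exp (- (t * (norm \<xi>)\<^sup>2))) \<le> C2 * t powr (- (real k + \<gamma> / 2))"
    using heat_decay_large_time[OF mod[OF assms] \<gamma>(1,2)] by blast
  show thesis
  proof (rule that[of "C1 + C2"])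
    fix t :: real and x assume t: "0 < t" and x: "x \<in> ball x0 r"
    show "norm (heat (\<lambda>\<xi>. normsq \<xi> ^ k * u \<xi>) t x) \<le> (C1 + C2) * \<beta> k t"
    proof (cases "t \<le> 1")
      case True
      have "norm (heat (\<lambda>\<xi>. normsq \<xi> ^ k * u \<xi>) t x) \<le> C1 * \<beta> k t"
        using C1(2)[OF t True x] True by (simp add: \<beta>_def c_def)
      also have "\<dots> \<le> (C1 + C2) * \<beta> k t" using C2(1) by (intro mult_right_mono \<beta>_nonneg) auto
      finally show ?thesis .
    next
      case False
      have "norm (heat (\<lambda>\<xi>. normsq \<xi> ^ k * u \<xi>) t x) \<le> C2 * \<beta> k t"
        using order_trans[OF norm_heat_le C2(2)[of t]] False by (simp add: \<beta>_def)
      also have "\<dots> \<le> (C1 + C2) * \<beta> k t" using C1(1) by (intro mult_right_mono \<beta>_nonneg) auto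
      finally show ?thesis .
    qed
  qed (use C1 C2 in auto)
qed

lemma weight_integrable:
  assumes a: "0 \<le> a" "a < c" and p: "p - real k + 1 < \<gamma> / 2"
  shows "integrable halfline (\<lambda>t. t powr p * exp (a / t) * \<beta> k t)"
proof (rule integrableI_nonneg)
  show "(\<lambda>t. t powr p * exp (a / t) * \<beta> k t) \<in> borel_measurable halfline" by measurable
  show "AE t in halfline. 0 \<le> t powr p * exp (a / t) * \<beta> k t" by (simp add: \<beta>_nonneg)
  obtain D where D: "D > 0" "\<And>t. 0 < t \<Longrightarrow> t \<le> 1 \<Longrightarrow> t powr p * exp (- ((c - a) / t)) \<le> D"
    using powr_exp_inverse_bound[of "c - a" p] a by auto
  show "(\<integral>\<^sup>+t. ennreal (t powr p * exp (a / t) * \<beta> k t) \<partial>halfline) < \<infinity>"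
  proof (rule nn_integral_halfline_powr[where a=0 and b="p - real k - \<gamma> / 2" and C="max D (exp a)"])
    fix t :: real
    show "t powr p * exp (a / t) * \<beta> k t \<le> max D (exp a) * t powr 0" if t: "0 < t" "t \<le> 1"
    proof -
      have "t powr p * exp (a / t) * \<beta> k t = t powr p * exp (- ((c - a) / t))"
        using t by (simp add: \<beta>_def mult_exp_exp diff_divide_distrib mult.assoc)
      also have "\<dots> \<le> D" by (rule D(2)[OF t])
      also have "\<dots> \<le> max D (exp a) * t powr 0" using t by simp
      finally show ?thesis .
    qed
    show "t powr p * exp (a / t) * \<beta> k t \<le> max D (exp a) * t powr (p - real k - \<gamma> / 2)" if t: "1 \<le> t"
    proof (cases "t = 1")
      case True
      have "exp a * exp (- c) = exp (- ((c - a) / 1))" by (simp add: mult_exp_exp)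
      also have "\<dots> \<le> D" using D(2)[of 1] by simp
      finally show ?thesis using True by (simp add: \<beta>_def le_max_iff_disj)
    next
      case False
      have "exp (a / t) \<le> exp a" using t a by (simp add: divide_le_eq mult_le_cancel_left1 mult_left_le)
      then have "t powr p * exp (a / t) * \<beta> k t \<le> t powr p * exp a * \<beta> k t" by (intro mult_right_mono mult_left_mono \<beta>_nonneg) auto
      also have "\<dots> = exp a * (t powr p * t powr (- (real k + \<gamma> / 2)))" using t False by (simp add: \<beta>_def)
      also have "t powr p * t powr (- (real k + \<gamma> / 2)) = t powr (p - real k - \<gamma> / 2)"
        by (simp add: powr_add[symmetric] algebra_simps)
      also have "exp a * t powr (p - real k - \<gamma> / 2) \<le> max D (exp a) * t powr (p - real k - \<gamma> / 2)" by (intro mult_right_mono) auto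
      finally show ?thesis .
    qed
  qed (use p in auto)
qed

text \<open>
  Power moments in time of the \<open>k\<close>-th derivative of the heat flow at \<open>x0\<close>, up to sign.
\<close>

definition J where "J p k u = (LINT t|halfline. complex_of_real (t powr p) * heat (\<lambda>\<xi>. normsq \<xi> ^ k * u \<xi>) t x0)"

lemma heat_meas [measurable]: "u \<in> UU \<Longrightarrow> (\<lambda>t. heat (\<lambda>\<xi>. normsq \<xi> ^ k * u \<xi>) t x) \<in> borel_measurable borel"
  by (intro heat_measurable_time moderate_measurable mod normsq_power_closed)

lemma time_integrable:
  assumes u: "u \<in> UU" and a: "0 \<le> a" "a < c" and p: "p - real k + 1 < \<gamma> / 2" and x: "x \<in> ball x0 r"
  shows "integrable halfline (\<lambda>t. complex_of_real (t powr p * exp (a / t)) * heat (\<lambda>\<xi>. normsq \<xi> ^ k * u \<xi>) t x)"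
proof -
  obtain C where C: "C > 0" "\<And>t x. 0 < t \<Longrightarrow> x \<in> ball x0 r \<Longrightarrow> norm (heat (\<lambda>\<xi>. normsq \<xi> ^ k * u \<xi>) t x) \<le> C * \<beta> k t"
    using heat_bound[OF u, of k] by blast
  have [measurable]: "(\<lambda>t. heat (\<lambda>\<xi>. normsq \<xi> ^ k * u \<xi>) t x) \<in> borel_measurable borel" by (rule heat_meas[OF u])
  show ?thesis
  proof (rule Bochner_Integration.integrable_bound)
    show "integrable halfline (\<lambda>t. C * (t powr p * exp (a / t) * \<beta> k t))" by (rule integrable_mult_right[OF weight_integrable[OF a p]])
    show "AE t in halfline. norm (complex_of_real (t powr p * exp (a / t)) * heat (\<lambda>\<xi>. normsq \<xi> ^ k * u \<xi>) t x) \<le> norm (C * (t powr p * exp (a / t) * \<beta> k t))"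
    proof (rule AE_halflineI)
      fix t :: real assume t: "t > 0"
      have "norm (complex_of_real (t powr p * exp (a / t)) * heat (\<lambda>\<xi>. normsq \<xi> ^ k * u \<xi>) t x) = (t powr p * exp (a / t)) * norm (heat (\<lambda>\<xi>. normsq \<xi> ^ k * u \<xi>) t x)"
        by (simp add: norm_mult)
      also have "\<dots> \<le> (t powr p * exp (a / t)) * (C * \<beta> k t)" by (intro mult_left_mono C t x) auto
      also have "\<dots> = norm (C * (t powr p * exp (a / t) * \<beta> k t))" using C(1) \<beta>_nonneg by (simp add: abs_mult mult_ac)
      finally show "norm (complex_of_real (t powr p * exp (a / t)) * heat (\<lambda>\<xi>. normsq \<xi> ^ k * u \<xi>) t x) \<le> norm (C * (t powr p * exp (a / t) * \<beta> k t))" .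
    qed
  qed measurable
qed

lemma J_integrable:
  assumes "u \<in> UU" "p - real k + 1 < \<gamma> / 2"
  shows "integrable halfline (\<lambda>t. complex_of_real (t powr p) * heat (\<lambda>\<xi>. normsq \<xi> ^ k * u \<xi>) t x0)"
  using time_integrable[OF assms(1) order_refl c_pos assms(2), of x0] r by simp

text \<open>
  Integration by parts in \<open>t\<close>. The boundary term at \<open>0\<close> vanishes for every power of \<open>t\<close>, since the heat
  flow is exponentially small there; the one at infinity vanishes under the stated condition, by the
  decay \<open>t\<^bsup>-k-\<gamma>/2\<^esup>\<close>.
\<close>

lemma J_Suc:
  assumes u: "u \<in> UU" and p: "p - real k < \<gamma> / 2"
  shows "J p (Suc k) u = complex_of_real p * J (p - 1) k u"
proof -
  define h where "h = (\<lambda>k t. heat (\<lambda>\<xi>. normsq \<xi> ^ k * u \<xi>) t x0)"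
  have hd: "(h k has_vector_derivative - h (Suc k) t) (at t)" if "t > 0" for k t
  proof -
    have "(\<lambda>\<xi>. normsq \<xi> * (normsq \<xi> ^ k * u \<xi>)) = (\<lambda>\<xi>. normsq \<xi> ^ Suc k * u \<xi>)" by (simp only: power_Suc mult.assoc)
    then show ?thesis
      using heat_time_derivative[OF mod[OF normsq_power_closed[OF u]] that, of k x0] unfolding h_def by (simp only:)
  qed
  have hc: "isCont (h k) t" if "t > 0" for k t using hd[OF that] by (rule has_vector_derivative_continuous)
  define F where "F = (\<lambda>t. complex_of_real (t powr p) * h k t)"
  define f where "f = (\<lambda>t. complex_of_real p * (complex_of_real (t powr (p - 1)) * h k t) - complex_of_real (t powr p) * h (Suc k) t)"
  have i1: "integrable halfline (\<lambda>t. complex_of_real (t powr (p - 1)) * h k t)" unfolding h_def by (rule J_integrable[OF u]) (use p in auto)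
  have i2: "integrable halfline (\<lambda>t. complex_of_real (t powr p) * h (Suc k) t)" unfolding h_def by (rule J_integrable[OF u]) (use p in auto)
  have fi: "integrable halfline f" unfolding f_def by (intro Bochner_Integration.integrable_diff integrable_mult_right i1 i2)
  have [measurable]: "h k \<in> borel_measurable borel" for k unfolding h_def by (rule heat_meas[OF u])
  have fm: "f \<in> borel_measurable borel" unfolding f_def by measurable
  obtain C where C: "C > 0" "\<And>t. 0 < t \<Longrightarrow> norm (h k t) \<le> C * \<beta> k t"
  proof -
    obtain C where "C > 0" "\<And>t x. 0 < t \<Longrightarrow> x \<in> ball x0 r \<Longrightarrow> norm (heat (\<lambda>\<xi>. normsq \<xi> ^ k * u \<xi>) t x) \<le> C * \<beta> k t"
      using heat_bound[OF u, of k] by blast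
    then show thesis using that[of C] r unfolding h_def by simp
  qed
  have Fle: "norm (F t) \<le> C * (t powr p * \<beta> k t)" if "t > 0" for t
  proof -
    have "norm (F t) = t powr p * norm (h k t)" by (simp add: F_def norm_mult)
    also have "\<dots> \<le> t powr p * (C * \<beta> k t)" by (intro mult_left_mono C that) auto
    finally show ?thesis by (simp add: mult_ac)
  qed
  obtain D where D: "D > 0" "\<And>t. 0 < t \<Longrightarrow> t \<le> 1 \<Longrightarrow> t powr (p - 1) * exp (- (c / t)) \<le> D"
    using powr_exp_inverse_bound[OF c_pos, of "p - 1"] by blast
  have lim0: "(F \<longlongrightarrow> 0) (at_right 0)"
  proof (rule Lim_null_comparison)
    show "eventually (\<lambda>t. norm (F t) \<le> C * D * t) (at_right 0)"
      unfolding eventually_at_right_field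
    proof (intro exI[of _ 1] conjI allI impI)
      fix t :: real assume t: "0 < t" "t < 1"
      have "norm (F t) \<le> C * (t powr p * exp (- (c / t)))" using Fle[OF t(1)] t by (simp add: \<beta>_def)
      also have "t powr p = t * t powr (p - 1)" using t by (simp add: powr_diff)
      also have "C * (t * t powr (p - 1) * exp (- (c / t))) = C * t * (t powr (p - 1) * exp (- (c / t)))" by simp
      also have "\<dots> \<le> C * t * D" using C(1) t by (intro mult_left_mono D) auto
      finally show "norm (F t) \<le> C * D * t" by (simp add: mult_ac)
    qed simp
    show "((\<lambda>t. C * D * t) \<longlongrightarrow> 0) (at_right 0)" by (auto intro!: tendsto_eq_intros)
  qed
  have liminf: "(F \<longlongrightarrow> 0) at_top"
  proof (rule Lim_null_comparison)
    show "eventually (\<lambda>t. norm (F t) \<le> C * t powr (p - real k - \<gamma> / 2)) at_top"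
      using eventually_gt_at_top[of 1]
    proof eventually_elim
      case (elim t)
      have "norm (F t) \<le> C * (t powr p * t powr (- (real k + \<gamma> / 2)))" using Fle[of t] elim by (simp add: \<beta>_def)
      also have "t powr p * t powr (- (real k + \<gamma> / 2)) = t powr (p - real k - \<gamma> / 2)"
        by (simp add: powr_add[symmetric] algebra_simps)
      finally show ?case .
    qed
    have "((\<lambda>t. t powr (p - real k - \<gamma> / 2)) \<longlongrightarrow> 0) at_top"
      using p by (intro tendsto_neg_powr filterlim_ident) auto
    then show "((\<lambda>t. C * t powr (p - real k - \<gamma> / 2)) \<longlongrightarrow> 0) at_top" by (rule tendsto_mult_right_zero)
  qed
  have "(LBINT t=0..\<infinity>. f t) = 0 - 0"
  proof (rule interval_integral_FTC_integrable[where F=F])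
    show "(0::ereal) < \<infinity>" by simp
    show "(F has_vector_derivative f t) (at t)" if "0 < ereal t" for t
    proof -
      have t: "t > 0" using that by simp
      have "((\<lambda>t. t powr p) has_real_derivative p * t powr (p - 1)) (at t)"
        using t by (auto intro!: derivative_eq_intros)
      from has_vector_derivative_of_real[OF this]
      have "((\<lambda>t. complex_of_real (t powr p)) has_vector_derivative complex_of_real (p * t powr (p - 1))) (at t)" .
      from has_vector_derivative_mult[OF this hd[OF t, of k]]
      show ?thesis unfolding F_def f_def by (simp add: algebra_simps)
    qed
    show "isCont f t" if "0 < ereal t" for t
    proof -
      have t: "t > 0" using that by simp
      show ?thesis unfolding f_def using t hc by (intro continuous_intros) auto
    qed
    show "set_integrable lborel (einterval 0 \<infinity>) f"
      using fi unfolding integrable_halfline[OF fm] by (simp add: einterval_eq zero_ereal_def)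
    show "((F \<circ> real_of_ereal) \<longlongrightarrow> 0) (at_right 0)"
      unfolding zero_ereal_def by (simp add: ereal_tendsto_simps lim0)
    show "((F \<circ> real_of_ereal) \<longlongrightarrow> 0) (at_left \<infinity>)"
      by (simp add: ereal_tendsto_simps liminf)
  qed
  then have "(LINT t|halfline. f t) = 0"
    unfolding integral_halfline[OF fm] by (simp add: interval_lebesgue_integral_0_infty)
  moreover have "(LINT t|halfline. f t) = complex_of_real p * J (p - 1) k u - J p (Suc k) u"
  proof -
    have "J (p - 1) k u = (LINT t|halfline. complex_of_real (t powr (p - 1)) * h k t)"
      "J p (Suc k) u = (LINT t|halfline. complex_of_real (t powr p) * h (Suc k) t)" unfolding J_def h_def by (rule refl)+
    then show ?thesis
      unfolding f_def using Bochner_Integration.integral_diff[OF integrable_mult_right[OF i1, of "complex_of_real p"] i2]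
      by (simp only: integral_mult_right_zero)
  qed
  ultimately show ?thesis by simp
qed

text \<open>
  Each integration by parts produces a factor which differs from \<open>-s\<close> by an integer and hence is
  nonzero.
\<close>

lemma J_vanishes_descend:
  assumes u: "u \<in> UU" and zero: "J (real k0 - s - 1) (k0 + j) u = 0" and i: "i \<le> k0 + j"
  shows "J (real k0 - s - 1 - real i) (k0 + j - i) u = 0"
  using i
proof (induction i)
  case 0 then show ?case using zero by simp
next
  case (Suc i)
  let ?p = "real k0 - s - 1 - real i" and ?k = "k0 + j - Suc i"
  have k: "k0 + j - i = Suc ?k" using Suc.prems by simp
  have "real ?k = real k0 + real j - real i - 1" using Suc.prems by (simp add: of_nat_diff)
  then have cond: "?p - real ?k < \<gamma> / 2" using \<gamma>(3) by simp
  have "complex_of_real ?p * J (?p - 1) ?k u = 0"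
    using J_Suc[OF u cond] Suc.IH Suc.prems by (simp add: k)
  moreover have "?p \<noteq> 0"
  proof
    assume "?p = 0"
    then have "s = of_int (int k0 - 1 - int i)" by simp
    then show False using s by (metis Ints_of_int)
  qed
  then have "complex_of_real ?p \<noteq> 0" by (simp only: of_real_eq_0_iff not_False_eq_True)
  ultimately have "J (?p - 1) ?k u = 0" by (simp only: mult_eq_0_iff) simp
  moreover have "?p - 1 = real k0 - s - 1 - real (Suc i)" by simp
  ultimately show ?case by (simp only:)
qed

end

section \<open>Fractional powers as superpositions of Gaussians\<close>

lemma gamma_subordination_integral:
  assumes "m > 0" "y > 0"
  shows "(LINT t|halfline. t powr (m - 1) * exp (- (t * y))) = Gamma m * y powr (- m)"
proof -
  have "Gamma m > 0" using assms by (simp add: Gamma_real_pos)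
  then show ?thesis
    using gamma_subordination[OF assms] by (subst integral_eq_nn_integral) auto
qed

lemma heat_continuous_space:
  assumes u: "moderate u" and t: "t > 0"
  shows "continuous_on S (heat u t)"
proof (rule continuous_on_subset[OF _ subset_UNIV])
  have [measurable]: "u \<in> borel_measurable borel" by (rule moderate_measurable[OF u])
  show "continuous_on UNIV (heat u t)"
    unfolding continuous_on_sequentially o_def
  proof (intro allI ballI impI, elim conjE)
    fix x and a :: "real^'a" assume x: "x \<longlonglongrightarrow> a"
    show "(\<lambda>n. heat u t (x n)) \<longlonglongrightarrow> heat u t a"
      unfolding heat_def
    proof (rule integral_dominated_convergence[where w="\<lambda>\<xi>. norm (u \<xi>) * exp (- (t * (norm \<xi>)\<^sup>2))"])
      show "integrable lborel (\<lambda>\<xi>. norm (u \<xi>) * exp (- (t * (norm \<xi>)\<^sup>2)))" by (rule abs_gauss_integrable[OF u t])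
      show "AE \<xi> in lborel. (\<lambda>n. u \<xi> * (gauss t \<xi> * exp (\<i> * complex_of_real (x n \<bullet> \<xi>)))) \<longlonglongrightarrow> u \<xi> * (gauss t \<xi> * exp (\<i> * complex_of_real (a \<bullet> \<xi>)))"
        by (intro AE_I2 tendsto_intros x)
    qed (auto simp: norm_mult norm_gauss)
  qed
qed

text \<open>
  Near the origin the factor \<open>|\<xi>|\<^sup>2\<^sup>s\<close> is dominated by an integrable singularity \<open>|\<xi>|\<^bsup>-\<gamma>\<^esup>\<close>, and
  elsewhere by a power that the Schwartz function absorbs.
\<close>

lemma fractional_integrable:
  fixes u \<phi> :: "'n::finite cfun"
  assumes s: "- real CARD('n) / 2 < s" and u: "moderate u" and \<phi>: "\<phi> \<in> schwartz"
  shows "integrable lborel (\<lambda>\<xi>. norm \<xi> powr (2 * s) * norm (u \<xi> * \<phi> \<xi>))"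
proof (rule Bochner_Integration.integrable_bound)
  (* the midpoint of the interval from max 0 (- 2 s) to n *)
  define \<gamma> where "\<gamma> = (max 0 (- 2 * s) + real CARD('n)) / 2"
  have \<gamma>: "0 < \<gamma>" "\<gamma> < real CARD('n)" "- 2 * s < \<gamma>" using s by (auto simp: \<gamma>_def max_def field_simps)
  define k0 where "k0 = nat \<lceil>s\<rceil>"
  have k0: "s \<le> real k0" unfolding k0_def by linarith
  have [measurable]: "u \<in> borel_measurable borel" "\<phi> \<in> borel_measurable borel"
    by (auto intro: moderate_measurable u schwartz_measurable \<phi>)
  let ?h = "\<lambda>\<xi>. norm (u \<xi> * \<phi> \<xi>)"
  obtain B where B: "B > 0" "\<And>\<xi>. ?h \<xi> \<le> B" using bounded_moderate_mult_schwartz[OF u \<phi>] by blast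
  have hi: "integrable lborel ?h" by (intro integrable_norm tame_schwartz_integrable moderate_tame u \<phi>)
  have "integrable lborel (\<lambda>\<xi>. norm ((normsq \<xi> ^ k0 * u \<xi>) * \<phi> \<xi>))"
    by (intro integrable_norm tame_schwartz_integrable moderate_tame moderate_mult slow_growth_power slow_growth_norm_sq u \<phi>)
  then have i2: "integrable lborel (\<lambda>\<xi>. norm \<xi> ^ (2 * k0) * ?h \<xi>)"
    by (simp add: norm_mult norm_power power_mult mult.assoc)
  show "integrable lborel (\<lambda>\<xi>. norm \<xi> powr (- \<gamma>) * ?h \<xi> + norm \<xi> ^ (2 * k0) * ?h \<xi>)"
    by (intro Bochner_Integration.integrable_add i2 singular_integrable[OF \<gamma>(1,2) hi _ B(2)]) auto
  show "(\<lambda>\<xi>. norm \<xi> powr (2 * s) * ?h \<xi>) \<in> borel_measurable lborel" by measurable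
  show "AE \<xi> in lborel. norm (norm \<xi> powr (2 * s) * ?h \<xi>) \<le> norm (norm \<xi> powr (- \<gamma>) * ?h \<xi> + norm \<xi> ^ (2 * k0) * ?h \<xi>)"
  proof (rule AE_I2)
    fix \<xi> :: "real^'n"
    have "norm \<xi> powr (2 * s) \<le> norm \<xi> powr (- \<gamma>) + norm \<xi> ^ (2 * k0)"
    proof (cases "norm \<xi> \<le> 1")
      case True
      have "norm \<xi> powr (2 * s) \<le> norm \<xi> powr (- \<gamma>)" using True \<gamma>(3) by (intro powr_mono') auto
      then show ?thesis by (simp add: add_increasing2)
    next
      case False
      have "norm \<xi> powr (2 * s) \<le> norm \<xi> powr (real (2 * k0))" using False k0 by (intro powr_mono) auto
      also have "\<dots> = norm \<xi> ^ (2 * k0)" using False by (intro powr_realpow) auto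
      finally show ?thesis by (simp add: add_increasing)
    qed
    then have "norm \<xi> powr (2 * s) * ?h \<xi> \<le> (norm \<xi> powr (- \<gamma>) + norm \<xi> ^ (2 * k0)) * ?h \<xi>" by (rule mult_right_mono) simp
    then show "norm (norm \<xi> powr (2 * s) * ?h \<xi>) \<le> norm (norm \<xi> powr (- \<gamma>) * ?h \<xi> + norm \<xi> ^ (2 * k0) * ?h \<xi>)"
      by (simp add: abs_mult distrib_right)
  qed
qed

context continuation_class
begin

lemma s_lower: "- real CARD('n) / 2 < s" using \<gamma>(2,3) by linarith

text \<open>
  Subordination applied to \<open>|\<xi>|\<^sup>2\<^sup>s = |\<xi>|\<^bsup>2 k0\<^esup> |\<xi>|\<^bsup>-2 (k0 - s)\<^esup>\<close>; the integer power \<open>k0\<close> makes the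
  exponent of the second factor negative and is given to \<open>u\<close>.
\<close>

lemma subordinated_pairing:
  assumes u: "u \<in> UU" and k0: "real k0 - s > 0" and \<phi>: "\<phi> \<in> schwartz"
  shows "complex_of_real (Gamma (real k0 - s)) * (LINT \<xi>|lborel. complex_of_real (norm \<xi> powr (2 * s)) * u \<xi> * \<phi> \<xi>)
    = (LINT t|halfline. complex_of_real (t powr (real k0 - s - 1)) * (LINT \<xi>|lborel. (normsq \<xi> ^ k0 * u \<xi>) * (gauss t \<xi> * \<phi> \<xi>)))"
proof -
  define m where "m = real k0 - s"
  have m: "m > 0" using k0 by (simp add: m_def)
  have G: "Gamma m > 0" using m by (simp add: Gamma_real_pos)
  have [measurable]: "u \<in> borel_measurable borel" "\<phi> \<in> borel_measurable borel"
    by (auto intro: moderate_measurable mod u schwartz_measurable \<phi>)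
  let ?v = "\<lambda>\<xi>. normsq \<xi> ^ k0 * u \<xi>"
  define f where "f = (\<lambda>\<xi> t. complex_of_real (t powr (m - 1)) * (?v \<xi> * (gauss t \<xi> * \<phi> \<xi>)))"
  have pw: "((norm \<xi>)\<^sup>2) powr (- m) * norm \<xi> ^ (2 * k0) = norm \<xi> powr (2 * s)" if "\<xi> \<noteq> 0" for \<xi> :: "real^'n"
  proof -
    have "((norm \<xi>)\<^sup>2) powr (- m) = norm \<xi> powr (- (2 * m))" using norm_sq_powr[OF that, of "2 * m"] by simp
    moreover have "norm \<xi> ^ (2 * k0) = norm \<xi> powr (2 * real k0)" using that powr_realpow[of "norm \<xi>" "2 * k0"] by simp
    ultimately show ?thesis by (simp add: m_def flip: powr_add)
  qed
  have "(LINT \<xi>|lborel. LINT t|halfline. f \<xi> t) = (LINT t|halfline. LINT \<xi>|lborel. f \<xi> t)"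
  proof (rule fubini_swap(1)[OF sigma_finite_lborel sigma_finite_halfline])
    show "case_prod f \<in> borel_measurable (lborel \<Otimes>\<^sub>M halfline)" unfolding f_def gauss_def by measurable
    have "(\<integral>\<^sup>+\<xi>. \<integral>\<^sup>+t. norm (f \<xi> t) \<partial>halfline \<partial>lborel) = (\<integral>\<^sup>+\<xi>. ennreal (Gamma m * (norm \<xi> powr (2 * s) * norm (u \<xi> * \<phi> \<xi>))) \<partial>lborel)"
    proof (rule nn_integral_cong_AE)
      show "AE \<xi> in lborel. (\<integral>\<^sup>+t. norm (f \<xi> t) \<partial>halfline) = ennreal (Gamma m * (norm \<xi> powr (2 * s) * norm (u \<xi> * \<phi> \<xi>)))"
        using AE_lborel_singleton[of "0 :: real^'n"]
      proof eventually_elim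
        case (elim \<xi>)
        let ?b = "norm \<xi> ^ (2 * k0) * norm (u \<xi> * \<phi> \<xi>)"
        have "(\<integral>\<^sup>+t. norm (f \<xi> t) \<partial>halfline) = (\<integral>\<^sup>+t. ennreal (t powr (m - 1) * exp (- (t * (norm \<xi>)\<^sup>2))) * ennreal ?b \<partial>halfline)"
        proof (intro nn_integral_cong)
          fix t :: real
          have e: "norm (normsq \<xi> ^ k0) = norm \<xi> ^ (2 * k0)" unfolding norm_power norm_of_real power_mult by simp
          show "ennreal (norm (f \<xi> t)) = ennreal (t powr (m - 1) * exp (- (t * (norm \<xi>)\<^sup>2))) * ennreal ?b"
            unfolding f_def norm_mult e norm_gauss norm_of_real by (simp add: mult_ac flip: ennreal_mult)
        qed
        also have "\<dots> = ennreal (Gamma m * ((norm \<xi>)\<^sup>2) powr (- m)) * ennreal ?b"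
          using m elim by (subst nn_integral_multc) (auto simp: gamma_subordination)
        also have "\<dots> = ennreal (Gamma m * (((norm \<xi>)\<^sup>2) powr (- m) * norm \<xi> ^ (2 * k0)) * norm (u \<xi> * \<phi> \<xi>))"
          using G by (simp add: mult_ac flip: ennreal_mult)
        also have "\<dots> = ennreal (Gamma m * (norm \<xi> powr (2 * s) * norm (u \<xi> * \<phi> \<xi>)))" unfolding pw[OF elim] by (simp only: mult.assoc)
        finally show ?case .
      qed
    qed
    also have "\<dots> < \<infinity>"
      using integrable_mult_right[OF fractional_integrable[OF s_lower mod[OF u] \<phi>], of "Gamma m"] G
      unfolding integrable_iff_bounded by (simp add: abs_mult)
    finally show "(\<integral>\<^sup>+\<xi>. \<integral>\<^sup>+t. norm (f \<xi> t) \<partial>halfline \<partial>lborel) < \<infinity>" .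
  qed
  also have "(LINT \<xi>|lborel. LINT t|halfline. f \<xi> t) = (LINT \<xi>|lborel. complex_of_real (Gamma m) * (complex_of_real (norm \<xi> powr (2 * s)) * u \<xi> * \<phi> \<xi>))"
  proof (rule integral_cong_AE)
    show "AE \<xi> in lborel. (LINT t|halfline. f \<xi> t) = complex_of_real (Gamma m) * (complex_of_real (norm \<xi> powr (2 * s)) * u \<xi> * \<phi> \<xi>)"
      using AE_lborel_singleton[of "0 :: real^'n"]
    proof eventually_elim
      case (elim \<xi>)
      have "(LINT t|halfline. f \<xi> t) = (LINT t|halfline. complex_of_real (t powr (m - 1) * exp (- (t * (norm \<xi>)\<^sup>2))) * (?v \<xi> * \<phi> \<xi>))"
        unfolding f_def gauss_def by (simp add: mult_ac)
      also have "\<dots> = complex_of_real (Gamma m * ((norm \<xi>)\<^sup>2) powr (- m)) * (?v \<xi> * \<phi> \<xi>)"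
        using m elim by (simp only: integral_mult_left_zero integral_complex_of_real) (simp add: gamma_subordination_integral)
      also have "\<dots> = complex_of_real (Gamma m) * (complex_of_real (((norm \<xi>)\<^sup>2) powr (- m) * norm \<xi> ^ (2 * k0)) * u \<xi> * \<phi> \<xi>)"
        unfolding power_mult[of "norm \<xi>" 2 k0] by (simp add: mult_ac)
      finally show ?case unfolding pw[OF elim] .
    qed
    show "(\<lambda>\<xi>. LINT t|halfline. f \<xi> t) \<in> borel_measurable lborel"
      unfolding f_def gauss_def
      by (rule sigma_finite_measure.borel_measurable_lebesgue_integral[OF sigma_finite_halfline]) measurable
  qed measurable
  also have "(LINT t|halfline. LINT \<xi>|lborel. f \<xi> t) = (LINT t|halfline. complex_of_real (t powr (m - 1)) * (LINT \<xi>|lborel. ?v \<xi> * (gauss t \<xi> * \<phi> \<xi>)))"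
    unfolding f_def by simp
  finally show ?thesis unfolding m_def by simp
qed

lemma gauss_pairing_heat:
  fixes v :: "'n cfun"
  assumes v: "moderate v" and t: "t > 0" and \<phi>: "\<phi> \<in> schwartz"
  shows "(LINT \<xi>|lborel. v \<xi> * (gauss t \<xi> * inv_fourier \<phi> \<xi>)) = (LINT x|lborel. \<phi> x * heat v t x) / of_real ((2 * pi) ^ CARD('n))"
proof -
  let ?P = "complex_of_real ((2 * pi) ^ CARD('n))"
  have [measurable]: "v \<in> borel_measurable borel" "\<phi> \<in> borel_measurable borel"
    by (auto intro: moderate_measurable v schwartz_measurable \<phi>)
  define f where "f = (\<lambda>\<xi> x. v \<xi> * (gauss t \<xi> * exp (\<i> * complex_of_real (x \<bullet> \<xi>))) * \<phi> x)"
  have "(LINT \<xi>|lborel. LINT x|lborel. f \<xi> x) = (LINT x|lborel. LINT \<xi>|lborel. f \<xi> x)"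
  proof (rule fubini_swap(1)[OF sigma_finite_lborel sigma_finite_lborel])
    show "case_prod f \<in> borel_measurable (lborel \<Otimes>\<^sub>M lborel)" unfolding f_def by measurable
    show "(\<integral>\<^sup>+x. \<integral>\<^sup>+y. norm (f x y) \<partial>lborel \<partial>lborel) < \<infinity>"
      using abs_gauss_integrable[OF v t] integrable_norm[OF schwartz_integrable[OF \<phi>]]
      by (rule nn_integral_product_bound) (simp add: f_def norm_mult norm_gauss)
  qed
  moreover have "v \<xi> * (gauss t \<xi> * inv_fourier \<phi> \<xi>) = (LINT x|lborel. f \<xi> x) / ?P" for \<xi>
  proof -
    have "(LINT x|lborel. f \<xi> x) = (LINT x|lborel. (v \<xi> * gauss t \<xi>) * (exp (\<i> * complex_of_real (\<xi> \<bullet> x)) * \<phi> x))"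
      unfolding f_def by (simp add: inner_commute mult_ac)
    also have "\<dots> = (v \<xi> * gauss t \<xi>) * (inv_fourier \<phi> \<xi> * ?P)"
      unfolding inv_fourier_def by simp
    finally show ?thesis by simp
  qed
  moreover have "(LINT \<xi>|lborel. f \<xi> x) = \<phi> x * heat v t x" for x
    unfolding f_def heat_def by (simp add: mult.commute)
  ultimately show ?thesis by simp
qed

text \<open>
  Both \<open>x \<mapsto> \<integral> t\<^bsup>k0-s-1\<^esup> heat (|\<xi>|\<^bsup>2 k0\<^esup> u) t x dt\<close> and a constant multiple of \<open>g\<close> represent the fractional
  Laplacian near \<open>x0\<close>, by subordination and by assumption. They are continuous, hence they agree at
  \<open>x0\<close>, where \<open>g\<close> vanishes.
\<close>

lemma J_vanishes:
  assumes u: "u \<in> UU" and k0: "real k0 - s > 0"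
  shows "J (real k0 - s - 1) k0 u = 0"
proof -
  define m where "m = real k0 - s"
  let ?v = "\<lambda>\<xi>. normsq \<xi> ^ k0 * u \<xi>"
  let ?V = "ball x0 r"
  let ?P = "complex_of_real ((2 * pi) ^ CARD('n))"
  have v: "moderate ?v" by (intro mod normsq_power_closed u)
  have [measurable]: "?v \<in> borel_measurable borel" by (rule moderate_measurable[OF v])
  obtain C where C: "C > 0" "\<And>t x. 0 < t \<Longrightarrow> x \<in> ?V \<Longrightarrow> norm (heat ?v t x) \<le> C * \<beta> k0 t"
    using heat_bound[OF u, of k0] by blast
  (* the factor exp (0 / t) is 1; it matches the form of the general weight *)
  define w where "w = (\<lambda>t. C * (t powr (m - 1) * exp (0 / t) * \<beta> k0 t))"
  have wi: "integrable halfline w"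
    unfolding w_def using \<gamma> c_pos by (intro integrable_mult_right weight_integrable) (auto simp: m_def)
  define vt where "vt = (\<lambda>x. LINT t|halfline. complex_of_real (t powr (m - 1)) * heat ?v t x)"
  have cont: "continuous_on ?V vt"
    unfolding continuous_on_sequentially o_def
  proof (intro allI ballI impI, elim conjE)
    fix x a assume a: "a \<in> ?V" and x: "\<forall>n. x n \<in> ?V" "x \<longlonglongrightarrow> a"
    show "(\<lambda>n. vt (x n)) \<longlonglongrightarrow> vt a"
      unfolding vt_def
    proof (rule integral_dominated_convergence[where w=w])
      show "integrable halfline w" by (rule wi)
      show "AE t in halfline. (\<lambda>n. complex_of_real (t powr (m - 1)) * heat ?v t (x n)) \<longlonglongrightarrow> complex_of_real (t powr (m - 1)) * heat ?v t a"
      proof (rule AE_halflineI)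
        fix t :: real assume t: "t > 0"
        have "continuous_on UNIV (heat ?v t)" by (rule heat_continuous_space[OF v t])
        then have "(\<lambda>n. heat ?v t (x n)) \<longlonglongrightarrow> heat ?v t a"
          using x(2) by (simp add: continuous_on_sequentially o_def)
        then show "(\<lambda>n. complex_of_real (t powr (m - 1)) * heat ?v t (x n)) \<longlonglongrightarrow> complex_of_real (t powr (m - 1)) * heat ?v t a"
          by (intro tendsto_mult tendsto_const)
      qed
      show "AE t in halfline. norm (complex_of_real (t powr (m - 1)) * heat ?v t (x n)) \<le> w t" for n
      proof (rule AE_halflineI)
        fix t :: real assume t: "t > 0"
        have "t powr (m - 1) * norm (heat ?v t (x n)) \<le> t powr (m - 1) * (C * \<beta> k0 t)"
          using x(1) by (intro mult_left_mono C(2)[OF t]) auto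
        then show "norm (complex_of_real (t powr (m - 1)) * heat ?v t (x n)) \<le> w t" by (simp add: w_def norm_mult mult_ac)
      qed
    qed measurable
  qed
  obtain g where g: "continuous_on (ball x0 (4 * r)) g" "g x0 = 0"
    "\<And>\<phi>. \<phi> \<in> test_functions (ball x0 (4 * r)) \<Longrightarrow>
      (LINT \<xi>|lborel. complex_of_real (norm \<xi> powr (2 * s)) * u \<xi> * inv_fourier \<phi> \<xi>) = (LINT x|lborel. g x * \<phi> x)"
    using frac[OF u] by blast
  have sub: "?V \<subseteq> ball x0 (4 * r)" using r by (intro subset_ball) auto
  have pair: "(LINT x|lborel. vt x * \<phi> x) = (LINT x|lborel. (?P * (complex_of_real (Gamma m) * g x)) * \<phi> x)"
    if \<phi>: "\<phi> \<in> test_functions ?V" for \<phi>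
  proof -
    have S: "\<phi> \<in> schwartz" by (rule test_functions_schwartz[OF \<phi>])
    have [measurable]: "\<phi> \<in> borel_measurable borel" by (rule schwartz_measurable[OF S])
    have out: "\<phi> x = 0" if "x \<notin> ?V" for x
      using \<phi> that closure_subset[of "{x. \<phi> x \<noteq> 0}"] unfolding test_functions_def by blast
    (* extended by 0 to t <= 0, since the bounds on the heat flow only hold for positive times *)
    define f where "f = (\<lambda>t x. if t > 0 then complex_of_real (t powr (m - 1)) * (\<phi> x * heat ?v t x) else 0)"
    have "(LINT t|halfline. LINT x|lborel. f t x) = (LINT x|lborel. LINT t|halfline. f t x)"
    proof (rule fubini_swap(1)[OF sigma_finite_halfline sigma_finite_lborel])
      have hm [measurable]: "(\<lambda>p. heat ?v (fst p) (snd p)) \<in> borel_measurable (halfline \<Otimes>\<^sub>M lborel)"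
        by (subst measurable_cong_sets[OF sets_pair_measure_cong[OF sets_halfline sets_lborel] refl])
           (rule heat_measurable, measurable)
      have "case_prod f = (\<lambda>p. if fst p > 0 then complex_of_real (fst p powr (m - 1)) * (\<phi> (snd p) * heat ?v (fst p) (snd p)) else 0)"
        by (auto simp: f_def fun_eq_iff)
      then show "case_prod f \<in> borel_measurable (halfline \<Otimes>\<^sub>M lborel)" by simp
      show "(\<integral>\<^sup>+x. \<integral>\<^sup>+y. norm (f x y) \<partial>lborel \<partial>halfline) < \<infinity>"
      proof (rule nn_integral_product_bound[OF wi integrable_norm[OF schwartz_integrable[OF S]]])
        fix t x
        have w0: "w t \<ge> 0" using C(1) \<beta>_nonneg by (simp add: w_def)
        show "norm (f t x) \<le> w t * norm (\<phi> x)"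
        proof (cases "t > 0 \<and> x \<in> ?V")
          case True
          have "t powr (m - 1) * (norm (\<phi> x) * norm (heat ?v t x)) \<le> t powr (m - 1) * (norm (\<phi> x) * (C * \<beta> k0 t))"
            using True by (intro mult_left_mono C(2)) auto
          then show ?thesis using True by (simp add: f_def w_def norm_mult mult_ac)
        next
          case False
          then have "f t x = 0" using out by (auto simp: f_def)
          then show ?thesis using w0 by simp
        qed
      qed
    qed
    also have "(LINT x|lborel. LINT t|halfline. f t x) = (LINT x|lborel. vt x * \<phi> x)"
    proof (intro Bochner_Integration.integral_cong refl)
      fix x
      have "(LINT t|halfline. f t x) = (LINT t|halfline. (complex_of_real (t powr (m - 1)) * heat ?v t x) * \<phi> x)"
      proof (rule integral_cong_AE)
        show "AE t in halfline. f t x = (complex_of_real (t powr (m - 1)) * heat ?v t x) * \<phi> x"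
          by (rule AE_halflineI) (simp add: f_def)
      qed (unfold f_def, measurable)
      then show "(LINT t|halfline. f t x) = vt x * \<phi> x" unfolding vt_def by simp
    qed
    also have "(LINT t|halfline. LINT x|lborel. f t x) = (LINT t|halfline. ?P * (complex_of_real (t powr (m - 1)) * (LINT \<xi>|lborel. ?v \<xi> * (gauss t \<xi> * inv_fourier \<phi> \<xi>))))"
    proof (rule integral_cong_AE)
      show "AE t in halfline. (LINT x|lborel. f t x) = ?P * (complex_of_real (t powr (m - 1)) * (LINT \<xi>|lborel. ?v \<xi> * (gauss t \<xi> * inv_fourier \<phi> \<xi>)))"
      proof (rule AE_halflineI)
        fix t :: real assume t: "t > 0"
        show "(LINT x|lborel. f t x) = ?P * (complex_of_real (t powr (m - 1)) * (LINT \<xi>|lborel. ?v \<xi> * (gauss t \<xi> * inv_fourier \<phi> \<xi>)))"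
          unfolding gauss_pairing_heat[OF v t S] using t by (simp add: f_def)
      qed
      show "(\<lambda>t. LINT x|lborel. f t x) \<in> borel_measurable halfline"
      proof (rule sigma_finite_measure.borel_measurable_lebesgue_integral[OF sigma_finite_lborel])
        have hm [measurable]: "(\<lambda>p. heat ?v (fst p) (snd p)) \<in> borel_measurable (halfline \<Otimes>\<^sub>M lborel)"
          by (subst measurable_cong_sets[OF sets_pair_measure_cong[OF sets_halfline sets_lborel] refl])
             (rule heat_measurable, measurable)
        have "case_prod f = (\<lambda>p. if fst p > 0 then complex_of_real (fst p powr (m - 1)) * (\<phi> (snd p) * heat ?v (fst p) (snd p)) else 0)"
          by (auto simp: f_def fun_eq_iff)
        then show "case_prod f \<in> borel_measurable (halfline \<Otimes>\<^sub>M lborel)" by simp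
      qed
      have [measurable]: "inv_fourier \<phi> \<in> borel_measurable borel" by (intro schwartz_measurable schwartz_inv_fourier S)
      have "(\<lambda>t. LINT \<xi>|lborel. ?v \<xi> * (gauss t \<xi> * inv_fourier \<phi> \<xi>)) \<in> borel_measurable halfline"
        unfolding gauss_def
        by (rule sigma_finite_measure.borel_measurable_lebesgue_integral[OF sigma_finite_lborel]) measurable
      then show "(\<lambda>t. ?P * (complex_of_real (t powr (m - 1)) * (LINT \<xi>|lborel. ?v \<xi> * (gauss t \<xi> * inv_fourier \<phi> \<xi>)))) \<in> borel_measurable halfline"
        by measurable
    qed
    also have "\<dots> = ?P * (complex_of_real (Gamma m) * (LINT x|lborel. g x * \<phi> x))"
      using subordinated_pairing[OF u k0 schwartz_inv_fourier[OF S]] g(3)[OF test_functions_mono[OF sub \<phi>]]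
      by (simp add: m_def)
    finally show ?thesis by (simp add: mult.assoc)
  qed
  have "vt x0 = ?P * (complex_of_real (Gamma m) * g x0)"
  proof (rule fundamental_lemma[where U="?V"])
    show "continuous_on ?V (\<lambda>x. ?P * (complex_of_real (Gamma m) * g x))"
      by (intro continuous_intros continuous_on_subset[OF g(1) sub])
  qed (use cont pair r in auto)
  then have "vt x0 = 0" using g(2) by simp
  then show ?thesis by (simp add: vt_def J_def m_def)
qed

text \<open>
  Apply the preceding vanishing to \<open>|\<xi>|\<^sup>2\<^sup>j u\<close> and integrate by parts until no derivative is left.
\<close>

lemma J_moments_vanish:
  assumes u: "u \<in> UU"
  shows "J (- s - 1 - real j) 0 u = 0"
proof -
  obtain k0 :: nat where "s < real k0" using reals_Archimedean2 by blast
  then have k0: "real k0 - s > 0" by simp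
  have "(\<lambda>\<xi>. normsq \<xi> ^ k0 * (normsq \<xi> ^ j * u \<xi>)) = (\<lambda>\<xi>. normsq \<xi> ^ (k0 + j) * u \<xi>)"
    by (simp only: power_add mult.assoc)
  then have "J (real k0 - s - 1) (k0 + j) u = J (real k0 - s - 1) k0 (\<lambda>\<xi>. normsq \<xi> ^ j * u \<xi>)"
    unfolding J_def by (simp only:)
  also have "\<dots> = 0" by (rule J_vanishes[OF normsq_power_closed[OF u] k0])
  finally have "J (real k0 - s - 1 - real (k0 + j)) (k0 + j - (k0 + j)) u = 0"
    by (rule J_vanishes_descend[OF u _ order_refl])
  moreover have "real k0 - s - 1 - real (k0 + j) = - s - 1 - real j" by simp
  ultimately show ?thesis by (simp only: diff_self_eq_0)
qed

text \<open>
  Expand \<open>exp (- a / t)\<close> into its series: each term contributes a vanishing moment. The partial sums are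
  dominated by \<open>exp (a / t)\<close>, which is integrable against the heat flow because \<open>a < c\<close>.
\<close>

lemma bessel_average_vanishes:
  assumes u: "u \<in> UU" and a: "0 < a" "a < c"
  shows "(LINT t|halfline. complex_of_real (t powr (- s - 1) * exp (- (a / t))) * heat u t x0) = 0"
proof -
  define S where "S = (\<lambda>n t. \<Sum>j<n. (- (a / t)) ^ j / fact j)"
  have [measurable]: "(\<lambda>t. heat u t x0) \<in> borel_measurable borel" using heat_meas[OF u, of 0] by simp
  have wi: "integrable halfline (\<lambda>t. complex_of_real (t powr (- s - 1) * exp (a / t)) * heat u t x0)"
    using time_integrable[OF u less_imp_le[OF a(1)] a(2), of "- s - 1" 0 x0] \<gamma> r by simp
  have lim: "(\<lambda>n. LINT t|halfline. complex_of_real (t powr (- s - 1) * S n t) * heat u t x0) \<longlonglongrightarrow>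
     (LINT t|halfline. complex_of_real (t powr (- s - 1) * exp (- (a / t))) * heat u t x0)"
  proof (rule integral_dominated_convergence[where w="\<lambda>t. norm (complex_of_real (t powr (- s - 1) * exp (a / t)) * heat u t x0)"])
    show "integrable halfline (\<lambda>t. norm (complex_of_real (t powr (- s - 1) * exp (a / t)) * heat u t x0))" by (rule integrable_norm[OF wi])
    show "AE t in halfline. (\<lambda>n. complex_of_real (t powr (- s - 1) * S n t) * heat u t x0) \<longlonglongrightarrow> complex_of_real (t powr (- s - 1) * exp (- (a / t))) * heat u t x0"
    proof (intro AE_I2 tendsto_intros)
      fix t
      have "(\<lambda>j. (- (a / t)) ^ j /\<^sub>R fact j) sums exp (- (a / t))" by (rule exp_converges)
      then show "(\<lambda>n. S n t) \<longlonglongrightarrow> exp (- (a / t))" unfolding sums_def S_def by (simp add: divide_inverse_commute)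
    qed
    show "AE t in halfline. norm (complex_of_real (t powr (- s - 1) * S n t) * heat u t x0) \<le> norm (complex_of_real (t powr (- s - 1) * exp (a / t)) * heat u t x0)" for n
    proof (rule AE_halflineI)
      fix t :: real assume t: "t > 0"
      have "\<bar>S n t\<bar> \<le> (\<Sum>j<n. \<bar>(- (a / t)) ^ j / fact j\<bar>)" unfolding S_def by (rule sum_abs)
      also have "\<dots> = (\<Sum>j<n. (a / t) ^ j /\<^sub>R fact j)" using a t by (simp add: abs_mult power_abs divide_inverse_commute)
      also have "\<dots> \<le> suminf (\<lambda>j. (a / t) ^ j /\<^sub>R fact j)"
        using exp_converges[of "a / t"] a t by (intro sum_le_suminf) (auto intro: sums_summable)
      also have "\<dots> = exp (a / t)" using exp_converges[of "a / t"] by (simp add: sums_unique[symmetric])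
      finally have "t powr (- s - 1) * \<bar>S n t\<bar> * norm (heat u t x0) \<le> t powr (- s - 1) * exp (a / t) * norm (heat u t x0)"
        by (intro mult_right_mono mult_left_mono) auto
      then show "norm (complex_of_real (t powr (- s - 1) * S n t) * heat u t x0) \<le> norm (complex_of_real (t powr (- s - 1) * exp (a / t)) * heat u t x0)"
        by (simp add: norm_mult abs_mult)
    qed
  qed (unfold S_def, measurable)
  have zero: "(LINT t|halfline. complex_of_real (t powr (- s - 1) * S n t) * heat u t x0) = 0" for n
  proof -
    have ji: "integrable halfline (\<lambda>t. complex_of_real (t powr (- s - 1 - real j)) * heat u t x0)" for j
      using J_integrable[OF u, of "- s - 1 - real j" 0] \<gamma>(3) by simp
    have "(LINT t|halfline. complex_of_real (t powr (- s - 1) * S n t) * heat u t x0)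
       = (LINT t|halfline. (\<Sum>j<n. complex_of_real ((- a) ^ j / fact j) * (complex_of_real (t powr (- s - 1 - real j)) * heat u t x0)))"
    proof (rule integral_cong_AE)
      show "AE t in halfline. complex_of_real (t powr (- s - 1) * S n t) * heat u t x0
        = (\<Sum>j<n. complex_of_real ((- a) ^ j / fact j) * (complex_of_real (t powr (- s - 1 - real j)) * heat u t x0))"
      proof (rule AE_halflineI)
        fix t :: real assume t: "t > 0"
        have "t powr (- s - 1) * ((- (a / t)) ^ j / fact j) = (- a) ^ j / fact j * t powr (- s - 1 - real j)" for j
        proof -
          have "t powr (- s - 1 - real j) = t powr (- s - 1) / t ^ j" using t by (simp add: powr_diff powr_realpow)
          moreover have "(- (a / t)) ^ j = (- a) ^ j / t ^ j" by (metis divide_minus_left power_divide)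
          ultimately show ?thesis by (simp add: mult_ac)
        qed
        then have "t powr (- s - 1) * S n t = (\<Sum>j<n. (- a) ^ j / fact j * t powr (- s - 1 - real j))"
          unfolding S_def sum_distrib_left by simp
        then show "complex_of_real (t powr (- s - 1) * S n t) * heat u t x0
          = (\<Sum>j<n. complex_of_real ((- a) ^ j / fact j) * (complex_of_real (t powr (- s - 1 - real j)) * heat u t x0))"
          by (simp only: of_real_sum sum_distrib_right of_real_mult mult.assoc)
      qed
    qed (unfold S_def, measurable)
    also have "\<dots> = (\<Sum>j<n. complex_of_real ((- a) ^ j / fact j) * J (- s - 1 - real j) 0 u)"
      using ji by (subst Bochner_Integration.integral_sum) (auto simp: J_def)
    finally show ?thesis using J_moments_vanish[OF u] by simp
  qed
  show ?thesis by (rule LIMSEQ_unique[OF lim]) (unfold zero, rule tendsto_const)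
qed

end

section \<open>Determinacy of the moment problem\<close>

definition monomial :: "'n list \<Rightarrow> 'n::finite cfun"
  where "monomial L \<xi> = (\<Prod>i\<leftarrow>L. complex_of_real (\<xi> $ i))"

lemma monomial_slow_growth: "slow_growth (monomial L)"
  unfolding monomial_def by (induction L) (auto intro: slow_growth_mult)

lemma monomial_measurable [measurable]: "monomial L \<in> borel_measurable borel"
  by (intro borel_measurable_continuous_onI slow_growth_continuous monomial_slow_growth)

lemma norm_monomial_le: "norm (monomial L \<xi>) \<le> norm \<xi> ^ length L"
proof (induction L)
  case (Cons i L)
  have "norm (monomial (i # L) \<xi>) = \<bar>\<xi> $ i\<bar> * norm (monomial L \<xi>)" by (simp add: monomial_def norm_mult)
  also have "\<dots> \<le> norm \<xi> * norm \<xi> ^ length L" by (intro mult_mono Cons component_le_norm_cart) auto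
  finally show ?case by simp
qed (simp add: monomial_def)

lemma power_le_exp:
  assumes "\<delta> > 0" "(x::real) \<ge> 0"
  shows "x ^ k \<le> fact k / \<delta> ^ k * exp (\<delta> * x)"
proof -
  have "(\<delta> * x) ^ k / fact k \<le> exp (\<delta> * x)" using assms by (intro exp_ge_power_div_fact) auto
  then show ?thesis using assms by (simp add: field_simps power_mult_distrib)
qed

lemma exponential_moments_integrable:
  fixes \<Theta> :: "'n::finite cfun"
  assumes [measurable]: "\<Theta> \<in> borel_measurable borel" "g \<in> borel_measurable borel"
    and int: "integrable lborel (\<lambda>\<xi>. norm (\<Theta> \<xi>) * exp (\<delta> * norm \<xi>))"
    and g: "\<And>\<xi>. norm (g \<xi>) \<le> C * exp (\<delta> * norm \<xi>)"
  shows "integrable lborel (\<lambda>\<xi>. g \<xi> * \<Theta> \<xi>)"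
proof (rule Bochner_Integration.integrable_bound)
  show "integrable lborel (\<lambda>\<xi>. C * (norm (\<Theta> \<xi>) * exp (\<delta> * norm \<xi>)))" using int by (rule integrable_mult_right)
  show "AE \<xi> in lborel. norm (g \<xi> * \<Theta> \<xi>) \<le> norm (C * (norm (\<Theta> \<xi>) * exp (\<delta> * norm \<xi>)))"
  proof (rule AE_I2)
    fix \<xi>
    have "norm (g \<xi> * \<Theta> \<xi>) \<le> C * exp (\<delta> * norm \<xi>) * norm (\<Theta> \<xi>)" unfolding norm_mult by (intro mult_right_mono g) auto
    also have "\<dots> \<le> norm (C * (norm (\<Theta> \<xi>) * exp (\<delta> * norm \<xi>)))" by (simp add: abs_mult mult_ac mult_right_mono mult_left_mono)
    finally show "norm (g \<xi> * \<Theta> \<xi>) \<le> norm (C * (norm (\<Theta> \<xi>) * exp (\<delta> * norm \<xi>)))" .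
  qed
qed measurable

text \<open>
  The exponential series of a character \<open>exp (i z \<xi>)\<close> with \<open>|z| \<le> \<delta> / 2\<close> converges under the integral,
  dominated by half of the available exponential moment; the other half is left for the monomial. The
  conclusion says that the moments still vanish after multiplication by the character.
\<close>

lemma moment_step:
  fixes \<Theta> :: "'n::finite cfun" and z :: "real ^ 'n"
  assumes m [measurable]: "\<Theta> \<in> borel_measurable borel" and \<delta>: "\<delta> > 0"
    and int: "integrable lborel (\<lambda>\<xi>. norm (\<Theta> \<xi>) * exp (\<delta> * norm \<xi>))"
    and mom: "\<And>L. (LINT \<xi>|lborel. monomial L \<xi> * \<Theta> \<xi>) = 0"
    and z: "norm z \<le> \<delta> / 2"
  shows "(LINT \<xi>|lborel. monomial L \<xi> * (exp (\<i> * complex_of_real (z \<bullet> \<xi>)) * \<Theta> \<xi>)) = 0"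
proof -
  have gi: "integrable lborel (\<lambda>\<xi>. (complex_of_real (z \<bullet> \<xi>) ^ k * monomial L \<xi>) * \<Theta> \<xi>)" for k L
  proof (rule exponential_moments_integrable[OF m _ int])
    show "(\<lambda>\<xi>. complex_of_real (z \<bullet> \<xi>) ^ k * monomial L \<xi>) \<in> borel_measurable borel" by measurable
    fix \<xi> :: "real^'n"
    have "norm (complex_of_real (z \<bullet> \<xi>) ^ k * monomial L \<xi>) \<le> (norm z * norm \<xi>) ^ k * norm \<xi> ^ length L"
      unfolding norm_mult norm_power norm_of_real
      by (intro mult_mono power_mono norm_monomial_le Cauchy_Schwarz_ineq2) auto
    also have "\<dots> = norm z ^ k * norm \<xi> ^ (k + length L)" by (simp add: power_add power_mult_distrib)
    also have "\<dots> \<le> norm z ^ k * (fact (k + length L) / \<delta> ^ (k + length L) * exp (\<delta> * norm \<xi>))"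
      using \<delta> by (intro mult_left_mono power_le_exp) auto
    finally show "norm (complex_of_real (z \<bullet> \<xi>) ^ k * monomial L \<xi>) \<le> (norm z ^ k * (fact (k + length L) / \<delta> ^ (k + length L))) * exp (\<delta> * norm \<xi>)"
      by (simp only: mult.assoc)
  qed
  have zero: "(LINT \<xi>|lborel. (complex_of_real (z \<bullet> \<xi>) ^ k * monomial L \<xi>) * \<Theta> \<xi>) = 0" for k L
  proof (induction k arbitrary: L)
    case 0 then show ?case using mom by simp
  next
    case (Suc k)
    have "(complex_of_real (z \<bullet> \<xi>) ^ Suc k * monomial L \<xi>) * \<Theta> \<xi>
      = (\<Sum>i\<in>UNIV. complex_of_real (z $ i) * ((complex_of_real (z \<bullet> \<xi>) ^ k * monomial (i # L) \<xi>) * \<Theta> \<xi>))" for \<xi>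
    proof -
      have "complex_of_real (z \<bullet> \<xi>) = (\<Sum>i\<in>UNIV. complex_of_real (z $ i) * complex_of_real (\<xi> $ i))"
        by (simp add: inner_vec_def)
      then have "(complex_of_real (z \<bullet> \<xi>) ^ Suc k * monomial L \<xi>) * \<Theta> \<xi>
        = (\<Sum>i\<in>UNIV. complex_of_real (z $ i) * complex_of_real (\<xi> $ i)) * ((complex_of_real (z \<bullet> \<xi>) ^ k * monomial L \<xi>) * \<Theta> \<xi>)"
        by (simp only: power_Suc mult.assoc)
      then show ?thesis
        unfolding sum_distrib_right by (simp only:) (intro sum.cong refl, simp add: monomial_def mult_ac)
    qed
    then have "(LINT \<xi>|lborel. (complex_of_real (z \<bullet> \<xi>) ^ Suc k * monomial L \<xi>) * \<Theta> \<xi>)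
      = (\<Sum>i\<in>UNIV. LINT \<xi>|lborel. complex_of_real (z $ i) * ((complex_of_real (z \<bullet> \<xi>) ^ k * monomial (i # L) \<xi>) * \<Theta> \<xi>))"
      using gi by (simp only:) (rule Bochner_Integration.integral_sum, rule integrable_mult_right, rule gi)
    then show ?case by (simp only: integral_mult_right_zero Suc.IH) simp
  qed
  define S where "S = (\<lambda>n \<xi>. \<Sum>k<n. (\<i> * complex_of_real (z \<bullet> \<xi>)) ^ k /\<^sub>R fact k)"
  let ?e = "\<lambda>\<xi>. exp (\<i> * complex_of_real (z \<bullet> \<xi>))"
  define C where "C = fact (length L) / (\<delta> / 2) ^ length L"
  have bi: "integrable lborel (\<lambda>\<xi>. C * (norm (\<Theta> \<xi>) * exp (\<delta> * norm \<xi>)))" using int by (rule integrable_mult_right)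
  have lim: "(\<lambda>n. LINT \<xi>|lborel. monomial L \<xi> * (S n \<xi> * \<Theta> \<xi>)) \<longlonglongrightarrow> (LINT \<xi>|lborel. monomial L \<xi> * (?e \<xi> * \<Theta> \<xi>))"
  proof (rule integral_dominated_convergence[OF _ _ bi])
    show "AE \<xi> in lborel. (\<lambda>n. monomial L \<xi> * (S n \<xi> * \<Theta> \<xi>)) \<longlonglongrightarrow> monomial L \<xi> * (?e \<xi> * \<Theta> \<xi>)"
    proof (intro AE_I2 tendsto_intros)
      fix \<xi>
      show "(\<lambda>n. S n \<xi>) \<longlonglongrightarrow> ?e \<xi>" using exp_converges[of "\<i> * complex_of_real (z \<bullet> \<xi>)"] unfolding sums_def S_def .
    qed
    show "AE \<xi> in lborel. norm (monomial L \<xi> * (S n \<xi> * \<Theta> \<xi>)) \<le> C * (norm (\<Theta> \<xi>) * exp (\<delta> * norm \<xi>))" for n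
    proof (rule AE_I2)
      fix \<xi> :: "real^'n"
      have "norm (S n \<xi>) \<le> (\<Sum>k<n. norm ((\<i> * complex_of_real (z \<bullet> \<xi>)) ^ k /\<^sub>R fact k))" unfolding S_def by (rule norm_sum)
      also have "\<dots> = (\<Sum>k<n. \<bar>z \<bullet> \<xi>\<bar> ^ k /\<^sub>R fact k)" by (simp add: norm_power norm_mult)
      also have "\<dots> \<le> suminf (\<lambda>k. \<bar>z \<bullet> \<xi>\<bar> ^ k /\<^sub>R fact k)"
        using exp_converges[of "\<bar>z \<bullet> \<xi>\<bar>"] by (intro sum_le_suminf) (auto intro: sums_summable)
      also have "\<dots> = exp \<bar>z \<bullet> \<xi>\<bar>" using exp_converges[of "\<bar>z \<bullet> \<xi>\<bar>"] by (simp add: sums_unique[symmetric])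
      also have "\<dots> \<le> exp (\<delta> / 2 * norm \<xi>)"
      proof -
        have "\<bar>z \<bullet> \<xi>\<bar> \<le> norm z * norm \<xi>" by (rule Cauchy_Schwarz_ineq2)
        also have "\<dots> \<le> \<delta> / 2 * norm \<xi>" using z by (intro mult_right_mono) auto
        finally show ?thesis by simp
      qed
      finally have S: "norm (S n \<xi>) \<le> exp (\<delta> / 2 * norm \<xi>)" .
      have M: "norm (monomial L \<xi>) \<le> C * exp (\<delta> / 2 * norm \<xi>)"
        unfolding C_def using \<delta> by (intro order_trans[OF norm_monomial_le power_le_exp]) auto
      have "norm (monomial L \<xi> * (S n \<xi> * \<Theta> \<xi>)) = (norm (monomial L \<xi>) * norm (S n \<xi>)) * norm (\<Theta> \<xi>)" by (simp add: norm_mult)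
      also have "\<dots> \<le> ((C * exp (\<delta> / 2 * norm \<xi>)) * exp (\<delta> / 2 * norm \<xi>)) * norm (\<Theta> \<xi>)"
        using \<delta> by (intro mult_right_mono mult_mono M S) (auto simp: C_def)
      also have "\<dots> = C * (norm (\<Theta> \<xi>) * (exp (\<delta> / 2 * norm \<xi>) * exp (\<delta> / 2 * norm \<xi>)))" by (simp only: mult_ac)
      also have "exp (\<delta> / 2 * norm \<xi>) * exp (\<delta> / 2 * norm \<xi>) = exp (\<delta> * norm \<xi>)" by (simp add: mult_exp_exp)
      finally show "norm (monomial L \<xi> * (S n \<xi> * \<Theta> \<xi>)) \<le> C * (norm (\<Theta> \<xi>) * exp (\<delta> * norm \<xi>))" .
    qed
  qed (unfold S_def, measurable)
  have S0: "(LINT \<xi>|lborel. monomial L \<xi> * (S n \<xi> * \<Theta> \<xi>)) = 0" for n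
  proof -
    have "monomial L \<xi> * (S n \<xi> * \<Theta> \<xi>) = (\<Sum>k<n. (\<i> ^ k /\<^sub>R fact k) * ((complex_of_real (z \<bullet> \<xi>) ^ k * monomial L \<xi>) * \<Theta> \<xi>))" for \<xi>
      unfolding S_def sum_distrib_left sum_distrib_right
      by (intro sum.cong refl) (simp add: power_mult_distrib scaleR_conv_of_real mult_ac)
    then have "(LINT \<xi>|lborel. monomial L \<xi> * (S n \<xi> * \<Theta> \<xi>)) = (\<Sum>k<n. LINT \<xi>|lborel. (\<i> ^ k /\<^sub>R fact k) * ((complex_of_real (z \<bullet> \<xi>) ^ k * monomial L \<xi>) * \<Theta> \<xi>))"
      by (simp only:) (rule Bochner_Integration.integral_sum, rule integrable_mult_right, rule gi)
    then show ?thesis by (simp only: integral_mult_right_zero zero) simp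
  qed
  show ?thesis by (rule LIMSEQ_unique[OF lim]) (unfold S0, rule tendsto_const)
qed

text \<open>
  One step reaches only frequencies \<open>z\<close> up to \<open>\<delta> / 2\<close>. Since multiplication by a character preserves the
  hypotheses, with the same \<open>\<delta>\<close>, finitely many steps reach every frequency \<open>y\<close>.
\<close>

theorem moments_determine:
  fixes \<Theta> :: "'n::finite cfun"
  assumes m: "\<Theta> \<in> borel_measurable borel" and \<delta>: "\<delta> > 0"
    and int: "integrable lborel (\<lambda>\<xi>. norm (\<Theta> \<xi>) * exp (\<delta> * norm \<xi>))"
    and mom: "\<And>L. (LINT \<xi>|lborel. monomial L \<xi> * \<Theta> \<xi>) = 0"
  shows "(LINT \<xi>|lborel. exp (\<i> * complex_of_real (y \<bullet> \<xi>)) * \<Theta> \<xi>) = 0"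
proof -
  obtain N :: nat where N: "2 * norm y / \<delta> < real N" using reals_Archimedean2 by blast
  have N0: "real N > 0" using N \<delta> by (smt (verit, best) divide_nonneg_pos norm_ge_zero)
  (* the frequency y is reached in N equal steps *)
  define z where "z = y /\<^sub>R real N"
  have z: "norm z \<le> \<delta> / 2" using N N0 \<delta> by (simp add: z_def field_simps)
  have "(LINT \<xi>|lborel. monomial L \<xi> * (exp (\<i> * complex_of_real ((real k *\<^sub>R z) \<bullet> \<xi>)) * \<Theta> \<xi>)) = 0" for k L
  proof (induction k arbitrary: L)
    case 0 then show ?case using mom by simp
  next
    case (Suc k)
    let ?\<Psi> = "\<lambda>\<xi>. exp (\<i> * complex_of_real ((real k *\<^sub>R z) \<bullet> \<xi>)) * \<Theta> \<xi>"
    have "(LINT \<xi>|lborel. monomial L \<xi> * (exp (\<i> * complex_of_real (z \<bullet> \<xi>)) * ?\<Psi> \<xi>)) = 0"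
    proof (rule moment_step[OF _ \<delta> _ Suc.IH z])
      show "?\<Psi> \<in> borel_measurable borel" using m by measurable
      show "integrable lborel (\<lambda>\<xi>. norm (?\<Psi> \<xi>) * exp (\<delta> * norm \<xi>))" using int by (simp add: norm_mult)
    qed
    moreover have "exp (\<i> * complex_of_real (z \<bullet> \<xi>)) * ?\<Psi> \<xi> = exp (\<i> * complex_of_real ((real (Suc k) *\<^sub>R z) \<bullet> \<xi>)) * \<Theta> \<xi>" for \<xi>
      unfolding mult.assoc[symmetric] mult_exp_exp by (simp add: inner_add_left scaleR_left_distrib distrib_left)
    ultimately show ?case by (simp only:)
  qed
  from this[of "[]" N] show ?thesis using N0 by (simp add: z_def monomial_def)
qed

context continuation_class
begin

lemma monomial_closed: "u \<in> UU \<Longrightarrow> (\<lambda>\<xi>. monomial L \<xi> * u \<xi>) \<in> UU"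
proof (induction L)
  case (Cons i L)
  from coord[OF Cons.IH[OF Cons.prems], of i] show ?case by (simp add: monomial_def mult.assoc)
qed (simp add: monomial_def)

section \<open>The Bessel kernel\<close>

text \<open>
  Up to a constant, \<open>|\<xi>|\<^sup>s\<close> times the modified Bessel function of the second kind of order \<open>s\<close> at
  \<open>2 \<surd>a |\<xi>|\<close>.
\<close>

definition K :: "real \<Rightarrow> real ^ 'n \<Rightarrow> real"
  where "K a \<xi> = (LINT t|halfline. t powr (- s - 1) * exp (- (a / t)) * exp (- (t * (norm \<xi>)\<^sup>2)))"

lemma bessel_integrand_integrable:
  assumes a: "a > 0" and \<xi>: "\<xi> \<noteq> 0"
  shows "integrable halfline (\<lambda>t. t powr (- s - 1) * exp (- (a / t)) * exp (- (t * (norm \<xi>)\<^sup>2)))"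
proof (rule integrableI_nonneg)
  define y where "y = (norm \<xi>)\<^sup>2"
  have y: "y > 0" using \<xi> by (simp add: y_def)
  obtain D where D: "D > 0" "\<And>t. 0 < t \<Longrightarrow> t \<le> 1 \<Longrightarrow> t powr (- s - 1) * exp (- (a / t)) \<le> D"
    using powr_exp_inverse_bound[OF a, of "- s - 1"] by blast
  (* a nonnegative exponent is needed for the bound by an exponential *)
  define b where "b = max 0 (1 - s)"
  obtain E where E: "E > 0" "\<And>x. x \<ge> 0 \<Longrightarrow> x powr b * exp (- (x / 2)) \<le> E"
    using powr_exp_bound[of b] by (auto simp: b_def)
  define C where "C = max D (E / (2 * y) powr b)"
  show "(\<integral>\<^sup>+t. ennreal (t powr (- s - 1) * exp (- (a / t)) * exp (- (t * (norm \<xi>)\<^sup>2))) \<partial>halfline) < \<infinity>"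
  proof (rule nn_integral_halfline_powr[where a=0 and b="-2" and C=C])
    fix t :: real
    show "t powr (- s - 1) * exp (- (a / t)) * exp (- (t * (norm \<xi>)\<^sup>2)) \<le> C * t powr 0" if t: "0 < t" "t \<le> 1"
    proof -
      have "t powr (- s - 1) * exp (- (a / t)) * exp (- (t * (norm \<xi>)\<^sup>2)) \<le> D * 1"
        using D t by (intro mult_mono) auto
      then show ?thesis using t by (simp add: C_def le_max_iff_disj)
    qed
    show "t powr (- s - 1) * exp (- (a / t)) * exp (- (t * (norm \<xi>)\<^sup>2)) \<le> C * t powr - 2" if t: "1 \<le> t"
    proof -
      have "t powr (- s - 1) = t powr (1 - s) * t powr (- 2)"
        unfolding powr_add[symmetric] by (rule arg_cong[where f="(powr) t"]) simp
      also have "\<dots> \<le> t powr b * t powr (- 2)" using t by (intro mult_right_mono powr_mono) (auto simp: b_def)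
      finally have 1: "t powr (- s - 1) \<le> t powr b * t powr (- 2)" .
      have "(2 * y * t) powr b * exp (- (2 * y * t / 2)) \<le> E" using y t by (intro E(2)) auto
      then have "(2 * y) powr b * (t powr b * exp (- (t * y))) \<le> E" using y t by (simp add: powr_mult mult_ac)
      then have 2: "t powr b * exp (- (t * y)) \<le> E / (2 * y) powr b" using y by (simp add: pos_le_divide_eq mult.commute)
      have "t powr (- s - 1) * exp (- (a / t)) * exp (- (t * y)) \<le> (t powr b * t powr (- 2)) * 1 * exp (- (t * y))"
        using a t by (intro mult_right_mono mult_mono 1) auto
      also have "\<dots> = (t powr b * exp (- (t * y))) * t powr (- 2)" by simp
      also have "\<dots> \<le> C * t powr (- 2)" using 2 by (intro mult_right_mono) (auto simp: C_def le_max_iff_disj)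
      finally show ?thesis by (simp add: y_def)
    qed
  qed auto
qed (auto intro!: measurable_compose_countable)

lemma K_pos:
  assumes a: "a > 0" and \<xi>: "\<xi> \<noteq> 0"
  shows "K a \<xi> > 0"
proof (rule ccontr)
  let ?f = "\<lambda>t. t powr (- s - 1) * exp (- (a / t)) * exp (- (t * (norm \<xi>)\<^sup>2))"
  assume "\<not> K a \<xi> > 0"
  moreover have "K a \<xi> \<ge> 0" unfolding K_def by (intro integral_nonneg_AE) auto
  ultimately have "K a \<xi> = 0" by linarith
  then have "(LINT t|halfline. ?f t) = 0" unfolding K_def .
  moreover have "AE t in halfline. 0 \<le> ?f t" by (rule AE_I2) simp
  ultimately have "AE t in halfline. ?f t = 0"
    using integral_nonneg_eq_0_iff_AE[OF bessel_integrand_integrable[OF assms]] by simp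
  then have "AE t in halfline. False" using AE_halfline
  proof eventually_elim
    case (elim t)
    then show ?case by simp
  qed
  then have "AE t in lborel. t \<notin> {0::real<..}"
    unfolding halfline_def by (subst (asm) AE_density) (auto simp: indicator_def elim!: eventually_mono)
  moreover have "{0::real<..} \<noteq> {}" by simp
  ultimately show False by (intro open_not_AE_null[of "{0::real<..}"]) auto
qed

end

lemma fourier_transform_determines:
  fixes \<Theta> :: "'n::finite cfun"
  assumes \<Theta>: "integrable lborel \<Theta>"
    and zero: "\<And>y. (LINT \<xi>|lborel. exp (\<i> * complex_of_real (y \<bullet> \<xi>)) * \<Theta> \<xi>) = 0"
    and \<phi>: "\<phi> \<in> schwartz"
  shows "(LINT \<xi>|lborel. \<Theta> \<xi> * \<phi> \<xi>) = 0"
proof -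
  define \<psi> where "\<psi> = fourier \<phi>"
  have \<psi>: "\<psi> \<in> schwartz" unfolding \<psi>_def by (rule schwartz_fourier[OF \<phi>])
  have [measurable]: "\<psi> \<in> borel_measurable borel" "\<Theta> \<in> borel_measurable borel"
    using \<Theta> schwartz_measurable[OF \<psi>] by auto
  define f where "f = (\<lambda>\<xi> y. \<Theta> \<xi> * (exp (\<i> * complex_of_real (\<xi> \<bullet> y)) * \<psi> y))"
  have "(LINT \<xi>|lborel. LINT y|lborel. f \<xi> y) = (LINT y|lborel. LINT \<xi>|lborel. f \<xi> y)"
  proof (rule fubini_swap(1)[OF sigma_finite_lborel sigma_finite_lborel])
    show "case_prod f \<in> borel_measurable (lborel \<Otimes>\<^sub>M lborel)" unfolding f_def by measurable
    show "(\<integral>\<^sup>+x. \<integral>\<^sup>+y. norm (f x y) \<partial>lborel \<partial>lborel) < \<infinity>"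
      using integrable_norm[OF \<Theta>] integrable_norm[OF schwartz_integrable[OF \<psi>]]
      by (rule nn_integral_product_bound) (simp add: f_def norm_mult)
  qed
  moreover have "(LINT \<xi>|lborel. f \<xi> y) = 0" for y
  proof -
    have "(LINT \<xi>|lborel. f \<xi> y) = (LINT \<xi>|lborel. \<psi> y * (exp (\<i> * complex_of_real (y \<bullet> \<xi>)) * \<Theta> \<xi>))"
      unfolding f_def by (simp add: inner_commute mult_ac)
    then show ?thesis by (simp only: integral_mult_right_zero zero) simp
  qed
  moreover have "(LINT y|lborel. f \<xi> y) = \<Theta> \<xi> * \<phi> \<xi> * of_real ((2 * pi) ^ CARD('n))" for \<xi>
  proof -
    have "(LINT y|lborel. f \<xi> y) = \<Theta> \<xi> * (inv_fourier \<psi> \<xi> * of_real ((2 * pi) ^ CARD('n)))"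
      unfolding f_def inv_fourier_def by simp
    then show ?thesis unfolding \<psi>_def fourier_inversion[OF \<phi>] by simp
  qed
  ultimately show ?thesis by simp
qed

context continuation_class
begin

lemma K_measurable [measurable]: "K a \<in> borel_measurable borel"
  unfolding K_def
  by (rule sigma_finite_measure.borel_measurable_lebesgue_integral[OF sigma_finite_halfline]) measurable

text \<open>
  The factor \<open>exp (- a / (2 t))\<close> compensates the polynomial growth of the heat flow as \<open>t\<close> tends to
  \<open>0\<close>; at infinity the decay \<open>t\<^bsup>-\<gamma>/2\<^esup>\<close> suffices because \<open>- s < \<gamma> / 2\<close>.
\<close>

lemma bessel_weight_finite:
  assumes u: "u \<in> UU" and a: "a > 0"
  shows "(\<integral>\<^sup>+t. ennreal (t powr (- s - 1) * exp (- (a / 2 / t)) * (LINT \<xi>|lborel. norm (u \<xi>) * exp (- (t / 2 * (norm \<xi>)\<^sup>2)))) \<partial>halfline) < \<infinity>"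
proof -
  define N where "N = (\<lambda>t. LINT \<xi>|lborel. norm (u \<xi>) * exp (- (t / 2 * (norm \<xi>)\<^sup>2)))"
  have [measurable]: "u \<in> borel_measurable borel" by (rule moderate_measurable[OF mod[OF u]])
  have [measurable]: "N \<in> borel_measurable borel" unfolding N_def
    by (rule sigma_finite_measure.borel_measurable_lebesgue_integral[OF sigma_finite_lborel]) measurable
  have N0: "N t \<ge> 0" for t unfolding N_def by (intro integral_nonneg_AE) auto
  obtain C1 L where C1: "C1 > 0" "\<And>t. 0 < t \<Longrightarrow> t \<le> 1 \<Longrightarrow> (LINT \<xi>|lborel. norm (u \<xi>) * exp (- (t * (norm \<xi>)\<^sup>2))) \<le> C1 * (1 / t) ^ L"
    using heat_growth_small_time[OF mod[OF u]] by blast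
  obtain C2 where C2: "C2 > 0" "\<And>t. t \<ge> 1 \<Longrightarrow> (LINT \<xi>|lborel. norm (normsq \<xi> ^ 0 * u \<xi>) * exp (- (t * (norm \<xi>)\<^sup>2))) \<le> C2 * t powr (- (real 0 + \<gamma> / 2))"
    using heat_decay_large_time[OF mod[OF u] \<gamma>(1,2), where k=0] by blast
  obtain D where D: "D > 0" "\<And>t. 0 < t \<Longrightarrow> t \<le> 1 \<Longrightarrow> t powr (- s - 1 - real L) * exp (- (a / 2 / t)) \<le> D"
    using powr_exp_inverse_bound[of "a / 2" "- s - 1 - real L"] a by auto
  define B where "B = C1 * 2 ^ L"
  define E where "E = max B C2 * 2 powr (\<gamma> / 2)"
  have B: "B > 0" using C1 by (simp add: B_def)
  have Ns: "N t \<le> B * t powr (- real L)" if "0 < t" "t \<le> 2" for t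
  proof -
    have "N t \<le> C1 * (1 / (t / 2)) ^ L" using C1(2)[of "t / 2"] that by (simp add: N_def)
    also have "(1 / (t / 2)) ^ L = 2 ^ L * t powr (- real L)"
    proof -
      have "1 / (t / 2) = 2 * inverse t" using that by (simp add: field_simps)
      then show ?thesis using that by (simp only: powr_minus powr_realpow power_mult_distrib power_inverse)
    qed
    finally show ?thesis by (simp only: B_def mult.assoc)
  qed
  have Nl: "N t \<le> E * t powr (- (\<gamma> / 2))" if t: "1 \<le> t" for t
  proof (cases "t \<le> 2")
    case True
    have "N t \<le> B * t powr (- real L)" using Ns t True by simp
    also have "\<dots> \<le> B * 1" using B t by (intro mult_left_mono) (auto simp: powr_minus powr_realpow inverse_le_1_iff)
    also have "\<dots> \<le> max B C2 * ((2 / t) powr (\<gamma> / 2))" using B t True \<gamma> by (intro mult_mono ge_one_powr_ge_zero) auto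
    also have "(2 / t) powr (\<gamma> / 2) = 2 powr (\<gamma> / 2) * t powr (- (\<gamma> / 2))"
      using t by (simp add: powr_divide powr_minus_divide)
    finally show ?thesis by (simp only: E_def mult.assoc)
  next
    case False
    have "N t \<le> C2 * (t / 2) powr (- (\<gamma> / 2))" using C2(2)[of "t / 2"] False by (simp add: N_def)
    also have "\<dots> \<le> max B C2 * (t / 2) powr (- (\<gamma> / 2))" by (intro mult_right_mono) auto
    also have "(t / 2) powr (- (\<gamma> / 2)) = 2 powr (\<gamma> / 2) * t powr (- (\<gamma> / 2))"
      using t by (simp add: powr_divide powr_minus_divide)
    finally show ?thesis by (simp only: E_def mult.assoc)
  qed
  define C where "C = max (B * D) E"
  have Nt: "(LINT \<xi>|lborel. norm (u \<xi>) * exp (- (t / 2 * (norm \<xi>)\<^sup>2))) = N t" for t by (simp add: N_def)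
  show ?thesis
    unfolding Nt
  proof (rule nn_integral_halfline_powr[where a=0 and b="- s - 1 - \<gamma> / 2" and C=C])
    show "- s - 1 - \<gamma> / 2 < - 1" using \<gamma>(3) by simp
    fix t :: real
    show "t powr (- s - 1) * exp (- (a / 2 / t)) * N t \<le> C * t powr 0" if t: "0 < t" "t \<le> 1"
    proof -
      have "t powr (- s - 1) * exp (- (a / 2 / t)) * N t \<le> t powr (- s - 1) * exp (- (a / 2 / t)) * (B * t powr (- real L))"
        using t by (intro mult_left_mono Ns) auto
      also have "\<dots> = B * ((t powr (- s - 1) * t powr (- real L)) * exp (- (a / 2 / t)))" by (simp only: mult_ac)
      also have "t powr (- s - 1) * t powr (- real L) = t powr (- s - 1 - real L)" by (simp flip: powr_add)
      also have "B * (t powr (- s - 1 - real L) * exp (- (a / 2 / t))) \<le> B * D" using B t by (intro mult_left_mono D) auto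
      finally show ?thesis using t by (simp add: C_def)
    qed
    show "t powr (- s - 1) * exp (- (a / 2 / t)) * N t \<le> C * t powr (- s - 1 - \<gamma> / 2)" if t: "1 \<le> t"
    proof -
      have "t powr (- s - 1) * exp (- (a / 2 / t)) * N t \<le> t powr (- s - 1) * 1 * (E * t powr (- (\<gamma> / 2)))"
        using t a by (intro mult_mono Nl N0) auto
      also have "\<dots> = E * (t powr (- s - 1) * t powr (- (\<gamma> / 2)))" by simp
      also have "t powr (- s - 1) * t powr (- (\<gamma> / 2)) = t powr (- s - 1 - \<gamma> / 2)" by (simp flip: powr_add)
      also have "E * \<dots> \<le> C * \<dots>" by (intro mult_right_mono) (auto simp: C_def)
      finally show ?thesis .
    qed
  qed auto
qed

text \<open>
  The exponential decay of the kernel is never computed. It enters through the inequality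
  \<open>\<delta> |\<xi>| \<le> \<delta>\<^sup>2 / (2 t) + t |\<xi>|\<^sup>2 / 2\<close>, which pays for the factor \<open>exp (\<delta> |\<xi>|)\<close> with one half of each of
  the two exponents in the kernel when \<open>\<delta>\<^sup>2 \<le> a\<close>. The case \<open>\<delta> = 0\<close> is the exchange of the
  integrals, the case \<open>\<delta> = \<surd>a\<close> the exponential moment.
\<close>

lemma bessel_kernel_pairing:
  assumes u: "u \<in> UU" and a: "a > 0" and \<delta>: "\<delta> \<ge> 0" "\<delta>\<^sup>2 \<le> a"
  shows "integrable lborel (\<lambda>\<xi>. (u \<xi> * exp (\<i> * complex_of_real (x0 \<bullet> \<xi>)) * complex_of_real (K a \<xi>)) * complex_of_real (exp (\<delta> * norm \<xi>)))"
    and "(LINT \<xi>|lborel. (u \<xi> * exp (\<i> * complex_of_real (x0 \<bullet> \<xi>)) * complex_of_real (K a \<xi>)) * complex_of_real (exp (\<delta> * norm \<xi>))) = (LINT t|halfline. complex_of_real (t powr (- s - 1) * exp (- (a / t))) *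
      (LINT \<xi>|lborel. u \<xi> * (gauss t \<xi> * exp (\<i> * complex_of_real (x0 \<bullet> \<xi>))) * complex_of_real (exp (\<delta> * norm \<xi>))))"
proof -
  let ?g = "\<lambda>\<xi>. (u \<xi> * exp (\<i> * complex_of_real (x0 \<bullet> \<xi>)) * complex_of_real (K a \<xi>)) * complex_of_real (exp (\<delta> * norm \<xi>))"
  have [measurable]: "u \<in> borel_measurable borel" by (rule moderate_measurable[OF mod[OF u]])
  define f where "f = (\<lambda>\<xi> t. complex_of_real (t powr (- s - 1) * exp (- (a / t))) *
      (u \<xi> * (gauss t \<xi> * exp (\<i> * complex_of_real (x0 \<bullet> \<xi>))) * complex_of_real (exp (\<delta> * norm \<xi>))))"
  have fm: "case_prod f \<in> borel_measurable (lborel \<Otimes>\<^sub>M halfline)" unfolding f_def gauss_def by measurable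
  have fm': "case_prod (\<lambda>t \<xi>. ennreal (norm (f \<xi> t))) \<in> borel_measurable (halfline \<Otimes>\<^sub>M lborel)" unfolding f_def gauss_def by measurable
  have fin: "(\<integral>\<^sup>+\<xi>. \<integral>\<^sup>+t. norm (f \<xi> t) \<partial>halfline \<partial>lborel) < \<infinity>"
  proof -
    have "(\<integral>\<^sup>+\<xi>. \<integral>\<^sup>+t. norm (f \<xi> t) \<partial>halfline \<partial>lborel) = (\<integral>\<^sup>+t. \<integral>\<^sup>+\<xi>. norm (f \<xi> t) \<partial>lborel \<partial>halfline)"
      by (rule tonelli_swap[OF sigma_finite_halfline sigma_finite_lborel fm', symmetric])
    also have "\<dots> \<le> (\<integral>\<^sup>+t. ennreal (t powr (- s - 1) * exp (- (a / 2 / t)) * (LINT \<xi>|lborel. norm (u \<xi>) * exp (- (t / 2 * (norm \<xi>)\<^sup>2)))) \<partial>halfline)"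
    proof (rule nn_integral_mono_AE, rule AE_halflineI)
      fix t :: real assume t: "t > 0"
      let ?p = "t powr (- s - 1) * exp (- (a / 2 / t))"
      let ?h = "\<lambda>\<xi>. norm (u \<xi>) * exp (- (t / 2 * (norm \<xi>)\<^sup>2))"
      have hi: "integrable lborel ?h" using abs_gauss_integrable[OF mod[OF u], of "t / 2"] t by simp
      have "norm (f \<xi> t) \<le> ?p * ?h \<xi>" for \<xi>
      proof -
        have "0 \<le> (\<delta> - t * norm \<xi>)\<^sup>2 / (2 * t)" using t by simp
        also have "\<dots> = \<delta>\<^sup>2 / 2 / t - \<delta> * norm \<xi> + t / 2 * (norm \<xi>)\<^sup>2"
          using t by (simp add: field_simps power2_eq_square)
        also have "\<dots> \<le> a / 2 / t - \<delta> * norm \<xi> + t / 2 * (norm \<xi>)\<^sup>2" using \<delta> t by (simp add: divide_right_mono)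
        finally have "- (a / t) + (- (t * (norm \<xi>)\<^sup>2)) + \<delta> * norm \<xi> \<le> - (a / 2 / t) + (- (t / 2 * (norm \<xi>)\<^sup>2))"
          by (simp add: field_simps)
        then have "exp (- (a / t)) * exp (- (t * (norm \<xi>)\<^sup>2)) * exp (\<delta> * norm \<xi>) \<le> exp (- (a / 2 / t)) * exp (- (t / 2 * (norm \<xi>)\<^sup>2))"
          unfolding mult_exp_exp by (simp only: exp_le_cancel_iff)
        then have "t powr (- s - 1) * norm (u \<xi>) * (exp (- (a / t)) * exp (- (t * (norm \<xi>)\<^sup>2)) * exp (\<delta> * norm \<xi>))
          \<le> t powr (- s - 1) * norm (u \<xi>) * (exp (- (a / 2 / t)) * exp (- (t / 2 * (norm \<xi>)\<^sup>2)))"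
          by (rule mult_left_mono) simp
        moreover have "norm (f \<xi> t) = t powr (- s - 1) * norm (u \<xi>) * (exp (- (a / t)) * exp (- (t * (norm \<xi>)\<^sup>2)) * exp (\<delta> * norm \<xi>))"
          unfolding f_def norm_mult norm_gauss norm_of_real by (simp add: abs_mult norm_exp_i_times mult_ac)
        ultimately show ?thesis by (simp only: mult_ac)
      qed
      then have "(\<integral>\<^sup>+\<xi>. norm (f \<xi> t) \<partial>lborel) \<le> (\<integral>\<^sup>+\<xi>. ennreal (?p * ?h \<xi>) \<partial>lborel)" by (intro nn_integral_mono ennreal_leI)
      also have "\<dots> = ennreal (LINT \<xi>|lborel. ?p * ?h \<xi>)"
        by (rule nn_integral_eq_integral[OF integrable_mult_right[OF hi]]) simp
      also have "(LINT \<xi>|lborel. ?p * ?h \<xi>) = ?p * (LINT \<xi>|lborel. ?h \<xi>)" by (rule integral_mult_right_zero)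
      finally show "(\<integral>\<^sup>+\<xi>. norm (f \<xi> t) \<partial>lborel) \<le> ennreal (?p * (LINT \<xi>|lborel. ?h \<xi>))" .
    qed
    also have "\<dots> < \<infinity>" by (rule bessel_weight_finite[OF u a])
    finally show ?thesis .
  qed
  have g: "(LINT t|halfline. f \<xi> t) = ?g \<xi>" for \<xi>
  proof -
    have "f \<xi> t = complex_of_real (t powr (- s - 1) * exp (- (a / t)) * exp (- (t * (norm \<xi>)\<^sup>2))) *
      (u \<xi> * exp (\<i> * complex_of_real (x0 \<bullet> \<xi>)) * complex_of_real (exp (\<delta> * norm \<xi>)))" for t
      unfolding f_def gauss_def of_real_mult by (simp only: mult_ac)
    then have "(LINT t|halfline. f \<xi> t) = complex_of_real (K a \<xi>) * (u \<xi> * exp (\<i> * complex_of_real (x0 \<bullet> \<xi>)) * complex_of_real (exp (\<delta> * norm \<xi>)))"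
      unfolding K_def by (simp only: integral_mult_left_zero integral_complex_of_real)
    then show ?thesis by (simp only: mult_ac)
  qed
  note sw = fubini_swap[OF sigma_finite_lborel sigma_finite_halfline fm fin]
  show "integrable lborel ?g" using sw(2) unfolding g .
  have "(LINT \<xi>|lborel. f \<xi> t) = complex_of_real (t powr (- s - 1) * exp (- (a / t))) *
      (LINT \<xi>|lborel. u \<xi> * (gauss t \<xi> * exp (\<i> * complex_of_real (x0 \<bullet> \<xi>))) * complex_of_real (exp (\<delta> * norm \<xi>)))" for t
    unfolding f_def by (rule integral_mult_right_zero)
  then show "(LINT \<xi>|lborel. ?g \<xi>) = (LINT t|halfline. complex_of_real (t powr (- s - 1) * exp (- (a / t))) *
      (LINT \<xi>|lborel. u \<xi> * (gauss t \<xi> * exp (\<i> * complex_of_real (x0 \<bullet> \<xi>))) * complex_of_real (exp (\<delta> * norm \<xi>))))"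
    using sw(1) unfolding g by (simp only:)
qed

text \<open>
  The Bessel averages of all monomial multiples of \<open>u\<close> are the moments of \<open>u\<close> times a character times
  \<open>K a\<close>. They vanish, so this product vanishes, and the positive kernel can be divided out away from
  the origin.
\<close>

theorem members_vanish:
  assumes u: "u \<in> UU"
  shows "u \<xi> = 0"
proof -
  (* any value strictly between 0 and c will do *)
  define a where "a = c / 2"
  have a: "0 < a" "a < c" using c_pos by (auto simp: a_def)
  define h where "h = (\<lambda>\<xi>. u \<xi> * exp (\<i> * complex_of_real (x0 \<bullet> \<xi>)))"
  define \<Theta> where "\<Theta> = (\<lambda>\<xi>. h \<xi> * complex_of_real (K a \<xi>))"
  have [measurable]: "u \<in> borel_measurable borel" by (rule moderate_measurable[OF mod[OF u]])
  have \<Theta>m: "\<Theta> \<in> borel_measurable borel" unfolding \<Theta>_def h_def by measurable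
  have \<Theta>e: "integrable lborel (\<lambda>\<xi>. norm (\<Theta> \<xi>) * exp (sqrt a * norm \<xi>))"
    using integrable_norm[OF bessel_kernel_pairing(1)[OF u a(1), of "sqrt a"]] a
    by (simp add: \<Theta>_def h_def norm_mult)
  have \<Theta>i: "integrable lborel \<Theta>"
    using bessel_kernel_pairing(1)[OF u a(1), of 0] a by (simp add: \<Theta>_def h_def)
  have "(LINT \<xi>|lborel. monomial L \<xi> * \<Theta> \<xi>) = 0" for L
  proof -
    let ?v = "\<lambda>\<xi>. monomial L \<xi> * u \<xi>"
    have v: "?v \<in> UU" by (rule monomial_closed[OF u])
    have "(LINT \<xi>|lborel. ?v \<xi> * exp (\<i> * complex_of_real (x0 \<bullet> \<xi>)) * complex_of_real (K a \<xi>)) = 0"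
      using bessel_kernel_pairing(2)[OF v a(1), of 0] bessel_average_vanishes[OF v a] a by (simp add: heat_def)
    then show ?thesis by (simp add: \<Theta>_def h_def mult_ac)
  qed
  then have ft: "(LINT \<xi>|lborel. exp (\<i> * complex_of_real (y \<bullet> \<xi>)) * \<Theta> \<xi>) = 0" for y
    using a by (intro moments_determine[OF \<Theta>m _ \<Theta>e]) auto
  have cont: "continuous_on UNIV h" unfolding h_def
    by (intro continuous_intros moderate_continuous mod u)
  have off: "h \<zeta> = 0" if "\<zeta> \<noteq> 0" for \<zeta>
  proof (rule weighted_fundamental_lemma[where U="- {0}" and K="K a"])
    show "continuous_on (- {0}) h" using cont by (rule continuous_on_subset) simp
    show "K a x > 0" if "x \<in> - {0}" for x using that a by (intro K_pos) auto
    fix \<phi> :: "'n cfun" assume "\<phi> \<in> test_functions (- {0})"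
    then have S: "\<phi> \<in> schwartz" by (rule test_functions_schwartz)
    show "(LINT x|lborel. h x * complex_of_real (K a x) * \<phi> x) = 0"
      using fourier_transform_determines[OF \<Theta>i ft S] by (simp add: \<Theta>_def)
    have [measurable]: "\<phi> \<in> borel_measurable borel" by (rule schwartz_measurable[OF S])
    have "norm (1 :: complex) \<le> 1 * jap x ^ 0" for x :: "real^'n" by simp
    then have "moderate (\<lambda>x :: real^'n. 1)" unfolding moderate_def using continuous_on_const by blast
    then obtain B where B: "\<And>x. norm (1 * \<phi> x) \<le> B" using bounded_moderate_mult_schwartz[OF _ S] by blast
    have "integrable lborel (\<lambda>x. \<phi> x * \<Theta> x)"
    proof (rule exponential_moments_integrable[OF \<Theta>m _ \<Theta>e])
      fix x :: "real^'n"
      have "norm (\<phi> x) \<le> B * 1" using B[of x] by simp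
      also have "\<dots> \<le> B * exp (sqrt a * norm x)"
        using a order_trans[OF norm_ge_zero B] by (intro mult_left_mono) auto
      finally show "norm (\<phi> x) \<le> B * exp (sqrt a * norm x)" .
    qed measurable
    then show "integrable lborel (\<lambda>x. h x * complex_of_real (K a x) * \<phi> x)"
      by (simp add: \<Theta>_def mult.commute)
  qed (use that in auto)
  (* the origin is reached by continuity *)
  have "h \<xi> = 0"
  proof (rule continuous_constant_on_closure[where S="- {0}" and f=h and x=\<xi>])
    show "continuous_on (closure (- {0})) h" using cont by (rule continuous_on_subset) simp
    show "\<xi> \<in> closure (- {0})" unfolding closure_complement by simp
  qed (rule off, simp)
  then show ?thesis by (simp add: h_def)
qed

end

section \<open>Flatness under constant coefficient operators\<close>

lemma moderate_add:
  assumes "moderate u" "moderate v" shows "moderate (\<lambda>\<xi>. u \<xi> + v \<xi>)"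
proof -
  obtain C M where C: "C > 0" "\<And>\<xi>. norm (u \<xi>) \<le> C * jap \<xi> ^ M" using moderate_bound[OF assms(1)] by blast
  obtain D N where D: "D > 0" "\<And>\<xi>. norm (v \<xi>) \<le> D * jap \<xi> ^ N" using moderate_bound[OF assms(2)] by blast
  have "norm (u \<xi> + v \<xi>) \<le> (C + D) * jap \<xi> ^ (M + N)" for \<xi>
  proof -
    have "jap \<xi> ^ M \<le> jap \<xi> ^ (M + N)" "jap \<xi> ^ N \<le> jap \<xi> ^ (M + N)" by (intro power_increasing; simp add: jap_def)+
    then have "C * jap \<xi> ^ M + D * jap \<xi> ^ N \<le> C * jap \<xi> ^ (M + N) + D * jap \<xi> ^ (M + N)"
      using C(1) D(1) by (intro add_mono mult_left_mono) auto
    then show ?thesis using norm_triangle_ineq[of "u \<xi>" "v \<xi>"] C(2)[of \<xi>] D(2)[of \<xi>] by (simp add: distrib_right)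
  qed
  then show ?thesis unfolding moderate_def
    using moderate_continuous[OF assms(1)] moderate_continuous[OF assms(2)] by (blast intro: continuous_on_add)
qed

lemma partials_linear_combination:
  assumes "smooth_on U \<phi>" "smooth_on U \<psi>"
  shows "x \<in> U \<Longrightarrow> partials is (\<lambda>x. a * \<phi> x + b * \<psi> x) x = a * partials is \<phi> x + b * partials is \<psi> x"
proof (induction "is" arbitrary: x)
  case (Cons i "is")
  have d: "partials is \<phi> differentiable (at x)" "partials is \<psi> differentiable (at x)"
    using assms Cons.prems unfolding smooth_on_def by blast+
  have "partial i (partials is (\<lambda>x. a * \<phi> x + b * \<psi> x)) x = partial i (\<lambda>y. a * partials is \<phi> y + b * partials is \<psi> y) x"
    by (rule partial_cong_open[OF smooth_on_open[OF assms(1)] Cons.IH Cons.prems])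
  also have "\<dots> = a * partial i (partials is \<phi>) x + b * partial i (partials is \<psi>) x"
    using d by (subst partial_add) (auto simp: partial_cmult intro: differentiable_mult differentiable_const)
  finally show ?case by simp
qed simp

lemma smooth_on_linear_combination:
  assumes "smooth_on U \<phi>" "smooth_on U \<psi>"
  shows "smooth_on U (\<lambda>x. a * \<phi> x + b * \<psi> x)"
  unfolding smooth_on_def
proof (intro conjI allI ballI)
  show U: "open U" by (rule smooth_on_open[OF assms(1)])
  fix "is" x assume x: "x \<in> U"
  have d: "partials is \<phi> differentiable (at x)" "partials is \<psi> differentiable (at x)"
    using assms x unfolding smooth_on_def by blast+
  have "(\<lambda>y. a * partials is \<phi> y + b * partials is \<psi> y) differentiable (at x)"
    using d by (auto intro!: differentiable_add differentiable_mult differentiable_const)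
  then obtain D where D: "((\<lambda>y. a * partials is \<phi> y + b * partials is \<psi> y) has_derivative D) (at x)"
    unfolding differentiable_def by blast
  have "(partials is (\<lambda>x. a * \<phi> x + b * \<psi> x) has_derivative D) (at x)"
    by (rule has_derivative_transform_within_open[OF D U x]) (simp add: partials_linear_combination[OF assms])
  then show "partials is (\<lambda>x. a * \<phi> x + b * \<psi> x) differentiable (at x)"
    unfolding differentiable_def by blast
qed

lemma product_with_test_function:
  fixes h \<psi> :: "'n::finite cfun"
  assumes h: "smooth_on U h" and \<psi>: "\<psi> \<in> test_functions U"
  shows "(\<lambda>x. h x * \<psi> x) differentiable (at x) \<and>
    partial i (\<lambda>x. h x * \<psi> x) x = partial i h x * \<psi> x + h x * partial i \<psi> x"
proof (cases "x \<in> U")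
  case True
  have "h differentiable (at x)" "\<psi> differentiable (at x)"
    using smooth_on_differentiable[OF h True] smooth_on_differentiable[OF test_functions_smooth[OF \<psi>]] by auto
  then show ?thesis by (auto intro: differentiable_mult partial_mult)
next
  case False
  let ?K = "closure {x. \<psi> x \<noteq> 0}"
  have x: "x \<in> - ?K" using False \<psi> unfolding test_functions_def by blast
  have z: "h y * \<psi> y = 0" if "y \<in> - ?K" for y using that closure_subset[of "{x. \<psi> x \<noteq> 0}"] by auto
  have zero: "((\<lambda>x::real^'n. 0::complex) has_derivative (\<lambda>_. 0)) (at x)" by (rule has_derivative_const)
  have "((\<lambda>x. h x * \<psi> x) has_derivative (\<lambda>_. 0)) (at x)"
    by (rule has_derivative_transform_within_open[OF zero open_Compl[OF closed_closure] x]) (rule z[symmetric])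
  moreover have "partial i (\<lambda>x. h x * \<psi> x) x = partial i (\<lambda>x. 0) x"
    by (rule partial_cong_open[OF open_Compl[OF closed_closure] z x])
  moreover have "partial i \<psi> x = 0" "\<psi> x = 0"
    using partial_eq_0_outside[of x \<psi> "[i]"] partial_eq_0_outside[of x \<psi> "[]"] x by simp_all
  ultimately show ?thesis by (auto simp: differentiable_def)
qed

lemma test_functions_smooth_mult:
  assumes g: "smooth_on U g" and \<phi>: "\<phi> \<in> test_functions U"
  shows "(\<lambda>x. g x * \<phi> x) \<in> test_functions U"
  using \<phi>
proof (rule test_functions_support_mono)
  note rules = product_with_test_function[THEN conjunct1] product_with_test_function[THEN conjunct2]
  let ?T = "{\<lambda>(_::unit) x. h x * \<psi> x |h \<psi>. smooth_on U h \<and> \<psi> \<in> test_functions U}"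
  have "smooth_on UNIV ((\<lambda>(_::unit) x. g x * \<phi> x) ())"
  proof (rule smooth_coinduct[where T="?T" and I=UNIV])
    show "\<Phi> p differentiable (at x)" if "\<Phi> \<in> ?T" for \<Phi> p x using that rules(1) by fastforce
    show "\<exists>L. set L \<subseteq> ?T \<and> (\<forall>p\<in>UNIV. \<forall>x. partial i (\<Phi> p) x = (\<Sum>\<Psi>\<leftarrow>L. \<Psi> p x))" if \<Phi>: "\<Phi> \<in> ?T" for \<Phi> i
    proof -
      obtain h \<psi> where h: "\<Phi> = (\<lambda>_ x. h x * \<psi> x)" "smooth_on U h" "\<psi> \<in> test_functions U" using \<Phi> by blast
      have "(\<lambda>(_::unit) x. partial i h x * \<psi> x) \<in> ?T"
        by (rule CollectI, rule exI, rule exI, rule conjI[OF refl]) (auto intro: smooth_on_partial h)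
      moreover have "(\<lambda>(_::unit) x. h x * partial i \<psi> x) \<in> ?T"
        by (rule CollectI, rule exI, rule exI, rule conjI[OF refl]) (auto intro: test_functions_partial h)
      ultimately have "set [\<lambda>(_::unit) x. partial i h x * \<psi> x, \<lambda>(_::unit) x. h x * partial i \<psi> x] \<subseteq> ?T" by (simp only: set_simps insert_subset) simp
      then show ?thesis
        using rules(2)[OF h(2,3)] h(1) by (intro exI conjI) (assumption, simp)
    qed
    show "(\<lambda>(_::unit) x. g x * \<phi> x) \<in> ?T"
      by (rule CollectI, rule exI, rule exI, rule conjI[OF refl]) (auto intro: g \<phi>)
  qed simp
  then show "smooth_on UNIV (\<lambda>x. g x * \<phi> x)" .
qed simp

lemma integration_by_parts:
  assumes g: "smooth_on U g" and \<phi>: "\<phi> \<in> test_functions U"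
  shows "(LINT x|lborel. g x * partial i \<phi> x) = - (LINT x|lborel. partial i g x * \<phi> x)"
proof -
  have T: "(\<lambda>x. g x * \<phi> x) \<in> test_functions U" by (rule test_functions_smooth_mult[OF assms])
  have p: "partial i (\<lambda>x. g x * \<phi> x) x = partial i g x * \<phi> x + g x * partial i \<phi> x" for x
    using product_with_test_function[OF assms] by blast
  have i1: "integrable lborel (\<lambda>x. partial i g x * \<phi> x)"
    by (rule integrable_continuous_test[OF smooth_on_continuous_on[OF smooth_on_partial[OF g]] \<phi>])
  have i2: "integrable lborel (\<lambda>x. g x * partial i \<phi> x)"
    by (rule integrable_continuous_test[OF smooth_on_continuous_on[OF g] test_functions_partial[OF \<phi>]])
  have "(LINT x|lborel. partial i g x * \<phi> x + g x * partial i \<phi> x) = 0"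
    using integral_partial_zero[OF test_functions_schwartz[OF T], of i] by (simp only: p)
  then have "(LINT x|lborel. partial i g x * \<phi> x) + (LINT x|lborel. g x * partial i \<phi> x) = 0"
    by (simp only: Bochner_Integration.integral_add[OF i1 i2])
  then show ?thesis by (simp add: add_eq_0_iff add.commute)
qed

text \<open>
  The fractional Laplacian of the inverse Fourier transform of \<open>u\<close> is given on \<open>U\<close> by a smooth function
  that vanishes to infinite order at \<open>x0\<close>.
\<close>

definition fractionally_flat :: "real \<Rightarrow> (real ^ 'n::finite) set \<Rightarrow> real ^ 'n \<Rightarrow> 'n cfun \<Rightarrow> bool"
  where "fractionally_flat s U x0 u \<longleftrightarrow> (\<exists>g. smooth_on U g \<and> (\<forall>is. partials is g x0 = 0) \<and>
    (\<forall>\<phi>\<in>test_functions U. (LINT \<xi>|lborel. complex_of_real (norm \<xi> powr (2 * s)) * u \<xi> * inv_fourier \<phi> \<xi>) = (LINT x|lborel. g x * \<phi> x)))"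

lemma coord_inv_fourier:
  assumes "\<phi> \<in> schwartz"
  shows "complex_of_real (\<xi> $ i) * inv_fourier \<phi> \<xi> = \<i> * inv_fourier (partial i \<phi>) \<xi>"
  by (simp add: inv_fourier_partial[OF assms] flip: mult.assoc)

text \<open>
  Multiplication by \<open>\<xi>\<^sub>i\<close> is the operator \<open>D\<^sub>i\<close>, which commutes with the fractional Laplacian, and
  derivatives of a function flat at \<open>x0\<close> are flat at \<open>x0\<close>.
\<close>

lemma fractionally_flat_coord:
  assumes "fractionally_flat s U x0 u" and x0: "x0 \<in> U"
  shows "fractionally_flat s U x0 (\<lambda>\<xi>. complex_of_real (\<xi> $ i) * u \<xi>)"
proof -
  obtain g where g: "smooth_on U g" "\<And>is. partials is g x0 = 0"
    "\<And>\<phi>. \<phi> \<in> test_functions U \<Longrightarrow> (LINT \<xi>|lborel. complex_of_real (norm \<xi> powr (2 * s)) * u \<xi> * inv_fourier \<phi> \<xi>) = (LINT x|lborel. g x * \<phi> x)"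
    using assms unfolding fractionally_flat_def by blast
  show ?thesis
    unfolding fractionally_flat_def
  proof (intro exI conjI allI ballI)
    (* the second summand is 0; it makes this a linear combination of two functions *)
    let ?g = "\<lambda>x. - \<i> * partial i g x + 0 * partial i g x"
    have gi: "smooth_on U (partial i g)" by (rule smooth_on_partial[OF g(1)])
    show "smooth_on U ?g" by (rule smooth_on_linear_combination[OF gi gi])
    show "partials is ?g x0 = 0" for "is"
      unfolding partials_linear_combination[OF gi gi x0] using g(2)[of "is @ [i]"] by (simp add: partials_append)
    fix \<phi> assume \<phi>: "\<phi> \<in> test_functions U"
    have "complex_of_real (norm \<xi> powr (2 * s)) * (complex_of_real (\<xi> $ i) * u \<xi>) * inv_fourier \<phi> \<xi>
      = \<i> * (complex_of_real (norm \<xi> powr (2 * s)) * u \<xi> * inv_fourier (partial i \<phi>) \<xi>)" for \<xi>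
    proof -
      have "complex_of_real (norm \<xi> powr (2 * s)) * (complex_of_real (\<xi> $ i) * u \<xi>) * inv_fourier \<phi> \<xi>
        = complex_of_real (norm \<xi> powr (2 * s)) * u \<xi> * (complex_of_real (\<xi> $ i) * inv_fourier \<phi> \<xi>)" by (simp only: mult_ac)
      then show ?thesis
        unfolding coord_inv_fourier[OF test_functions_schwartz[OF \<phi>]] by (simp only: mult_ac)
    qed
    then have "(LINT \<xi>|lborel. complex_of_real (norm \<xi> powr (2 * s)) * (complex_of_real (\<xi> $ i) * u \<xi>) * inv_fourier \<phi> \<xi>)
      = \<i> * (LINT x|lborel. g x * partial i \<phi> x)"
      by (simp only: integral_mult_right_zero g(3)[OF test_functions_partial[OF \<phi>]])
    also have "\<dots> = - \<i> * (LINT x|lborel. partial i g x * \<phi> x)" by (simp add: integration_by_parts[OF g(1) \<phi>])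
    also have "\<dots> = (LINT x|lborel. - \<i> * (partial i g x * \<phi> x))" by (simp only: integral_mult_right_zero)
    also have "\<dots> = (LINT x|lborel. ?g x * \<phi> x)" by (simp only: mult.assoc mult_zero_left add_0_right)
    finally show "(LINT \<xi>|lborel. complex_of_real (norm \<xi> powr (2 * s)) * (complex_of_real (\<xi> $ i) * u \<xi>) * inv_fourier \<phi> \<xi>) = (LINT x|lborel. ?g x * \<phi> x)" .
  qed
qed

lemma fractionally_flat_linear_combination:
  fixes u v :: "'n::finite cfun"
  assumes s: "- real CARD('n) / 2 < s" and m: "moderate u" "moderate v" and x0: "x0 \<in> U"
    and "fractionally_flat s U x0 u" "fractionally_flat s U x0 v"
  shows "fractionally_flat s U x0 (\<lambda>\<xi>. a * u \<xi> + b * v \<xi>)"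
proof -
  have fi: "integrable lborel (\<lambda>\<xi>. complex_of_real (norm \<xi> powr (2 * s)) * w \<xi> * \<phi> \<xi>)" if "moderate w" "\<phi> \<in> schwartz" for w \<phi> :: "'n cfun"
  proof -
    have [measurable]: "w \<in> borel_measurable borel" "\<phi> \<in> borel_measurable borel"
      using that by (auto intro: moderate_measurable schwartz_measurable)
    show ?thesis
      by (rule Bochner_Integration.integrable_bound[OF fractional_integrable[OF s that]]) (auto simp: norm_mult)
  qed
  obtain g where g: "smooth_on U g" "\<And>is. partials is g x0 = 0"
    "\<And>\<phi>. \<phi> \<in> test_functions U \<Longrightarrow> (LINT \<xi>|lborel. complex_of_real (norm \<xi> powr (2 * s)) * u \<xi> * inv_fourier \<phi> \<xi>) = (LINT x|lborel. g x * \<phi> x)"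
    using assms unfolding fractionally_flat_def by blast
  obtain h where h: "smooth_on U h" "\<And>is. partials is h x0 = 0"
    "\<And>\<phi>. \<phi> \<in> test_functions U \<Longrightarrow> (LINT \<xi>|lborel. complex_of_real (norm \<xi> powr (2 * s)) * v \<xi> * inv_fourier \<phi> \<xi>) = (LINT x|lborel. h x * \<phi> x)"
    using assms unfolding fractionally_flat_def by blast
  show ?thesis
    unfolding fractionally_flat_def
  proof (intro exI conjI allI ballI)
    let ?g = "\<lambda>x. a * g x + b * h x"
    show "smooth_on U ?g" by (rule smooth_on_linear_combination[OF g(1) h(1)])
    show "partials is ?g x0 = 0" for "is"
      using g(2) h(2) partials_linear_combination[OF g(1) h(1) x0] by simp
    fix \<phi> assume \<phi>: "\<phi> \<in> test_functions U"
    have S: "inv_fourier \<phi> \<in> schwartz" by (intro schwartz_inv_fourier test_functions_schwartz[OF \<phi>])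
    have "(LINT \<xi>|lborel. complex_of_real (norm \<xi> powr (2 * s)) * (a * u \<xi> + b * v \<xi>) * inv_fourier \<phi> \<xi>)
      = (LINT \<xi>|lborel. a * (complex_of_real (norm \<xi> powr (2 * s)) * u \<xi> * inv_fourier \<phi> \<xi>) + b * (complex_of_real (norm \<xi> powr (2 * s)) * v \<xi> * inv_fourier \<phi> \<xi>))"
      by (simp add: algebra_simps)
    also have "\<dots> = a * (LINT x|lborel. g x * \<phi> x) + b * (LINT x|lborel. h x * \<phi> x)"
      by (simp only: Bochner_Integration.integral_add[OF integrable_mult_right[OF fi[OF m(1) S]] integrable_mult_right[OF fi[OF m(2) S]]]
        integral_mult_right_zero g(3)[OF \<phi>] h(3)[OF \<phi>])
    also have "\<dots> = (LINT x|lborel. a * (g x * \<phi> x) + b * (h x * \<phi> x))"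
      using integrable_continuous_test[OF smooth_on_continuous_on[OF g(1)] \<phi>] integrable_continuous_test[OF smooth_on_continuous_on[OF h(1)] \<phi>]
      by (subst Bochner_Integration.integral_add) auto
    also have "\<dots> = (LINT x|lborel. ?g x * \<phi> x)" by (simp only: distrib_right mult.assoc)
    finally show "(LINT \<xi>|lborel. complex_of_real (norm \<xi> powr (2 * s)) * (a * u \<xi> + b * v \<xi>) * inv_fourier \<phi> \<xi>) = (LINT x|lborel. ?g x * \<phi> x)" .
  qed
qed

lemma spectrally_vanishes_coord:
  assumes "spectrally_vanishes U u" shows "spectrally_vanishes U (\<lambda>\<xi>. complex_of_real (\<xi> $ i) * u \<xi>)"
  unfolding spectrally_vanishes_def
proof
  fix \<phi> assume \<phi>: "\<phi> \<in> test_functions U"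
  have "(complex_of_real (\<xi> $ i) * u \<xi>) * inv_fourier \<phi> \<xi> = \<i> * (u \<xi> * inv_fourier (partial i \<phi>) \<xi>)" for \<xi>
  proof -
    have "(complex_of_real (\<xi> $ i) * u \<xi>) * inv_fourier \<phi> \<xi> = u \<xi> * (complex_of_real (\<xi> $ i) * inv_fourier \<phi> \<xi>)" by (simp only: mult_ac)
    then show ?thesis
      unfolding coord_inv_fourier[OF test_functions_schwartz[OF \<phi>]] by (simp only: mult_ac)
  qed
  then show "(LINT \<xi>|lborel. (complex_of_real (\<xi> $ i) * u \<xi>) * inv_fourier \<phi> \<xi>) = 0"
    using assms test_functions_partial[OF \<phi>] unfolding spectrally_vanishes_def by (simp only: integral_mult_right_zero) simp
qed

lemma spectrally_vanishes_add:
  assumes m: "moderate u" "moderate v" and "spectrally_vanishes U u" "spectrally_vanishes U v"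
  shows "spectrally_vanishes U (\<lambda>\<xi>. u \<xi> + v \<xi>)"
  unfolding spectrally_vanishes_def
proof
  fix \<phi> assume \<phi>: "\<phi> \<in> test_functions U"
  have "inv_fourier \<phi> \<in> schwartz" by (intro schwartz_inv_fourier test_functions_schwartz[OF \<phi>])
  then have "integrable lborel (\<lambda>\<xi>. u \<xi> * inv_fourier \<phi> \<xi>)" "integrable lborel (\<lambda>\<xi>. v \<xi> * inv_fourier \<phi> \<xi>)"
    by (auto intro: tame_schwartz_integrable moderate_tame m)
  then show "(LINT \<xi>|lborel. (u \<xi> + v \<xi>) * inv_fourier \<phi> \<xi>) = 0"
    using assms(3,4) \<phi> unfolding spectrally_vanishes_def by (simp add: distrib_right)
qed

section \<open>Polynomials and their operators\<close>

text \<open>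
  Induction on the set \<open>J\<close> of variables. As a polynomial in the variable \<open>j\<close> alone, the sum has infinitely
  many zeros, so the coefficient of each power of that variable vanishes; these coefficients are
  polynomials in the remaining variables. The exponents in \<open>A\<close> are only required to differ on \<open>J\<close>,
  which is preserved when \<open>A\<close> is restricted to a fixed exponent of \<open>j\<close>.
\<close>

lemma polynomial_nonzero_on_grid:
  fixes A :: "('n \<Rightarrow> nat) set" and a :: "('n \<Rightarrow> nat) \<Rightarrow> complex" and X :: "'n \<Rightarrow> real set"
  assumes "finite J" and X: "\<And>i. infinite (X i)"
  shows "finite A \<Longrightarrow> (\<And>\<alpha> \<beta>. \<alpha> \<in> A \<Longrightarrow> \<beta> \<in> A \<Longrightarrow> (\<forall>i\<in>J. \<alpha> i = \<beta> i) \<Longrightarrow> \<alpha> = \<beta>) \<Longrightarrow>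
    (\<And>x. (\<forall>i. x i \<in> X i) \<Longrightarrow> (\<Sum>\<alpha>\<in>A. a \<alpha> * (\<Prod>i\<in>J. complex_of_real (x i) ^ \<alpha> i)) = 0) \<Longrightarrow> \<alpha> \<in> A \<Longrightarrow> a \<alpha> = 0"
  using assms(1)
proof (induction J arbitrary: A \<alpha> rule: finite_induct)
  case empty
  have "A = {\<alpha>}" using empty.prems(2,4) by auto
  moreover have "\<exists>t. t \<in> X i" for i using X[of i] by (metis finite.emptyI ex_in_conv)
  then obtain x where "\<And>i. x i \<in> X i" by metis
  ultimately show ?case using empty.prems(3)[of x] by simp
next
  case (insert j J)
  (* the sum as a polynomial in the variable j, for fixed values of the others *)
  define q where "q = (\<lambda>x. \<Sum>\<beta>\<in>A. monom (a \<beta> * (\<Prod>i\<in>J. complex_of_real (x i) ^ \<beta> i)) (\<beta> j))"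
  have q0: "q x = 0" if x: "\<forall>i. x i \<in> X i" for x
  proof (rule ccontr)
    assume "q x \<noteq> 0"
    then have "finite {z. poly (q x) z = 0}" by (rule poly_roots_finite)
    moreover have "complex_of_real ` X j \<subseteq> {z. poly (q x) z = 0}"
    proof (intro image_subsetI CollectI)
      fix t assume t: "t \<in> X j"
      have "poly (q x) (complex_of_real t) = (\<Sum>\<beta>\<in>A. a \<beta> * (\<Prod>i\<in>insert j J. complex_of_real ((x(j := t)) i) ^ \<beta> i))"
        unfolding q_def poly_sum poly_monom
      proof (intro sum.cong refl)
        fix \<beta> :: "'n \<Rightarrow> nat"
        have "(\<Prod>i\<in>J. complex_of_real ((x(j := t)) i) ^ \<beta> i) = (\<Prod>i\<in>J. complex_of_real (x i) ^ \<beta> i)"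
          using insert.hyps by (intro prod.cong) auto
        then show "a \<beta> * (\<Prod>i\<in>J. complex_of_real (x i) ^ \<beta> i) * complex_of_real t ^ \<beta> j
          = a \<beta> * (\<Prod>i\<in>insert j J. complex_of_real ((x(j := t)) i) ^ \<beta> i)"
          using insert.hyps by simp
      qed
      also have "\<dots> = 0" using x t by (intro insert.prems(3)) auto
      finally show "poly (q x) (complex_of_real t) = 0" .
    qed
    ultimately have "finite (complex_of_real ` X j)" by (rule finite_subset[rotated])
    then show False using X[of j] by (metis finite_imageD inj_onI of_real_eq_iff)
  qed
  define A' where "A' = {\<beta> \<in> A. \<beta> j = \<alpha> j}"
  show ?case
  proof (rule insert.IH[of A'])
    show "finite A'" "\<alpha> \<in> A'" using insert.prems by (auto simp: A'_def)
    show "\<beta> = \<gamma>" if "\<beta> \<in> A'" "\<gamma> \<in> A'" "\<forall>i\<in>J. \<beta> i = \<gamma> i" for \<beta> \<gamma>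
      using that by (intro insert.prems(2)) (auto simp: A'_def)
    fix x assume x: "\<forall>i. x i \<in> X i"
    have "(\<Sum>\<beta>\<in>A'. a \<beta> * (\<Prod>i\<in>J. complex_of_real (x i) ^ \<beta> i)) = coeff (q x) (\<alpha> j)"
      unfolding q_def coeff_sum coeff_monom A'_def using insert.prems(1)
      by (simp add: sum.inter_filter[symmetric] eq_commute)
    then show "(\<Sum>\<beta>\<in>A'. a \<beta> * (\<Prod>i\<in>J. complex_of_real (x i) ^ \<beta> i)) = 0" using q0[OF x] by simp
  qed
qed

definition symbol :: "('n::finite multiindex \<Rightarrow>\<^sub>0 complex) \<Rightarrow> 'n cfun"
  where "symbol P \<xi> = (\<Sum>\<alpha>\<in>Poly_Mapping.keys P. Poly_Mapping.lookup P \<alpha> * monomial (mi_list \<alpha>) \<xi>)"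

lemma prod_list_mi_list:
  fixes h :: "'n::finite \<Rightarrow> 'a::comm_monoid_mult"
  shows "(\<Prod>i\<leftarrow>mi_list \<alpha>. h i) = (\<Prod>i\<in>UNIV. h i ^ \<alpha> i)"
proof -
  have "(\<Prod>i\<leftarrow>concat (map (\<lambda>i. replicate (\<alpha> i) i) xs). h i) = (\<Prod>i\<leftarrow>xs. h i ^ \<alpha> i)" for xs :: "'n list"
    by (induction xs) auto
  then show ?thesis
    using prod.distinct_set_conv_list[OF coordinates(1), of "\<lambda>i. h i ^ \<alpha> i"] by (simp add: mi_list_def coordinates(2))
qed

lemma length_mi_list: "length (mi_list \<alpha>) = mi_order \<alpha>"
proof -
  have "length (concat (map (\<lambda>i. replicate (\<alpha> i) i) xs)) = (\<Sum>i\<leftarrow>xs. \<alpha> i)" for xs :: "'a list"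
    by (induction xs) auto
  then show ?thesis
    using sum.distinct_set_conv_list[OF coordinates(1), of \<alpha>] by (simp add: mi_list_def mi_order_def coordinates(2))
qed

lemma symbol_slow_growth: "slow_growth (symbol P)"
  unfolding symbol_def by (intro slow_growth_sum slow_growth_mult monomial_slow_growth) simp

text \<open>
  An open set contains a product of open sets of reals, which are infinite.
\<close>

lemma symbol_nonzero:
  fixes P :: "'n::finite multiindex \<Rightarrow>\<^sub>0 complex"
  assumes P: "P \<noteq> 0" and S: "open S" "S \<noteq> {}"
  shows "\<exists>\<xi>\<in>S. symbol P \<xi> \<noteq> 0"
proof (rule ccontr)
  assume "\<not> ?thesis"
  then have zero: "symbol P \<zeta> = 0" if "\<zeta> \<in> S" for \<zeta> using that by blast
  obtain \<eta> where "\<eta> \<in> S" using S by blast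
  then obtain X where X: "\<And>i. open (X i)" "\<And>i. \<eta> $ i \<in> X i" "\<And>y. (\<forall>i. y $ i \<in> X i) \<Longrightarrow> y \<in> S"
    using S(1) unfolding open_vec_def by metis
  have van: "Poly_Mapping.lookup P \<alpha> = 0" if "\<alpha> \<in> Poly_Mapping.keys P" for \<alpha>
  proof (rule polynomial_nonzero_on_grid[where J=UNIV and A="Poly_Mapping.keys P" and X=X])
    show "infinite (X i)" for i using X(1,2)[of i] by (metis empty_iff finite_imp_not_open)
    fix x :: "'n \<Rightarrow> real" assume "\<forall>i. x i \<in> X i"
    then have "symbol P (\<chi> i. x i) = 0" by (intro zero X(3)) simp
    then show "(\<Sum>\<alpha>\<in>Poly_Mapping.keys P. Poly_Mapping.lookup P \<alpha> * (\<Prod>i\<in>UNIV. complex_of_real (x i) ^ \<alpha> i)) = 0"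
      by (simp add: symbol_def monomial_def prod_list_mi_list)
  qed (use that in \<open>auto simp: fun_eq_iff\<close>)
  have "P = 0"
  proof (rule poly_mapping_eqI)
    fix \<alpha>
    show "Poly_Mapping.lookup P \<alpha> = Poly_Mapping.lookup 0 \<alpha>" using van[of \<alpha>] by (auto simp: in_keys_iff)
  qed
  then show False using P by simp
qed

lemma inv_fourier_partials:
  assumes "\<phi> \<in> schwartz"
  shows "inv_fourier (partials L \<phi>) \<xi> = (- \<i>) ^ length L * monomial L \<xi> * inv_fourier \<phi> \<xi>"
proof (induction L)
  case (Cons i L)
  have "inv_fourier (partials (i # L) \<phi>) \<xi> = - (\<i> * complex_of_real (\<xi> $ i)) * inv_fourier (partials L \<phi>) \<xi>"
    using inv_fourier_partial[OF schwartz_partials[OF assms]] by simp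
  then show ?case unfolding Cons.IH by (simp add: monomial_def)
qed (simp add: monomial_def)

text \<open>
  On the Fourier side \<open>P(D)\<close> is multiplication by the symbol: the powers of \<open>-i\<close> from \<open>D\<^sup>\<alpha>\<close> and from the
  transform of a derivative combine to the sign in the definition of the distributional derivative.
\<close>

lemma dist_op_symbol:
  fixes f :: "'n::finite functional"
  assumes F: "moderate F" and f: "\<And>\<psi>. \<psi> \<in> schwartz \<Longrightarrow> f \<psi> = (LINT \<xi>|lborel. F \<xi> * inv_fourier \<psi> \<xi>)"
    and \<phi>: "\<phi> \<in> schwartz"
  shows "dist_op P f \<phi> = (LINT \<xi>|lborel. symbol P \<xi> * F \<xi> * inv_fourier \<phi> \<xi>)"
proof -
  have S: "inv_fourier \<phi> \<in> schwartz" by (rule schwartz_inv_fourier[OF \<phi>])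
  have i: "integrable lborel (\<lambda>\<xi>. (monomial L \<xi> * F \<xi>) * inv_fourier \<phi> \<xi>)" for L
    by (intro tame_schwartz_integrable moderate_tame moderate_mult monomial_slow_growth F S)
  have D: "dist_D \<alpha> f \<phi> = (LINT \<xi>|lborel. (monomial (mi_list \<alpha>) \<xi> * F \<xi>) * inv_fourier \<phi> \<xi>)" for \<alpha>
  proof -
    have m: "mi_D \<alpha> \<phi> \<in> schwartz" unfolding mi_D_def mi_partial_eq by (intro schwartz_cmult schwartz_partials \<phi>)
    have "(- \<i>) ^ mi_order \<alpha> * (- \<i>) ^ mi_order \<alpha> = (- 1 :: complex) ^ mi_order \<alpha>"
      by (simp flip: power_mult_distrib)
    then have "(- 1) ^ mi_order \<alpha> * (F \<xi> * inv_fourier (mi_D \<alpha> \<phi>) \<xi>) = (monomial (mi_list \<alpha>) \<xi> * F \<xi>) * inv_fourier \<phi> \<xi>" for \<xi>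
      unfolding mi_D_def mi_partial_eq inv_fourier_cmult inv_fourier_partials[OF \<phi>] length_mi_list
      by (simp add: mult_ac)
    then show ?thesis
      unfolding dist_D_def using \<phi> f[OF m] by (simp only: restrict_apply if_True integral_mult_right_zero[symmetric])
  qed
  have "dist_op P f \<phi> = (\<Sum>\<alpha>\<in>Poly_Mapping.keys P. LINT \<xi>|lborel. Poly_Mapping.lookup P \<alpha> * ((monomial (mi_list \<alpha>) \<xi> * F \<xi>) * inv_fourier \<phi> \<xi>))"
    unfolding dist_op_def using \<phi> by (simp only: restrict_apply if_True D integral_mult_right_zero)
  also have "\<dots> = (LINT \<xi>|lborel. (\<Sum>\<alpha>\<in>Poly_Mapping.keys P. Poly_Mapping.lookup P \<alpha> * ((monomial (mi_list \<alpha>) \<xi> * F \<xi>) * inv_fourier \<phi> \<xi>)))"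
    by (rule Bochner_Integration.integral_sum[symmetric]) (intro integrable_mult_right i)
  also have "\<dots> = (LINT \<xi>|lborel. symbol P \<xi> * F \<xi> * inv_fourier \<phi> \<xi>)"
    unfolding symbol_def sum_distrib_right mult.assoc ..
  finally show ?thesis .
qed

lemma fractionally_flat_symbol:
  fixes u :: "'n::finite cfun"
  assumes s: "- real CARD('n) / 2 < s" and m: "moderate u" and x0: "x0 \<in> U"
    and u: "fractionally_flat s U x0 u"
  shows "fractionally_flat s U x0 (\<lambda>\<xi>. symbol P \<xi> * u \<xi>)"
proof -
  have mono: "fractionally_flat s U x0 (\<lambda>\<xi>. monomial L \<xi> * u \<xi>)" for L
  proof (induction L)
    case Nil then show ?case using u by (simp add: monomial_def)
  next
    case (Cons i L)
    from fractionally_flat_coord[OF Cons x0, of i] show ?case by (simp add: monomial_def mult.assoc)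
  qed
  have mm: "moderate (\<lambda>\<xi>. monomial L \<xi> * u \<xi>)" for L by (intro moderate_mult monomial_slow_growth m)
  have "fractionally_flat s U x0 (\<lambda>\<xi>. (\<Sum>\<alpha>\<in>A. Poly_Mapping.lookup P \<alpha> * monomial (mi_list \<alpha>) \<xi>) * u \<xi>)" for A
  proof (induction A rule: infinite_finite_induct)
    case (insert \<alpha> A)
    have "moderate (\<lambda>\<xi>. (\<Sum>\<alpha>\<in>A. Poly_Mapping.lookup P \<alpha> * monomial (mi_list \<alpha>) \<xi>) * u \<xi>)"
      by (intro moderate_mult slow_growth_sum slow_growth_mult monomial_slow_growth m) simp
    from fractionally_flat_linear_combination[OF s mm this x0 mono insert.IH, of "Poly_Mapping.lookup P \<alpha>" "mi_list \<alpha>" 1]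
    show ?case using insert.hyps by (simp add: distrib_right mult.assoc)
  qed (use fractionally_flat_linear_combination[OF s m m x0 u u, of 0 0] in simp_all)
  then show ?thesis unfolding symbol_def .
qed

section \<open>Unique continuation\<close>

text \<open>
  The products of \<open>w\<close> with polynomials, generated inductively so that the closure properties of a
  continuation class hold by construction.
\<close>

inductive_set coordinate_closure :: "'n::finite cfun \<Rightarrow> 'n cfun set" for w
  where base: "w \<in> coordinate_closure w"
  | coord: "u \<in> coordinate_closure w \<Longrightarrow> (\<lambda>\<xi>. complex_of_real (\<xi> $ i) * u \<xi>) \<in> coordinate_closure w"
  | add: "u \<in> coordinate_closure w \<Longrightarrow> v \<in> coordinate_closure w \<Longrightarrow> (\<lambda>\<xi>. u \<xi> + v \<xi>) \<in> coordinate_closure w"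

text \<open>
  All members of the closure of \<open>w\<close> inherit the two properties of \<open>w\<close>, so it is a continuation class.
  The four balls of radii \<open>r\<close> to \<open>4 r\<close> in the heat estimates explain the factor \<open>1 / 4\<close>.
\<close>

theorem fractional_unique_continuation:
  fixes w :: "'n::finite cfun"
  assumes s: "s \<notin> \<int>" "- real CARD('n) / 2 < s" and m: "moderate w" and \<rho>: "\<rho> > 0"
    and van: "spectrally_vanishes (ball x0 \<rho>) w" and flat: "fractionally_flat s (ball x0 \<rho>) x0 w"
  shows "w \<xi> = 0"
proof -
  (* the midpoint of the admissible interval, which is nonempty by the lower bound on s *)
  define \<gamma> where "\<gamma> = (max 0 (- 2 * s) + real CARD('n)) / 2"
  have \<gamma>: "0 < \<gamma>" "\<gamma> < real CARD('n)" "- 2 * s < \<gamma>" using s(2) by (auto simp: \<gamma>_def max_def field_simps)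
  have x0: "x0 \<in> ball x0 \<rho>" using \<rho> by simp
  have closed: "moderate u \<and> spectrally_vanishes (ball x0 \<rho>) u \<and> fractionally_flat s (ball x0 \<rho>) x0 u" if "u \<in> coordinate_closure w" for u
    using that
  proof induction
    case base then show ?case using m van flat by blast
  next
    case (coord u i)
    then show ?case using moderate_mult[OF slow_growth_coord] spectrally_vanishes_coord fractionally_flat_coord[OF _ x0] by blast
  next
    case (add u v)
    then show ?case using moderate_add spectrally_vanishes_add fractionally_flat_linear_combination[OF s(2) _ _ x0, of u v 1 1] by auto
  qed
  interpret continuation_class "coordinate_closure w" s \<gamma> "\<rho> / 4" x0
  proof
    fix u assume "u \<in> coordinate_closure w"
    then have u: "moderate u" "spectrally_vanishes (ball x0 \<rho>) u" "fractionally_flat s (ball x0 \<rho>) x0 u" using closed by auto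
    show "moderate u" by (rule u)
    show "spectrally_vanishes (ball x0 (4 * (\<rho> / 4))) u" using u by simp
    obtain g where "smooth_on (ball x0 \<rho>) g" "\<And>is. partials is g x0 = 0"
      "\<And>\<phi>. \<phi> \<in> test_functions (ball x0 \<rho>) \<Longrightarrow> (LINT \<xi>|lborel. complex_of_real (norm \<xi> powr (2 * s)) * u \<xi> * inv_fourier \<phi> \<xi>) = (LINT x|lborel. g x * \<phi> x)"
      using u(3) unfolding fractionally_flat_def by blast
    moreover from this have "g x0 = 0" by (metis partials_Nil)
    ultimately show "\<exists>g. continuous_on (ball x0 (4 * (\<rho> / 4))) g \<and> g x0 = 0 \<and>
      (\<forall>\<phi>\<in>test_functions (ball x0 (4 * (\<rho> / 4))).
        (LINT \<xi>|lborel. complex_of_real (norm \<xi> powr (2 * s)) * u \<xi> * inv_fourier \<phi> \<xi>) = (LINT x|lborel. g x * \<phi> x))"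
      using smooth_on_continuous_on by (intro exI[of _ g]) auto
  qed (use s \<gamma> \<rho> in \<open>auto intro: coordinate_closure.intros\<close>)
  show ?thesis by (rule members_vanish[OF coordinate_closure.base])
qed

theorem theorem1p2:
  fixes s :: real and V :: "(real ^ 'n::finite) set" and f :: "'n functional"
  assumes "CARD('n) \<ge> 2"
    and "- real CARD('n) / 2 < s" and "s \<notin> \<int>"
    and "open V" and "V \<noteq> {}"
    and "f \<in> compactly_supported \<inter> admissible V"
    and "\<exists>x\<^sub>0\<in>V. \<exists>U g. x\<^sub>0 \<in> U \<and> smooth_on U g \<and>
           dist_restrict (frac_laplacian s f) U = dist_of_fun (test_functions U) g \<and>
           (\<forall>\<beta>. mi_partial \<beta> g x\<^sub>0 = 0)"
  shows "f = zero_dist schwartz"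
proof -
  have s: "s \<notin> \<int>" "- real CARD('n) / 2 < s" by fact+
  obtain r P where r: "f \<in> sobolev r" and P: "P \<noteq> 0" "dist_restrict (dist_op P f) V = zero_dist (test_functions V)"
    using assms(6) unfolding admissible_def sobolev_minus_infinity_def by blast
  have f: "f \<in> compactly_supported" "f \<in> tempered" using assms(6) by (auto simp: compactly_supported_def)
  obtain F C M where F: "continuous_on UNIV F" "C > 0" "\<And>\<xi>. norm (F \<xi>) \<le> C * jap \<xi> ^ M"
    "\<And>\<phi>. \<phi> \<in> schwartz \<Longrightarrow> f (fourier \<phi>) = (LINT \<xi>|lborel. F \<xi> * \<phi> \<xi>)"
    using compactly_supported_fourier[OF f(1) r] by blast
  have mF: "moderate F" unfolding moderate_def using F by blast
  have ff: "fourier_fun f = F" by (rule fourier_fun_eqI[OF F(1,4)])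
  have fF: "f \<psi> = (LINT \<xi>|lborel. F \<xi> * inv_fourier \<psi> \<xi>)" if "\<psi> \<in> schwartz" for \<psi>
  proof -
    have "fourier (inv_fourier \<psi>) = \<psi>" using fourier_inv_fourier[OF that] by (rule ext)
    then show ?thesis using F(4)[OF schwartz_inv_fourier[OF that]] by simp
  qed
  obtain x0 U g where x0: "x0 \<in> V" "x0 \<in> U" and g: "smooth_on U g"
    "dist_restrict (frac_laplacian s f) U = dist_of_fun (test_functions U) g" "\<And>\<beta>. mi_partial \<beta> g x0 = 0"
    using assms(7) by blast
  have "open (U \<inter> V)" using smooth_on_open[OF g(1)] \<open>open V\<close> by blast
  then obtain \<rho> where \<rho>: "\<rho> > 0" "ball x0 \<rho> \<subseteq> U \<inter> V" using x0 by (meson IntI open_contains_ball)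
  let ?B = "ball x0 \<rho>"
  have B: "?B \<subseteq> U" "?B \<subseteq> V" "x0 \<in> ?B" using \<rho> by auto
  have flat: "fractionally_flat s ?B x0 F"
    unfolding fractionally_flat_def
  proof (intro exI[of _ g] conjI allI ballI)
    show "smooth_on ?B g" using g(1) B unfolding smooth_on_def by auto
    show "partials is g x0 = 0" for "is" using partials_eq_mi_partial[OF g(1) x0(2)] g(3) by simp
    fix \<phi> assume "\<phi> \<in> test_functions ?B"
    then have \<phi>: "\<phi> \<in> test_functions U" by (rule test_functions_mono[OF B(1)])
    have S: "\<phi> \<in> schwartz" "inv_fourier \<phi> \<in> schwartz" using test_functions_schwartz[OF \<phi>] by (auto intro: schwartz_inv_fourier)
    have "frac_laplacian s f \<phi> = (LINT x|lborel. g x * \<phi> x)"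
      using fun_cong[OF g(2), of \<phi>] \<phi> by (simp add: dist_restrict_def dist_of_fun_def)
    then show "(LINT \<xi>|lborel. complex_of_real (norm \<xi> powr (2 * s)) * F \<xi> * inv_fourier \<phi> \<xi>) = (LINT x|lborel. g x * \<phi> x)"
      using S by (simp add: frac_laplacian_def dist_inv_fourier_def dist_of_fun_def ff)
  qed
  have "spectrally_vanishes ?B (\<lambda>\<xi>. symbol P \<xi> * F \<xi>)"
    unfolding spectrally_vanishes_def
  proof
    fix \<phi> assume "\<phi> \<in> test_functions ?B"
    then have \<phi>: "\<phi> \<in> test_functions V" by (rule test_functions_mono[OF B(2)])
    have "dist_op P f \<phi> = 0"
      using fun_cong[OF P(2), of \<phi>] \<phi> by (simp add: dist_restrict_def zero_dist_def)
    then show "(LINT \<xi>|lborel. symbol P \<xi> * F \<xi> * inv_fourier \<phi> \<xi>) = 0"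
      using dist_op_symbol[OF mF fF test_functions_schwartz[OF \<phi>], of P] by simp
  qed
  from fractional_unique_continuation[OF s moderate_mult[OF symbol_slow_growth mF] \<rho>(1) this fractionally_flat_symbol[OF s(2) mF B(3) flat]]
  have PF: "symbol P \<xi> * F \<xi> = 0" for \<xi> .
  have F0: "F \<xi> = 0" for \<xi>
  proof (rule ccontr)
    assume "F \<xi> \<noteq> 0"
    moreover have "open {\<xi>. F \<xi> \<noteq> 0}" using F(1) by (intro open_Collect_neq) auto
    ultimately obtain \<zeta> where "F \<zeta> \<noteq> 0" "symbol P \<zeta> \<noteq> 0" using symbol_nonzero[OF P(1), of "{\<xi>. F \<xi> \<noteq> 0}"] by blast
    then show False using PF[of \<zeta>] by simp
  qed
  show ?thesis
  proof
    fix \<psi>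
    show "f \<psi> = zero_dist schwartz \<psi>"
    proof (cases "\<psi> \<in> schwartz")
      case True
      then show ?thesis using fF[OF True] by (simp add: zero_dist_def F0)
    next
      case False
      then show ?thesis using f(2) by (simp add: zero_dist_def tempered_def extensional_def)
    qed
  qed
qed

end
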